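(* Let $K$ be a field, $n\ge 1$, and let $\mathbb{X}\subseteq\mathbb{P}^n_K$ be a $0$-dimensional locally Gorenstein scheme in generic position, where $\operatorname{char}(K)=0$ or $\operatorname{char}(K)>\deg(\mathbb{X})$ and no closed point of $\mathbb{X}$ lies on the hyperplane $\{X_0=0\}$. Let $R$ be the homogeneous coordinate ring of $\mathbb{X}$, let $\widetilde{R}=S[x_0]\supseteq R$, and let $\mathfrak{F}_{\widetilde{R}/R}$ be the conductor of $R$ in $\widetilde{R}$. Then $\mathbb{X}$ is arithmetically Gorenstein if and only if $$\ell(\widetilde{R}/R)=\ell(R/\mathfrak{F}_{\widetilde{R}/R}).$$
   Context: Let $P=K[X_0,\dots,X_n]$ with the standard grading, $I_{\mathbb{X}}\subseteq P$ the (saturated) homogeneous vanishing ideal of the non-empty $0$-dimensional scheme $\mathbb{X}$, $R=P/I_{\mathbb{X}}$, and $x_0$ the image of $X_0$ in $R$. Since no closed point of $\mathbb{X}$ lies on $\{X_0=0\}$, $x_0$ is a non-zerodivisor of $R$. Write $\operatorname{HF}_{\mathbb{X}}(i)=\dim_K R_i$ for $i\in\mathbb{Z}$. $\mathbb{X}$ is in generic position if $\operatorname{HF}_{\mathbb{X}}(i)=\min\{\deg(\mathbb{X}),\binom{n+i}{n}\}$ for all $i\in\mathbb{Z}$ (the binomial coefficient being $0$ for $i<0$). $\mathbb{X}$ is locally Gorenstein if the local ring $\mathcal{O}_{\mathbb{X},p}$ is Gorenstein for every closed point $p$ of $\mathbb{X}$; $\mathbb{X}$ is arithmetically Gorenstein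 if $R$ is a Gorenstein ring. Let $S=R/\langle x_0-1\rangle$ be the affine coordinate ring of $\mathbb{X}$ in $\{X_0\neq 0\}$; it is isomorphic to the product of the local rings of $\mathbb{X}$ at its closed points. Let $Q^h(R)$ be the localization of $R$ at the set of all homogeneous non-zerodivisors; $Q^h(R)\cong S[x_0,x_0^{-1}]$, and $R$ embeds into it via $f\mapsto f^{\rm deh}x_0^i$ for $f\in R_i$, where $f^{\rm deh}$ is the image of $f$ in $S$. Put $\widetilde{R}=S[x_0]\subseteq Q^h(R)$, which contains $R$. The conductor is $\mathfrak{F}_{\widetilde{R}/R}=\{f\in Q^h(R)\mid f\cdot\widetilde{R}\subseteq R\}$, an ideal of both $R$ and $\widetilde{R}$. $\ell$ denotes dimension as a $K$-vector space. *)

theory Defs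
  imports
    "HOL-Algebra.Algebra"
    "HOL-Algebra.Algebraic_Closure_Type"
    "HOL-Library.Poly_Mapping"
    "HOL-Library.Extended_Nat"
begin

section \<open>Vector spaces: subspaces of an algebra, quotients, dimension\<close>

text \<open>The subspace \<open>V\<close> of a ring \<open>A\<close> that is a \<open>K\<close>-algebra through \<open>\<eta> : K \<rightarrow> A\<close>.\<close>

definition subspace_of_algebra ::
    "('k \<Rightarrow> 'a) \<Rightarrow> ('a, 'x) ring_scheme \<Rightarrow> 'a set \<Rightarrow> ('k, 'a) module" where
  "subspace_of_algebra \<eta> A V =
     \<lparr>carrier = V, monoid.mult = monoid.mult A, monoid.one = monoid.one A,
      ring.zero = ring.zero A, ring.add = ring.add A,
      module.smult = (\<lambda>c v. \<eta> c \<otimes>\<^bsub>A\<^esub> v)\<rparr>"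

text \<open>In the additive-group part this is the library's factor group; only the fields
  relevant for a module are meaningful (\<open>mult\<close> and \<open>one\<close> are left arbitrary).\<close>

definition quotient_module :: "('k, 'a) module \<Rightarrow> 'a set \<Rightarrow> ('k, 'a set) module" where
  "quotient_module M W =
     \<lparr>carrier = a_rcosets\<^bsub>M\<^esub> W, monoid.mult = undefined, monoid.one = undefined,
      ring.zero = W, ring.add = set_add M,
      module.smult = (\<lambda>c C. W <+>\<^bsub>M\<^esub> ((\<lambda>v. c \<odot>\<^bsub>M\<^esub> v) ` C))\<rparr>"

definition finite_basis :: "('k::field, 'v) module \<Rightarrow> 'v set \<Rightarrow> bool" where
  "finite_basis M B \<longleftrightarrow>
     finite B \<and> B \<subseteq> carrier M \<and>
     (\<forall>c. (\<Oplus>\<^bsub>M\<^esub>b\<in>B. c b \<odot>\<^bsub>M\<^esub> b) = \<zero>\<^bsub>M\<^esub> \<longrightarrow> (\<forall>b\<in>B. c b = 0)) \<and>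
     (\<forall>v\<in>carrier M. \<exists>c. v = (\<Oplus>\<^bsub>M\<^esub>b\<in>B. c b \<odot>\<^bsub>M\<^esub> b))"

definition vdim :: "('k::field, 'v) module \<Rightarrow> enat" where
  "vdim M = (if \<exists>B. finite_basis M B then enat (card (SOME B. finite_basis M B)) else \<infinity>)"


section \<open>Localization\<close>

definition fraction :: "('a, 'x) ring_scheme \<Rightarrow> 'a set \<Rightarrow> 'a \<Rightarrow> 'a \<Rightarrow> ('a \<times> 'a) set" where
  "fraction A U a u =
     {(b, v). b \<in> carrier A \<and> v \<in> U \<and>
        (\<exists>w\<in>U. w \<otimes>\<^bsub>A\<^esub> ((a \<otimes>\<^bsub>A\<^esub> v) \<ominus>\<^bsub>A\<^esub> (b \<otimes>\<^bsub>A\<^esub> u)) = \<zero>\<^bsub>A\<^esub>)}"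

text \<open>The unions in the operations range over all representatives; for multiplicatively closed
  \<open>U\<close> all the sets united are equal.\<close>

definition localization :: "('a, 'x) ring_scheme \<Rightarrow> 'a set \<Rightarrow> ('a \<times> 'a) set ring" where
  "localization A U =
     \<lparr>carrier = {fraction A U a u | a u. a \<in> carrier A \<and> u \<in> U},
      monoid.mult = (\<lambda>C D. \<Union>(a, u)\<in>C. \<Union>(b, v)\<in>D. fraction A U (a \<otimes>\<^bsub>A\<^esub> b) (u \<otimes>\<^bsub>A\<^esub> v)),
      monoid.one = fraction A U \<one>\<^bsub>A\<^esub> \<one>\<^bsub>A\<^esub>,
      ring.zero = fraction A U \<zero>\<^bsub>A\<^esub> \<one>\<^bsub>A\<^esub>,
      ring.add = (\<lambda>C D. \<Union>(a, u)\<in>C. \<Union>(b, v)\<in>D.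
               fraction A U ((a \<otimes>\<^bsub>A\<^esub> v) \<oplus>\<^bsub>A\<^esub> (b \<otimes>\<^bsub>A\<^esub> u)) (u \<otimes>\<^bsub>A\<^esub> v))\<rparr>"


section \<open>Gorenstein rings\<close>

definition linear_maps ::
    "('r, 'x) ring_scheme \<Rightarrow> ('r, 'm) module \<Rightarrow> ('r, 'n) module \<Rightarrow> ('m \<Rightarrow> 'n) set" where
  "linear_maps A M N =
     {f \<in> carrier M \<rightarrow> carrier N.
        (\<forall>x\<in>carrier M. \<forall>y\<in>carrier M. f (x \<oplus>\<^bsub>M\<^esub> y) = f x \<oplus>\<^bsub>N\<^esub> f y) \<and>
        (\<forall>a\<in>carrier A. \<forall>x\<in>carrier M. f (a \<odot>\<^bsub>M\<^esub> x) = a \<odot>\<^bsub>N\<^esub> f x)}"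

definition regular_module :: "('r, 'x) ring_scheme \<Rightarrow> ('r, 'r) module" where
  "regular_module A =
     \<lparr>carrier = carrier A, monoid.mult = monoid.mult A, monoid.one = monoid.one A,
      ring.zero = ring.zero A, ring.add = ring.add A,
      module.smult = monoid.mult A\<rparr>"

text \<open>Test modules live on the same type as \<open>E\<close>. As soon as this type is at least as large as
  \<open>carrier A\<close>, copies of all ideals of \<open>A\<close> are among them, so by Baer's criterion the restriction
  to one type is harmless.\<close>

definition injective_module :: "('r, 'x) ring_scheme \<Rightarrow> ('r, 'u) module \<Rightarrow> bool" where
  "injective_module A E \<longleftrightarrow>
     module A E \<and>
     (\<forall>(M :: ('r, 'u) module) (N :: ('r, 'u) module) i f.
        module A M \<and> module A N \<and>
        i \<in> linear_maps A M N \<and> inj_on i (carrier M) \<and> f \<in> linear_maps A M E \<longrightarrow>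
        (\<exists>g\<in>linear_maps A N E. \<forall>x\<in>carrier M. g (i x) = f x))"

definition injective_resolution ::
    "('r, 'x) ring_scheme \<Rightarrow> ('r, 'm) module \<Rightarrow> ('m \<Rightarrow> 'u) \<Rightarrow>
     (nat \<Rightarrow> ('r, 'u) module) \<Rightarrow> (nat \<Rightarrow> 'u \<Rightarrow> 'u) \<Rightarrow> bool" where
  "injective_resolution A M \<epsilon> E \<delta> \<longleftrightarrow>
     (\<forall>i. injective_module A (E i)) \<and>
     \<epsilon> \<in> linear_maps A M (E 0) \<and> inj_on \<epsilon> (carrier M) \<and>
     (\<forall>i. \<delta> i \<in> linear_maps A (E i) (E (Suc i))) \<and>
     \<epsilon> ` carrier M = a_kernel (E 0) (E 1) (\<delta> 0) \<and>
     (\<forall>i. \<delta> i ` carrier (E i) = a_kernel (E (Suc i)) (E (Suc (Suc i))) (\<delta> (Suc i)))"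

text \<open>Finite injective dimension of a ring over itself. The modules of the resolution are taken on
  the type \<open>('r \<times> 'r) set\<close>, which loses nothing for Noetherian \<open>A\<close>: each term of a
  finite minimal injective resolution of \<open>A\<close> is a direct sum, over primes \<open>P\<close>, of finitely many
  copies of the injective hull of \<open>A/P\<close>, hence no larger than \<open>A\<close> if \<open>A\<close> is infinite; and if \<open>A\<close> is finite,
  it is Artinian, so finite injective dimension means that \<open>A\<close> itself is injective.\<close>

definition finite_self_injective_dimension :: "('r, 'x) ring_scheme \<Rightarrow> bool" where
  "finite_self_injective_dimension A \<longleftrightarrow>
     (\<exists>(\<epsilon> :: 'r \<Rightarrow> ('r \<times> 'r) set) E \<delta> d.
        injective_resolution A (regular_module A) \<epsilon> E \<delta> \<and>
        (\<forall>i>d. carrier (E i) = {\<zero>\<^bsub>E i\<^esub>}))"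

definition gorenstein_local_ring :: "('r, 'x) ring_scheme \<Rightarrow> bool" where
  "gorenstein_local_ring A \<longleftrightarrow>
     cring A \<and> noetherian_ring A \<and> (\<exists>!\<mm>. maximalideal \<mm> A) \<and>
     finite_self_injective_dimension A"

definition gorenstein_ring :: "('r, 'x) ring_scheme \<Rightarrow> bool" where
  "gorenstein_ring A \<longleftrightarrow>
     cring A \<and> noetherian_ring A \<and>
     (\<forall>\<mm>. maximalideal \<mm> A \<longrightarrow> gorenstein_local_ring (localization A (carrier A - \<mm>)))"


section \<open>Subschemes of projective space and their homogeneous coordinate rings\<close>

text \<open>A closed subscheme of projective \<open>n\<close>-space is represented by its saturated homogeneous
  vanishing ideal in \<open>K[X\<^sub>0,\<dots>,X\<^sub>n]\<close>; this correspondence is bijective.\<close>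

type_synonym 'k mpoly = "(nat \<Rightarrow>\<^sub>0 nat) \<Rightarrow>\<^sub>0 'k"

definition poly_ring :: "nat \<Rightarrow> 'k::field mpoly ring" where
  "poly_ring n =
     ring_of_type_algebra \<lparr>carrier := {f. \<forall>t\<in>Poly_Mapping.keys f. Poly_Mapping.keys t \<subseteq> {0..n}}\<rparr>"

definition total_deg :: "(nat \<Rightarrow>\<^sub>0 nat) \<Rightarrow> nat" where
  "total_deg t = (\<Sum>j\<in>Poly_Mapping.keys t. Poly_Mapping.lookup t j)"

definition poly_piece :: "nat \<Rightarrow> int \<Rightarrow> 'k::field mpoly set" where
  "poly_piece n i =
     {f \<in> carrier (poly_ring n). \<forall>t\<in>Poly_Mapping.keys f. int (total_deg t) = i}"

text \<open>Homogeneous ideals of a ring with homogeneous pieces \<open>g i\<close>.\<close>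

definition homogeneous_ideal ::
    "('a, 'x) ring_scheme \<Rightarrow> (int \<Rightarrow> 'a set) \<Rightarrow> 'a set \<Rightarrow> bool" where
  "homogeneous_ideal A g J \<longleftrightarrow> ideal J A \<and> (\<exists>H \<subseteq> (\<Union>i. g i). J = Idl\<^bsub>A\<^esub> H)"

definition saturated_homogeneous_ideal :: "nat \<Rightarrow> 'k::field mpoly set \<Rightarrow> bool" where
  "saturated_homogeneous_ideal n I \<longleftrightarrow>
     homogeneous_ideal (poly_ring n) (poly_piece n) I \<and>
     (\<forall>f\<in>carrier (poly_ring n).
        (\<exists>k::nat. \<forall>h\<in>poly_piece n (int k). h \<otimes>\<^bsub>poly_ring n\<^esub> f \<in> I) \<longrightarrow> f \<in> I)"

definition coord_ring :: "nat \<Rightarrow> 'k::field mpoly set \<Rightarrow> 'k mpoly set ring" where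
  "coord_ring n I = poly_ring n Quot I"

definition residue_class :: "nat \<Rightarrow> 'k::field mpoly set \<Rightarrow> 'k mpoly \<Rightarrow> 'k mpoly set" where
  "residue_class n I f = I +>\<^bsub>poly_ring n\<^esub> f"

definition coord_scalar :: "nat \<Rightarrow> 'k::field mpoly set \<Rightarrow> 'k \<Rightarrow> 'k mpoly set" where
  "coord_scalar n I c = residue_class n I (Poly_Mapping.single 0 c)"

definition coord_x0 :: "nat \<Rightarrow> 'k::field mpoly set \<Rightarrow> 'k mpoly set" where
  "coord_x0 n I = residue_class n I (Poly_Mapping.single (Poly_Mapping.single 0 1) 1)"

definition coord_piece :: "nat \<Rightarrow> 'k::field mpoly set \<Rightarrow> int \<Rightarrow> 'k mpoly set set" where
  "coord_piece n I i = residue_class n I ` poly_piece n i"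

text \<open>The points of \<open>\<X> = Proj R\<close>: homogeneous prime ideals of \<open>R\<close> not containing \<open>R\<^sub>+\<close>.\<close>

definition points :: "nat \<Rightarrow> 'k::field mpoly set \<Rightarrow> 'k mpoly set set set" where
  "points n I =
     {p. primeideal p (coord_ring n I) \<and>
         homogeneous_ideal (coord_ring n I) (coord_piece n I) p \<and>
         \<not> (\<Union>i\<in>{1..}. coord_piece n I i) \<subseteq> p}"

definition closed_points :: "nat \<Rightarrow> 'k::field mpoly set \<Rightarrow> 'k mpoly set set set" where
  "closed_points n I = {p \<in> points n I. \<forall>q\<in>points n I. p \<subseteq> q \<longrightarrow> q = p}"

text \<open>Non-empty, and no strict chain of two irreducible closed subsets.\<close>

definition zero_dimensional :: "nat \<Rightarrow> 'k::field mpoly set \<Rightarrow> bool" where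
  "zero_dimensional n I \<longleftrightarrow>
     points n I \<noteq> {} \<and> (\<forall>p\<in>points n I. \<forall>q\<in>points n I. p \<subseteq> q \<longrightarrow> p = q)"

text \<open>The stalk at \<open>p\<close>: the degree-zero part of the localization of \<open>R\<close> at the homogeneous elements
  outside \<open>p\<close>.\<close>

definition local_ring :: "nat \<Rightarrow> 'k::field mpoly set \<Rightarrow> 'k mpoly set set \<Rightarrow>
    ('k mpoly set \<times> 'k mpoly set) set ring" where
  "local_ring n I p =
     (let R = coord_ring n I; U = (\<Union>i. coord_piece n I i) - p
      in localization R U
           \<lparr>carrier := {fraction R U f g | f g i. f \<in> coord_piece n I i \<and> g \<in> coord_piece n I i - p}\<rparr>)"

definition locally_gorenstein :: "nat \<Rightarrow> 'k::field mpoly set \<Rightarrow> bool" where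
  "locally_gorenstein n I \<longleftrightarrow> (\<forall>p\<in>closed_points n I. gorenstein_local_ring (local_ring n I p))"

definition arithmetically_gorenstein :: "nat \<Rightarrow> 'k::field mpoly set \<Rightarrow> bool" where
  "arithmetically_gorenstein n I \<longleftrightarrow> gorenstein_ring (coord_ring n I)"

definition hilbert_function :: "nat \<Rightarrow> 'k::field mpoly set \<Rightarrow> int \<Rightarrow> enat" where
  "hilbert_function n I i =
     vdim (subspace_of_algebra (coord_scalar n I) (coord_ring n I) (coord_piece n I i))"

text \<open>The degree of a zero-dimensional scheme: its (constant) Hilbert polynomial.\<close>

definition scheme_degree :: "nat \<Rightarrow> 'k::field mpoly set \<Rightarrow> nat" where
  "scheme_degree n I = (THE d. \<forall>\<^sub>F i in at_top. hilbert_function n I i = enat d)"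

definition generic_position :: "nat \<Rightarrow> 'k::field mpoly set \<Rightarrow> bool" where
  "generic_position n I \<longleftrightarrow>
     (\<forall>i. hilbert_function n I i =
        enat (min (scheme_degree n I) (if i < 0 then 0 else (n + nat i) choose n)))"


section \<open>The extension \<open>R \<subseteq> S[x\<^sub>0]\<close> inside \<open>Q\<^sup>h(R)\<close> and its conductor\<close>

definition affine_ring :: "nat \<Rightarrow> 'k::field mpoly set \<Rightarrow> 'k mpoly set set ring" where
  "affine_ring n I =
     (let R = coord_ring n I in R Quot (Idl\<^bsub>R\<^esub> {coord_x0 n I \<ominus>\<^bsub>R\<^esub> \<one>\<^bsub>R\<^esub>}))"

definition deh :: "nat \<Rightarrow> 'k::field mpoly set \<Rightarrow> 'k mpoly set \<Rightarrow> 'k mpoly set set" where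
  "deh n I f =
     (let R = coord_ring n I in (Idl\<^bsub>R\<^esub> {coord_x0 n I \<ominus>\<^bsub>R\<^esub> \<one>\<^bsub>R\<^esub>}) +>\<^bsub>R\<^esub> f)"

definition homogeneous_nzd :: "nat \<Rightarrow> 'k::field mpoly set \<Rightarrow> 'k mpoly set set" where
  "homogeneous_nzd n I =
     {u \<in> (\<Union>i. coord_piece n I i).
        \<forall>f\<in>carrier (coord_ring n I).
          u \<otimes>\<^bsub>coord_ring n I\<^esub> f = \<zero>\<^bsub>coord_ring n I\<^esub> \<longrightarrow> f = \<zero>\<^bsub>coord_ring n I\<^esub>}"

definition Qh :: "nat \<Rightarrow> 'k::field mpoly set \<Rightarrow> ('k mpoly set \<times> 'k mpoly set) set ring" where
  "Qh n I = localization (coord_ring n I) (homogeneous_nzd n I)"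

definition Qh_frac :: "nat \<Rightarrow> 'k::field mpoly set \<Rightarrow> 'k mpoly set \<Rightarrow> 'k mpoly set \<Rightarrow>
    ('k mpoly set \<times> 'k mpoly set) set" where
  "Qh_frac n I = fraction (coord_ring n I) (homogeneous_nzd n I)"

definition R_in_Qh :: "nat \<Rightarrow> 'k::field mpoly set \<Rightarrow> ('k mpoly set \<times> 'k mpoly set) set set" where
  "R_in_Qh n I = (\<lambda>f. Qh_frac n I f \<one>\<^bsub>coord_ring n I\<^esub>) ` carrier (coord_ring n I)"

text \<open>The identification of \<open>Q\<^sup>h(R)\<close> with \<open>S[x\<^sub>0, x\<^sub>0\<^sup>-\<^sup>1]\<close> takes \<open>f \<in> R\<^sub>i\<close> to \<open>f\<^sup>d\<^sup>e\<^sup>h x\<^sub>0\<^sup>i\<close>, so the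
  element \<open>f\<^sup>d\<^sup>e\<^sup>h\<close> of \<open>S\<close> sits in \<open>Q\<^sup>h(R)\<close> as the fraction \<open>f / x\<^sub>0\<^sup>i\<close>. Every element of \<open>S\<close> is of
  this form.\<close>

definition S_to_Qh :: "nat \<Rightarrow> 'k::field mpoly set \<Rightarrow> 'k mpoly set set \<Rightarrow>
    ('k mpoly set \<times> 'k mpoly set) set" where
  "S_to_Qh n I s =
     (THE q. \<exists>(i::nat) f. f \<in> coord_piece n I (int i) \<and> s = deh n I f \<and>
               q = Qh_frac n I f (coord_x0 n I [^]\<^bsub>coord_ring n I\<^esub> i))"

text \<open>\<open>R~ = S[x\<^sub>0]\<close>: the image of the polynomial ring over \<open>S\<close> in \<open>Q\<^sup>h(R)\<close>.\<close>

definition R_tilde :: "nat \<Rightarrow> 'k::field mpoly set \<Rightarrow> ('k mpoly set \<times> 'k mpoly set) set set" where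
  "R_tilde n I =
     UnivPoly.eval (affine_ring n I) (Qh n I) (S_to_Qh n I)
       (Qh_frac n I (coord_x0 n I) \<one>\<^bsub>coord_ring n I\<^esub>)
     ` carrier (UP (affine_ring n I))"

definition conductor :: "nat \<Rightarrow> 'k::field mpoly set \<Rightarrow> ('k mpoly set \<times> 'k mpoly set) set set" where
  "conductor n I =
     {f \<in> carrier (Qh n I). \<forall>g\<in>R_tilde n I. f \<otimes>\<^bsub>Qh n I\<^esub> g \<in> R_in_Qh n I}"

text \<open>\<open>\<ell>(V/W)\<close> for \<open>K\<close>-subspaces \<open>W \<subseteq> V\<close> of \<open>Q\<^sup>h(R)\<close>.\<close>

definition Qh_quotient_dim :: "nat \<Rightarrow> 'k::field mpoly set \<Rightarrow>
    ('k mpoly set \<times> 'k mpoly set) set set \<Rightarrow> ('k mpoly set \<times> 'k mpoly set) set set \<Rightarrow> enat" where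
  "Qh_quotient_dim n I V W =
     vdim (quotient_module
       (subspace_of_algebra (\<lambda>c. Qh_frac n I (coord_scalar n I c) \<one>\<^bsub>coord_ring n I\<^esub>) (Qh n I) V) W)"

end

theory Submission
  imports Defs "HOL-Library.Function_Algebras"
begin

text \<open>
Let \<open>S\<^sub>i \<subseteq> S\<close> be the space of dehomogenizations of forms of degree \<open>i\<close>, so that \<open>dim S\<^sub>i = HF(i)\<close>, and
let \<open>r\<close> be the first degree in which \<open>HF\<close> reaches \<open>d = deg(\<X>)\<close>. Splitting along powers of \<open>x\<^sub>0\<close>, the
two lengths are \<open>\<Sum>\<^sub>j dim(S/S\<^sub>j)\<close> and \<open>\<Sum>\<^sub>j dim(S\<^sub>j/C\<^sub>j)\<close> over \<open>j < r\<close>, where \<open>C\<^sub>j\<close> is the largest ideal of \<open>S\<close>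
contained in \<open>S\<^sub>j\<close>. In generic position, the growth of the binomial coefficients gives
\<open>HF(i) + HF(r-1-i) \<le> d\<close>; hence the lengths agree iff equality holds for all \<open>i\<close> and all \<open>C\<^sub>j\<close> with \<open>j < r\<close>
vanish. This in turn means that \<open>S\<close> carries a linear functional \<open>\<tau>\<close> such that the orthogonal complement of
\<open>S\<^sub>i\<close> for the form \<open>\<tau>(fg)\<close> is \<open>S\<^sub>r\<^sub>-\<^sub>1\<^sub>-\<^sub>i\<close>.

Homogenizing such a \<open>\<tau>\<close> yields a \<open>K[x\<^sub>0]\<close>-linear functional that makes \<open>R\<close> a Frobenius extension of
\<open>K[x\<^sub>0]\<close>, so \<open>R\<close> inherits injective dimension at most one from \<open>K[x\<^sub>0]\<close>. Conversely, if \<open>R\<close> is Gorenstein, then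
dimension shifting in an injective resolution of its localization at \<open>R\<^sub>+\<close> shows that the socle of \<open>R/x\<^sub>0R\<close>
is one-dimensional. It sits in degree \<open>r\<close>, and \<open>S \<rightarrow> S/S\<^sub>r\<^sub>-\<^sub>1 \<cong> K\<close> is the required \<open>\<tau>\<close>.
\<close>

section \<open>Localization\<close>

text \<open>Gorenstein means finite injective dimension of every local ring, with no bound given in
  advance. For a Frobenius extension the explicit resolution
  \<open>0 -> R_m -> Q -> Q/R_m -> 0\<close> suffices, where \<open>Q\<close> also inverts the
  nonzero polynomials in x_0. In the other direction it is known only that the resolution vanishes
  beyond some index; since injective modules are divisible by the non-zerodivisor x_0, this descends
  step by step to the first cosyzygy. The lengths are the two ends of a chain: sum_j dim(S_j/C_j) <=
  sum_j dim S_j = sum_j dim S_(r-1-j) <= sum_j dim(S/S_j). The equality reverses the summation; the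
  last inequality is the bound on HF(i) + HF(r-1-i). So agreement of the ends forces equality in
  each term. Degree bounds are strict: \<open>Vs (Suc i)\<close> is S_i, \<open>Vs 0\<close> is
  zero, and orthogonality pairs \<open>Vs m\<close> with \<open>Vs (Suc r - m)\<close>. Elements of
  S are represented by polynomials instead of cosets, so that the linear algebra takes place in one
  type.\<close>

locale mult_closed_subset = cring R for R (structure) + fixes U :: "'a set"
  assumes U_subset: "U \<subseteq> carrier R" and U_one [simp, intro]: "\<one> \<in> U"
    and U_mult [simp, intro]: "\<lbrakk>u \<in> U; v \<in> U\<rbrakk> \<Longrightarrow> u \<otimes> v \<in> U"
begin

abbreviation fr where "fr \<equiv> fraction R U"
abbreviation L where "L \<equiv> localization R U"

lemma U_carr [simp, intro]: "u \<in> U \<Longrightarrow> u \<in> carrier R"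
  using U_subset by auto

lemma minus_eq_zero_iff: "\<lbrakk>a \<in> carrier R; b \<in> carrier R\<rbrakk> \<Longrightarrow> a \<ominus> b = \<zero> \<longleftrightarrow> a = b"
  by auto

lemma fr_mem:
  assumes "a \<in> carrier R" "u \<in> U"
  shows "(b, v) \<in> fr a u \<longleftrightarrow> b \<in> carrier R \<and> v \<in> U \<and> (\<exists>w\<in>U. w \<otimes> (a \<otimes> v) = w \<otimes> (b \<otimes> u))"
proof -
  have "w \<otimes> (a \<otimes> v \<ominus> b \<otimes> u) = \<zero> \<longleftrightarrow> w \<otimes> (a \<otimes> v) = w \<otimes> (b \<otimes> u)"
    if "b \<in> carrier R" "v \<in> U" "w \<in> U" for w
  proof -
    have "w \<otimes> (a \<otimes> v \<ominus> b \<otimes> u) = w \<otimes> (a \<otimes> v) \<ominus> w \<otimes> (b \<otimes> u)"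
      using that assms U_carr by algebra
    then show ?thesis using minus_eq_zero_iff that assms by simp
  qed
  then show ?thesis using assms unfolding fraction_def by auto
qed

lemma fr_self: "\<lbrakk>a \<in> carrier R; u \<in> U\<rbrakk> \<Longrightarrow> (a, u) \<in> fr a u"
  by (auto simp: fr_mem)

lemma fr_memE:
  assumes "(b, v) \<in> fr a u" "a \<in> carrier R" "u \<in> U"
  obtains w where "w \<in> U" "w \<otimes> (a \<otimes> v) = w \<otimes> (b \<otimes> u)" "b \<in> carrier R" "v \<in> U"
  using fr_mem[of a u b v] assms by blast

text \<open>Elements of \<open>U\<close> may be zero-divisors, so \<open>v\<close> cannot be
  cancelled; it has to enter the multiplier, which becomes
  \<open>w \<otimes> w' \<otimes> v\<close>.\<close>

lemma fr_trans:
  assumes "a \<in> carrier R" "u \<in> U" "b \<in> carrier R" "v \<in> U" "c \<in> carrier R" "t \<in> U"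
    and "w \<in> U" "w \<otimes> (a \<otimes> v) = w \<otimes> (b \<otimes> u)" "w' \<in> U" "w' \<otimes> (b \<otimes> t) = w' \<otimes> (c \<otimes> v)"
  shows "\<exists>z\<in>U. z \<otimes> (a \<otimes> t) = z \<otimes> (c \<otimes> u)"
proof (rule bexI)
  have c: "w \<in> carrier R" "w' \<in> carrier R" "v \<in> carrier R" "u \<in> carrier R" "t \<in> carrier R" using assms by auto
  have "w \<otimes> w' \<otimes> v \<otimes> (a \<otimes> t) = (w' \<otimes> t) \<otimes> (w \<otimes> (a \<otimes> v))" using c assms(1,3,5) by algebra
  also have "\<dots> = (w \<otimes> u) \<otimes> (w' \<otimes> (b \<otimes> t))" using c assms(1,3,5,8) by algebra
  also have "\<dots> = w \<otimes> w' \<otimes> v \<otimes> (c \<otimes> u)" using c assms(1,3,5,10) by algebra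
  finally show "w \<otimes> w' \<otimes> v \<otimes> (a \<otimes> t) = w \<otimes> w' \<otimes> v \<otimes> (c \<otimes> u)" .
qed (use assms in auto)

lemma fr_eq_iff:
  assumes "a \<in> carrier R" "u \<in> U" "b \<in> carrier R" "v \<in> U"
  shows "fr a u = fr b v \<longleftrightarrow> (\<exists>w\<in>U. w \<otimes> (a \<otimes> v) = w \<otimes> (b \<otimes> u))"
proof
  assume "fr a u = fr b v"
  then have "(b, v) \<in> fr a u" using fr_self assms by auto
  then show "\<exists>w\<in>U. w \<otimes> (a \<otimes> v) = w \<otimes> (b \<otimes> u)" using assms by (auto simp: fr_mem)
next
  assume *: "\<exists>w\<in>U. w \<otimes> (a \<otimes> v) = w \<otimes> (b \<otimes> u)"
  then obtain w where w: "w \<in> U" "w \<otimes> (a \<otimes> v) = w \<otimes> (b \<otimes> u)" by auto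
  have "(c, t) \<in> fr a u \<longleftrightarrow> (c, t) \<in> fr b v" for c t
  proof -
    have "(\<exists>w\<in>U. w \<otimes> (a \<otimes> t) = w \<otimes> (c \<otimes> u)) \<longleftrightarrow> (\<exists>w\<in>U. w \<otimes> (b \<otimes> t) = w \<otimes> (c \<otimes> v))"
      if "c \<in> carrier R" "t \<in> U"
      using fr_trans[OF assms that w] fr_trans[OF assms(3,4,1,2) that w(1) w(2)[symmetric]] by blast
    then show ?thesis using assms by (auto simp: fr_mem)
  qed
  then show "fr a u = fr b v" by auto
qed

lemma fr_eqI:
  assumes "a \<in> carrier R" "u \<in> U" "b \<in> carrier R" "v \<in> U" "a \<otimes> v = b \<otimes> u"
  shows "fr a u = fr b v"
  using assms by (subst fr_eq_iff) auto

lemma fr_cancel: "\<lbrakk>a \<in> carrier R; u \<in> U; v \<in> U\<rbrakk> \<Longrightarrow> fr (v \<otimes> a) (v \<otimes> u) = fr a u"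
  by (rule fr_eqI) (auto simp: m_ac)

lemma fr_cancel': "\<lbrakk>a \<in> carrier R; u \<in> U; v \<in> U\<rbrakk> \<Longrightarrow> fr (v \<otimes> a) (u \<otimes> v) = fr a u"
  using fr_cancel[of a u v] by (simp add: m_comm)

lemma fr_closed [simp, intro]: "\<lbrakk>a \<in> carrier R; u \<in> U\<rbrakk> \<Longrightarrow> fr a u \<in> carrier L"
  by (auto simp: localization_def)

lemma carrE:
  assumes "x \<in> carrier L" obtains a u where "a \<in> carrier R" "u \<in> U" "x = fr a u"
  using assms by (auto simp: localization_def)

lemma one_L: "\<one>\<^bsub>L\<^esub> = fr \<one> \<one>" and zero_L: "\<zero>\<^bsub>L\<^esub> = fr \<zero> \<one>"
  by (auto simp: localization_def)

text \<open>The operations of \<open>localization\<close> are unions over all representatives. Once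
  the value is known not to depend on them, a union over nonempty index sets is that common
  value.\<close>

lemma UN_const2:
  assumes "\<And>a u b v. (a, u) \<in> C \<Longrightarrow> (b, v) \<in> D \<Longrightarrow> f a u b v = Y" "C \<noteq> {}" "D \<noteq> {}"
  shows "(\<Union>(a, u)\<in>C. \<Union>(b, v)\<in>D. f a u b v) = Y"
proof (rule SUP_eq_const)
  fix p assume "p \<in> C"
  then show "(case p of (a, u) \<Rightarrow> \<Union>(b, v)\<in>D. f a u b v) = Y"
    using assms by (auto simp: split_beta intro!: SUP_eq_const)
qed fact

lemma mult_L:
  assumes "a \<in> carrier R" "u \<in> U" "b \<in> carrier R" "v \<in> U"
  shows "fr a u \<otimes>\<^bsub>L\<^esub> fr b v = fr (a \<otimes> b) (u \<otimes> v)"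
proof -
  have "fr (a \<otimes> b) (u \<otimes> v) = fr (a' \<otimes> b') (u' \<otimes> v')" if h1: "(a', u') \<in> fr a u" and h2: "(b', v') \<in> fr b v" for a' u' b' v'
  proof -
    obtain w where w: "w \<in> U" "w \<otimes> (a \<otimes> u') = w \<otimes> (a' \<otimes> u)" and c1: "a' \<in> carrier R" "u' \<in> U"
      using fr_memE[OF h1 assms(1,2)] by blast
    obtain z where z: "z \<in> U" "z \<otimes> (b \<otimes> v') = z \<otimes> (b' \<otimes> v)" and c2: "b' \<in> carrier R" "v' \<in> U"
      using fr_memE[OF h2 assms(3,4)] by blast
    have c: "w \<in> carrier R" "z \<in> carrier R" "u \<in> carrier R" "u' \<in> carrier R" "v \<in> carrier R" "v' \<in> carrier R"
      using w z c1 c2 assms by auto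
    have "w \<otimes> z \<otimes> ((a \<otimes> b) \<otimes> (u' \<otimes> v')) = (w \<otimes> (a \<otimes> u')) \<otimes> (z \<otimes> (b \<otimes> v'))"
      using c c1(1) c2(1) assms(1,3) by algebra
    also have "\<dots> = w \<otimes> z \<otimes> ((a' \<otimes> b') \<otimes> (u \<otimes> v))" unfolding w(2) z(2)
      using c c1(1) c2(1) assms(1,3) by algebra
    finally have "\<exists>y\<in>U. y \<otimes> ((a \<otimes> b) \<otimes> (u' \<otimes> v')) = y \<otimes> ((a' \<otimes> b') \<otimes> (u \<otimes> v))" using w(1) z(1) by blast
    then show ?thesis using c1 c2 assms fr_eq_iff by simp
  qed
  moreover have "fr a u \<noteq> {}" "fr b v \<noteq> {}" using fr_self assms by auto
  ultimately have "(\<Union>(a', u')\<in>fr a u. \<Union>(b', v')\<in>fr b v. fr (a' \<otimes> b') (u' \<otimes> v')) = fr (a \<otimes> b) (u \<otimes> v)"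
    by (intro UN_const2) auto
  then show ?thesis by (simp add: localization_def)
qed

lemma add_L:
  assumes "a \<in> carrier R" "u \<in> U" "b \<in> carrier R" "v \<in> U"
  shows "fr a u \<oplus>\<^bsub>L\<^esub> fr b v = fr (a \<otimes> v \<oplus> b \<otimes> u) (u \<otimes> v)"
proof -
  have "fr (a \<otimes> v \<oplus> b \<otimes> u) (u \<otimes> v) = fr (a' \<otimes> v' \<oplus> b' \<otimes> u') (u' \<otimes> v')" if h1: "(a', u') \<in> fr a u" and h2: "(b', v') \<in> fr b v" for a' u' b' v'
  proof -
    obtain w where w: "w \<in> U" "w \<otimes> (a \<otimes> u') = w \<otimes> (a' \<otimes> u)" and c1: "a' \<in> carrier R" "u' \<in> U"
      using fr_memE[OF h1 assms(1,2)] by blast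
    obtain z where z: "z \<in> U" "z \<otimes> (b \<otimes> v') = z \<otimes> (b' \<otimes> v)" and c2: "b' \<in> carrier R" "v' \<in> U"
      using fr_memE[OF h2 assms(3,4)] by blast
    have c: "w \<in> carrier R" "z \<in> carrier R" "u \<in> carrier R" "u' \<in> carrier R" "v \<in> carrier R" "v' \<in> carrier R"
      using w z c1 c2 assms by auto
    have "w \<otimes> z \<otimes> ((a \<otimes> v \<oplus> b \<otimes> u) \<otimes> (u' \<otimes> v'))
       = (w \<otimes> (a \<otimes> u')) \<otimes> (z \<otimes> (v \<otimes> v')) \<oplus> (z \<otimes> (b \<otimes> v')) \<otimes> (w \<otimes> (u \<otimes> u'))"
      using c c1(1) c2(1) assms(1,3) by algebra
    also have "\<dots> = w \<otimes> z \<otimes> ((a' \<otimes> v' \<oplus> b' \<otimes> u') \<otimes> (u \<otimes> v))" unfolding w(2) z(2)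
      using c c1(1) c2(1) assms(1,3) by algebra
    finally have "\<exists>y\<in>U. y \<otimes> ((a \<otimes> v \<oplus> b \<otimes> u) \<otimes> (u' \<otimes> v')) = y \<otimes> ((a' \<otimes> v' \<oplus> b' \<otimes> u') \<otimes> (u \<otimes> v))" using w(1) z(1) by blast
    then show ?thesis using c1 c2 assms fr_eq_iff by simp
  qed
  moreover have "fr a u \<noteq> {}" "fr b v \<noteq> {}" using fr_self assms by auto
  ultimately have "(\<Union>(a', u')\<in>fr a u. \<Union>(b', v')\<in>fr b v. fr (a' \<otimes> v' \<oplus> b' \<otimes> u') (u' \<otimes> v')) = fr (a \<otimes> v \<oplus> b \<otimes> u) (u \<otimes> v)"
    by (intro UN_const2) auto
  then show ?thesis by (simp add: localization_def)
qed

lemma fr_zero_iff: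
  assumes "a \<in> carrier R" "u \<in> U" shows "fr a u = \<zero>\<^bsub>L\<^esub> \<longleftrightarrow> (\<exists>w\<in>U. w \<otimes> a = \<zero>)"
  unfolding zero_L using assms by (subst fr_eq_iff) auto

lemma add_same_L:
  assumes "a \<in> carrier R" "u \<in> U" "b \<in> carrier R"
  shows "fr a u \<oplus>\<^bsub>L\<^esub> fr b u = fr (a \<oplus> b) u"
proof -
  have "fr a u \<oplus>\<^bsub>L\<^esub> fr b u = fr (a \<otimes> u \<oplus> b \<otimes> u) (u \<otimes> u)" using assms by (simp add: add_L)
  also have "a \<otimes> u \<oplus> b \<otimes> u = u \<otimes> (a \<oplus> b)" using assms(1,3) U_carr[OF assms(2)] by algebra
  finally show ?thesis using assms by (simp add: fr_cancel)
qed

lemma common_denom2: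
  assumes "x \<in> carrier L" "y \<in> carrier L"
  obtains a b u where "a \<in> carrier R" "b \<in> carrier R" "u \<in> U" "x = fr a u" "y = fr b u"
proof -
  obtain a u where 1: "a \<in> carrier R" "u \<in> U" "x = fr a u" using assms carrE by blast
  obtain b v where 2: "b \<in> carrier R" "v \<in> U" "y = fr b v" using assms carrE by blast
  show ?thesis
    by (rule that[of "v \<otimes> a" "u \<otimes> b" "u \<otimes> v"])
       (use 1 2 in \<open>simp_all add: fr_cancel fr_cancel'\<close>)
qed

lemma cring_L: "cring L"
proof (rule cringI)
  show "abelian_group L"
  proof (rule abelian_groupI)
    fix x y assume "x \<in> carrier L" "y \<in> carrier L"
    then obtain a b u where "a \<in> carrier R" "b \<in> carrier R" "u \<in> U" "x = fr a u" "y = fr b u" by (rule common_denom2)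
    then show "x \<oplus>\<^bsub>L\<^esub> y \<in> carrier L" "x \<oplus>\<^bsub>L\<^esub> y = y \<oplus>\<^bsub>L\<^esub> x"
      by (auto simp: add_same_L a_comm)
  next
    show "\<zero>\<^bsub>L\<^esub> \<in> carrier L" by (simp add: zero_L)
  next
    fix x y z assume "x \<in> carrier L" "y \<in> carrier L" and z: "z \<in> carrier L"
    then obtain a b u where 1: "a \<in> carrier R" "b \<in> carrier R" "u \<in> U" "x = fr a u" "y = fr b u" by (rule_tac common_denom2)
    obtain c v where 2: "c \<in> carrier R" "v \<in> U" "z = fr c v" using carrE[OF z] .
    have 3: "x = fr (v \<otimes> a) (v \<otimes> u)" "y = fr (v \<otimes> b) (v \<otimes> u)" "z = fr (u \<otimes> c) (v \<otimes> u)"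
      using 1 2 fr_cancel'[of c v u] by (simp_all add: fr_cancel)
    show "x \<oplus>\<^bsub>L\<^esub> y \<oplus>\<^bsub>L\<^esub> z = x \<oplus>\<^bsub>L\<^esub> (y \<oplus>\<^bsub>L\<^esub> z)" unfolding 3
      using 1 2 by (simp add: add_same_L a_assoc)
  next
    fix x assume "x \<in> carrier L"
    then obtain a u where 1: "a \<in> carrier R" "u \<in> U" "x = fr a u" using carrE by blast
    have "\<zero>\<^bsub>L\<^esub> = fr \<zero> u" using 1 unfolding zero_L by (intro fr_eqI) auto
    then show "\<zero>\<^bsub>L\<^esub> \<oplus>\<^bsub>L\<^esub> x = x" "\<exists>y\<in>carrier L. y \<oplus>\<^bsub>L\<^esub> x = \<zero>\<^bsub>L\<^esub>"
      using 1 by (simp add: add_same_L, intro bexI[of _ "fr (\<ominus> a) u"]) (simp_all add: add_same_L l_neg)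
  qed
  show "Group.comm_monoid L"
  proof (rule comm_monoidI)
    fix x y assume x: "x \<in> carrier L" and y: "y \<in> carrier L"
    obtain a u where 1: "a \<in> carrier R" "u \<in> U" "x = fr a u" using x carrE by blast
    obtain b v where 2: "b \<in> carrier R" "v \<in> U" "y = fr b v" using y carrE by blast
    show "x \<otimes>\<^bsub>L\<^esub> y \<in> carrier L" "x \<otimes>\<^bsub>L\<^esub> y = y \<otimes>\<^bsub>L\<^esub> x"
      using 1 2 by (auto simp: mult_L m_comm)
    fix z assume z: "z \<in> carrier L"
    obtain c w where 3: "c \<in> carrier R" "w \<in> U" "z = fr c w" using z carrE by blast
    show "x \<otimes>\<^bsub>L\<^esub> y \<otimes>\<^bsub>L\<^esub> z = x \<otimes>\<^bsub>L\<^esub> (y \<otimes>\<^bsub>L\<^esub> z)"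
      using 1 2 3 by (auto simp: mult_L m_assoc)
  next
    show "\<one>\<^bsub>L\<^esub> \<in> carrier L" by (simp add: one_L)
    fix x assume x: "x \<in> carrier L"
    then obtain a u where 1: "a \<in> carrier R" "u \<in> U" "x = fr a u" using carrE by blast
    show "\<one>\<^bsub>L\<^esub> \<otimes>\<^bsub>L\<^esub> x = x" using 1 by (simp add: one_L mult_L)
  qed
  fix x y z assume "x \<in> carrier L" "y \<in> carrier L" and z: "z \<in> carrier L"
  then obtain a b u where 1: "a \<in> carrier R" "b \<in> carrier R" "u \<in> U" "x = fr a u" "y = fr b u" by (rule_tac common_denom2)
  obtain c v where 2: "c \<in> carrier R" "v \<in> U" "z = fr c v" using carrE[OF z] .
  show "(x \<oplus>\<^bsub>L\<^esub> y) \<otimes>\<^bsub>L\<^esub> z = x \<otimes>\<^bsub>L\<^esub> z \<oplus>\<^bsub>L\<^esub> y \<otimes>\<^bsub>L\<^esub> z"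
    using 1 2 by (simp add: add_same_L mult_L l_distr)
qed

lemma uminus_L:
  assumes "a \<in> carrier R" "u \<in> U" shows "\<ominus>\<^bsub>L\<^esub> fr a u = fr (\<ominus> a) u"
proof -
  interpret L: cring L by (rule cring_L)
  have "fr (\<ominus> a) u \<oplus>\<^bsub>L\<^esub> fr a u = \<zero>\<^bsub>L\<^esub>" using assms
    by (simp add: add_same_L l_neg fr_zero_iff, blast)
  then show ?thesis using assms by (intro L.minus_equality) simp_all
qed

lemma minus_same_L:
  assumes "a \<in> carrier R" "u \<in> U" "b \<in> carrier R"
  shows "fr a u \<ominus>\<^bsub>L\<^esub> fr b u = fr (a \<ominus> b) u"
  using assms by (simp add: a_minus_def uminus_L add_same_L)

lemma hom_L: "(\<lambda>a. fr a \<one>) \<in> ring_hom R L"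
  by (rule ring_hom_memI) (auto simp: mult_L add_same_L one_L)

lemma ideal_contraction:
  assumes "ideal J L" shows "ideal {a \<in> carrier R. fr a \<one> \<in> J} R"
proof -
  interpret ring_hom_ring R L "\<lambda>a. fr a \<one>"
    by (rule ring_hom_ringI2) (use cring_L hom_L cring.axioms ring_axioms in auto)
  show ?thesis using ideal_vimage[OF assms] by simp
qed

lemma fr_in_ideal_iff:
  assumes "ideal J L" "a \<in> carrier R" "u \<in> U"
  shows "fr a u \<in> J \<longleftrightarrow> fr a \<one> \<in> J"
proof -
  interpret J: ideal J L by fact
  have 1: "fr a u = fr \<one> u \<otimes>\<^bsub>L\<^esub> fr a \<one>" using assms by (simp add: mult_L)
  have 2: "fr a \<one> = fr u \<one> \<otimes>\<^bsub>L\<^esub> fr a u" using assms fr_eqI[of "u \<otimes> a" u a \<one>] by (simp add: mult_L m_comm)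
  show ?thesis using 1 2 assms J.I_l_closed by (metis U_carr U_one fr_closed one_closed)
qed

text \<open>An ideal of the localization is determined by its contraction, since denominators are
  units (\<open>fr_in_ideal_iff\<close>). Generators of the contraction therefore generate the
  ideal.\<close>

lemma noetherian_L:
  assumes "noetherian_ring R" shows "noetherian_ring L"
proof -
  interpret N: noetherian_ring R by fact
  interpret L: cring L by (rule cring_L)
  show ?thesis
  proof (unfold_locales, goal_cases)
    case (1 J)
    let ?I = "{a \<in> carrier R. fr a \<one> \<in> J}"
    obtain A where A: "A \<subseteq> carrier R" "finite A" "?I = Idl A"
      using N.finetely_gen[OF ideal_contraction[OF 1]] by auto
    let ?B = "(\<lambda>a. fr a \<one>) ` A"
    have B: "?B \<subseteq> carrier L" using A(1) by auto
    have AI: "A \<subseteq> ?I" unfolding A(3) using genideal_self[OF A(1)] .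
    have "?B \<subseteq> J" using AI by auto
    then have *: "Idl\<^bsub>L\<^esub> ?B \<subseteq> J" using L.genideal_minimal[OF 1] by simp
    have iB: "ideal (Idl\<^bsub>L\<^esub> ?B) L" by (rule L.genideal_ideal[OF B])
    have "A \<subseteq> {a \<in> carrier R. fr a \<one> \<in> Idl\<^bsub>L\<^esub> ?B}" using A(1) L.genideal_self[OF B] by auto
    then have **: "?I \<subseteq> {a \<in> carrier R. fr a \<one> \<in> Idl\<^bsub>L\<^esub> ?B}"
      unfolding A(3) by (rule genideal_minimal[OF ideal_contraction[OF iB]])
    have "J \<subseteq> Idl\<^bsub>L\<^esub> ?B"
    proof
      fix x assume x: "x \<in> J"
      then have "x \<in> carrier L" using 1 by (simp add: ideal.Icarr)
      then obtain a u where au: "a \<in> carrier R" "u \<in> U" "x = fr a u" using carrE by blast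
      have "a \<in> ?I" using x au(1) fr_in_ideal_iff[OF 1 au(1,2)] unfolding au(3) by simp
      then show "x \<in> Idl\<^bsub>L\<^esub> ?B" using ** fr_in_ideal_iff[OF iB au(1,2)] unfolding au(3) by auto
    qed
    with * have "J = Idl\<^bsub>L\<^esub> ?B" by simp
    then show ?case using B A(2) by blast
  qed
qed

end

section \<open>Localization at a maximal ideal\<close>

locale localization_at = cring R for R (structure) + fixes \<mm> :: "'a set"
  assumes max: "maximalideal \<mm> R"
begin

sublocale m: maximalideal \<mm> R by (rule max)

lemma prime_m: "primeideal \<mm> R" by (rule maximalideal_prime[OF max])

sublocale mult_closed_subset R "carrier R - \<mm>"
proof
  show "\<one> \<in> carrier R - \<mm>" using m.I_notcarr m.one_imp_carrier by auto
next
  fix u v assume "u \<in> carrier R - \<mm>" "v \<in> carrier R - \<mm>"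
  then show "u \<otimes> v \<in> carrier R - \<mm>" using primeideal.I_prime[OF prime_m] by blast
qed auto

definition "mloc = {x. \<exists>a\<in>\<mm>. \<exists>u\<in>carrier R - \<mm>. x = fr a u}"

lemma fr_in_mloc_iff:
  assumes "a \<in> carrier R" "u \<in> carrier R - \<mm>"
  shows "fr a u \<in> mloc \<longleftrightarrow> a \<in> \<mm>"
proof
  assume "fr a u \<in> mloc"
  then obtain b v where b: "b \<in> \<mm>" "v \<in> carrier R - \<mm>" "fr a u = fr b v" unfolding mloc_def by auto
  then obtain w where w: "w \<in> carrier R - \<mm>" "w \<otimes> (a \<otimes> v) = w \<otimes> (b \<otimes> u)"
    using fr_eq_iff[of a u b v] assms m.Icarr by blast
  have "w \<otimes> (b \<otimes> u) \<in> \<mm>" using b w(1) assms by (simp add: m.I_l_closed m.I_r_closed)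
  then have "w \<otimes> (a \<otimes> v) \<in> \<mm>" using w by simp
  then have "a \<otimes> v \<in> \<mm>" using primeideal.I_prime[OF prime_m, of w "a \<otimes> v"] w(1) b(2) assms by auto
  then show "a \<in> \<mm>" using primeideal.I_prime[OF prime_m, of a v] b(2) assms by auto
qed (use assms in \<open>auto simp: mloc_def\<close>)

text \<open>A fraction outside \<open>mloc\<close> has numerator and denominator outside \<mm>, so
  its inverse is again a fraction. Hence every proper ideal lies in \<open>mloc\<close>.\<close>

lemma unit_outside_mloc:
  assumes "ideal J L" "x \<in> J" "x \<notin> mloc"
  shows "J = carrier L"
proof -
  interpret J: ideal J L by fact
  have "x \<in> carrier L" using assms J.Icarr by auto
  then obtain a u where au: "a \<in> carrier R" "u \<in> carrier R - \<mm>" "x = fr a u" using carrE by blast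
  then have a: "a \<in> carrier R - \<mm>" using assms(3) by (auto simp: mloc_def)
  have "fr u a \<otimes>\<^bsub>L\<^esub> x = \<one>\<^bsub>L\<^esub>" unfolding au(3) one_L using au a
    fr_eqI[of "u \<otimes> a" "a \<otimes> u" \<one> \<one>] U_mult[OF a au(2)] U_one by (simp add: mult_L m_comm)
  then have "\<one>\<^bsub>L\<^esub> \<in> J" using assms(2) J.I_l_closed[of x "fr u a"] au a by auto
  then show ?thesis using J.one_imp_carrier by simp
qed

lemma ideal_mloc_carr: "x \<in> mloc \<Longrightarrow> x \<in> carrier L"
  using m.Icarr by (auto simp: mloc_def)

lemma ideal_mloc: "ideal mloc L"
proof -
  interpret L: cring L by (rule cring_L)
  show ?thesis
  proof (rule idealI)
    show "ring L" by (rule L.ring_axioms)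
    show "subgroup mloc (add_monoid L)"
    proof (rule L.add.subgroupI)
      show "mloc \<subseteq> carrier L" using m.Icarr by (auto simp: mloc_def)
      have "fr \<zero> \<one> \<in> mloc" using m.zero_closed U_one unfolding mloc_def by blast
      then show "mloc \<noteq> {}" by blast
    next
      fix x assume "x \<in> mloc"
      then obtain a u where "a \<in> \<mm>" "u \<in> carrier R - \<mm>" "x = fr a u" by (auto simp: mloc_def)
      then show "\<ominus>\<^bsub>L\<^esub> x \<in> mloc"
        using uminus_L[of a u] m.Icarr m.a_inv_closed fr_in_mloc_iff[of "\<ominus> a" u] by simp
    next
      fix x y assume "x \<in> mloc" "y \<in> mloc"
      then obtain a u b v where 1: "a \<in> \<mm>" "u \<in> carrier R - \<mm>" "x = fr a u" "b \<in> \<mm>" "v \<in> carrier R - \<mm>" "y = fr b v"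
        by (auto simp: mloc_def)
      then have "a \<otimes> v \<oplus> b \<otimes> u \<in> \<mm>" by (auto intro!: m.a_closed m.I_r_closed)
      moreover have "u \<otimes> v \<in> carrier R - \<mm>" using U_mult[OF 1(2,5)] .
      ultimately have "fr (a \<otimes> v \<oplus> b \<otimes> u) (u \<otimes> v) \<in> mloc" by (auto simp: mloc_def)
      then show "x \<oplus>\<^bsub>L\<^esub> y \<in> mloc" using 1 m.Icarr by (simp add: add_L)
    qed
  next
    fix x y assume x: "x \<in> mloc" and "y \<in> carrier L"
    then obtain b v where 2: "b \<in> carrier R" "v \<in> carrier R - \<mm>" "y = fr b v" using carrE by blast
    obtain a u where 1: "a \<in> \<mm>" "u \<in> carrier R - \<mm>" "x = fr a u" using x unfolding mloc_def by auto
    have "a \<otimes> b \<in> \<mm>" using 1(1) 2(1) by (rule m.I_r_closed)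
    then have *: "x \<otimes>\<^bsub>L\<^esub> y \<in> mloc"
      using m.Icarr[OF 1(1)] 1 2 U_mult[OF 1(2) 2(2)] by (simp add: mult_L fr_in_mloc_iff)
    then show "x \<otimes>\<^bsub>L\<^esub> y \<in> mloc" "y \<otimes>\<^bsub>L\<^esub> x \<in> mloc"
      using L.m_comm[OF \<open>y \<in> carrier L\<close> ideal_mloc_carr[OF x]] by simp_all
  qed
qed

lemma maximalideal_mloc: "maximalideal mloc L"
proof (rule maximalidealI)
  show "ideal mloc L" by (rule ideal_mloc)
  have "fr \<one> \<one> \<notin> mloc" using fr_in_mloc_iff[of \<one> \<one>] U_one by auto
  then show "carrier L \<noteq> mloc" using fr_closed[OF one_closed U_one] by metis
  fix J assume "ideal J L" "mloc \<subseteq> J" "J \<subseteq> carrier L"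
  then show "J = mloc \<or> J = carrier L" using unit_outside_mloc[of J] by blast
qed

lemma maximalideal_unique:
  assumes "maximalideal N L" shows "N = mloc"
proof -
  interpret N: maximalideal N L by fact
  have "N \<subseteq> mloc" using unit_outside_mloc[OF N.ideal_axioms] N.I_notcarr by blast
  moreover have "mloc \<subseteq> carrier L" using ideal_mloc_carr by blast
  ultimately show ?thesis using N.I_maximal[OF ideal_mloc] maximalideal.I_notcarr[OF maximalideal_mloc] by blast
qed

lemma ex1_maximalideal: "\<exists>!N. maximalideal N L"
  using maximalideal_mloc maximalideal_unique by blast

end

section \<open>Injective modules\<close>

text \<open>Homomorphisms on an ideal that is given as a subset of the ring; the ideal does not have
  to be packaged as a module record, as \<open>linear_maps\<close> would demand.\<close>

definition linear_on where
  "linear_on A E J f \<longleftrightarrow> f \<in> J \<rightarrow> carrier E \<and>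
     (\<forall>x\<in>J. \<forall>y\<in>J. f (x \<oplus>\<^bsub>A\<^esub> y) = f x \<oplus>\<^bsub>E\<^esub> f y) \<and>
     (\<forall>a\<in>carrier A. \<forall>x\<in>J. f (a \<otimes>\<^bsub>A\<^esub> x) = a \<odot>\<^bsub>E\<^esub> f x)"

definition baer where
  "baer A E \<longleftrightarrow> (\<forall>J f. ideal J A \<and> linear_on A E J f \<longrightarrow> (\<exists>e\<in>carrier E. \<forall>x\<in>J. f x = x \<odot>\<^bsub>E\<^esub> e))"

lemma module_uminus:
  assumes "module A E" "e \<in> carrier E"
  shows "(\<ominus>\<^bsub>A\<^esub> \<one>\<^bsub>A\<^esub>) \<odot>\<^bsub>E\<^esub> e = \<ominus>\<^bsub>E\<^esub> e"
proof -
  interpret module A E by fact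
  have "(\<ominus>\<^bsub>A\<^esub> \<one>\<^bsub>A\<^esub>) \<odot>\<^bsub>E\<^esub> e \<oplus>\<^bsub>E\<^esub> e = (\<ominus>\<^bsub>A\<^esub> \<one>\<^bsub>A\<^esub> \<oplus>\<^bsub>A\<^esub> \<one>\<^bsub>A\<^esub>) \<odot>\<^bsub>E\<^esub> e"
    using assms by (simp add: smult_l_distr)
  also have "\<dots> = \<zero>\<^bsub>E\<^esub>" using assms by (simp add: R.l_neg)
  finally show ?thesis using assms by (intro M.minus_equality[symmetric]) auto
qed

text \<open>Baer's criterion. Partial extensions of \<open>f\<close> are handled as graphs. A
  maximal graph, from Zorn's lemma, has full domain: any \<open>n\<close> can be adjoined, because
  Baer's condition supplies a value compatible with the multiples of \<open>n\<close> already in the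
  domain.\<close>

lemma baer_imp_injective_module:
  fixes E :: "('r, 'u) module"
  assumes E: "module A E" and baer: "baer A E"
  shows "injective_module A E"
  unfolding injective_module_def
proof (intro conjI allI impI)
  fix M N :: "('r, 'u) module" and i f
  assume *: "module A M \<and> module A N \<and> i \<in> linear_maps A M N \<and> inj_on i (carrier M) \<and> f \<in> linear_maps A M E"
  interpret E: module A E by fact
  interpret M: module A M using * by simp
  interpret N: module A N using * by simp
  have i: "\<And>x. x \<in> carrier M \<Longrightarrow> i x \<in> carrier N"
     "\<And>x y. x \<in> carrier M \<Longrightarrow> y \<in> carrier M \<Longrightarrow> i (x \<oplus>\<^bsub>M\<^esub> y) = i x \<oplus>\<^bsub>N\<^esub> i y"
     "\<And>a x. a \<in> carrier A \<Longrightarrow> x \<in> carrier M \<Longrightarrow> i (a \<odot>\<^bsub>M\<^esub> x) = a \<odot>\<^bsub>N\<^esub> i x"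
    using * by (auto simp: linear_maps_def)
  have f: "\<And>x. x \<in> carrier M \<Longrightarrow> f x \<in> carrier E"
     "\<And>x y. x \<in> carrier M \<Longrightarrow> y \<in> carrier M \<Longrightarrow> f (x \<oplus>\<^bsub>M\<^esub> y) = f x \<oplus>\<^bsub>E\<^esub> f y"
     "\<And>a x. a \<in> carrier A \<Longrightarrow> x \<in> carrier M \<Longrightarrow> f (a \<odot>\<^bsub>M\<^esub> x) = a \<odot>\<^bsub>E\<^esub> f x"
    using * by (auto simp: linear_maps_def)
  have inj: "inj_on i (carrier M)" using * by simp
  \<comment> \<open>Single-valuedness is demanded only over the zero of \<open>N\<close>; closure
    under addition and negation extends it to all arguments.\<close>
  define S where "S = {H. H \<subseteq> carrier N \<times> carrier E \<and>
      (\<forall>n e n' e'. (n, e) \<in> H \<longrightarrow> (n', e') \<in> H \<longrightarrow> (n \<oplus>\<^bsub>N\<^esub> n', e \<oplus>\<^bsub>E\<^esub> e') \<in> H) \<and>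
      (\<forall>a n e. a \<in> carrier A \<longrightarrow> (n, e) \<in> H \<longrightarrow> (a \<odot>\<^bsub>N\<^esub> n, a \<odot>\<^bsub>E\<^esub> e) \<in> H) \<and>
      (\<forall>e. (\<zero>\<^bsub>N\<^esub>, e) \<in> H \<longrightarrow> e = \<zero>\<^bsub>E\<^esub>) \<and>
      (\<forall>x\<in>carrier M. (i x, f x) \<in> H)}"
  define H0 where "H0 = (\<lambda>x. (i x, f x)) ` carrier M"
  have i0: "i \<zero>\<^bsub>M\<^esub> = \<zero>\<^bsub>N\<^esub>" using i(3)[of "\<zero>\<^bsub>A\<^esub>" "\<zero>\<^bsub>M\<^esub>"] i(1) by simp
  have f0: "f \<zero>\<^bsub>M\<^esub> = \<zero>\<^bsub>E\<^esub>" using f(3)[of "\<zero>\<^bsub>A\<^esub>" "\<zero>\<^bsub>M\<^esub>"] f(1) by simp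
  have H0: "H0 \<in> S"
  proof -
    have "f x = \<zero>\<^bsub>E\<^esub>" if "x \<in> carrier M" "i x = \<zero>\<^bsub>N\<^esub>" for x
    proof -
      have "x = \<zero>\<^bsub>M\<^esub>" using that i0 inj by (metis M.M.zero_closed inj_on_def)
      then show ?thesis using f0 by simp
    qed
    moreover have "\<exists>z\<in>carrier M. i x \<oplus>\<^bsub>N\<^esub> i y = i z \<and> f x \<oplus>\<^bsub>E\<^esub> f y = f z" if "x \<in> carrier M" "y \<in> carrier M" for x y
      using that i f by (metis M.M.a_closed)
    moreover have "\<exists>z\<in>carrier M. a \<odot>\<^bsub>N\<^esub> i x = i z \<and> a \<odot>\<^bsub>E\<^esub> f x = f z" if "a \<in> carrier A" "x \<in> carrier M" for a x
      using that i f by (metis M.smult_closed)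
    ultimately show ?thesis unfolding S_def H0_def using i(1) f(1) by (auto simp: image_iff)
  qed
  have chain: "\<Union>\<C> \<in> S" if "\<C> \<noteq> {}" "subset.chain S \<C>" for \<C>
  proof -
    have sub: "\<And>H. H \<in> \<C> \<Longrightarrow> H \<in> S" using that(2) unfolding subset.chain_def by auto
    have tot: "\<And>H H'. H \<in> \<C> \<Longrightarrow> H' \<in> \<C> \<Longrightarrow> H \<subseteq> H' \<or> H' \<subseteq> H" using that(2) unfolding subset.chain_def by auto
    show ?thesis unfolding S_def
    proof (intro CollectI conjI allI impI ballI)
      show "\<Union>\<C> \<subseteq> carrier N \<times> carrier E" using sub unfolding S_def by blast
    next
      fix n e n' e' assume "(n, e) \<in> \<Union>\<C>" "(n', e') \<in> \<Union>\<C>"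
      then obtain H H' where HH: "H \<in> \<C>" "H' \<in> \<C>" "(n, e) \<in> H" "(n', e') \<in> H'" by auto
      then obtain H'' where "H'' \<in> \<C>" "(n, e) \<in> H''" "(n', e') \<in> H''" using tot[OF HH(1,2)] by blast
      then show "(n \<oplus>\<^bsub>N\<^esub> n', e \<oplus>\<^bsub>E\<^esub> e') \<in> \<Union>\<C>" using sub unfolding S_def by blast
    next
      fix a n e assume "a \<in> carrier A" "(n, e) \<in> \<Union>\<C>"
      then show "(a \<odot>\<^bsub>N\<^esub> n, a \<odot>\<^bsub>E\<^esub> e) \<in> \<Union>\<C>" using sub unfolding S_def by blast
    next
      fix e assume "(\<zero>\<^bsub>N\<^esub>, e) \<in> \<Union>\<C>"
      then show "e = \<zero>\<^bsub>E\<^esub>" using sub unfolding S_def by blast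
    next
      fix x assume "x \<in> carrier M"
      then show "(i x, f x) \<in> \<Union>\<C>" using sub that(1) unfolding S_def by blast
    qed
  qed
  obtain H where H: "H \<in> S" and Hmax: "\<And>H'. H' \<in> S \<Longrightarrow> H \<subseteq> H' \<Longrightarrow> H' = H"
    using subset_Zorn_nonempty[of S] H0 chain by blast
  have Hc: "\<And>n e. (n, e) \<in> H \<Longrightarrow> n \<in> carrier N \<and> e \<in> carrier E"
    and Ha: "\<And>n e n' e'. (n, e) \<in> H \<Longrightarrow> (n', e') \<in> H \<Longrightarrow> (n \<oplus>\<^bsub>N\<^esub> n', e \<oplus>\<^bsub>E\<^esub> e') \<in> H"
    and Hs: "\<And>a n e. a \<in> carrier A \<Longrightarrow> (n, e) \<in> H \<Longrightarrow> (a \<odot>\<^bsub>N\<^esub> n, a \<odot>\<^bsub>E\<^esub> e) \<in> H"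
    and Hz: "\<And>e. (\<zero>\<^bsub>N\<^esub>, e) \<in> H \<Longrightarrow> e = \<zero>\<^bsub>E\<^esub>"
    and Hi: "\<And>x. x \<in> carrier M \<Longrightarrow> (i x, f x) \<in> H"
    using H unfolding S_def by auto
  have Hneg: "(\<ominus>\<^bsub>N\<^esub> n, \<ominus>\<^bsub>E\<^esub> e) \<in> H" if "(n, e) \<in> H" for n e
    using Hs[OF _ that, of "\<ominus>\<^bsub>A\<^esub> \<one>\<^bsub>A\<^esub>"] Hc[OF that] module_uminus[OF E, of e] module_uminus[of A N n] * by simp
  have Hfun: "e = e'" if "(n, e) \<in> H" "(n, e') \<in> H" for n e e'
  proof -
    have "(n \<oplus>\<^bsub>N\<^esub> \<ominus>\<^bsub>N\<^esub> n, e \<oplus>\<^bsub>E\<^esub> \<ominus>\<^bsub>E\<^esub> e') \<in> H" using Ha[OF that(1) Hneg[OF that(2)]] .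
    then have "e \<oplus>\<^bsub>E\<^esub> \<ominus>\<^bsub>E\<^esub> e' = \<zero>\<^bsub>E\<^esub>" using Hz Hc[OF that(1)] by (simp add: N.M.r_neg)
    then show ?thesis using Hc[OF that(1)] Hc[OF that(2)]
      by (metis E.M.a_inv_closed E.M.minus_equality E.M.minus_minus)
  qed
  have H00: "(\<zero>\<^bsub>N\<^esub>, \<zero>\<^bsub>E\<^esub>) \<in> H" using Hi[of "\<zero>\<^bsub>M\<^esub>"] i0 f0 by simp
  have dom: "\<exists>e. (n, e) \<in> H" if n: "n \<in> carrier N" for n
  proof -
    \<comment> \<open>Ideal of the scalars that carry \<open>n\<close> into the current domain. A
      value \<open>e0\<close> for \<open>n\<close> must satisfy \<open>g a = a e0\<close> on it,
      which is what Baer's condition provides.\<close>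
    define J where "J = {a \<in> carrier A. \<exists>e. (a \<odot>\<^bsub>N\<^esub> n, e) \<in> H}"
    define g where "g a = (THE e. (a \<odot>\<^bsub>N\<^esub> n, e) \<in> H)" for a
    have g: "(a \<odot>\<^bsub>N\<^esub> n, g a) \<in> H" if "a \<in> J" for a
      using that Hfun unfolding g_def J_def by (auto intro: theI2)
    have g_eq: "g a = e" if "(a \<odot>\<^bsub>N\<^esub> n, e) \<in> H" for a e
      using that Hfun unfolding g_def by blast
    have Jadd: "(a \<oplus>\<^bsub>A\<^esub> b) \<in> J \<and> g (a \<oplus>\<^bsub>A\<^esub> b) = g a \<oplus>\<^bsub>E\<^esub> g b" if "a \<in> J" "b \<in> J" for a b
    proof -
      have "((a \<oplus>\<^bsub>A\<^esub> b) \<odot>\<^bsub>N\<^esub> n, g a \<oplus>\<^bsub>E\<^esub> g b) \<in> H"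
        using Ha[OF g[OF that(1)] g[OF that(2)]] that n unfolding J_def by (simp add: N.smult_l_distr)
      then show ?thesis using g_eq that unfolding J_def by auto
    qed
    have Jmul: "(a \<otimes>\<^bsub>A\<^esub> b) \<in> J \<and> g (a \<otimes>\<^bsub>A\<^esub> b) = a \<odot>\<^bsub>E\<^esub> g b" if "a \<in> carrier A" "b \<in> J" for a b
    proof -
      have "((a \<otimes>\<^bsub>A\<^esub> b) \<odot>\<^bsub>N\<^esub> n, a \<odot>\<^bsub>E\<^esub> g b) \<in> H"
        using Hs[OF that(1) g[OF that(2)]] that n unfolding J_def by (simp add: N.smult_assoc1)
      then show ?thesis using g_eq that unfolding J_def by auto
    qed
    have J: "ideal J A"
    proof (rule idealI)
      show "ring A" by (rule E.R.ring_axioms)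
      show "subgroup J (add_monoid A)"
      proof (rule E.R.add.subgroupI)
        show "J \<subseteq> carrier A" by (auto simp: J_def)
        show "J \<noteq> {}" using H00 n by (auto simp: J_def intro!: exI[of _ "\<zero>\<^bsub>A\<^esub>"])
        fix a assume a: "a \<in> J"
        then have "\<ominus>\<^bsub>A\<^esub> \<one>\<^bsub>A\<^esub> \<otimes>\<^bsub>A\<^esub> a \<in> J" using Jmul by blast
        moreover have "\<ominus>\<^bsub>A\<^esub> \<one>\<^bsub>A\<^esub> \<otimes>\<^bsub>A\<^esub> a = \<ominus>\<^bsub>A\<^esub> a" using a unfolding J_def by (simp add: E.R.l_minus)
        ultimately show "\<ominus>\<^bsub>A\<^esub> a \<in> J" by simp
      qed (use Jadd in auto)
      fix a b assume ab: "a \<in> J" "b \<in> carrier A"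
      then show "b \<otimes>\<^bsub>A\<^esub> a \<in> J" using Jmul by blast
      then show "a \<otimes>\<^bsub>A\<^esub> b \<in> J" using ab unfolding J_def by (simp add: E.R.m_comm)
    qed
    have "linear_on A E J g" unfolding linear_on_def using Jadd Jmul g Hc by blast
    then obtain e0 where e0: "e0 \<in> carrier E" "\<And>x. x \<in> J \<Longrightarrow> g x = x \<odot>\<^bsub>E\<^esub> e0"
      using baer J unfolding baer_def by blast
    define H' where "H' = {(m \<oplus>\<^bsub>N\<^esub> a \<odot>\<^bsub>N\<^esub> n, e \<oplus>\<^bsub>E\<^esub> a \<odot>\<^bsub>E\<^esub> e0) | m e a. (m, e) \<in> H \<and> a \<in> carrier A}"
    have H'I: "(m \<oplus>\<^bsub>N\<^esub> a \<odot>\<^bsub>N\<^esub> n, e \<oplus>\<^bsub>E\<^esub> a \<odot>\<^bsub>E\<^esub> e0) \<in> H'" if "(m, e) \<in> H" "a \<in> carrier A" for m e a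
      using that unfolding H'_def by blast
    have HH': "(m, e) \<in> H'" if "(m, e) \<in> H" for m e
      using H'I[OF that, of "\<zero>\<^bsub>A\<^esub>"] n e0 Hc[OF that] by simp
    have "H' \<in> S" unfolding S_def
    proof (intro CollectI conjI allI impI ballI)
      show "H' \<subseteq> carrier N \<times> carrier E" unfolding H'_def using Hc n e0(1) by auto
    next
      fix k e k' e' assume "(k, e) \<in> H'" "(k', e') \<in> H'"
      then obtain m u a m' u' a' where 1: "(m, u) \<in> H" "a \<in> carrier A" "(m', u') \<in> H" "a' \<in> carrier A"
        "k = m \<oplus>\<^bsub>N\<^esub> a \<odot>\<^bsub>N\<^esub> n" "e = u \<oplus>\<^bsub>E\<^esub> a \<odot>\<^bsub>E\<^esub> e0" "k' = m' \<oplus>\<^bsub>N\<^esub> a' \<odot>\<^bsub>N\<^esub> n" "e' = u' \<oplus>\<^bsub>E\<^esub> a' \<odot>\<^bsub>E\<^esub> e0"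
        unfolding H'_def by blast
      have "k \<oplus>\<^bsub>N\<^esub> k' = (m \<oplus>\<^bsub>N\<^esub> m') \<oplus>\<^bsub>N\<^esub> (a \<oplus>\<^bsub>A\<^esub> a') \<odot>\<^bsub>N\<^esub> n" "e \<oplus>\<^bsub>E\<^esub> e' = (u \<oplus>\<^bsub>E\<^esub> u') \<oplus>\<^bsub>E\<^esub> (a \<oplus>\<^bsub>A\<^esub> a') \<odot>\<^bsub>E\<^esub> e0"
        using 1 Hc[OF 1(1)] Hc[OF 1(3)] n e0(1) by (simp_all add: N.smult_l_distr E.smult_l_distr N.M.a_ac E.M.a_ac)
      then show "(k \<oplus>\<^bsub>N\<^esub> k', e \<oplus>\<^bsub>E\<^esub> e') \<in> H'" using H'I[OF Ha[OF 1(1,3)], of "a \<oplus>\<^bsub>A\<^esub> a'"] 1 by simp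
    next
      fix b k e assume b: "b \<in> carrier A" "(k, e) \<in> H'"
      then obtain m u a where 1: "(m, u) \<in> H" "a \<in> carrier A"
        "k = m \<oplus>\<^bsub>N\<^esub> a \<odot>\<^bsub>N\<^esub> n" "e = u \<oplus>\<^bsub>E\<^esub> a \<odot>\<^bsub>E\<^esub> e0" unfolding H'_def by blast
      have "b \<odot>\<^bsub>N\<^esub> k = b \<odot>\<^bsub>N\<^esub> m \<oplus>\<^bsub>N\<^esub> (b \<otimes>\<^bsub>A\<^esub> a) \<odot>\<^bsub>N\<^esub> n" "b \<odot>\<^bsub>E\<^esub> e = b \<odot>\<^bsub>E\<^esub> u \<oplus>\<^bsub>E\<^esub> (b \<otimes>\<^bsub>A\<^esub> a) \<odot>\<^bsub>E\<^esub> e0"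
        using 1 Hc[OF 1(1)] n e0(1) b by (simp_all add: N.smult_r_distr E.smult_r_distr N.smult_assoc1 E.smult_assoc1)
      then show "(b \<odot>\<^bsub>N\<^esub> k, b \<odot>\<^bsub>E\<^esub> e) \<in> H'" using H'I[OF Hs[OF b(1) 1(1)], of "b \<otimes>\<^bsub>A\<^esub> a"] 1 b by simp
    next
      fix e assume "(\<zero>\<^bsub>N\<^esub>, e) \<in> H'"
      then obtain m u a where 1: "(m, u) \<in> H" "a \<in> carrier A"
        "\<zero>\<^bsub>N\<^esub> = m \<oplus>\<^bsub>N\<^esub> a \<odot>\<^bsub>N\<^esub> n" "e = u \<oplus>\<^bsub>E\<^esub> a \<odot>\<^bsub>E\<^esub> e0" unfolding H'_def by blast
      have c: "m \<in> carrier N" "u \<in> carrier E" using Hc[OF 1(1)] by auto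
      have "a \<odot>\<^bsub>N\<^esub> n = \<ominus>\<^bsub>N\<^esub> m" using 1(2,3) c n
        by (metis N.M.a_comm N.M.minus_equality N.smult_closed)
      then have "(a \<odot>\<^bsub>N\<^esub> n, \<ominus>\<^bsub>E\<^esub> u) \<in> H" using Hneg[OF 1(1)] by simp
      moreover from this have "a \<in> J" using 1 unfolding J_def by auto
      ultimately have "a \<odot>\<^bsub>E\<^esub> e0 = \<ominus>\<^bsub>E\<^esub> u" using g_eq e0(2) by metis
      then show "e = \<zero>\<^bsub>E\<^esub>" using 1(4) c by (simp add: E.M.r_neg)
    next
      fix x assume "x \<in> carrier M" then show "(i x, f x) \<in> H'" using HH' Hi by blast
    qed
    moreover have "H \<subseteq> H'" using HH' by auto
    ultimately have "H' = H" using Hmax by blast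
    moreover have "(n, e0) \<in> H'" using H'I[OF H00, of "\<one>\<^bsub>A\<^esub>"] n e0(1) by simp
    ultimately show ?thesis by blast
  qed
  define g where "g n = (THE e. (n, e) \<in> H)" for n
  have g_eq: "g n = e" if "(n, e) \<in> H" for n e using that Hfun unfolding g_def by blast
  have g: "(n, g n) \<in> H" if "n \<in> carrier N" for n using dom[OF that] g_eq by metis
  have "g \<in> linear_maps A N E" unfolding linear_maps_def
    using g Hc by (auto intro!: g_eq Ha Hs)
  moreover have "\<forall>x\<in>carrier M. g (i x) = f x" using Hi g_eq by blast
  ultimately show "\<exists>g\<in>linear_maps A N E. \<forall>x\<in>carrier M. g (i x) = f x" by blast
qed (rule E)

text \<open>For the inclusion of an ideal into the ring, injectivity gives an extension whose value
  at the unit is the wanted element. Test modules must live on the type of \<open>E\<close>, hence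
  the copies \<open>x \<mapsto> {(x, x)}\<close> of ring elements.\<close>

lemma injective_module_imp_baer:
  fixes E :: "('r, ('r \<times> 'r) set) module"
  assumes inj: "injective_module A E"
  shows "baer A E"
  unfolding baer_def
proof (intro allI impI, elim conjE)
  fix J f assume J: "ideal J A" and f: "linear_on A E J f"
  interpret E: module A E using inj by (simp add: injective_module_def)
  define cp :: "'r \<Rightarrow> ('r \<times> 'r) set" where "cp x = {(x, x)}" for x
  define dc :: "('r \<times> 'r) set \<Rightarrow> 'r" where "dc Y = fst (the_elem Y)" for Y
  have dc[simp]: "dc (cp x) = x" for x by (simp add: cp_def dc_def)
  define CM :: "'r set \<Rightarrow> ('r, ('r \<times> 'r) set) module" where
   "CM V = \<lparr>carrier = cp ` V, monoid.mult = undefined, monoid.one = undefined, ring.zero = cp \<zero>\<^bsub>A\<^esub>,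
         ring.add = (\<lambda>Y Z. cp (dc Y \<oplus>\<^bsub>A\<^esub> dc Z)), module.smult = (\<lambda>a Y. cp (a \<otimes>\<^bsub>A\<^esub> dc Y))\<rparr>" for V
  have CM: "module A (CM V)" if "ideal V A" for V
  proof -
    interpret V: ideal V A by fact
    have V: "\<And>x. x \<in> V \<Longrightarrow> x \<in> carrier A" using V.Icarr by auto
    show ?thesis
    proof (rule moduleI)
      show "abelian_group (CM V)"
      proof (rule abelian_groupI)
        fix x assume "x \<in> carrier (CM V)"
        then obtain y where y: "y \<in> V" "x = cp y" by (auto simp: CM_def)
        then show "\<exists>y\<in>carrier (CM V). y \<oplus>\<^bsub>CM V\<^esub> x = \<zero>\<^bsub>CM V\<^esub>"
          by (intro bexI[of _ "cp (\<ominus>\<^bsub>A\<^esub> y)"]) (auto simp: CM_def E.R.l_neg V)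
      qed (auto simp: CM_def E.R.a_ac V)
    qed (auto simp: CM_def V V.I_l_closed E.R.l_distr E.R.r_distr E.R.m_assoc E.R.cring_axioms)
  qed
  have i: "(\<lambda>x. x) \<in> linear_maps A (CM J) (CM (carrier A))"
    using ideal.Icarr[OF J] by (auto simp: linear_maps_def CM_def)
  have f': "(\<lambda>Y. f (dc Y)) \<in> linear_maps A (CM J) E"
    using f by (auto simp: linear_maps_def linear_on_def CM_def)
  obtain g where g: "g \<in> linear_maps A (CM (carrier A)) E" "\<And>x. x \<in> carrier (CM J) \<Longrightarrow> g x = f (dc x)"
    using inj CM[OF J] CM[OF E.R.oneideal] i f' unfolding injective_module_def by (metis inj_on_id2)
  have "f x = x \<odot>\<^bsub>E\<^esub> g (cp \<one>\<^bsub>A\<^esub>)" if x: "x \<in> J" for x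
  proof -
    have xc: "x \<in> carrier A" using x ideal.Icarr[OF J] by auto
    have gl: "\<forall>a\<in>carrier A. \<forall>y\<in>carrier (CM (carrier A)). g (a \<odot>\<^bsub>CM (carrier A)\<^esub> y) = a \<odot>\<^bsub>E\<^esub> g y"
      using g(1) by (simp add: linear_maps_def)
    have c1: "cp \<one>\<^bsub>A\<^esub> \<in> carrier (CM (carrier A))" by (simp add: CM_def)
    have "f x = g (cp x)" using g(2)[of "cp x"] x by (auto simp: CM_def)
    also have "cp x = x \<odot>\<^bsub>CM (carrier A)\<^esub> cp \<one>\<^bsub>A\<^esub>" using xc by (simp add: CM_def)
    also have "g \<dots> = x \<odot>\<^bsub>E\<^esub> g (cp \<one>\<^bsub>A\<^esub>)"
      using gl xc c1 by blast
    finally show ?thesis .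
  qed
  moreover have "g (cp \<one>\<^bsub>A\<^esub>) \<in> carrier E" using g(1) by (auto simp: linear_maps_def CM_def)
  ultimately show "\<exists>e\<in>carrier E. \<forall>x\<in>J. f x = x \<odot>\<^bsub>E\<^esub> e" by blast
qed

section \<open>The socle modulo a non-zero-divisor\<close>

lemma baerD:
  assumes "baer A E" "ideal J A" "linear_on A E J f"
  obtains e where "e \<in> carrier E" "\<And>y. y \<in> J \<Longrightarrow> f y = y \<odot>\<^bsub>E\<^esub> e"
  using assms unfolding baer_def by meson

lemma (in cring) ideal_add_cyclic:
  assumes J: "ideal J R" and b: "b \<in> carrier R"
  shows "ideal {j \<oplus> a \<otimes> b | j a. j \<in> J \<and> a \<in> carrier R} R" (is "ideal ?K R")
proof -
  interpret J: ideal J R by fact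
  show ?thesis
  proof (rule idealI)
    show "ring R" by (rule ring_axioms)
    show "subgroup ?K (add_monoid R)"
    proof (rule add.subgroupI)
      show "?K \<subseteq> carrier R" using b J.Icarr by auto
      show "?K \<noteq> {}" using J.zero_closed by blast
    next
      fix y assume "y \<in> ?K"
      then obtain j a where 1: "j \<in> J" "a \<in> carrier R" "y = j \<oplus> a \<otimes> b" by auto
      have "\<ominus> y = \<ominus> j \<oplus> (\<ominus> a) \<otimes> b" using 1 J.Icarr[OF 1(1)] b by (simp add: minus_add l_minus)
      then show "\<ominus> y \<in> ?K" using 1 J.a_inv_closed by blast
    next
      fix y z assume "y \<in> ?K" "z \<in> ?K"
      then obtain j a k c where 1: "j \<in> J" "a \<in> carrier R" "y = j \<oplus> a \<otimes> b" "k \<in> J" "c \<in> carrier R" "z = k \<oplus> c \<otimes> b" by auto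
      have "y \<oplus> z = (j \<oplus> k) \<oplus> (a \<oplus> c) \<otimes> b" using 1 J.Icarr[OF 1(1)] J.Icarr[OF 1(4)] b by (simp add: l_distr a_ac)
      then show "y \<oplus> z \<in> ?K" using 1 by blast
    qed
    fix y z assume "y \<in> ?K" and z: "z \<in> carrier R"
    then obtain j a where 1: "j \<in> J" "a \<in> carrier R" "y = j \<oplus> a \<otimes> b" by auto
    have "z \<otimes> y = z \<otimes> j \<oplus> (z \<otimes> a) \<otimes> b" using 1 J.Icarr[OF 1(1)] b z by (simp add: r_distr m_assoc)
    moreover have "z \<otimes> j \<in> J" using 1 z by (simp add: J.I_l_closed)
    ultimately show *: "z \<otimes> y \<in> ?K" using 1 z by blast
    then show "y \<otimes> z \<in> ?K" using 1 J.Icarr[OF 1(1)] b z by (simp add: m_comm)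
  qed
qed

text \<open>The annihilator of \<open>b\<close> modulo \<open>J\<close> contains \<mm> and omits the
  unit, so it equals \<mm> by maximality.\<close>

lemma (in cring) maximalideal_colon:
  assumes m: "maximalideal \<mm> R" and J: "ideal J R" and b: "b \<in> carrier R" "b \<notin> J"
    and mb: "\<And>a. a \<in> \<mm> \<Longrightarrow> a \<otimes> b \<in> J" and a: "a \<in> carrier R" "a \<otimes> b \<in> J"
  shows "a \<in> \<mm>"
proof -
  interpret m: maximalideal \<mm> R by fact
  interpret J: ideal J R by fact
  let ?K = "{a \<in> carrier R. a \<otimes> b \<in> J}"
  have "ideal ?K R"
  proof (rule idealI)
    show "ring R" by (rule ring_axioms)
    show "subgroup ?K (add_monoid R)"
      by (rule add.subgroupI) (use b in \<open>auto simp: l_minus l_distr intro!: exI[of _ \<zero>] J.a_inv_closed J.a_closed\<close>)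
    fix y z assume "y \<in> ?K" and z: "z \<in> carrier R"
    then show "z \<otimes> y \<in> ?K" using b by (auto simp: m_assoc J.I_l_closed)
    then show "y \<otimes> z \<in> ?K" using \<open>y \<in> ?K\<close> z by (simp add: m_comm)
  qed
  moreover have "\<mm> \<subseteq> ?K" using mb m.Icarr by auto
  moreover have "?K \<noteq> carrier R" using b by (auto dest!: equalityD2 subsetD[of _ _ \<one>])
  ultimately have "?K = \<mm>" using m.I_maximal by blast
  then show ?thesis using a by blast
qed

text \<open>Modulo \<open>J\<close> the element \<open>b\<close> spans a copy of the residue field,
  so it can be sent to any \<open>w\<close> killed by \<mm>. The resulting homomorphism lives on
  \<open>J + A b\<close>.\<close>

lemma linear_on_add_cyclic:
  assumes E: "module A E" and m: "maximalideal \<mm> A" and J: "ideal J A" and b: "b \<in> carrier A" "b \<notin> J"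
    and mb: "\<And>a. a \<in> \<mm> \<Longrightarrow> a \<otimes>\<^bsub>A\<^esub> b \<in> J"
    and w: "w \<in> carrier E" "\<And>a. a \<in> \<mm> \<Longrightarrow> a \<odot>\<^bsub>E\<^esub> w = \<zero>\<^bsub>E\<^esub>"
  obtains K h where "ideal K A" "J \<subseteq> K" "b \<in> K" "linear_on A E K h"
     "\<And>y. y \<in> K \<Longrightarrow> \<exists>a\<in>carrier A. h y = a \<odot>\<^bsub>E\<^esub> w" "\<And>j. j \<in> J \<Longrightarrow> h j = \<zero>\<^bsub>E\<^esub>" "h b = w"
proof -
  interpret E: module A E by fact
  interpret J: ideal J A by fact
  interpret m: maximalideal \<mm> A by fact
  define K where "K = {j \<oplus>\<^bsub>A\<^esub> a \<otimes>\<^bsub>A\<^esub> b | j a. j \<in> J \<and> a \<in> carrier A}"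
  have K: "ideal K A" unfolding K_def by (rule E.R.ideal_add_cyclic[OF J b(1)])
  \<comment> \<open>The coefficient \<open>a\<close> is determined only modulo \<mm>, which does not
    affect its product with \<open>w\<close>.\<close>
  define h where "h y = (SOME a. a \<in> carrier A \<and> (\<exists>j\<in>J. y = j \<oplus>\<^bsub>A\<^esub> a \<otimes>\<^bsub>A\<^esub> b)) \<odot>\<^bsub>E\<^esub> w" for y
  have h: "h (j \<oplus>\<^bsub>A\<^esub> a \<otimes>\<^bsub>A\<^esub> b) = a \<odot>\<^bsub>E\<^esub> w" if ja: "j \<in> J" "a \<in> carrier A" for j a
  proof -
    let ?P = "\<lambda>c. c \<in> carrier A \<and> (\<exists>k\<in>J. j \<oplus>\<^bsub>A\<^esub> a \<otimes>\<^bsub>A\<^esub> b = k \<oplus>\<^bsub>A\<^esub> c \<otimes>\<^bsub>A\<^esub> b)"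
    define c where "c = (SOME c. ?P c)"
    have "?P c" unfolding c_def by (rule someI[of ?P a]) (use ja in auto)
    then obtain k where k: "k \<in> J" "c \<in> carrier A" "j \<oplus>\<^bsub>A\<^esub> a \<otimes>\<^bsub>A\<^esub> b = k \<oplus>\<^bsub>A\<^esub> c \<otimes>\<^bsub>A\<^esub> b" by blast
    have jk: "j \<in> carrier A" "k \<in> carrier A" using J.Icarr ja k by auto
    have "(a \<ominus>\<^bsub>A\<^esub> c) \<otimes>\<^bsub>A\<^esub> b = (j \<oplus>\<^bsub>A\<^esub> a \<otimes>\<^bsub>A\<^esub> b) \<ominus>\<^bsub>A\<^esub> j \<ominus>\<^bsub>A\<^esub> c \<otimes>\<^bsub>A\<^esub> b"
      using jk ja(2) k(2) b(1) by algebra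
    also have "\<dots> = k \<ominus>\<^bsub>A\<^esub> j" unfolding k(3) using jk ja(2) k(2) b(1) by algebra
    also have "\<dots> \<in> J" using ja(1) k(1) by (simp add: a_minus_def J.a_closed J.a_inv_closed)
    finally have ac: "a \<ominus>\<^bsub>A\<^esub> c \<in> \<mm>"
      using E.R.maximalideal_colon[OF m J b mb] ja k by simp
    have "a = (a \<ominus>\<^bsub>A\<^esub> c) \<oplus>\<^bsub>A\<^esub> c" using ja(2) k(2) by algebra
    then have "a \<odot>\<^bsub>E\<^esub> w = (a \<ominus>\<^bsub>A\<^esub> c) \<odot>\<^bsub>E\<^esub> w \<oplus>\<^bsub>E\<^esub> c \<odot>\<^bsub>E\<^esub> w"
      using E.smult_l_distr[of "a \<ominus>\<^bsub>A\<^esub> c" c w] ja(2) k(2) w(1) by simp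
    then have "a \<odot>\<^bsub>E\<^esub> w = c \<odot>\<^bsub>E\<^esub> w" using w(2)[OF ac] k(2) w(1) by simp
    then show ?thesis unfolding h_def c_def by simp
  qed
  have "linear_on A E K h" unfolding linear_on_def
  proof (intro conjI ballI)
    show "h \<in> K \<rightarrow> carrier E" unfolding K_def using h w(1) by auto
    fix y z assume "y \<in> K" "z \<in> K"
    then obtain j a k c where 1: "j \<in> J" "a \<in> carrier A" "y = j \<oplus>\<^bsub>A\<^esub> a \<otimes>\<^bsub>A\<^esub> b" "k \<in> J" "c \<in> carrier A" "z = k \<oplus>\<^bsub>A\<^esub> c \<otimes>\<^bsub>A\<^esub> b" unfolding K_def by blast
    have "y \<oplus>\<^bsub>A\<^esub> z = (j \<oplus>\<^bsub>A\<^esub> k) \<oplus>\<^bsub>A\<^esub> (a \<oplus>\<^bsub>A\<^esub> c) \<otimes>\<^bsub>A\<^esub> b" using 1 J.Icarr[OF 1(1)] J.Icarr[OF 1(4)] b(1) by (simp add: E.R.l_distr E.R.a_ac)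
    then have "h (y \<oplus>\<^bsub>A\<^esub> z) = (a \<oplus>\<^bsub>A\<^esub> c) \<odot>\<^bsub>E\<^esub> w" using h[OF J.a_closed[OF 1(1,4)]] 1 by simp
    then show "h (y \<oplus>\<^bsub>A\<^esub> z) = h y \<oplus>\<^bsub>E\<^esub> h z" using h 1 w(1) by (simp add: E.smult_l_distr)
  next
    fix z y assume z: "z \<in> carrier A" and "y \<in> K"
    then obtain j a where 1: "j \<in> J" "a \<in> carrier A" "y = j \<oplus>\<^bsub>A\<^esub> a \<otimes>\<^bsub>A\<^esub> b" unfolding K_def by blast
    have "z \<otimes>\<^bsub>A\<^esub> y = z \<otimes>\<^bsub>A\<^esub> j \<oplus>\<^bsub>A\<^esub> (z \<otimes>\<^bsub>A\<^esub> a) \<otimes>\<^bsub>A\<^esub> b" using 1 J.Icarr[OF 1(1)] b z by (simp add: E.R.r_distr E.R.m_assoc)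
    then have "h (z \<otimes>\<^bsub>A\<^esub> y) = (z \<otimes>\<^bsub>A\<^esub> a) \<odot>\<^bsub>E\<^esub> w" using h[OF J.I_l_closed[OF 1(1) z], of "z \<otimes>\<^bsub>A\<^esub> a"] 1 z by simp
    then show "h (z \<otimes>\<^bsub>A\<^esub> y) = z \<odot>\<^bsub>E\<^esub> h y" using h 1 w(1) z by (simp add: E.smult_assoc1)
  qed
  moreover have "J \<subseteq> K"
  proof
    fix j assume j: "j \<in> J"
    then have "j = j \<oplus>\<^bsub>A\<^esub> \<zero>\<^bsub>A\<^esub> \<otimes>\<^bsub>A\<^esub> b" using b(1) J.Icarr by simp
    then show "j \<in> K" unfolding K_def using j by blast
  qed
  moreover have "b \<in> K"
  proof -
    have "b = \<zero>\<^bsub>A\<^esub> \<oplus>\<^bsub>A\<^esub> \<one>\<^bsub>A\<^esub> \<otimes>\<^bsub>A\<^esub> b" using b(1) by simp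
    then show ?thesis unfolding K_def using J.zero_closed by blast
  qed
  moreover have "\<exists>a\<in>carrier A. h y = a \<odot>\<^bsub>E\<^esub> w" if "y \<in> K" for y
    using that h unfolding K_def by blast
  moreover have "h j = \<zero>\<^bsub>E\<^esub>" if "j \<in> J" for j
    using h[OF that, of "\<zero>\<^bsub>A\<^esub>"] that b(1) w(1) J.Icarr by simp
  moreover have "h b = w"
    using h[OF J.zero_closed, of "\<one>\<^bsub>A\<^esub>"] b(1) w(1) by simp
  ultimately show ?thesis using that K by blast
qed

text \<open>\<open>C \<subseteq> E\<close> has no extensions by \<open>A/J\<close> for ideals \<open>J \<ni> x\<close>.\<close>
definition ext_vanishing where
  "ext_vanishing A x E C \<longleftrightarrow> (\<forall>J f. ideal J A \<and> x \<in> J \<and> linear_on A E J f \<and> f ` J \<subseteq> C \<longrightarrow>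
     (\<exists>c\<in>C. \<forall>a\<in>J. f a = a \<odot>\<^bsub>E\<^esub> c))"

lemma ext_vanishingD:
  assumes "ext_vanishing A x E C" "ideal J A" "x \<in> J" "linear_on A E J f" "f ` J \<subseteq> C"
  obtains c where "c \<in> C" "\<And>a. a \<in> J \<Longrightarrow> f a = a \<odot>\<^bsub>E\<^esub> c"
  using assms unfolding ext_vanishing_def by meson

lemma ext_vanishing_zero:
  assumes "module A E" "carrier E = {\<zero>\<^bsub>E\<^esub>}" "C \<subseteq> carrier E" "C \<noteq> {}"
  shows "ext_vanishing A x E C"
  unfolding ext_vanishing_def
proof (intro allI impI, elim conjE)
  interpret E: module A E by fact
  fix J f assume J: "ideal J A" and f: "linear_on A E J f"
  have "f a = a \<odot>\<^bsub>E\<^esub> \<zero>\<^bsub>E\<^esub>" if "a \<in> J" for a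
  proof -
    have "f a \<in> carrier E" using f that unfolding linear_on_def by auto
    then show ?thesis using assms(2) ideal.Icarr[OF J that] by auto
  qed
  moreover have "\<zero>\<^bsub>E\<^esub> \<in> C" using assms(2,3,4) by auto
  ultimately show "\<exists>c\<in>C. \<forall>a\<in>J. f a = a \<odot>\<^bsub>E\<^esub> c" by blast
qed

text \<open>\<open>D k\<close> plays the part of the elements of order at least \<open>k\<close>:
  multiplication by \<mm> raises the order, and order \<open>N\<close> forces divisibility by
  \<open>x\<close>. Thus \<open>D\<close> and \<open>N\<close> encode that \<mm> is nilpotent modulo
  \<open>x\<close>. The element \<sigma> is a nonzero socle element modulo \<open>x\<close>.\<close>

locale socle_setup = noetherian_ring A + cring A for A (structure) + fixes x \<mm> and D :: "nat \<Rightarrow> 'a set" and N \<sigma>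
  assumes max: "maximalideal \<mm> A" and xm: "x \<in> \<mm>"
    and nzd: "\<And>a. \<lbrakk>a \<in> carrier A; x \<otimes> a = \<zero>\<rbrakk> \<Longrightarrow> a = \<zero>"
    and D0: "\<one> \<in> D 0" and Dc: "\<And>k. D k \<subseteq> carrier A"
    and DS: "\<And>k a b. \<lbrakk>a \<in> \<mm>; b \<in> D k\<rbrakk> \<Longrightarrow> a \<otimes> b \<in> D (Suc k)"
    and DN: "\<And>b. b \<in> D N \<Longrightarrow> \<exists>c\<in>carrier A. b = x \<otimes> c"
    and sc: "\<sigma> \<in> carrier A" and s_not: "\<And>c. c \<in> carrier A \<Longrightarrow> \<sigma> \<noteq> x \<otimes> c"
    and s_soc: "\<And>a. a \<in> \<mm> \<Longrightarrow> \<exists>c\<in>carrier A. a \<otimes> \<sigma> = x \<otimes> c"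
begin

sublocale mm: maximalideal \<mm> A by (rule max)

lemma x_carr [simp]: "x \<in> carrier A" using xm mm.Icarr by auto

definition "xA = {x \<otimes> c | c. c \<in> carrier A}"

lemma ideal_xA: "ideal xA A"
proof (rule idealI)
  show "ring A" by (rule ring_axioms)
  show "subgroup xA (add_monoid A)"
  proof (rule add.subgroupI)
    show "xA \<subseteq> carrier A" "xA \<noteq> {}" by (auto simp: xA_def)
    fix y assume "y \<in> xA"
    then obtain c where "c \<in> carrier A" "y = x \<otimes> c" by (auto simp: xA_def)
    then have "\<ominus> c \<in> carrier A" "\<ominus> y = x \<otimes> (\<ominus> c)" by (simp_all add: r_minus)
    then show "\<ominus> y \<in> xA" unfolding xA_def by blast
  next
    fix y z assume "y \<in> xA" "z \<in> xA"
    then show "y \<oplus> z \<in> xA" unfolding xA_def by (auto simp: r_distr[symmetric])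
  qed
  fix y z assume y: "y \<in> xA" and z: "z \<in> carrier A"
  then obtain c where c: "c \<in> carrier A" "y = x \<otimes> c" by (auto simp: xA_def)
  have "z \<otimes> y = x \<otimes> (z \<otimes> c)" using c z by (simp add: m_lcomm)
  then show "z \<otimes> y \<in> xA" using c z by (auto simp: xA_def)
  then show "y \<otimes> z \<in> xA" using c z by (simp add: m_comm)
qed

lemma x_in_xA: "x \<in> xA" by (auto simp: xA_def intro!: exI[of _ \<one>])

lemma x_cancel: "\<lbrakk>a \<in> carrier A; b \<in> carrier A; x \<otimes> a = x \<otimes> b\<rbrakk> \<Longrightarrow> a = b"
  using nzd[of "a \<ominus> b"] by (metis minus_closed r_right_minus_eq r_distr a_minus_def r_minus x_carr m_closed a_inv_closed)

lemma sigma_colon: "\<And>a. a \<in> \<mm> \<Longrightarrow> a \<otimes> \<sigma> \<in> xA" and sigma_notin: "\<sigma> \<notin> xA"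
  using s_soc s_not by (auto simp: xA_def)

text \<open>Since \<open>x\<close> is a non-zerodivisor, \<open>x c \<mapsto> c e\<close> is well
  defined on \<open>xA\<close>; an element representing it is a quotient of \<open>e\<close> by
  \<open>x\<close>.\<close>

lemma baer_divisible:
  assumes E: "module A E" "baer A E" and e: "e \<in> carrier E"
  obtains e' where "e' \<in> carrier E" "x \<odot>\<^bsub>E\<^esub> e' = e"
proof -
  interpret E: module A E by fact
  define g where "g y = (THE c. c \<in> carrier A \<and> y = x \<otimes> c) \<odot>\<^bsub>E\<^esub> e" for y
  have g: "g (x \<otimes> c) = c \<odot>\<^bsub>E\<^esub> e" if "c \<in> carrier A" for c
  proof -
    have "(THE c'. c' \<in> carrier A \<and> x \<otimes> c = x \<otimes> c') = c"
      by (rule the_equality) (use that x_cancel in auto)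
    then show ?thesis by (simp add: g_def)
  qed
  have "linear_on A E xA g" unfolding linear_on_def
  proof (intro conjI ballI)
    show "g \<in> xA \<rightarrow> carrier E" using g e by (auto simp: xA_def)
    fix y z assume "y \<in> xA" "z \<in> xA"
    then obtain c d where "c \<in> carrier A" "y = x \<otimes> c" "d \<in> carrier A" "z = x \<otimes> d" by (auto simp: xA_def)
    then show "g (y \<oplus> z) = g y \<oplus>\<^bsub>E\<^esub> g z" using g e by (simp add: r_distr[symmetric] E.smult_l_distr)
  next
    fix a y assume a: "a \<in> carrier A" "y \<in> xA"
    then obtain c where c: "c \<in> carrier A" "y = x \<otimes> c" by (auto simp: xA_def)
    have "a \<otimes> y = x \<otimes> (a \<otimes> c)" using a c by (simp add: m_lcomm)
    then show "g (a \<otimes> y) = a \<odot>\<^bsub>E\<^esub> g y" using g a c e by (simp add: E.smult_assoc1)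
  qed
  then obtain e' where "e' \<in> carrier E" "\<And>y. y \<in> xA \<Longrightarrow> g y = y \<odot>\<^bsub>E\<^esub> e'" using baerD[OF E(2) ideal_xA] by metis
  then show ?thesis using that[of e'] x_in_xA g[of \<one>] e by simp
qed

text \<open>Descends along \<open>0 \<rightarrow> C \<rightarrow> E \<rightarrow> C' \<rightarrow> 0\<close>.\<close>
lemma ext_vanishing_step:
  assumes E: "module A E" "baer A E" and E': "module A E'"
    and \<delta>: "\<delta> \<in> linear_maps A E E'" and C: "C = {e \<in> carrier E. \<delta> e = \<zero>\<^bsub>E'\<^esub>}"
    and div: "\<And>c. c \<in> C \<Longrightarrow> \<exists>c'\<in>C. x \<odot>\<^bsub>E\<^esub> c' = c"
    and ext': "ext_vanishing A x E' (\<delta> ` carrier E)"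
  shows "ext_vanishing A x E C"
proof -
  interpret E: module A E by fact
  interpret E': module A E' by fact
  have d: "\<And>e. e \<in> carrier E \<Longrightarrow> \<delta> e \<in> carrier E'" "\<And>e e'. e \<in> carrier E \<Longrightarrow> e' \<in> carrier E \<Longrightarrow> \<delta> (e \<oplus>\<^bsub>E\<^esub> e') = \<delta> e \<oplus>\<^bsub>E'\<^esub> \<delta> e'"
    "\<And>a e. a \<in> carrier A \<Longrightarrow> e \<in> carrier E \<Longrightarrow> \<delta> (a \<odot>\<^bsub>E\<^esub> e) = a \<odot>\<^bsub>E'\<^esub> \<delta> e"
    using \<delta> unfolding linear_maps_def by auto
  have dneg: "\<delta> (\<ominus>\<^bsub>E\<^esub> e) = \<ominus>\<^bsub>E'\<^esub> \<delta> e" if "e \<in> carrier E" for e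
    using d(3)[of "\<ominus> \<one>" e] that module_uminus[OF E(1) that] module_uminus[OF E' d(1)[OF that]] by simp
  have dsub: "\<delta> (e \<ominus>\<^bsub>E\<^esub> e') = \<delta> e \<ominus>\<^bsub>E'\<^esub> \<delta> e'" if "e \<in> carrier E" "e' \<in> carrier E" for e e'
    using that d dneg by (simp add: a_minus_def)
  have smin: "a \<odot>\<^bsub>E\<^esub> (e \<ominus>\<^bsub>E\<^esub> e') = a \<odot>\<^bsub>E\<^esub> e \<ominus>\<^bsub>E\<^esub> a \<odot>\<^bsub>E\<^esub> e'" if "a \<in> carrier A" "e \<in> carrier E" "e' \<in> carrier E" for a e e'
    using that by (simp add: a_minus_def E.smult_r_distr E.smult_r_minus)
  have Cc: "\<And>c. c \<in> C \<Longrightarrow> c \<in> carrier E" using C by auto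
  \<comment> \<open>The case of \<mm> itself. The obstruction \<open>\<delta> e\<close> is killed by
    \<mm>, so \<sigma> can be sent to it by a map on \<open>xA + A \<sigma>\<close> that vanishes on
    \<open>xA\<close>; the hypothesis on the next module applies to this map.\<close>
  have residue: "\<exists>c\<in>C. \<forall>a\<in>\<mm>. f a = a \<odot>\<^bsub>E\<^esub> c" if f: "linear_on A E \<mm> f" "f ` \<mm> \<subseteq> C" for f
  proof -
    obtain e where e: "e \<in> carrier E" "\<And>a. a \<in> \<mm> \<Longrightarrow> f a = a \<odot>\<^bsub>E\<^esub> e"
      by (rule baerD[OF E(2) mm.ideal_axioms f(1)]) blast
    have w: "\<delta> e \<in> carrier E'" "\<And>a. a \<in> \<mm> \<Longrightarrow> a \<odot>\<^bsub>E'\<^esub> \<delta> e = \<zero>\<^bsub>E'\<^esub>"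
      using d(1)[OF e(1)] d(3)[OF _ e(1), symmetric] f(2) e(2) C mm.Icarr by auto
    obtain K h where K: "ideal K A" "xA \<subseteq> K" "\<sigma> \<in> K" "linear_on A E' K h"
     "\<And>y. y \<in> K \<Longrightarrow> \<exists>a\<in>carrier A. h y = a \<odot>\<^bsub>E'\<^esub> \<delta> e" "\<And>j. j \<in> xA \<Longrightarrow> h j = \<zero>\<^bsub>E'\<^esub>" "h \<sigma> = \<delta> e"
      using linear_on_add_cyclic[OF E' max ideal_xA sc sigma_notin sigma_colon w] by metis
    have xK: "x \<in> K" using K(2) x_in_xA by auto
    have hK: "h ` K \<subseteq> \<delta> ` carrier E"
    proof
      fix z assume "z \<in> h ` K"
      then obtain a where "a \<in> carrier A" "z = a \<odot>\<^bsub>E'\<^esub> \<delta> e" using K(5) by auto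
      then show "z \<in> \<delta> ` carrier E" using d(3)[OF _ e(1)] e(1) by (metis E.smult_closed imageI)
    qed
    obtain y where y: "y \<in> carrier E" "\<And>a. a \<in> K \<Longrightarrow> h a = a \<odot>\<^bsub>E'\<^esub> \<delta> y"
      by (rule ext_vanishingD[OF ext' K(1) xK K(4) hK]) blast
    have "\<delta> (x \<odot>\<^bsub>E\<^esub> y) = \<zero>\<^bsub>E'\<^esub>" using y(2)[of x] K(2,6) x_in_xA d(3)[of x y] y(1) by auto
    then obtain c where c: "c \<in> C" "x \<odot>\<^bsub>E\<^esub> c = x \<odot>\<^bsub>E\<^esub> y" using div[of "x \<odot>\<^bsub>E\<^esub> y"] C y(1) by auto
    \<comment> \<open>Correcting \<open>y\<close> by an element of \<open>C\<close> makes it killed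
      by \<open>x\<close> without changing its image under \<delta>. Then \<open>\<sigma> y0\<close>
      is killed by \<mm>, because \<mm> moves \<sigma> into \<open>xA\<close>.\<close>
    define y0 where "y0 = y \<ominus>\<^bsub>E\<^esub> c"
    have y0: "y0 \<in> carrier E" "x \<odot>\<^bsub>E\<^esub> y0 = \<zero>\<^bsub>E\<^esub>" "\<delta> y0 = \<delta> y"
      using y(1) c Cc[OF c(1)] C d(1) unfolding y0_def by (auto simp: smin dsub) (auto simp: a_minus_def E.M.r_neg)
    define s where "s = \<sigma> \<odot>\<^bsub>E\<^esub> y0"
    have s: "s \<in> carrier E" "\<delta> s = \<delta> e" using y0 sc d(3) y(2)[OF K(3)] K(7) unfolding s_def by auto
    have ms: "a \<odot>\<^bsub>E\<^esub> s = \<zero>\<^bsub>E\<^esub>" if a: "a \<in> \<mm>" for a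
    proof -
      obtain b where b: "b \<in> carrier A" "a \<otimes> \<sigma> = x \<otimes> b" using s_soc[OF a] by blast
      have "a \<odot>\<^bsub>E\<^esub> s = (b \<otimes> x) \<odot>\<^bsub>E\<^esub> y0" unfolding s_def using a mm.Icarr sc y0 b
        by (simp add: E.smult_assoc1[symmetric] m_comm)
      also have "\<dots> = \<zero>\<^bsub>E\<^esub>" using b y0 by (simp add: E.smult_assoc1)
      finally show ?thesis .
    qed
    have "e \<ominus>\<^bsub>E\<^esub> s \<in> C" using C e(1) s dsub[of e s] d(1) by (auto simp: a_minus_def E'.M.r_neg)
    moreover have "f a = a \<odot>\<^bsub>E\<^esub> (e \<ominus>\<^bsub>E\<^esub> s)" if "a \<in> \<mm>" for a
      using smin[of a e s] ms[OF that] e s that mm.Icarr by (simp add: a_minus_def)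
    ultimately show ?thesis by blast
  qed
  have sub0: "C \<subseteq> carrier E" using Cc by auto
  show ?thesis unfolding ext_vanishing_def
  proof (intro allI impI, elim conjE)
    fix J f assume J: "ideal J A" "x \<in> J" and f: "linear_on A E J f" "f ` J \<subseteq> C"
    \<comment> \<open>An ideal is good if some element representing \<open>f\<close> on
      \<open>J\<close> carries that ideal into \<open>C\<close>. If the whole ring is good, that
      element itself is in \<open>C\<close>. A maximal good ideal exists because in a Noetherian
      ring a chain of ideals attains its union.\<close>
    define good where "good J' \<longleftrightarrow> ideal J' A \<and> J \<subseteq> J' \<and>
       (\<exists>e\<in>carrier E. (\<forall>a\<in>J. f a = a \<odot>\<^bsub>E\<^esub> e) \<and> (\<forall>a\<in>J'. a \<odot>\<^bsub>E\<^esub> e \<in> C))" for J'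
    obtain e where "e \<in> carrier E" "\<And>a. a \<in> J \<Longrightarrow> f a = a \<odot>\<^bsub>E\<^esub> e"
      by (rule baerD[OF E(2) J(1) f(1)]) blast
    then have "good J" using J(1) f(2) unfolding good_def by (intro conjI bexI[of _ e]) auto
    moreover have "\<Union>\<C> \<in> Collect good" if "\<C> \<noteq> {}" "subset.chain (Collect good) \<C>" for \<C>
    proof -
      have "subset.chain {I. ideal I A} \<C>" using that(2) unfolding subset.chain_def good_def by auto
      then have "\<Union>\<C> \<in> \<C>" using ideal_chain_is_trivial[OF that(1)] by simp
      then show ?thesis using that(2) unfolding subset.chain_def by auto
    qed
    ultimately obtain K where K: "good K" and Kmax: "\<And>K'. good K' \<Longrightarrow> K \<subseteq> K' \<Longrightarrow> K' = K"
      using subset_Zorn_nonempty[of "Collect good"] by (metis (mono_tags, lifting) empty_iff mem_Collect_eq)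
    from K obtain e where e: "e \<in> carrier E" "\<And>a. a \<in> J \<Longrightarrow> f a = a \<odot>\<^bsub>E\<^esub> e" "\<And>a. a \<in> K \<Longrightarrow> a \<odot>\<^bsub>E\<^esub> e \<in> C"
      and KJ: "ideal K A" "J \<subseteq> K" unfolding good_def by blast
    interpret K: ideal K A by fact
    have "\<one> \<in> K"
    proof (rule ccontr)
      assume "\<one> \<notin> K"
      then have "\<not> D 0 \<subseteq> K" using D0 by auto
      have xK: "xA \<subseteq> K" unfolding xA_def using KJ(2) J(2) K.I_r_closed by auto
      then have "D N \<subseteq> K" using DN Dc unfolding xA_def by blast
      \<comment> \<open>The last level of \<open>D\<close> not contained in \<open>K\<close> yields
        \<open>b\<close> outside \<open>K\<close> that \<mm> multiplies into
        \<open>K\<close>.\<close>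
      then obtain k where k: "\<not> D k \<subseteq> K" "D (Suc k) \<subseteq> K"
        using ex_least_nat_less[of "\<lambda>k. D k \<subseteq> K" N] \<open>\<not> D 0 \<subseteq> K\<close> by blast
      then obtain b where b: "b \<in> D k" "b \<notin> K" by auto
      have bc: "b \<in> carrier A" using b(1) Dc by auto
      have mb: "a \<otimes> b \<in> K" if "a \<in> \<mm>" for a using DS[OF that b(1)] k(2) by auto
      have "linear_on A E \<mm> (\<lambda>a. (a \<otimes> b) \<odot>\<^bsub>E\<^esub> e)" unfolding linear_on_def
        using bc e(1) mm.Icarr by (auto simp: l_distr E.smult_l_distr m_assoc E.smult_assoc1)
      moreover have "(\<lambda>a. (a \<otimes> b) \<odot>\<^bsub>E\<^esub> e) ` \<mm> \<subseteq> C" using mb e(3) by auto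
      ultimately obtain c where c: "c \<in> C" "\<And>a. a \<in> \<mm> \<Longrightarrow> (a \<otimes> b) \<odot>\<^bsub>E\<^esub> e = a \<odot>\<^bsub>E\<^esub> c"
        using residue by blast
      define w where "w = b \<odot>\<^bsub>E\<^esub> e \<ominus>\<^bsub>E\<^esub> c"
      have w: "w \<in> carrier E" "\<And>a. a \<in> \<mm> \<Longrightarrow> a \<odot>\<^bsub>E\<^esub> w = \<zero>\<^bsub>E\<^esub>"
        unfolding w_def using bc e(1) Cc[OF c(1)] c(2) mm.Icarr
        by (auto simp: smin E.smult_assoc1[symmetric]) (auto simp: a_minus_def E.M.r_neg)
      obtain L h where L: "ideal L A" "K \<subseteq> L" "b \<in> L" "linear_on A E L h"
        "\<And>j. j \<in> K \<Longrightarrow> h j = \<zero>\<^bsub>E\<^esub>" "h b = w"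
        using linear_on_add_cyclic[OF E(1) max KJ(1) bc b(2) mb w] by metis
      obtain t where t: "t \<in> carrier E" "\<And>a. a \<in> L \<Longrightarrow> h a = a \<odot>\<^bsub>E\<^esub> t"
        by (rule baerD[OF E(2) L(1,4)]) blast
      \<comment> \<open>Subtracting \<open>t\<close> leaves the values on \<open>K\<close> unchanged
        and moves the value at \<open>b\<close> to \<open>c\<close>, which lies in \<open>C\<close>;
        so \<open>K\<close> was not maximal.\<close>
      define e' where "e' = e \<ominus>\<^bsub>E\<^esub> t"
      have e': "e' \<in> carrier E" unfolding e'_def using e t by auto
      have eK: "a \<odot>\<^bsub>E\<^esub> e' = a \<odot>\<^bsub>E\<^esub> e" if "a \<in> K" for a
      proof -
        have "a \<odot>\<^bsub>E\<^esub> t = \<zero>\<^bsub>E\<^esub>" using t(2)[of a, symmetric] L(5)[OF that] subsetD[OF L(2) that] by simp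
        then show ?thesis unfolding e'_def using smin[OF K.Icarr[OF that] e(1) t(1)] e(1) K.Icarr[OF that] by (simp add: a_minus_def)
      qed
      have eb: "b \<odot>\<^bsub>E\<^esub> e' = c"
      proof -
        have "b \<odot>\<^bsub>E\<^esub> t = w" using t(2)[OF L(3), symmetric] L(6) by simp
        then have "b \<odot>\<^bsub>E\<^esub> e' = b \<odot>\<^bsub>E\<^esub> e \<ominus>\<^bsub>E\<^esub> (b \<odot>\<^bsub>E\<^esub> e \<ominus>\<^bsub>E\<^esub> c)" unfolding e'_def using smin[OF bc e(1) t(1)] w_def by simp
        then show ?thesis using bc e(1) Cc[OF c(1)] by (simp add: a_minus_def E.M.minus_add E.M.a_assoc[symmetric] E.M.r_neg)
      qed
      have L': "ideal {a \<in> carrier A. a \<odot>\<^bsub>E\<^esub> e' \<in> C} A" (is "ideal ?L' A")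
      proof (rule idealI)
        show "ring A" by (rule ring_axioms)
        show "subgroup ?L' (add_monoid A)"
        proof (rule add.subgroupI)
          have "\<zero> \<odot>\<^bsub>E\<^esub> e' \<in> C" using eK[OF K.zero_closed] e(3)[OF K.zero_closed] by simp
          then show "?L' \<noteq> {}" by blast
          fix a assume "a \<in> ?L'"
          then have "a \<in> carrier A" "\<delta> (a \<odot>\<^bsub>E\<^esub> e') = \<zero>\<^bsub>E'\<^esub>" using C by auto
          then show "\<ominus> a \<in> ?L'" using e' dneg[of "a \<odot>\<^bsub>E\<^esub> e'"] unfolding C by (simp add: E.smult_l_minus)
        next
          fix a a' assume "a \<in> ?L'" "a' \<in> ?L'"
          then show "a \<oplus> a' \<in> ?L'" using e' d unfolding C by (simp add: E.smult_l_distr)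
        qed auto
        fix a z assume a: "a \<in> ?L'" "z \<in> carrier A"
        then show "z \<otimes> a \<in> ?L'" using e' d unfolding C by (simp add: E.smult_assoc1)
        then show "a \<otimes> z \<in> ?L'" using a by (simp add: m_comm)
      qed
      have KL: "K \<subseteq> ?L'"
      proof
        fix a assume a: "a \<in> K"
        show "a \<in> ?L'" using K.Icarr[OF a] eK[OF a] e(3)[OF a] by simp
      qed
      have "f a = a \<odot>\<^bsub>E\<^esub> e'" if "a \<in> J" for a using e(2)[OF that] eK[of a] KJ(2) that by auto
      then have "good ?L'" unfolding good_def using L' KJ(2) KL e' by blast
      moreover have "K \<subseteq> ?L'" using KL .
      ultimately have "?L' = K" using Kmax by blast
      then show False using eb c(1) bc b(2) by blast
    qed
    then have "e \<in> C" using e(3)[of \<one>] e(1) by simp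
    then show "\<exists>c\<in>C. \<forall>a\<in>J. f a = a \<odot>\<^bsub>E\<^esub> c" using e(2) by blast
  qed
qed

text \<open>Division by \<open>x\<close> turns \<open>s\<close> into the homomorphism
  \<open>a \<mapsto> a s / x\<close> on \<mm>, an extension class. Vanishing for the first cosyzygy,
  reached by descent from the zero end of the resolution, shows that this class is a multiple of the
  one belonging to \<sigma>; the multiplier is \<open>r\<close>.\<close>

lemma socle_cyclic:
  assumes fin: "finite_self_injective_dimension A"
    and s: "s \<in> carrier A" and ms: "\<And>a. a \<in> \<mm> \<Longrightarrow> \<exists>c\<in>carrier A. a \<otimes> s = x \<otimes> c"
  shows "\<exists>r\<in>carrier A. \<exists>q\<in>carrier A. s = r \<otimes> \<sigma> \<oplus> x \<otimes> q"
proof -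
  obtain \<epsilon> :: "'a \<Rightarrow> ('a \<times> 'a) set" and E \<delta> d where res: "injective_resolution A (regular_module A) \<epsilon> E \<delta>"
    and d0: "\<And>i. i > d \<Longrightarrow> carrier (E i) = {\<zero>\<^bsub>E i\<^esub>}"
    using fin unfolding finite_self_injective_dimension_def by blast
  have inj: "\<And>i. injective_module A (E i)" and eps: "\<epsilon> \<in> linear_maps A (regular_module A) (E 0)"
    and epsi: "inj_on \<epsilon> (carrier A)" and del: "\<And>i. \<delta> i \<in> linear_maps A (E i) (E (Suc i))"
    and ker0: "\<epsilon> ` carrier A = {e \<in> carrier (E 0). \<delta> 0 e = \<zero>\<^bsub>E (Suc 0)\<^esub>}"
    and ker: "\<And>i. \<delta> i ` carrier (E i) = {e \<in> carrier (E (Suc i)). \<delta> (Suc i) e = \<zero>\<^bsub>E (Suc (Suc i))\<^esub>}"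
    using res unfolding injective_resolution_def by (simp_all add: regular_module_def a_kernel_def')
  have mods: "\<And>i. module A (E i)" using inj unfolding injective_module_def by blast
  have baers: "\<And>i. baer A (E i)" using injective_module_imp_baer[OF inj] .
  have ext: "ext_vanishing A x (E (Suc j)) (\<delta> j ` carrier (E j))" for j
  proof -
    have triv: "ext_vanishing A x (E (Suc j)) (\<delta> j ` carrier (E j))" if "j \<ge> d" for j
    proof (rule ext_vanishing_zero[OF mods])
      show "carrier (E (Suc j)) = {\<zero>\<^bsub>E (Suc j)\<^esub>}" using d0 that by auto
      interpret Ej: module A "E j" by (rule mods)
      show "\<delta> j ` carrier (E j) \<noteq> {}" using Ej.M.zero_closed by blast
      show "\<delta> j ` carrier (E j) \<subseteq> carrier (E (Suc j))" using del[of j] unfolding linear_maps_def by auto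
    qed
    \<comment> \<open>Beyond \<open>d\<close> the modules are zero, so the induction runs downward
      from \<open>max d j\<close>.\<close>
    have "j \<le> max d j" by simp
    then show ?thesis
    proof (induction rule: inc_induct)
      case base
      show ?case by (rule triv) simp
    next
      case (step n)
      show ?case
      proof (rule ext_vanishing_step[OF mods baers mods del ker _ step.IH])
        fix c assume "c \<in> \<delta> n ` carrier (E n)"
        then obtain e where e: "e \<in> carrier (E n)" "c = \<delta> n e" by auto
        obtain e' where "e' \<in> carrier (E n)" "x \<odot>\<^bsub>E n\<^esub> e' = e" by (rule baer_divisible[OF mods baers e(1)])
        then show "\<exists>c'\<in>\<delta> n ` carrier (E n). x \<odot>\<^bsub>E (Suc n)\<^esub> c' = c"
          using del[of n] e unfolding linear_maps_def by (auto intro!: bexI[of _ e'])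
      qed
    qed
  qed
  interpret E0: module A "E 0" by (rule mods)
  interpret E1: module A "E (Suc 0)" by (rule mods)
  have ep: "\<And>a. a \<in> carrier A \<Longrightarrow> \<epsilon> a \<in> carrier (E 0)" "\<And>a b. a \<in> carrier A \<Longrightarrow> b \<in> carrier A \<Longrightarrow> \<epsilon> (a \<oplus> b) = \<epsilon> a \<oplus>\<^bsub>E 0\<^esub> \<epsilon> b"
    "\<And>a b. a \<in> carrier A \<Longrightarrow> b \<in> carrier A \<Longrightarrow> \<epsilon> (a \<otimes> b) = a \<odot>\<^bsub>E 0\<^esub> \<epsilon> b"
    using eps unfolding linear_maps_def regular_module_def by auto
  have de: "\<And>e. e \<in> carrier (E 0) \<Longrightarrow> \<delta> 0 e \<in> carrier (E (Suc 0))" "\<And>e e'. e \<in> carrier (E 0) \<Longrightarrow> e' \<in> carrier (E 0) \<Longrightarrow> \<delta> 0 (e \<oplus>\<^bsub>E 0\<^esub> e') = \<delta> 0 e \<oplus>\<^bsub>E (Suc 0)\<^esub> \<delta> 0 e'"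
    "\<And>a e. a \<in> carrier A \<Longrightarrow> e \<in> carrier (E 0) \<Longrightarrow> \<delta> 0 (a \<odot>\<^bsub>E 0\<^esub> e) = a \<odot>\<^bsub>E (Suc 0)\<^esub> \<delta> 0 e"
    using del[of 0] unfolding linear_maps_def by auto
  define b where "b a = (SOME c. c \<in> carrier A \<and> a \<otimes> s = x \<otimes> c)" for a
  have b: "b a \<in> carrier A" "a \<otimes> s = x \<otimes> b a" if "a \<in> \<mm>" for a
    using someI_ex[of "\<lambda>c. c \<in> carrier A \<and> a \<otimes> s = x \<otimes> c"] ms[OF that] unfolding b_def by blast+
  have b_eq: "b a = c" if "a \<in> \<mm>" "c \<in> carrier A" "a \<otimes> s = x \<otimes> c" for a c
    using x_cancel b[OF that(1)] that by simp
  have badd: "b (a \<oplus> a') = b a \<oplus> b a'" if "a \<in> \<mm>" "a' \<in> \<mm>" for a a'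
    using that b[OF that(1)] b[OF that(2)] mm.Icarr s by (intro b_eq) (auto simp: l_distr r_distr)
  have bmul: "b (r \<otimes> a) = r \<otimes> b a" if "a \<in> \<mm>" "r \<in> carrier A" for a r
    using that b[OF that(1)] mm.Icarr s by (intro b_eq) (auto simp: m_assoc m_lcomm mm.I_l_closed)
  have bx: "b x = s" using xm s by (intro b_eq) auto
  have lb: "linear_on A (E 0) \<mm> (\<lambda>a. \<epsilon> (b a))" unfolding linear_on_def
    using b ep mm.Icarr by (auto simp: badd bmul)
  obtain e where e: "e \<in> carrier (E 0)" "\<And>a. a \<in> \<mm> \<Longrightarrow> \<epsilon> (b a) = a \<odot>\<^bsub>E 0\<^esub> e"
    by (rule baerD[OF baers mm.ideal_axioms lb]) blast
  have de0: "\<delta> 0 (\<epsilon> a) = \<zero>\<^bsub>E (Suc 0)\<^esub>" if "a \<in> carrier A" for a using ker0 that by auto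
  have w: "\<delta> 0 e \<in> carrier (E (Suc 0))" "\<And>a. a \<in> \<mm> \<Longrightarrow> a \<odot>\<^bsub>E (Suc 0)\<^esub> \<delta> 0 e = \<zero>\<^bsub>E (Suc 0)\<^esub>"
    using de(1)[OF e(1)] de(3)[OF _ e(1), symmetric] e(2)[symmetric] de0 b mm.Icarr by auto
  obtain K h where K: "ideal K A" "xA \<subseteq> K" "\<sigma> \<in> K" "linear_on A (E (Suc 0)) K h"
     "\<And>y. y \<in> K \<Longrightarrow> \<exists>a\<in>carrier A. h y = a \<odot>\<^bsub>E (Suc 0)\<^esub> \<delta> 0 e" "\<And>j. j \<in> xA \<Longrightarrow> h j = \<zero>\<^bsub>E (Suc 0)\<^esub>" "h \<sigma> = \<delta> 0 e"
    using linear_on_add_cyclic[OF mods max ideal_xA sc sigma_notin sigma_colon w] by metis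
  have xK: "x \<in> K" using K(2) x_in_xA by auto
  have hK: "h ` K \<subseteq> \<delta> 0 ` carrier (E 0)"
  proof
    fix z assume "z \<in> h ` K"
    then obtain a where "a \<in> carrier A" "z = a \<odot>\<^bsub>E (Suc 0)\<^esub> \<delta> 0 e" using K(5) by auto
    then show "z \<in> \<delta> 0 ` carrier (E 0)" using de(3)[OF _ e(1)] e(1) by (metis E0.smult_closed imageI)
  qed
  obtain y where y: "y \<in> carrier (E 0)" "\<And>a. a \<in> K \<Longrightarrow> h a = a \<odot>\<^bsub>E (Suc 0)\<^esub> \<delta> 0 y"
    by (rule ext_vanishingD[OF ext[of 0] K(1) xK K(4) hK]) blast
  \<comment> \<open>Exactness at \<open>E 0\<close> converts two elements killed by
    \<open>\<delta> 0\<close> into ring elements \<open>r\<close> and \<open>q\<close>. Computing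
    \<open>x \<sigma> y\<close> in two ways then gives the relation between \<open>s\<close>,
    \<sigma> and \<open>x\<close>.\<close>
  have dxy: "\<delta> 0 (x \<odot>\<^bsub>E 0\<^esub> y) = \<zero>\<^bsub>E (Suc 0)\<^esub>" using y(2)[of x] K(2,6) x_in_xA de(3)[of x y] y(1) by auto
  have "x \<odot>\<^bsub>E 0\<^esub> y \<in> \<epsilon> ` carrier A" unfolding ker0 using y(1) dxy by simp
  then obtain r where r: "r \<in> carrier A" "x \<odot>\<^bsub>E 0\<^esub> y = \<epsilon> r" by (rule imageE)
  have "\<delta> 0 (\<sigma> \<odot>\<^bsub>E 0\<^esub> y) = \<delta> 0 e" using y(2)[OF K(3)] K(7) de(3)[of \<sigma> y] sc y(1) by simp
  moreover have "\<delta> 0 (\<ominus>\<^bsub>E 0\<^esub> e) = \<ominus>\<^bsub>E (Suc 0)\<^esub> \<delta> 0 e"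
    using de(3)[of "\<ominus> \<one>" e] e(1) module_uminus[OF mods e(1)] module_uminus[OF mods w(1)] by simp
  ultimately have dq: "\<delta> 0 (\<sigma> \<odot>\<^bsub>E 0\<^esub> y \<ominus>\<^bsub>E 0\<^esub> e) = \<zero>\<^bsub>E (Suc 0)\<^esub>" using de(2) e(1) y(1) sc w(1) by (simp add: a_minus_def E1.M.r_neg)
  have "\<sigma> \<odot>\<^bsub>E 0\<^esub> y \<ominus>\<^bsub>E 0\<^esub> e \<in> \<epsilon> ` carrier A" unfolding ker0 using y(1) e(1) sc dq by simp
  then obtain q where q: "q \<in> carrier A" "\<sigma> \<odot>\<^bsub>E 0\<^esub> y \<ominus>\<^bsub>E 0\<^esub> e = \<epsilon> q" by (rule imageE)
  have "\<sigma> \<odot>\<^bsub>E 0\<^esub> y = \<epsilon> q \<oplus>\<^bsub>E 0\<^esub> e" unfolding q(2)[symmetric] using sc y(1) e(1)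
    by (simp add: a_minus_def E0.M.a_assoc E0.M.l_neg)
  then have "x \<odot>\<^bsub>E 0\<^esub> (\<sigma> \<odot>\<^bsub>E 0\<^esub> y) = x \<odot>\<^bsub>E 0\<^esub> \<epsilon> q \<oplus>\<^bsub>E 0\<^esub> x \<odot>\<^bsub>E 0\<^esub> e" using q(1) e(1) ep(1) by (simp add: E0.smult_r_distr)
  moreover have "x \<odot>\<^bsub>E 0\<^esub> (\<sigma> \<odot>\<^bsub>E 0\<^esub> y) = \<sigma> \<odot>\<^bsub>E 0\<^esub> \<epsilon> r" unfolding r(2)[symmetric] using sc y(1)
    by (simp add: E0.smult_assoc1[symmetric] m_comm)
  moreover have "x \<odot>\<^bsub>E 0\<^esub> e = \<epsilon> s" using e(2)[OF xm] bx by simp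
  ultimately have "\<epsilon> (\<sigma> \<otimes> r) = \<epsilon> (x \<otimes> q \<oplus> s)" using ep sc r(1) q(1) s by simp
  then have "\<sigma> \<otimes> r = x \<otimes> q \<oplus> s" using epsi sc r(1) q(1) s by (auto dest: inj_onD)
  moreover have "s = (x \<otimes> q \<oplus> s) \<oplus> x \<otimes> (\<ominus> q)" using x_carr q(1) s by algebra
  ultimately have "s = \<sigma> \<otimes> r \<oplus> x \<otimes> (\<ominus> q)" by metis
  then have "s = r \<otimes> \<sigma> \<oplus> x \<otimes> (\<ominus> q)" unfolding m_comm[OF sc r(1)] .
  then show ?thesis using r(1) a_inv_closed[OF q(1)] by blast
qed

end

section \<open>Submodules of free modules over a univariate polynomial ring\<close>

definition poly_submodule :: "('b \<Rightarrow> 'k::field poly) set \<Rightarrow> bool" where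
  "poly_submodule M \<longleftrightarrow> (\<lambda>_. 0) \<in> M \<and> (\<forall>c\<in>M. \<forall>d\<in>M. (\<lambda>b. c b + d b) \<in> M) \<and>
     (\<forall>p. \<forall>c\<in>M. (\<lambda>b. p * c b) \<in> M)"

lemma poly_submoduleD:
  assumes "poly_submodule M"
  shows "(\<lambda>_. 0) \<in> M" "c \<in> M \<Longrightarrow> (\<lambda>b. p * c b) \<in> M"
    "\<lbrakk>c \<in> M; d \<in> M\<rbrakk> \<Longrightarrow> (\<lambda>b. d b + p * c b) \<in> M"
  using assms by (simp_all add: poly_submodule_def)

text \<open>An element of least degree in coordinate \<open>b\<close> divides all others there, by
  division with remainder.\<close>

lemma poly_submodule_pivot:
  assumes "poly_submodule M"
  obtains c where "c \<in> M" "\<And>d. d \<in> M \<Longrightarrow> c b dvd d b"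
proof (cases "\<forall>d\<in>M. d b = 0")
  case True
  then show ?thesis using that[of "\<lambda>_. 0"] assms by (simp add: poly_submodule_def)
next
  case False
  then obtain c0 where c0: "c0 \<in> M" "c0 b \<noteq> 0" by auto
  define k where "k = (LEAST k. \<exists>c\<in>M. c b \<noteq> 0 \<and> degree (c b) = k)"
  have "\<exists>c\<in>M. c b \<noteq> 0 \<and> degree (c b) = k"
    unfolding k_def by (rule LeastI[of _ "degree (c0 b)"]) (use c0 in blast)
  then obtain c where c: "c \<in> M" "c b \<noteq> 0" "degree (c b) = k" by blast
  have min: "k \<le> degree (d b)" if "d \<in> M" "d b \<noteq> 0" for d
    unfolding k_def by (rule Least_le) (use that in blast)
  have "c b dvd d b" if d: "d \<in> M" for d
  proof (rule ccontr)
    assume n: "\<not> c b dvd d b"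
    define q where "q = - (d b div c b)"
    have 1: "(\<lambda>j. d j + q * c j) \<in> M"
      by (rule poly_submoduleD(3)[OF assms c(1) d])
    have 2: "d b + q * c b = d b mod c b"
      unfolding q_def by (simp add: minus_div_mult_eq_mod)
    have 3: "d b mod c b \<noteq> 0" using n by (simp add: dvd_eq_mod_eq_0)
    then have "degree (d b mod c b) < degree (c b)" using degree_mod_less'[of "c b" "d b"] c(2) by simp
    moreover have "k \<le> degree (d b mod c b)" using min[OF 1] 2 3 by simp
    ultimately show False using c(3) by simp
  qed
  then show ?thesis using that c(1) by blast
qed

lemma poly_submodule_eliminate:
  assumes "poly_submodule M" "c \<in> M" "d \<in> M" "c b dvd d b"
  obtains a d' where "d' \<in> M" "d' b = 0" "d = (\<lambda>j. d' j + a * c j)"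
proof -
  from assms(4) obtain a where a: "d b = c b * a" by (auto elim: dvdE)
  have "(\<lambda>j. d j + - a * c j) \<in> M" by (rule poly_submoduleD(3)[OF assms(1-3)])
  then show ?thesis using that[of "\<lambda>j. d j + - a * c j" a] a by (simp add: mult.commute)
qed

lemma poly_submodule_section:
  assumes "poly_submodule M" shows "poly_submodule {c \<in> M. c b = 0}"
  using assms unfolding poly_submodule_def by auto

text \<open>Induction over the coordinates: a pivot eliminates coordinate \<open>b\<close> and
  leaves the submodule vanishing there. Generation is expressed through all submodules containing
  \<open>G\<close> instead of a span.\<close>

lemma poly_submodule_finitely_generated:
  fixes M :: "('b \<Rightarrow> 'k::field poly) set"
  assumes "finite B" "poly_submodule M" "\<And>c b. c \<in> M \<Longrightarrow> b \<notin> B \<Longrightarrow> c b = 0"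
  shows "\<exists>G. finite G \<and> G \<subseteq> M \<and> (\<forall>M'. poly_submodule M' \<and> G \<subseteq> M' \<longrightarrow> M \<subseteq> M')"
  using assms
proof (induction B arbitrary: M rule: finite_induct)
  case empty
  then have "M \<subseteq> {\<lambda>_. 0}" by auto
  then show ?case unfolding poly_submodule_def by (intro exI[of _ "{}"]) auto
next
  case (insert b B)
  let ?M0 = "{c \<in> M. c b = 0}"
  have "\<exists>G. finite G \<and> G \<subseteq> ?M0 \<and> (\<forall>M'. poly_submodule M' \<and> G \<subseteq> M' \<longrightarrow> ?M0 \<subseteq> M')"
  proof (rule insert.IH[OF poly_submodule_section[OF insert.prems(1)]])
    fix c j assume "c \<in> ?M0" "j \<notin> B"
    then show "c j = 0" using insert.prems(2)[of c j] by (cases "j = b") auto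
  qed
  then obtain G where G: "finite G" "G \<subseteq> ?M0" "\<forall>M'. poly_submodule M' \<and> G \<subseteq> M' \<longrightarrow> ?M0 \<subseteq> M'"
    by (elim exE conjE)
  obtain c where c: "c \<in> M" "\<And>d. d \<in> M \<Longrightarrow> c b dvd d b"
    by (rule poly_submodule_pivot[OF insert.prems(1)]) blast
  have "M \<subseteq> M'" if M': "poly_submodule M'" "insert c G \<subseteq> M'" for M'
  proof
    fix d assume d: "d \<in> M"
    obtain a d' where 1: "d' \<in> M" "d' b = 0" "d = (\<lambda>j. d' j + a * c j)"
      by (rule poly_submodule_eliminate[OF insert.prems(1) c(1) d c(2)[OF d]]) blast
    have "?M0 \<subseteq> M'" using G(3) M' by simp
    then have "d' \<in> M'" using 1(1,2) by auto
    then show "d \<in> M'" unfolding 1(3) using M' by (intro poly_submoduleD(3)) auto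
  qed
  then show ?case using G(1,2) c(1) by (intro exI[of _ "insert c G"]) auto
qed

definition fract_submodule :: "'k::field poly fract set \<Rightarrow> bool" where
  "fract_submodule T \<longleftrightarrow> 0 \<in> T \<and> (\<forall>x\<in>T. \<forall>y\<in>T. x + y \<in> T) \<and> (\<forall>p. \<forall>x\<in>T. to_fract p * x \<in> T)"

lemma fract_submoduleD:
  assumes "fract_submodule T"
  shows "0 \<in> T" "\<lbrakk>x \<in> T; y \<in> T\<rbrakk> \<Longrightarrow> x + y \<in> T" "x \<in> T \<Longrightarrow> to_fract p * x \<in> T" "x \<in> T \<Longrightarrow> - x \<in> T"
    "\<lbrakk>x \<in> T; y \<in> T\<rbrakk> \<Longrightarrow> x - y \<in> T"
proof -
  show 1: "0 \<in> T" "\<lbrakk>x \<in> T; y \<in> T\<rbrakk> \<Longrightarrow> x + y \<in> T" "x \<in> T \<Longrightarrow> to_fract p * x \<in> T" for x y p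
    using assms by (auto simp: fract_submodule_def)
  show 2: "x \<in> T \<Longrightarrow> - x \<in> T" for x using 1(3)[of x "-1"] by simp
  show "\<lbrakk>x \<in> T; y \<in> T\<rbrakk> \<Longrightarrow> x - y \<in> T" using 1(2)[of x "- y"] 2 by simp
qed

text \<open>Quotients of the fraction field are divisible, hence injective over the principal ideal domain
  of polynomials.\<close>
lemma extend_to_divisible:
  fixes M :: "('b \<Rightarrow> 'k::field poly) set"
  assumes T: "fract_submodule T"
    and "finite B" "poly_submodule M" "\<And>c b. c \<in> M \<Longrightarrow> b \<notin> B \<Longrightarrow> c b = 0"
    and "\<And>c d. c \<in> M \<Longrightarrow> d \<in> M \<Longrightarrow> g (\<lambda>b. c b + d b) - (g c + g d) \<in> T"
    and "\<And>p c. c \<in> M \<Longrightarrow> g (\<lambda>b. p * c b) - to_fract p * g c \<in> T"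
  shows "\<exists>t. \<forall>c\<in>M. g c - (\<Sum>b\<in>B. to_fract (c b) * t b) \<in> T"
  using assms(2-)
proof (induction B arbitrary: M rule: finite_induct)
  case empty
  have "g (\<lambda>_. 0) \<in> T" using empty.prems(1) empty.prems(4)[of "\<lambda>_. 0" 0] unfolding poly_submodule_def by simp
  moreover have "c = (\<lambda>_. 0)" if "c \<in> M" for c using empty.prems(2)[OF that] by auto
  ultimately show ?case by (metis diff_zero sum.empty)
next
  case (insert b B)
  let ?M0 = "{c \<in> M. c b = 0}"
  have "\<exists>t. \<forall>c\<in>?M0. g c - (\<Sum>b\<in>B. to_fract (c b) * t b) \<in> T"
  proof (rule insert.IH[OF poly_submodule_section[OF insert.prems(1)]])
    fix c j assume "c \<in> ?M0" "j \<notin> B"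
    then show "c j = 0" using insert.prems(2)[of c j] by (cases "j = b") auto
  qed (use insert.prems in simp_all)
  then obtain t where t: "\<And>c. c \<in> M \<Longrightarrow> c b = 0 \<Longrightarrow> g c - (\<Sum>b\<in>B. to_fract (c b) * t b) \<in> T"
    by blast
  obtain c where c: "c \<in> M" "\<And>d. d \<in> M \<Longrightarrow> c b dvd d b"
    by (rule poly_submodule_pivot[OF insert.prems(1)]) blast
  \<comment> \<open>The new coordinate of \<open>t\<close> is dictated by the pivot
    \<open>c\<close>; the division takes place in the fraction field. If \<open>c b = 0\<close>, its
    value is irrelevant, since then every element vanishes at \<open>b\<close>.\<close>
  define t' where "t' = t(b := (g c - (\<Sum>j\<in>B. to_fract (c j) * t j)) / to_fract (c b))"
  have sumB: "(\<Sum>j\<in>insert b B. to_fract (d j) * t' j) = to_fract (d b) * t' b + (\<Sum>j\<in>B. to_fract (d j) * t j)" for d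
  proof -
    have "(\<Sum>j\<in>B. to_fract (d j) * t' j) = (\<Sum>j\<in>B. to_fract (d j) * t j)"
      by (rule sum.cong) (use insert.hyps in \<open>auto simp: t'_def\<close>)
    then show ?thesis using insert.hyps by simp
  qed
  have "g d - (\<Sum>j\<in>insert b B. to_fract (d j) * t' j) \<in> T" if d: "d \<in> M" for d
  proof (cases "c b = 0")
    case True
    then have "d b = 0" using c(2)[OF d] by simp
    then show ?thesis using t[OF d] by (simp add: sumB del: sum.insert)
  next
    case False
    obtain a d' where 1: "d' \<in> M" "d' b = 0" "d = (\<lambda>j. d' j + a * c j)"
      by (rule poly_submodule_eliminate[OF insert.prems(1) c(1) d c(2)[OF d]]) blast
    have ac: "(\<lambda>j. a * c j) \<in> M" using insert.prems(1) c(1) by (rule poly_submoduleD(2))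
    have e1: "g d - (g d' + g (\<lambda>j. a * c j)) \<in> T" unfolding 1(3) by (rule insert.prems(3)[OF 1(1) ac])
    have e2: "g (\<lambda>j. a * c j) - to_fract a * g c \<in> T" by (rule insert.prems(4)[OF c(1)])
    have e3: "g d' - (\<Sum>j\<in>B. to_fract (d' j) * t j) \<in> T" by (rule t[OF 1(1,2)])
    have "to_fract (c b) * t' b = g c - (\<Sum>j\<in>B. to_fract (c j) * t j)"
      using False by (simp add: t'_def)
    then have "to_fract (d b) * t' b = to_fract a * (g c - (\<Sum>j\<in>B. to_fract (c j) * t j))"
      unfolding 1(3) using 1(2) by (simp add: mult.assoc)
    moreover have "(\<Sum>j\<in>B. to_fract (d j) * t j) = (\<Sum>j\<in>B. to_fract (d' j) * t j) + to_fract a * (\<Sum>j\<in>B. to_fract (c j) * t j)"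
      unfolding 1(3) by (simp add: sum_distrib_left sum.distrib distrib_right mult.assoc)
    ultimately have "g d - (\<Sum>j\<in>insert b B. to_fract (d j) * t' j) =
      (g d - (g d' + g (\<lambda>j. a * c j))) + (g (\<lambda>j. a * c j) - to_fract a * g c) + (g d' - (\<Sum>j\<in>B. to_fract (d' j) * t j))"
      unfolding sumB by (simp add: algebra_simps)
    then show ?thesis using fract_submoduleD(2)[OF T fract_submoduleD(2)[OF T e1 e2] e3] by (rule ssubst)
  qed
  then show ?case by blast
qed

lemma fract_common_denominator:
  fixes t :: "'b \<Rightarrow> 'k::field poly fract"
  assumes "finite B"
  shows "\<exists>p n. p \<noteq> 0 \<and> (\<forall>b\<in>B. t b = to_fract (n b) / to_fract p)"
  using assms
proof (induction B rule: finite_induct)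
  case empty
  show ?case by (intro exI[of _ 1]) auto
next
  case (insert b B)
  then obtain p n where p: "p \<noteq> 0" "\<forall>b\<in>B. t b = to_fract (n b) / to_fract p" by blast
  obtain a q where q: "q \<noteq> 0" "t b = to_fract a / to_fract q"
    by (cases "t b") (auto simp: to_fract_def divide_fract)
  let ?n = "\<lambda>j. if j = b then a * p else q * n j"
  have "t j = to_fract (?n j) / to_fract (p * q)" if "j \<in> insert b B" for j
    using p q insert.hyps that by auto
  then show ?case using p(1) q(1) by (intro exI[of _ "p * q"] exI[of _ ?n]) auto
qed

section \<open>Quotient modules carried by a prescribed type\<close>

locale labelled_quotient = A: cring A + Q: cring Q + N: additive_subgroup N Q
  for A :: "('a, 'x) ring_scheme" and Q :: "('q, 'y) ring_scheme" and \<iota> :: "'a \<Rightarrow> 'q" and N +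
  assumes hom: "\<iota> \<in> ring_hom A Q"
    and N_smult: "\<And>a n. \<lbrakk>a \<in> carrier A; n \<in> N\<rbrakk> \<Longrightarrow> \<iota> a \<otimes>\<^bsub>Q\<^esub> n \<in> N"
begin

text \<open>The coset of \<open>q\<close> modulo \<open>N\<close>, moved to the diagonal so that it
  has the kind of type on which \<open>finite_self_injective_dimension\<close> places the modules of
  a resolution.\<close>

definition cls :: "'q \<Rightarrow> ('q \<times> 'q) set" where
  "cls q = Id_on {r \<in> carrier Q. q \<ominus>\<^bsub>Q\<^esub> r \<in> N}"

definition rep where "rep Y = (SOME q. q \<in> carrier Q \<and> cls q = Y)"

definition quo :: "('a, ('q \<times> 'q) set) module" where
  "quo = \<lparr>carrier = cls ` carrier Q, monoid.mult = undefined, monoid.one = undefined,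
     ring.zero = cls \<zero>\<^bsub>Q\<^esub>, ring.add = (\<lambda>Y Z. cls (rep Y \<oplus>\<^bsub>Q\<^esub> rep Z)),
     module.smult = (\<lambda>a Y. cls (\<iota> a \<otimes>\<^bsub>Q\<^esub> rep Y))\<rparr>"

lemma N_carr: "n \<in> N \<Longrightarrow> n \<in> carrier Q" using N.a_subset by auto

lemma N_minus_swap:
  assumes "q \<in> carrier Q" "r \<in> carrier Q" "q \<ominus>\<^bsub>Q\<^esub> r \<in> N" shows "r \<ominus>\<^bsub>Q\<^esub> q \<in> N"
proof -
  have "r \<ominus>\<^bsub>Q\<^esub> q = \<ominus>\<^bsub>Q\<^esub> (q \<ominus>\<^bsub>Q\<^esub> r)" using assms(1,2) by algebra
  then show ?thesis using N.a_inv_closed[OF assms(3)] by simp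
qed

lemma N_minus_trans:
  assumes "q \<in> carrier Q" "r \<in> carrier Q" "s \<in> carrier Q" "q \<ominus>\<^bsub>Q\<^esub> r \<in> N" "r \<ominus>\<^bsub>Q\<^esub> s \<in> N"
  shows "q \<ominus>\<^bsub>Q\<^esub> s \<in> N"
proof -
  have "q \<ominus>\<^bsub>Q\<^esub> s = (q \<ominus>\<^bsub>Q\<^esub> r) \<oplus>\<^bsub>Q\<^esub> (r \<ominus>\<^bsub>Q\<^esub> s)" using assms(1-3) by algebra
  then show ?thesis using N.a_closed[OF assms(4,5)] by simp
qed

lemma cls_eq_iff:
  assumes "q \<in> carrier Q" "r \<in> carrier Q" shows "cls q = cls r \<longleftrightarrow> q \<ominus>\<^bsub>Q\<^esub> r \<in> N"
proof
  assume "cls q = cls r"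
  moreover have "r \<ominus>\<^bsub>Q\<^esub> r \<in> N" using assms N.zero_closed by (simp add: a_minus_def Q.r_neg)
  then have "(r, r) \<in> cls r" using assms by (simp add: cls_def Id_on_iff)
  ultimately have "(r, r) \<in> cls q" by simp
  then show "q \<ominus>\<^bsub>Q\<^esub> r \<in> N" by (simp add: cls_def Id_on_iff)
next
  assume *: "q \<ominus>\<^bsub>Q\<^esub> r \<in> N"
  have "{s \<in> carrier Q. q \<ominus>\<^bsub>Q\<^esub> s \<in> N} = {s \<in> carrier Q. r \<ominus>\<^bsub>Q\<^esub> s \<in> N}"
    using N_minus_trans[OF assms(1,2)] N_minus_trans[OF assms(2,1)] * N_minus_swap[OF assms *] by blast
  then show "cls q = cls r" by (simp add: cls_def)
qed

lemma rep: "q \<in> carrier Q \<Longrightarrow> rep (cls q) \<in> carrier Q \<and> cls (rep (cls q)) = cls q"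
  unfolding rep_def by (rule someI[of "\<lambda>r. r \<in> carrier Q \<and> cls r = cls q" q]) simp

lemma carrier_quo: "carrier quo = cls ` carrier Q" and zero_quo: "\<zero>\<^bsub>quo\<^esub> = cls \<zero>\<^bsub>Q\<^esub>"
  by (simp_all add: quo_def)

lemma cls_in: "q \<in> carrier Q \<Longrightarrow> cls q \<in> carrier quo"
  by (simp add: quo_def)

lemma quoE:
  assumes "Y \<in> carrier quo" obtains q where "q \<in> carrier Q" "Y = cls q"
  using assms by (auto simp: quo_def)

lemma iota_closed [simp, intro]: "a \<in> carrier A \<Longrightarrow> \<iota> a \<in> carrier Q"
  using hom by (auto simp: ring_hom_def)

lemma add_quo:
  assumes "q \<in> carrier Q" "r \<in> carrier Q" shows "cls q \<oplus>\<^bsub>quo\<^esub> cls r = cls (q \<oplus>\<^bsub>Q\<^esub> r)"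
proof -
  let ?q = "rep (cls q)" and ?r = "rep (cls r)"
  have c: "?q \<in> carrier Q" "?r \<in> carrier Q" using rep assms by auto
  have "?q \<ominus>\<^bsub>Q\<^esub> q \<in> N" "?r \<ominus>\<^bsub>Q\<^esub> r \<in> N" using rep assms cls_eq_iff by metis+
  then have "(?q \<ominus>\<^bsub>Q\<^esub> q) \<oplus>\<^bsub>Q\<^esub> (?r \<ominus>\<^bsub>Q\<^esub> r) \<in> N" by (rule N.a_closed)
  moreover have "(?q \<ominus>\<^bsub>Q\<^esub> q) \<oplus>\<^bsub>Q\<^esub> (?r \<ominus>\<^bsub>Q\<^esub> r) = (?q \<oplus>\<^bsub>Q\<^esub> ?r) \<ominus>\<^bsub>Q\<^esub> (q \<oplus>\<^bsub>Q\<^esub> r)"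
    using assms c by algebra
  ultimately have "cls (?q \<oplus>\<^bsub>Q\<^esub> ?r) = cls (q \<oplus>\<^bsub>Q\<^esub> r)" using cls_eq_iff assms c by simp
  then show ?thesis by (simp add: quo_def)
qed

lemma smult_quo:
  assumes "a \<in> carrier A" "q \<in> carrier Q" shows "a \<odot>\<^bsub>quo\<^esub> cls q = cls (\<iota> a \<otimes>\<^bsub>Q\<^esub> q)"
proof -
  let ?q = "rep (cls q)"
  have c: "?q \<in> carrier Q" "\<iota> a \<in> carrier Q" using rep assms by auto
  have "?q \<ominus>\<^bsub>Q\<^esub> q \<in> N" using rep assms cls_eq_iff by metis
  then have "\<iota> a \<otimes>\<^bsub>Q\<^esub> (?q \<ominus>\<^bsub>Q\<^esub> q) \<in> N" using N_smult assms by blast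
  moreover have "\<iota> a \<otimes>\<^bsub>Q\<^esub> (?q \<ominus>\<^bsub>Q\<^esub> q) = \<iota> a \<otimes>\<^bsub>Q\<^esub> ?q \<ominus>\<^bsub>Q\<^esub> \<iota> a \<otimes>\<^bsub>Q\<^esub> q"
    using assms c by algebra
  ultimately have "cls (\<iota> a \<otimes>\<^bsub>Q\<^esub> ?q) = cls (\<iota> a \<otimes>\<^bsub>Q\<^esub> q)" using cls_eq_iff assms c by simp
  then show ?thesis by (simp add: quo_def)
qed

lemma module_quo: "module A quo"
proof (rule moduleI)
  show "abelian_group quo"
  proof (rule abelian_groupI)
    fix Y assume "Y \<in> carrier quo"
    then obtain q where q: "q \<in> carrier Q" "Y = cls q" by (rule quoE)
    show "\<exists>Z\<in>carrier quo. Z \<oplus>\<^bsub>quo\<^esub> Y = \<zero>\<^bsub>quo\<^esub>"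
      by (rule bexI[of _ "cls (\<ominus>\<^bsub>Q\<^esub> q)"]) (use q in \<open>simp_all add: cls_in add_quo zero_quo Q.l_neg\<close>)
  qed (auto elim!: quoE simp: add_quo zero_quo cls_in Q.a_ac)
next
  fix a b Y assume a: "a \<in> carrier A" "b \<in> carrier A" and "Y \<in> carrier quo"
  then obtain q where q: "q \<in> carrier Q" "Y = cls q" by (rule_tac quoE)
  show "(a \<oplus>\<^bsub>A\<^esub> b) \<odot>\<^bsub>quo\<^esub> Y = a \<odot>\<^bsub>quo\<^esub> Y \<oplus>\<^bsub>quo\<^esub> b \<odot>\<^bsub>quo\<^esub> Y"
    unfolding q(2) using q(1) a by (simp add: smult_quo add_quo ring_hom_add[OF hom] Q.l_distr)
  show "(a \<otimes>\<^bsub>A\<^esub> b) \<odot>\<^bsub>quo\<^esub> Y = a \<odot>\<^bsub>quo\<^esub> (b \<odot>\<^bsub>quo\<^esub> Y)"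
    unfolding q(2) using q(1) a by (simp add: smult_quo ring_hom_mult[OF hom] Q.m_assoc)
next
  fix a Y Z assume a: "a \<in> carrier A" and Y: "Y \<in> carrier quo" and Z: "Z \<in> carrier quo"
  obtain q where q: "q \<in> carrier Q" "Y = cls q" using Y by (rule quoE)
  obtain r where r: "r \<in> carrier Q" "Z = cls r" using Z by (rule quoE)
  show "a \<odot>\<^bsub>quo\<^esub> (Y \<oplus>\<^bsub>quo\<^esub> Z) = a \<odot>\<^bsub>quo\<^esub> Y \<oplus>\<^bsub>quo\<^esub> a \<odot>\<^bsub>quo\<^esub> Z"
    unfolding q(2) r(2) using q(1) r(1) a by (simp add: smult_quo add_quo Q.r_distr)
qed (auto elim!: quoE simp: smult_quo cls_in ring_hom_one[OF hom] A.cring_axioms)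

end

text \<open>The projection from the quotient by \<open>N\<close> to the one by \<open>N'\<close>,
  with its image and kernel, supplies the differentials of the resolution.\<close>

locale labelled_quotient_pair = S: labelled_quotient A Q \<iota> N + T: labelled_quotient A Q \<iota> N'
  for A Q \<iota> N N' + assumes sub: "N \<subseteq> N'"
begin

lemma proj_cls:
  assumes "q \<in> carrier Q" shows "T.cls (S.rep (S.cls q)) = T.cls q"
proof -
  have "S.rep (S.cls q) \<ominus>\<^bsub>Q\<^esub> q \<in> N" using S.rep[OF assms] S.cls_eq_iff assms by metis
  then show ?thesis using T.cls_eq_iff S.rep[OF assms] assms sub by blast
qed

lemma proj_linear: "(\<lambda>Y. T.cls (S.rep Y)) \<in> linear_maps A S.quo T.quo"
  unfolding linear_maps_def
  by (auto elim!: S.quoE simp: proj_cls S.add_quo T.add_quo S.smult_quo T.smult_quo T.cls_in)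

lemma proj_image: "(\<lambda>Y. T.cls (S.rep Y)) ` carrier S.quo = carrier T.quo"
  unfolding S.carrier_quo T.carrier_quo image_image using proj_cls by simp

lemma proj_kernel: "{Y \<in> carrier S.quo. T.cls (S.rep Y) = \<zero>\<^bsub>T.quo\<^esub>} = S.cls ` N'"
proof -
  have zero_iff: "T.cls q = T.cls \<zero>\<^bsub>Q\<^esub> \<longleftrightarrow> q \<in> N'" if "q \<in> carrier Q" for q
    using T.cls_eq_iff[OF that] by (simp add: a_minus_def that)
  have "q \<in> carrier Q \<and> T.cls (S.rep (S.cls q)) = T.cls \<zero>\<^bsub>Q\<^esub> \<longleftrightarrow> q \<in> N'" for q
  proof (cases "q \<in> carrier Q")
    case True
    then show ?thesis using proj_cls[OF True] zero_iff[OF True] by simp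
  next
    case False
    then show ?thesis using T.N_carr[of q] by blast
  qed
  then have "{q \<in> carrier Q. T.cls (S.rep (S.cls q)) = T.cls \<zero>\<^bsub>Q\<^esub>} = N'"
    by simp
  moreover have "{Y \<in> carrier S.quo. T.cls (S.rep Y) = \<zero>\<^bsub>T.quo\<^esub>} =
      S.cls ` {q \<in> carrier Q. T.cls (S.rep (S.cls q)) = T.cls \<zero>\<^bsub>Q\<^esub>}"
    unfolding S.carrier_quo T.zero_quo by blast
  ultimately show ?thesis by simp
qed

end

section \<open>Frobenius extensions of a univariate polynomial ring\<close>

text \<open>A Frobenius extension of \<open>K[x]\<close>, given by its trace form \<open>tau\<close>
  and by the expansion along \<open>e\<close> with coefficients read off through \<open>e'\<close>.
  The expansion yields finite generation, nondegeneracy of \<open>tau\<close>, and a test for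
  divisibility by a polynomial.\<close>

locale frobenius_extension = cring R for R (structure) +
  fixes \<alpha> :: "'k::field poly \<Rightarrow> 'a" and tau :: "'a \<Rightarrow> 'k poly" and B :: "'i set" and e e' :: "'i \<Rightarrow> 'a"
  assumes finB: "finite B"
    and al_closed [simp, intro]: "\<alpha> p \<in> carrier R" and al_one: "\<alpha> 1 = \<one>"
    and al_add: "\<alpha> (p + q) = \<alpha> p \<oplus> \<alpha> q" and al_mult: "\<alpha> (p * q) = \<alpha> p \<otimes> \<alpha> q"
    and tau_add: "\<lbrakk>x \<in> carrier R; y \<in> carrier R\<rbrakk> \<Longrightarrow> tau (x \<oplus> y) = tau x + tau y"
    and tau_scale: "x \<in> carrier R \<Longrightarrow> tau (\<alpha> p \<otimes> x) = p * tau x"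
    and e_closed: "b \<in> B \<Longrightarrow> e b \<in> carrier R" and e'_closed: "b \<in> B \<Longrightarrow> e' b \<in> carrier R"
    and expand: "x \<in> carrier R \<Longrightarrow> x = (\<Oplus>b\<in>B. \<alpha> (tau (x \<otimes> e' b)) \<otimes> e b)"
begin

lemma al_zero: "\<alpha> 0 = \<zero>"
proof -
  have "\<alpha> 0 \<oplus> \<alpha> 0 = \<alpha> 0" using al_add[of 0 0] by simp
  then show ?thesis by (metis add.l_cancel_one' al_closed)
qed

lemma tau_zero: "tau \<zero> = 0"
proof -
  have "tau \<zero> + tau \<zero> = tau \<zero> + 0" using tau_add[of \<zero> \<zero>] by (simp only: zero_closed l_zero add_0_right)
  then show ?thesis by (rule add_left_imp_eq)
qed

lemma tau_uminus: "x \<in> carrier R \<Longrightarrow> tau (\<ominus> x) = - tau x"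
  using tau_add[of x "\<ominus> x"] tau_zero by (simp add: r_neg eq_neg_iff_add_eq_0 add.commute)

lemma tau_minus: "\<lbrakk>x \<in> carrier R; y \<in> carrier R\<rbrakk> \<Longrightarrow> tau (x \<ominus> y) = tau x - tau y"
  by (simp add: a_minus_def tau_add tau_uminus)

lemma tau_finsum:
  assumes "finite C" "\<And>b. b \<in> C \<Longrightarrow> f b \<in> carrier R"
  shows "tau (\<Oplus>b\<in>C. f b) = (\<Sum>b\<in>C. tau (f b))"
  using assms
proof (induction C rule: finite_induct)
  case (insert b C)
  then have "(\<Oplus>j\<in>insert b C. f j) = f b \<oplus> (\<Oplus>j\<in>C. f j)" by (intro finsum_insert) auto
  then show ?case using insert by (simp add: tau_add finsum_closed Pi_def)
qed (simp add: tau_zero)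

text \<open>The coefficients in the expansion of \<open>z\<close> are values of \<open>tau\<close>
  on multiples of \<open>z\<close>, so a common factor \<open>p\<close> can be taken out. For
  \<open>p = 0\<close> this becomes nondegeneracy.\<close>

lemma expand_divisible:
  assumes "z \<in> carrier R" "\<And>y. y \<in> carrier R \<Longrightarrow> p dvd tau (z \<otimes> y)"
  shows "\<exists>n\<in>carrier R. z = \<alpha> p \<otimes> n"
proof -
  have "\<forall>b\<in>B. \<exists>n. tau (z \<otimes> e' b) = p * n" using assms(2) e'_closed by (auto elim!: dvdE)
  then obtain n where n: "\<And>b. b \<in> B \<Longrightarrow> tau (z \<otimes> e' b) = p * n b" by metis
  have c: "(\<Oplus>b\<in>B. \<alpha> (n b) \<otimes> e b) \<in> carrier R" using e_closed by (intro finsum_closed) auto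
  have "z = (\<Oplus>b\<in>B. \<alpha> (tau (z \<otimes> e' b)) \<otimes> e b)" by (rule expand[OF assms(1)])
  also have "\<dots> = (\<Oplus>b\<in>B. \<alpha> p \<otimes> (\<alpha> (n b) \<otimes> e b))"
    by (rule finsum_cong') (use e_closed n in \<open>auto simp: al_mult m_assoc\<close>)
  also have "\<dots> = \<alpha> p \<otimes> (\<Oplus>b\<in>B. \<alpha> (n b) \<otimes> e b)"
    using finsum_rdistr[OF finB al_closed[of p], of "\<lambda>b. \<alpha> (n b) \<otimes> e b"] e_closed by auto
  finally show ?thesis using c by blast
qed

lemma tau_nondegenerate:
  assumes "z \<in> carrier R" "\<And>y. y \<in> carrier R \<Longrightarrow> tau (z \<otimes> y) = 0" shows "z = \<zero>"
  using expand_divisible[OF assms(1), of 0] assms(2) al_zero by auto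

lemma al_nzd:
  assumes "z \<in> carrier R" "\<alpha> p \<otimes> z = \<zero>" "p \<noteq> 0" shows "z = \<zero>"
proof (rule tau_nondegenerate[OF assms(1)])
  fix y assume y: "y \<in> carrier R"
  have "p * tau (z \<otimes> y) = tau ((\<alpha> p \<otimes> z) \<otimes> y)" using y assms(1) by (simp add: tau_scale m_assoc)
  then show "tau (z \<otimes> y) = 0" using assms(2,3) y tau_zero by simp
qed

definition crd where "crd x = (\<lambda>b. if b \<in> B then tau (x \<otimes> e' b) else 0)"

lemma crd_add: "\<lbrakk>x \<in> carrier R; y \<in> carrier R\<rbrakk> \<Longrightarrow> crd (x \<oplus> y) = (\<lambda>b. crd x b + crd y b)"
  by (auto simp: crd_def fun_eq_iff e'_closed l_distr tau_add)

lemma crd_scale: "x \<in> carrier R \<Longrightarrow> crd (\<alpha> p \<otimes> x) = (\<lambda>b. p * crd x b)"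
  by (auto simp: crd_def fun_eq_iff e'_closed m_assoc tau_scale)

lemma crd_inj:
  assumes "x \<in> carrier R" "y \<in> carrier R" "crd x = crd y" shows "x = y"
proof -
  have "tau (x \<otimes> e' b) = tau (y \<otimes> e' b)" if "b \<in> B" for b
    using fun_cong[OF assms(3), of b] that by (simp add: crd_def)
  then have "(\<Oplus>b\<in>B. \<alpha> (tau (x \<otimes> e' b)) \<otimes> e b) = (\<Oplus>b\<in>B. \<alpha> (tau (y \<otimes> e' b)) \<otimes> e b)"
    by (intro finsum_cong') (auto simp: e_closed)
  then show ?thesis using expand[OF assms(1)] expand[OF assms(2)] by simp
qed

lemma poly_submodule_crd:
  assumes "ideal J R" shows "poly_submodule (crd ` J)"
proof -
  interpret J: ideal J R by fact
  have "(\<lambda>_. 0) = crd \<zero>" by (simp add: crd_def fun_eq_iff e'_closed tau_zero)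
  moreover have "(\<lambda>b. crd x b + crd y b) \<in> crd ` J" if "x \<in> J" "y \<in> J" for x y
    using crd_add[OF J.Icarr[OF that(1)] J.Icarr[OF that(2)]] J.a_closed[OF that] by (metis imageI)
  moreover have "(\<lambda>b. p * crd x b) \<in> crd ` J" if "x \<in> J" for x p
    using crd_scale[OF J.Icarr[OF that]] J.I_l_closed[OF that al_closed] by (metis imageI)
  ultimately show ?thesis unfolding poly_submodule_def using J.zero_closed by auto
qed

lemma noetherian_R: "noetherian_ring R"
proof
  fix J assume J: "ideal J R"
  interpret J: ideal J R by fact
  have "\<exists>G. finite G \<and> G \<subseteq> crd ` J \<and> (\<forall>M'. poly_submodule M' \<and> G \<subseteq> M' \<longrightarrow> crd ` J \<subseteq> M')"
    by (rule poly_submodule_finitely_generated[OF finB poly_submodule_crd[OF J]]) (auto simp: crd_def)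
  then obtain G where G: "finite G" "G \<subseteq> crd ` J"
    "\<forall>M'. poly_submodule M' \<and> G \<subseteq> M' \<longrightarrow> crd ` J \<subseteq> M'" by (elim exE conjE)
  obtain S where S: "S \<subseteq> J" "finite S" "G = crd ` S" using finite_subset_image[OF G(1,2)] by blast
  have Sc: "S \<subseteq> carrier R" using S(1) J.Icarr by auto
  have iS: "ideal (Idl S) R" by (rule genideal_ideal[OF Sc])
  have sub: "Idl S \<subseteq> J" by (rule genideal_minimal[OF J S(1)])
  have "G \<subseteq> crd ` (Idl S)" unfolding S(3) using genideal_self[OF Sc] by blast
  then have "crd ` J \<subseteq> crd ` (Idl S)" using G(3) poly_submodule_crd[OF iS] by simp
  have "J \<subseteq> Idl S"
  proof
    fix x assume x: "x \<in> J"
    then have "crd x \<in> crd ` (Idl S)" using \<open>crd ` J \<subseteq> _\<close> by blast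
    then obtain y where y: "crd x = crd y" "y \<in> Idl S" by (rule imageE)
    show "x \<in> Idl S" using crd_inj[OF J.Icarr[OF x] ideal.Icarr[OF iS y(2)] y(1)] y(2) by simp
  qed
  then show "\<exists>A\<subseteq>carrier R. finite A \<and> J = Idl A" using sub Sc S(2) by blast
qed

text \<open>In coordinates \<open>g\<close> extends, modulo \<open>T\<close>, to a linear form with
  coefficients \<open>t b\<close> in the fraction field. Over a common denominator \<open>p\<close>
  this form is the trace form against a single ring element, the combination of the
  \<open>e'\<close> with the numerators as coefficients.\<close>

lemma extend_functional:
  assumes T: "fract_submodule T" and J: "ideal J R"
    and g_add: "\<And>x y. \<lbrakk>x \<in> J; y \<in> J\<rbrakk> \<Longrightarrow> g (x \<oplus> y) - (g x + g y) \<in> T"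
    and g_scale: "\<And>p x. x \<in> J \<Longrightarrow> g (\<alpha> p \<otimes> x) - to_fract p * g x \<in> T"
  shows "\<exists>b\<in>carrier R. \<exists>p. p \<noteq> 0 \<and> (\<forall>x\<in>J. g x - to_fract (tau (x \<otimes> b)) / to_fract p \<in> T)"
proof -
  interpret J: ideal J R by fact
  define h where "h c = g (the_inv_into J crd c)" for c
  have inj: "inj_on crd J" using crd_inj J.Icarr by (auto intro!: inj_onI)
  have h: "h (crd x) = g x" if "x \<in> J" for x using the_inv_into_f_f[OF inj that] by (simp add: h_def)
  have "\<exists>t. \<forall>c\<in>crd ` J. h c - (\<Sum>b\<in>B. to_fract (c b) * t b) \<in> T"
  proof (rule extend_to_divisible[OF T finB poly_submodule_crd[OF J]])
    fix c d assume "c \<in> crd ` J" "d \<in> crd ` J"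
    then obtain x y where x: "x \<in> J" "y \<in> J" "c = crd x" "d = crd y" by auto
    have "(\<lambda>b. c b + d b) = crd (x \<oplus> y)" using x J.Icarr by (simp add: crd_add)
    then have "h (\<lambda>b. c b + d b) = g (x \<oplus> y)" using h[OF J.a_closed[OF x(1,2)]] by simp
    then show "h (\<lambda>b. c b + d b) - (h c + h d) \<in> T"
      using x g_add h by simp
  next
    fix p c assume "c \<in> crd ` J"
    then obtain x where x: "x \<in> J" "c = crd x" by auto
    have "(\<lambda>b. p * c b) = crd (\<alpha> p \<otimes> x)" using x J.Icarr by (simp add: crd_scale)
    then have "h (\<lambda>b. p * c b) = g (\<alpha> p \<otimes> x)" using h[OF J.I_l_closed[OF x(1) al_closed]] by simp
    then show "h (\<lambda>b. p * c b) - to_fract p * h c \<in> T"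
      using x g_scale h by simp
  qed (auto simp: crd_def)
  then obtain t where t: "\<And>x. x \<in> J \<Longrightarrow> g x - (\<Sum>b\<in>B. to_fract (crd x b) * t b) \<in> T" using h by auto
  obtain p n where p: "p \<noteq> 0" "\<forall>b\<in>B. t b = to_fract (n b) / to_fract p"
    using fract_common_denominator[OF finB, of t] by blast
  define b where "b = (\<Oplus>b\<in>B. \<alpha> (n b) \<otimes> e' b)"
  have b: "b \<in> carrier R" unfolding b_def using e'_closed by (intro finsum_closed) auto
  have "g x - to_fract (tau (x \<otimes> b)) / to_fract p \<in> T" if x: "x \<in> J" for x
  proof -
    have xc: "x \<in> carrier R" using x J.Icarr by auto
    have "x \<otimes> b = (\<Oplus>b\<in>B. x \<otimes> (\<alpha> (n b) \<otimes> e' b))" unfolding b_def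
      using finsum_rdistr[OF finB xc, of "\<lambda>b. \<alpha> (n b) \<otimes> e' b"] e'_closed by auto
    also have "tau \<dots> = (\<Sum>b\<in>B. tau (x \<otimes> (\<alpha> (n b) \<otimes> e' b)))"
      by (rule tau_finsum[OF finB]) (use xc e'_closed in auto)
    also have "\<dots> = (\<Sum>b\<in>B. n b * crd x b)"
    proof (rule sum.cong)
      fix b assume "b \<in> B"
      then have "x \<otimes> (\<alpha> (n b) \<otimes> e' b) = \<alpha> (n b) \<otimes> (x \<otimes> e' b)" using xc e'_closed by (simp add: m_lcomm)
      then show "tau (x \<otimes> (\<alpha> (n b) \<otimes> e' b)) = n b * crd x b"
        using \<open>b \<in> B\<close> xc e'_closed by (simp add: tau_scale crd_def)
    qed simp
    finally have 1: "tau (x \<otimes> b) = (\<Sum>b\<in>B. n b * crd x b)" .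
    have ts: "to_fract (\<Sum>b\<in>C. f b) = (\<Sum>b\<in>C. to_fract (f b))" for f :: "'i \<Rightarrow> 'k poly" and C
      by (induction C rule: infinite_finite_induct) auto
    have "to_fract (tau (x \<otimes> b)) / to_fract p = (\<Sum>b\<in>B. to_fract (crd x b) * t b)"
      unfolding 1 ts sum_divide_distrib using p(2) by (intro sum.cong) auto
    then show ?thesis using t[OF x] by simp
  qed
  then show ?thesis using b p(1) by blast
qed

end

lemma (in cring) ideal_criterion:
  assumes "S \<subseteq> carrier R" "\<zero> \<in> S" "\<And>x y. \<lbrakk>x \<in> S; y \<in> S\<rbrakk> \<Longrightarrow> x \<oplus> y \<in> S"
    "\<And>r x. \<lbrakk>r \<in> carrier R; x \<in> S\<rbrakk> \<Longrightarrow> r \<otimes> x \<in> S"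
  shows "ideal S R"
proof (rule idealI)
  show "ring R" by (rule ring_axioms)
  show "subgroup S (add_monoid R)"
  proof (rule add.subgroupI)
    fix x assume x: "x \<in> S"
    then have "\<ominus> \<one> \<otimes> x \<in> S" using assms(4) by simp
    then show "\<ominus> x \<in> S" using x assms(1) by (auto simp: l_minus)
  qed (use assms in auto)
  fix x r assume "x \<in> S" "r \<in> carrier R"
  then show "r \<otimes> x \<in> S" "x \<otimes> r \<in> S" using assms(4)[of r x] m_comm[of r x] assms(1) by auto
qed

text \<open>Makes a choice of denominators uniform: finitely many generators of \<open>J\<close>
  need finitely many denominators, and their product works for all of \<open>J\<close>.\<close>

lemma (in cring) noetherian_uniform:
  assumes "noetherian_ring R" "ideal J R" "mult_closed_subset R D"
    and W: "\<And>d. d \<in> D \<Longrightarrow> ideal (W d) R" "\<And>d d'. \<lbrakk>d \<in> D; d' \<in> D\<rbrakk> \<Longrightarrow> W d \<subseteq> W (d' \<otimes> d)"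
    and J: "\<And>x. x \<in> J \<Longrightarrow> \<exists>d\<in>D. x \<in> W d"
  shows "\<exists>d\<in>D. J \<subseteq> W d"
proof -
  interpret D: mult_closed_subset R D by fact
  obtain S where S: "S \<subseteq> carrier R" "finite S" "J = Idl S"
    using noetherian_ring.finetely_gen[OF assms(1,2)] by auto
  have "S \<subseteq> J" using genideal_self[OF S(1)] S(3) by simp
  with S(2) have "\<exists>d\<in>D. S \<subseteq> W d"
  proof (induction S rule: finite_induct)
    case (insert s S)
    then obtain d where d: "d \<in> D" "S \<subseteq> W d" by auto
    obtain d' where d': "d' \<in> D" "s \<in> W d'" using J insert.prems by blast
    have "insert s S \<subseteq> W (d' \<otimes> d)"
      using W(2)[OF d(1) d'(1)] W(2)[OF d'(1) d(1)] d d' D.U_carr by (auto simp: m_comm)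
    then show ?case using d(1) d'(1) D.U_mult by blast
  qed auto
  then obtain d where "d \<in> D" "S \<subseteq> W d" by blast
  then show ?thesis unfolding S(3) using genideal_minimal[OF W(1)] by blast
qed

section \<open>Localized Frobenius extensions and their injective resolution\<close>

locale frobenius_at = frobenius_extension R \<alpha> tau B e e' + localization_at R \<mm>
  for R (structure) and \<alpha> :: "'k::field poly \<Rightarrow> 'a" and tau and B :: "'i set" and e e' and \<mm>
begin

declare U_carr [simp del, rule del]

text \<open>Denominators outside \<mm> times nonzero polynomials: \<open>Vl.L\<close> is the
  localization at \<mm> in which the nonzero elements of \<open>K[x]\<close> are inverted as
  well.\<close>

definition V where "V = {u \<otimes> \<alpha> p | u p. u \<in> carrier R - \<mm> \<and> p \<noteq> 0}"

lemma V_I: "\<lbrakk>u \<in> carrier R - \<mm>; p \<noteq> 0\<rbrakk> \<Longrightarrow> u \<otimes> \<alpha> p \<in> V" unfolding V_def by blast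

lemma V_E: assumes "v \<in> V" obtains u p where "u \<in> carrier R - \<mm>" "p \<noteq> 0" "v = u \<otimes> \<alpha> p"
  using assms unfolding V_def by blast

lemma U_in_V: "u \<in> carrier R - \<mm> \<Longrightarrow> u \<in> V"
  using V_I[of u 1] by (simp add: al_one)

lemma al_in_V: "p \<noteq> 0 \<Longrightarrow> \<alpha> p \<in> V"
  using V_I[OF U_one, of p] by simp

sublocale Vl: mult_closed_subset R V
proof
  show "V \<subseteq> carrier R" unfolding V_def by auto
  show "\<one> \<in> V" using U_in_V[OF U_one] .
  fix v w assume "v \<in> V" "w \<in> V"
  then obtain u p u' p' where 1: "u \<in> carrier R - \<mm>" "p \<noteq> 0" "v = u \<otimes> \<alpha> p" "u' \<in> carrier R - \<mm>" "p' \<noteq> 0" "w = u' \<otimes> \<alpha> p'"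
    by (metis V_E)
  have "v \<otimes> w = (u \<otimes> u') \<otimes> \<alpha> (p * p')" using 1 by (simp add: al_mult m_ac)
  then show "v \<otimes> w \<in> V" using V_I[OF U_mult[OF 1(1,4)], of "p * p'"] 1 by simp
qed

definition iota where "iota x = (THE q. \<exists>a\<in>carrier R. \<exists>u\<in>carrier R - \<mm>. x = fr a u \<and> q = Vl.fr a u)"

lemma fr_eq_imp:
  assumes "a \<in> carrier R" "u \<in> carrier R - \<mm>" "b \<in> carrier R" "v \<in> carrier R - \<mm>" "fr a u = fr b v"
  shows "Vl.fr a u = Vl.fr b v"
  using assms U_in_V fr_eq_iff[of a u b v] Vl.fr_eq_iff[of a u b v] by blast

lemma iota_fr:
  assumes "a \<in> carrier R" "u \<in> carrier R - \<mm>" shows "iota (fr a u) = Vl.fr a u"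
  unfolding iota_def by (rule the_equality) (use assms fr_eq_imp in blast)+

lemma iota_hom: "iota \<in> ring_hom L Vl.L"
proof (rule ring_hom_memI)
  fix x y assume x: "x \<in> carrier L" and y: "y \<in> carrier L"
  obtain a u where 1: "a \<in> carrier R" "u \<in> carrier R - \<mm>" "x = fr a u" using x by (rule carrE)
  obtain b v where 2: "b \<in> carrier R" "v \<in> carrier R - \<mm>" "y = fr b v" using y by (rule carrE)
  show "iota x \<in> carrier Vl.L" unfolding 1(3) iota_fr[OF 1(1,2)] using 1 U_in_V by (intro Vl.fr_closed)
  have uv: "u \<otimes> v \<in> carrier R - \<mm>" by (rule U_mult[OF 1(2) 2(2)])
  show "iota (x \<otimes>\<^bsub>L\<^esub> y) = iota x \<otimes>\<^bsub>Vl.L\<^esub> iota y" unfolding 1(3) 2(3)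
    using 1(1,2) 2(1,2) U_in_V by (subst mult_L) (simp_all add: iota_fr Vl.mult_L uv del: Diff_iff)
  show "iota (x \<oplus>\<^bsub>L\<^esub> y) = iota x \<oplus>\<^bsub>Vl.L\<^esub> iota y" unfolding 1(3) 2(3)
    using 1(1,2) 2(1,2) U_in_V by (subst add_L) (simp_all add: iota_fr Vl.add_L uv del: Diff_iff)
next
  show "iota \<one>\<^bsub>L\<^esub> = \<one>\<^bsub>Vl.L\<^esub>" unfolding one_L Vl.one_L by (rule iota_fr[OF one_closed U_one])
qed

end

text \<open>\<open>M\<close> and \<open>T\<close> are instantiated with \<open>0, 0\<close> and with \<open>R, K[x]\<close>, so that the quotient is the
  total localization \<open>Q\<close> and \<open>Q/R\<^sub>\<mm>\<close>.\<close>
locale frobenius_at_quotient = frobenius_at +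
  fixes M T
  assumes M: "ideal M R" and T: "fract_submodule T"
    and MT: "\<And>n. n \<in> M \<Longrightarrow> to_fract (tau n) \<in> T"
    and TM: "\<And>z p. \<lbrakk>z \<in> carrier R; p \<noteq> 0; \<And>y. y \<in> carrier R \<Longrightarrow> to_fract (tau (z \<otimes> y)) / to_fract p \<in> T\<rbrakk>
         \<Longrightarrow> \<exists>n\<in>M. z = \<alpha> p \<otimes> n"
begin

sublocale M: ideal M R by (rule M)

definition "N = {Vl.fr n u | n u. n \<in> M \<and> u \<in> carrier R - \<mm>}"

lemma N_I: "\<lbrakk>n \<in> M; u \<in> carrier R - \<mm>\<rbrakk> \<Longrightarrow> Vl.fr n u \<in> N" unfolding N_def by blast

lemma N_E: assumes "x \<in> N" obtains n u where "n \<in> M" "u \<in> carrier R - \<mm>" "x = Vl.fr n u"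
  using assms unfolding N_def by blast

sublocale labelled_quotient L Vl.L iota N
proof (intro labelled_quotient.intro labelled_quotient_axioms.intro)
  show "cring L" by (rule cring_L)
  show "cring Vl.L" by (rule Vl.cring_L)
  show "iota \<in> ring_hom L Vl.L" by (rule iota_hom)
  interpret VL: cring Vl.L by (rule Vl.cring_L)
  show "additive_subgroup N Vl.L"
  proof (intro additive_subgroup.intro VL.add.subgroupI)
    show "N \<subseteq> carrier Vl.L"
      by (rule subsetI, erule N_E) (simp only: Vl.fr_closed[OF M.Icarr U_in_V])
    show "N \<noteq> {}" using N_I[OF M.zero_closed U_one] by blast
    fix x assume "x \<in> N"
    then obtain n u where 1: "n \<in> M" "u \<in> carrier R - \<mm>" "x = Vl.fr n u" by (rule N_E)
    show "\<ominus>\<^bsub>Vl.L\<^esub> x \<in> N" unfolding 1(3) Vl.uminus_L[OF M.Icarr[OF 1(1)] U_in_V[OF 1(2)]]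
      by (rule N_I[OF M.a_inv_closed[OF 1(1)] 1(2)])
    fix y assume "y \<in> N"
    then obtain n' u' where 2: "n' \<in> M" "u' \<in> carrier R - \<mm>" "y = Vl.fr n' u'" by (rule N_E)
    have "n \<otimes> u' \<oplus> n' \<otimes> u \<in> M" using 1 2 by (intro M.a_closed M.I_r_closed) auto
    then show "x \<oplus>\<^bsub>Vl.L\<^esub> y \<in> N"
      unfolding 1(3) 2(3) Vl.add_L[OF M.Icarr[OF 1(1)] U_in_V[OF 1(2)] M.Icarr[OF 2(1)] U_in_V[OF 2(2)]]
      by (rule N_I[OF _ U_mult[OF 1(2) 2(2)]])
  qed
next
  fix a n assume a: "a \<in> carrier L" and n: "n \<in> N"
  obtain b u where 1: "b \<in> carrier R" "u \<in> carrier R - \<mm>" "a = fr b u" using a by (rule carrE)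
  obtain m w where 2: "m \<in> M" "w \<in> carrier R - \<mm>" "n = Vl.fr m w" using n by (rule N_E)
  show "iota a \<otimes>\<^bsub>Vl.L\<^esub> n \<in> N"
    unfolding 1(3) 2(3) iota_fr[OF 1(1,2)] Vl.mult_L[OF 1(1) U_in_V[OF 1(2)] M.Icarr[OF 2(1)] U_in_V[OF 2(2)]]
    by (rule N_I[OF M.I_l_closed[OF 2(1) 1(1)] U_mult[OF 1(2) 2(2)]])
qed

text \<open>A homomorphism on an ideal of the local ring is brought to one denominator and composed
  with \<open>tau\<close>, becoming a functional with values modulo \<open>T\<close>. There
  \<open>extend_functional\<close> represents it by a ring element, and \<open>TM\<close> reads the
  result back in the ring.\<close>

lemma baer_quo: "baer L quo"
  unfolding baer_def
proof (intro allI impI, elim conjE)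
  fix J' f assume J': "ideal J' L" and lin: "linear_on L quo J' f"
  interpret J': ideal J' L by fact
  have f_closed: "\<And>y. y \<in> J' \<Longrightarrow> f y \<in> carrier quo"
    and f_add: "\<And>y z. \<lbrakk>y \<in> J'; z \<in> J'\<rbrakk> \<Longrightarrow> f (y \<oplus>\<^bsub>L\<^esub> z) = f y \<oplus>\<^bsub>quo\<^esub> f z"
    and f_mult: "\<And>a y. \<lbrakk>a \<in> carrier L; y \<in> J'\<rbrakk> \<Longrightarrow> f (a \<otimes>\<^bsub>L\<^esub> y) = a \<odot>\<^bsub>quo\<^esub> f y"
    using lin unfolding linear_on_def by auto
  define F where "F x = f (fr x \<one>)" for x
  define J where "J = {a \<in> carrier R. fr a \<one> \<in> J'}"
  have J: "ideal J R" unfolding J_def by (rule ideal_contraction[OF J'])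
  interpret J: ideal J R by fact
  have JD: "x \<in> carrier R" "fr x \<one> \<in> J'" if "x \<in> J" for x using that unfolding J_def by auto
  have F_add: "F (x \<oplus> y) = F x \<oplus>\<^bsub>quo\<^esub> F y" if "x \<in> J" "y \<in> J" for x y
    using f_add[OF JD(2)[OF that(1)] JD(2)[OF that(2)]]
    unfolding F_def add_same_L[OF JD(1)[OF that(1)] U_one JD(1)[OF that(2)]] .
  have F_mult: "F (r \<otimes> x) = fr r \<one> \<odot>\<^bsub>quo\<^esub> F x" if "r \<in> carrier R" "x \<in> J" for r x
    unfolding F_def using f_mult[OF fr_closed[OF that(1) U_one] JD(2)[OF that(2)]] JD(1) that U_one
    by (simp add: mult_L del: Diff_iff)
  have F_closed: "F x \<in> carrier quo" if "x \<in> J" for x unfolding F_def using f_closed JD that by blast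
  have VLc: "Vl.fr b d \<in> carrier Vl.L" if "b \<in> carrier R" "d \<in> V" for b d using that by (rule Vl.fr_closed)

  \<comment> \<open>Elements whose image under \<open>F\<close> has a representative with
    denominator \<open>d\<close>. These ideals grow when \<open>d\<close> is multiplied up, which
    makes one denominator possible for all of \<open>J\<close>.\<close>
  define C where "C d = {x \<in> J. \<exists>b\<in>carrier R. F x = cls (Vl.fr b d)}" for d
  have smul_cls: "fr r \<one> \<odot>\<^bsub>quo\<^esub> cls (Vl.fr b d) = cls (Vl.fr (r \<otimes> b) d)"
    if "r \<in> carrier R" "b \<in> carrier R" "d \<in> V" for r b d
    using that by (simp add: smult_quo[OF fr_closed[OF that(1) U_one] VLc[OF that(2,3)]] iota_fr[OF that(1) U_one] Vl.mult_L)
  have add_cls: "cls (Vl.fr b d) \<oplus>\<^bsub>quo\<^esub> cls (Vl.fr c d) = cls (Vl.fr (b \<oplus> c) d)"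
    if "b \<in> carrier R" "c \<in> carrier R" "d \<in> V" for b c d
    using that by (simp add: add_quo[OF VLc[OF that(1,3)] VLc[OF that(2,3)]] Vl.add_same_L)
  have C_ideal: "ideal (C d) R" if d: "d \<in> V" for d
  proof (rule ideal_criterion)
    show "C d \<subseteq> carrier R" unfolding C_def using JD by auto
    have "F \<zero> = fr \<zero> \<one> \<odot>\<^bsub>quo\<^esub> F \<zero>" using F_mult[OF zero_closed J.zero_closed] by simp
    also obtain q where q: "q \<in> carrier Vl.L" "F \<zero> = cls q" using F_closed[OF J.zero_closed] by (rule quoE)
    have "fr \<zero> \<one> \<odot>\<^bsub>quo\<^esub> F \<zero> = \<zero>\<^bsub>quo\<^esub>" using module.smult_l_null[OF module_quo F_closed[OF J.zero_closed]]
      by (simp add: zero_L)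
    also have "\<dots> = cls (Vl.fr \<zero> d)"
      using Vl.fr_zero_iff[OF zero_closed d] Vl.U_one by (metis r_null Vl.U_carr zero_quo)
    finally show "\<zero> \<in> C d" unfolding C_def using J.zero_closed by blast
  next
    fix x y assume "x \<in> C d" "y \<in> C d"
    then obtain b c where 1: "x \<in> J" "b \<in> carrier R" "F x = cls (Vl.fr b d)" "y \<in> J" "c \<in> carrier R" "F y = cls (Vl.fr c d)"
      unfolding C_def by blast
    have "F (x \<oplus> y) = cls (Vl.fr (b \<oplus> c) d)" unfolding F_add[OF 1(1,4)] 1(3) 1(6) by (rule add_cls[OF 1(2,5) d])
    then show "x \<oplus> y \<in> C d" unfolding C_def using J.a_closed[OF 1(1,4)] a_closed[OF 1(2,5)] by blast
  next
    fix r x assume r: "r \<in> carrier R" "x \<in> C d"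
    then obtain b where 1: "x \<in> J" "b \<in> carrier R" "F x = cls (Vl.fr b d)" unfolding C_def by blast
    have "F (r \<otimes> x) = cls (Vl.fr (r \<otimes> b) d)" unfolding F_mult[OF r(1) 1(1)] 1(3) by (rule smul_cls[OF r(1) 1(2) d])
    then show "r \<otimes> x \<in> C d" unfolding C_def using J.I_l_closed[OF 1(1) r(1)] m_closed[OF r(1) 1(2)] by blast
  qed
  have "\<exists>d\<in>V. J \<subseteq> C d"
  proof (rule noetherian_uniform[OF noetherian_R J Vl.mult_closed_subset_axioms C_ideal])
    fix d d' assume d: "d \<in> V" "d' \<in> V"
    show "C d \<subseteq> C (d' \<otimes> d)"
    proof
      fix x assume "x \<in> C d"
      then obtain b where 1: "x \<in> J" "b \<in> carrier R" "F x = cls (Vl.fr b d)" unfolding C_def by blast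
      then have "F x = cls (Vl.fr (d' \<otimes> b) (d' \<otimes> d))" using Vl.fr_cancel[OF 1(2) d] by simp
      then show "x \<in> C (d' \<otimes> d)" unfolding C_def using 1(1) m_closed[OF Vl.U_carr[OF d(2)] 1(2)] by blast
    qed
  next
    fix x assume x: "x \<in> J"
    obtain q where q: "q \<in> carrier Vl.L" "F x = cls q" using F_closed[OF x] by (rule quoE)
    obtain b d where "b \<in> carrier R" "d \<in> V" "q = Vl.fr b d" using q(1) by (rule Vl.carrE)
    then show "\<exists>d\<in>V. x \<in> C d" unfolding C_def using x q(2) by blast
  qed
  then obtain d where d: "d \<in> V" "J \<subseteq> C d" by blast
  obtain u0 p0 where u0: "u0 \<in> carrier R - \<mm>" "p0 \<noteq> 0" "d = u0 \<otimes> \<alpha> p0" using d(1) by (rule V_E)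
  have "\<forall>x\<in>J. \<exists>b. b \<in> carrier R \<and> F x = cls (Vl.fr b d)" using d(2) unfolding C_def by blast
  then obtain bb where bb: "\<And>x. x \<in> J \<Longrightarrow> bb x \<in> carrier R" "\<And>x. x \<in> J \<Longrightarrow> F x = cls (Vl.fr (bb x) d)" by metis
  \<comment> \<open>The chosen numerators \<open>bb x\<close> are additive and linear only up to
    \<open>M0\<close>, the numerators over \<open>d\<close> of elements of \<open>N\<close>.\<close>
  define M0 where "M0 = {c \<in> carrier R. Vl.fr c d \<in> N}"
  have M0_diff: "b \<ominus> c \<in> M0" if "b \<in> carrier R" "c \<in> carrier R" "cls (Vl.fr b d) = cls (Vl.fr c d)" for b c
    using that cls_eq_iff[OF VLc[OF that(1) d(1)] VLc[OF that(2) d(1)]] d(1)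
    unfolding M0_def by (simp add: Vl.minus_same_L)
  have M0_ideal: "ideal M0 R"
  proof (rule ideal_criterion)
    show "M0 \<subseteq> carrier R" unfolding M0_def by auto
    have "Vl.fr \<zero> d = Vl.fr \<zero> \<one>" using d(1) by (intro Vl.fr_eqI) auto
    then show "\<zero> \<in> M0" unfolding M0_def using N_I[OF M.zero_closed U_one] by simp
  next
    fix x y assume "x \<in> M0" "y \<in> M0"
    then show "x \<oplus> y \<in> M0" using N.a_closed[of "Vl.fr x d" "Vl.fr y d"] d(1) unfolding M0_def by (simp add: Vl.add_same_L)
  next
    fix r x assume "r \<in> carrier R" "x \<in> M0"
    then show "r \<otimes> x \<in> M0" using N_smult[OF fr_closed[OF _ U_one], of r "Vl.fr x d"] iota_fr[OF _ U_one, of r] d(1)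
      unfolding M0_def by (simp add: Vl.mult_L)
  qed
  \<comment> \<open>A second uniform choice: one \<open>v\<close> outside \<mm> moves all of
    \<open>M0\<close> into the multiples of \<open>\<alpha> p0\<close> by elements of
    \<open>M\<close>. Hence \<open>tau (v \<otimes> c) / p0\<close> lies in \<open>T\<close> for
    \<open>c\<close> in \<open>M0\<close>.\<close>
  define W where "W v = {c \<in> carrier R. \<exists>n\<in>M. v \<otimes> c = \<alpha> p0 \<otimes> n}" for v
  have "\<exists>v\<in>carrier R - \<mm>. M0 \<subseteq> W v"
  proof (rule noetherian_uniform[OF noetherian_R M0_ideal mult_closed_subset_axioms])
    fix v assume v: "v \<in> carrier R - \<mm>"
    then have vc: "v \<in> carrier R" by simp
    show "ideal (W v) R"
    proof (rule ideal_criterion)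
      show "W v \<subseteq> carrier R" unfolding W_def by auto
      show "\<zero> \<in> W v" unfolding W_def using vc M.zero_closed by (auto intro!: bexI[of _ \<zero>])
    next
      fix x y assume "x \<in> W v" "y \<in> W v"
      then obtain n m where 1: "x \<in> carrier R" "y \<in> carrier R" "n \<in> M" "m \<in> M" "v \<otimes> x = \<alpha> p0 \<otimes> n" "v \<otimes> y = \<alpha> p0 \<otimes> m"
        unfolding W_def by blast
      have "v \<otimes> (x \<oplus> y) = \<alpha> p0 \<otimes> (n \<oplus> m)" using 1 vc M.Icarr by (simp add: r_distr)
      then show "x \<oplus> y \<in> W v" unfolding W_def using 1 M.a_closed by blast
    next
      fix r x assume r: "r \<in> carrier R" "x \<in> W v"
      then obtain n where 1: "x \<in> carrier R" "n \<in> M" "v \<otimes> x = \<alpha> p0 \<otimes> n"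
        unfolding W_def by blast
      have "v \<otimes> (r \<otimes> x) = r \<otimes> (v \<otimes> x)" using 1 r vc by (simp add: m_lcomm)
      also have "\<dots> = \<alpha> p0 \<otimes> (r \<otimes> n)" unfolding 1(3) using M.Icarr[OF 1(2)] r by (simp add: m_lcomm)
      finally show "r \<otimes> x \<in> W v" unfolding W_def using 1 r M.I_l_closed by blast
    qed
    fix v' assume v': "v' \<in> carrier R - \<mm>"
    show "W v \<subseteq> W (v' \<otimes> v)"
    proof
      fix x assume "x \<in> W v"
      then obtain n where 1: "x \<in> carrier R" "n \<in> M" "v \<otimes> x = \<alpha> p0 \<otimes> n"
        unfolding W_def by blast
      have "(v' \<otimes> v) \<otimes> x = v' \<otimes> (v \<otimes> x)" using 1 v' vc by (simp add: m_assoc)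
      also have "\<dots> = \<alpha> p0 \<otimes> (v' \<otimes> n)" unfolding 1(3) using M.Icarr[OF 1(2)] v' by (simp add: m_lcomm)
      finally show "x \<in> W (v' \<otimes> v)" unfolding W_def using 1 v' M.I_l_closed by blast
    qed
  next
    fix c assume "c \<in> M0"
    then have c: "c \<in> carrier R" "Vl.fr c d \<in> N" unfolding M0_def by auto
    obtain n w where n: "n \<in> M" "w \<in> carrier R - \<mm>" "Vl.fr c d = Vl.fr n w" using c(2) by (rule N_E)
    have nc: "n \<in> carrier R" using M.Icarr n by auto
    obtain z where z: "z \<in> V" "z \<otimes> (c \<otimes> w) = z \<otimes> (n \<otimes> d)"
      using n Vl.fr_eq_iff[OF c(1) d(1) nc U_in_V[OF n(2)]] by blast
    obtain u1 p1 where u1: "u1 \<in> carrier R - \<mm>" "p1 \<noteq> 0" "z = u1 \<otimes> \<alpha> p1" using z(1) by (rule V_E)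
    have cc: "u1 \<in> carrier R" "w \<in> carrier R" "u0 \<in> carrier R" using u1 n u0 by auto
    have "\<alpha> p1 \<otimes> ((u1 \<otimes> w) \<otimes> c \<ominus> \<alpha> p0 \<otimes> (u1 \<otimes> u0 \<otimes> n)) = z \<otimes> (c \<otimes> w) \<ominus> z \<otimes> (n \<otimes> d)"
      unfolding u1(3) u0(3) using cc c(1) nc al_closed[of p1] al_closed[of p0] by algebra
    also have "\<dots> = \<zero>" unfolding z(2) using Vl.U_carr[OF z(1)] Vl.U_carr[OF d(1)] nc by (simp add: a_minus_def r_neg)
    finally have *: "\<alpha> p1 \<otimes> ((u1 \<otimes> w) \<otimes> c \<ominus> \<alpha> p0 \<otimes> (u1 \<otimes> u0 \<otimes> n)) = \<zero>" .
    have cl: "(u1 \<otimes> w) \<otimes> c \<in> carrier R" "\<alpha> p0 \<otimes> (u1 \<otimes> u0 \<otimes> n) \<in> carrier R" using cc c(1) nc by simp_all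
    have "(u1 \<otimes> w) \<otimes> c = \<alpha> p0 \<otimes> (u1 \<otimes> u0 \<otimes> n)"
      using al_nzd[OF minus_closed[OF cl] * u1(2)] unfolding minus_eq_zero_iff[OF cl] .
    moreover have "u1 \<otimes> u0 \<otimes> n \<in> M" using n(1) cc by (intro M.I_l_closed) auto
    ultimately have "c \<in> W (u1 \<otimes> w)" unfolding W_def using c(1) by blast
    then show "\<exists>v\<in>carrier R - \<mm>. c \<in> W v" using U_mult[OF u1(1) n(2)] by blast
  qed
  then obtain v where v: "v \<in> carrier R - \<mm>" "M0 \<subseteq> W v" by blast
  have vc: "v \<in> carrier R" and u0c: "u0 \<in> carrier R" using v(1) u0(1) by auto

  have t1: "to_fract (tau (v \<otimes> c)) / to_fract p0 \<in> T" if "c \<in> M0" for c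
  proof -
    have "c \<in> W v" using v(2) that by (rule subsetD)
    then obtain n where n: "n \<in> M" "v \<otimes> c = \<alpha> p0 \<otimes> n" unfolding W_def by (elim CollectE conjE bexE)
    have "tau (v \<otimes> c) = p0 * tau n" unfolding n(2) by (rule tau_scale[OF M.Icarr[OF n(1)]])
    then show ?thesis using MT[OF n(1)] u0(2) by simp
  qed
  have M0_mult: "bb (r \<otimes> x) \<ominus> r \<otimes> bb x \<in> M0" if "r \<in> carrier R" "x \<in> J" for r x
  proof (rule M0_diff)
    have "cls (Vl.fr (bb (r \<otimes> x)) d) = F (r \<otimes> x)" using bb(2)[OF J.I_l_closed[OF that(2,1)]] by simp
    also have "\<dots> = cls (Vl.fr (r \<otimes> bb x) d)" unfolding F_mult[OF that] bb(2)[OF that(2)]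
      by (rule smul_cls[OF that(1) bb(1)[OF that(2)] d(1)])
    finally show "cls (Vl.fr (bb (r \<otimes> x)) d) = cls (Vl.fr (r \<otimes> bb x) d)" .
  qed (use bb(1)[OF that(2)] bb(1)[OF J.I_l_closed[OF that(2,1)]] that in simp_all)
  define g where "g x = to_fract (tau (v \<otimes> bb x)) / to_fract p0" for x
  have "\<exists>b\<in>carrier R. \<exists>p. p \<noteq> 0 \<and> (\<forall>x\<in>J. g x - to_fract (tau (x \<otimes> b)) / to_fract p \<in> T)"
  proof (rule extend_functional[OF T J])
    fix x y assume xy: "x \<in> J" "y \<in> J"
    note c = bb(1)[OF xy(1)] bb(1)[OF xy(2)] bb(1)[OF J.a_closed[OF xy]]
    have "bb (x \<oplus> y) \<ominus> (bb x \<oplus> bb y) \<in> M0"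
    proof (rule M0_diff)
      have "cls (Vl.fr (bb (x \<oplus> y)) d) = F (x \<oplus> y)" using bb(2)[OF J.a_closed[OF xy]] by simp
      also have "\<dots> = cls (Vl.fr (bb x \<oplus> bb y) d)" unfolding F_add[OF xy] bb(2)[OF xy(1)] bb(2)[OF xy(2)]
        by (rule add_cls[OF c(1,2) d(1)])
      finally show "cls (Vl.fr (bb (x \<oplus> y)) d) = cls (Vl.fr (bb x \<oplus> bb y) d)" .
    qed (use c in simp_all)
    note m = t1[OF this]
    have eq: "v \<otimes> (bb (x \<oplus> y) \<ominus> (bb x \<oplus> bb y)) = v \<otimes> bb (x \<oplus> y) \<ominus> (v \<otimes> bb x \<oplus> v \<otimes> bb y)"
      using c vc by algebra
    have "tau (v \<otimes> bb (x \<oplus> y) \<ominus> (v \<otimes> bb x \<oplus> v \<otimes> bb y)) = tau (v \<otimes> bb (x \<oplus> y)) - (tau (v \<otimes> bb x) + tau (v \<otimes> bb y))"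
      using c vc by (simp add: tau_minus tau_add)
    with m have "to_fract (tau (v \<otimes> bb (x \<oplus> y)) - (tau (v \<otimes> bb x) + tau (v \<otimes> bb y))) / to_fract p0 \<in> T"
      unfolding eq by simp
    then show "g (x \<oplus> y) - (g x + g y) \<in> T" unfolding g_def by (simp add: diff_divide_distrib add_divide_distrib)
  next
    fix p x assume x: "x \<in> J"
    note c = bb(1)[OF x] bb(1)[OF J.I_l_closed[OF x al_closed]]
    have eq: "v \<otimes> (bb (\<alpha> p \<otimes> x) \<ominus> \<alpha> p \<otimes> bb x) = v \<otimes> bb (\<alpha> p \<otimes> x) \<ominus> \<alpha> p \<otimes> (v \<otimes> bb x)"
      using c vc al_closed[of p] by algebra
    have c1: "v \<otimes> bb (\<alpha> p \<otimes> x) \<in> carrier R" and c2: "v \<otimes> bb x \<in> carrier R" using c vc by simp_all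
    have "tau (v \<otimes> bb (\<alpha> p \<otimes> x) \<ominus> \<alpha> p \<otimes> (v \<otimes> bb x)) = tau (v \<otimes> bb (\<alpha> p \<otimes> x)) - p * tau (v \<otimes> bb x)"
      unfolding tau_minus[OF c1 m_closed[OF al_closed c2]] tau_scale[OF c2] ..
    then have "to_fract (tau (v \<otimes> bb (\<alpha> p \<otimes> x)) - p * tau (v \<otimes> bb x)) / to_fract p0 \<in> T"
      using t1[OF M0_mult[OF al_closed x, of p]] unfolding eq by simp
    then show "g (\<alpha> p \<otimes> x) - to_fract p * g x \<in> T" unfolding g_def by (simp add: diff_divide_distrib)
  qed
  then obtain b p' where b: "b \<in> carrier R" "p' \<noteq> 0" "\<And>x. x \<in> J \<Longrightarrow> g x - to_fract (tau (x \<otimes> b)) / to_fract p' \<in> T"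
    by blast
  \<comment> \<open>Testing against all \<open>y\<close> turns the congruence modulo
    \<open>T\<close> back into a divisibility in the ring.\<close>
  have key: "\<exists>n\<in>M. \<alpha> p' \<otimes> (v \<otimes> bb x) \<ominus> \<alpha> p0 \<otimes> (x \<otimes> b) = \<alpha> (p0 * p') \<otimes> n" if x: "x \<in> J" for x
  proof (rule TM)
    have xc: "x \<in> carrier R" and bc: "bb x \<in> carrier R" using JD(1) bb(1) x by auto
    show "\<alpha> p' \<otimes> (v \<otimes> bb x) \<ominus> \<alpha> p0 \<otimes> (x \<otimes> b) \<in> carrier R" using xc bc vc b(1) by simp
    show "p0 * p' \<noteq> 0" using u0(2) b(2) by simp
    fix y assume y: "y \<in> carrier R"
    have yx: "y \<otimes> x \<in> J" by (rule J.I_l_closed[OF x y])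
    note yxb = bb(1)[OF yx]
    have eq1: "(\<alpha> p' \<otimes> (v \<otimes> bb x) \<ominus> \<alpha> p0 \<otimes> (x \<otimes> b)) \<otimes> y = \<alpha> p' \<otimes> (v \<otimes> (y \<otimes> bb x)) \<ominus> \<alpha> p0 \<otimes> ((y \<otimes> x) \<otimes> b)"
      using xc bc vc b(1) y al_closed[of p'] al_closed[of p0] by algebra
    have c1: "v \<otimes> (y \<otimes> bb x) \<in> carrier R" and c2: "(y \<otimes> x) \<otimes> b \<in> carrier R"
      and c3: "v \<otimes> bb (y \<otimes> x) \<in> carrier R"
      using xc bc vc b(1) y yxb by simp_all
    have 1: "tau ((\<alpha> p' \<otimes> (v \<otimes> bb x) \<ominus> \<alpha> p0 \<otimes> (x \<otimes> b)) \<otimes> y) = p' * tau (v \<otimes> (y \<otimes> bb x)) - p0 * tau ((y \<otimes> x) \<otimes> b)"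
      unfolding eq1 tau_minus[OF m_closed[OF al_closed c1] m_closed[OF al_closed c2]] tau_scale[OF c1] tau_scale[OF c2] ..
    have eq2: "v \<otimes> (bb (y \<otimes> x) \<ominus> y \<otimes> bb x) = v \<otimes> bb (y \<otimes> x) \<ominus> v \<otimes> (y \<otimes> bb x)"
      using xc bc vc y yxb by algebra
    have "tau (v \<otimes> (bb (y \<otimes> x) \<ominus> y \<otimes> bb x)) = tau (v \<otimes> bb (y \<otimes> x)) - tau (v \<otimes> (y \<otimes> bb x))"
      unfolding eq2 by (rule tau_minus[OF c3 c1])
    then have 2: "g (y \<otimes> x) - to_fract (tau (v \<otimes> (y \<otimes> bb x))) / to_fract p0 \<in> T"
      using t1[OF M0_mult[OF y x]] unfolding g_def by (simp add: diff_divide_distrib)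
    have "to_fract (tau ((\<alpha> p' \<otimes> (v \<otimes> bb x) \<ominus> \<alpha> p0 \<otimes> (x \<otimes> b)) \<otimes> y)) / to_fract (p0 * p')
      = to_fract (tau (v \<otimes> (y \<otimes> bb x))) / to_fract p0 - to_fract (tau ((y \<otimes> x) \<otimes> b)) / to_fract p'"
      unfolding 1 using u0(2) b(2) by (simp add: diff_divide_distrib)
    also have "\<dots> = (g (y \<otimes> x) - to_fract (tau ((y \<otimes> x) \<otimes> b)) / to_fract p') - (g (y \<otimes> x) - to_fract (tau (v \<otimes> (y \<otimes> bb x))) / to_fract p0)"
      by simp
    also have "\<dots> \<in> T" by (rule fract_submoduleD(5)[OF T b(3)[OF yx] 2])
    finally show "to_fract (tau ((\<alpha> p' \<otimes> (v \<otimes> bb x) \<ominus> \<alpha> p0 \<otimes> (x \<otimes> b)) \<otimes> y)) / to_fract (p0 * p') \<in> T" .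
  qed
  \<comment> \<open>Up to \<open>N\<close>, the fraction \<open>bb x / (u0 \<alpha> p0)\<close>
    equals \<open>x b / (u0 v \<alpha> p')\<close> by \<open>key\<close>; so multiplication by this
    \<open>q\<close> represents \<open>F\<close>.\<close>
  define q where "q = Vl.fr b ((u0 \<otimes> v) \<otimes> \<alpha> p')"
  have uv: "u0 \<otimes> v \<in> carrier R - \<mm>" by (rule U_mult[OF u0(1) v(1)])
  have qV: "(u0 \<otimes> v) \<otimes> \<alpha> p' \<in> V" by (rule V_I[OF uv b(2)])
  have qc: "q \<in> carrier Vl.L" unfolding q_def by (rule Vl.fr_closed[OF b(1) qV])
  have Fq: "F x = cls (Vl.fr x \<one> \<otimes>\<^bsub>Vl.L\<^esub> q)" if x: "x \<in> J" for x
  proof -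
    have xc: "x \<in> carrier R" and bc: "bb x \<in> carrier R" using JD(1) bb(1) x by auto
    obtain n where n: "n \<in> M" "\<alpha> p' \<otimes> (v \<otimes> bb x) \<ominus> \<alpha> p0 \<otimes> (x \<otimes> b) = \<alpha> (p0 * p') \<otimes> n" using key[OF x] by blast
    have xq: "Vl.fr x \<one> \<otimes>\<^bsub>Vl.L\<^esub> q = Vl.fr (x \<otimes> b) ((u0 \<otimes> v) \<otimes> \<alpha> p')"
      unfolding q_def using xc b(1) qV Vl.U_carr[OF qV] by (simp add: Vl.mult_L)
    define D where "D = \<alpha> (p0 * p') \<otimes> (u0 \<otimes> v)"
    have DV: "D \<in> V" unfolding D_def using V_I[OF uv, of "p0 * p'"] u0(2) b(2) uv by (simp add: m_comm)
    have 1: "Vl.fr (bb x) d = Vl.fr (\<alpha> p' \<otimes> (v \<otimes> bb x)) D"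
      by (rule Vl.fr_eqI) (use bc d(1) DV vc u0c in \<open>simp_all add: u0(3) D_def al_mult m_ac\<close>)
    have 2: "Vl.fr (x \<otimes> b) ((u0 \<otimes> v) \<otimes> \<alpha> p') = Vl.fr (\<alpha> p0 \<otimes> (x \<otimes> b)) D"
      by (rule Vl.fr_eqI) (use xc b(1) qV DV vc u0c in \<open>simp_all add: D_def al_mult m_ac\<close>)
    have "Vl.fr (bb x) d \<ominus>\<^bsub>Vl.L\<^esub> Vl.fr x \<one> \<otimes>\<^bsub>Vl.L\<^esub> q = Vl.fr (\<alpha> (p0 * p') \<otimes> n) D"
      unfolding xq 1 2 n(2)[symmetric] using bc vc xc b(1) DV by (intro Vl.minus_same_L) simp_all
    also have "\<dots> = Vl.fr n (u0 \<otimes> v)" unfolding D_def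
      using M.Icarr[OF n(1)] uv u0(2) b(2) by (intro Vl.fr_cancel U_in_V al_in_V) simp_all
    also have "\<dots> \<in> N" by (rule N_I[OF n(1) uv])
    finally have "cls (Vl.fr (bb x) d) = cls (Vl.fr x \<one> \<otimes>\<^bsub>Vl.L\<^esub> q)"
      using cls_eq_iff[OF VLc[OF bc d(1)], of "Vl.fr x \<one> \<otimes>\<^bsub>Vl.L\<^esub> q"] VLc[OF xc Vl.U_one] qc by simp
    then show ?thesis using bb(2)[OF x] by simp
  qed
  have "f y = y \<odot>\<^bsub>quo\<^esub> cls q" if y: "y \<in> J'" for y
  proof -
    obtain x u where xu: "x \<in> carrier R" "u \<in> carrier R - \<mm>" "y = fr x u" using J'.Icarr[OF y] by (rule carrE)
    have xJ: "x \<in> J" unfolding J_def using y fr_in_ideal_iff[OF J' xu(1,2)] xu by simp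
    have y_eq: "y = fr \<one> u \<otimes>\<^bsub>L\<^esub> fr x \<one>" unfolding xu(3) using xu(1,2) U_one by (subst mult_L) auto
    have uc: "fr \<one> u \<in> carrier L" by (rule fr_closed[OF one_closed xu(2)])
    have xqc: "Vl.fr x \<one> \<otimes>\<^bsub>Vl.L\<^esub> q \<in> carrier Vl.L" using qc VLc[OF xu(1) Vl.U_one] by simp
    have "f y = fr \<one> u \<odot>\<^bsub>quo\<^esub> F x" unfolding F_def using y_eq f_mult[OF uc JD(2)[OF xJ]] by simp
    also have "\<dots> = cls (iota (fr \<one> u) \<otimes>\<^bsub>Vl.L\<^esub> (Vl.fr x \<one> \<otimes>\<^bsub>Vl.L\<^esub> q))"
      unfolding Fq[OF xJ] by (rule smult_quo[OF uc xqc])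
    also have "iota (fr \<one> u) \<otimes>\<^bsub>Vl.L\<^esub> (Vl.fr x \<one> \<otimes>\<^bsub>Vl.L\<^esub> q) = iota y \<otimes>\<^bsub>Vl.L\<^esub> q"
    proof -
      have "iota y = iota (fr \<one> u) \<otimes>\<^bsub>Vl.L\<^esub> iota (fr x \<one>)"
        unfolding y_eq by (rule ring_hom_mult[OF iota_hom uc fr_closed[OF xu(1) U_one]])
      then show ?thesis unfolding iota_fr[OF xu(1) U_one]
        using Q.m_assoc[OF iota_closed[OF uc] VLc[OF xu(1) Vl.U_one] qc] by simp
    qed
    also have "cls (iota y \<otimes>\<^bsub>Vl.L\<^esub> q) = y \<odot>\<^bsub>quo\<^esub> cls q" using smult_quo[OF J'.Icarr[OF y] qc] by simp
    finally show ?thesis .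
  qed
  then show "\<exists>e\<in>carrier quo. \<forall>x\<in>J'. f x = x \<odot>\<^bsub>quo\<^esub> e" using cls_in[OF qc] by blast
qed

end

context frobenius_at
begin

text \<open>Nonzero polynomials act without torsion (\<open>al_nzd\<close>), so inverting them
  identifies no elements of the local ring.\<close>

lemma iota_inj: "inj_on iota (carrier L)"
proof (rule inj_onI)
  fix x y assume x: "x \<in> carrier L" and y: "y \<in> carrier L" and eq: "iota x = iota y"
  obtain a u where 1: "a \<in> carrier R" "u \<in> carrier R - \<mm>" "x = fr a u" using x by (rule carrE)
  obtain b v where 2: "b \<in> carrier R" "v \<in> carrier R - \<mm>" "y = fr b v" using y by (rule carrE)
  obtain z where z: "z \<in> V" "z \<otimes> (a \<otimes> v) = z \<otimes> (b \<otimes> u)"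
    using eq Vl.fr_eq_iff[OF 1(1) U_in_V[OF 1(2)] 2(1) U_in_V[OF 2(2)]]
    unfolding 1(3) 2(3) iota_fr[OF 1(1,2)] iota_fr[OF 2(1,2)] by blast
  obtain w p where w: "w \<in> carrier R - \<mm>" "p \<noteq> 0" "z = w \<otimes> \<alpha> p" using z(1) by (rule V_E)
  have c: "w \<in> carrier R" "u \<in> carrier R" "v \<in> carrier R" using w 1 2 by auto
  have cl: "w \<otimes> (a \<otimes> v) \<in> carrier R" "w \<otimes> (b \<otimes> u) \<in> carrier R" using c 1(1) 2(1) by simp_all
  have "\<alpha> p \<otimes> (w \<otimes> (a \<otimes> v) \<ominus> w \<otimes> (b \<otimes> u)) = z \<otimes> (a \<otimes> v) \<ominus> z \<otimes> (b \<otimes> u)"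
    unfolding w(3) using c 1(1) 2(1) al_closed[of p] by algebra
  also have "\<dots> = \<zero>" unfolding z(2) using Vl.U_carr[OF z(1)] c 2(1) by (simp add: a_minus_def r_neg)
  finally have "w \<otimes> (a \<otimes> v) = w \<otimes> (b \<otimes> u)"
    using al_nzd[OF minus_closed[OF cl] _ w(2)] unfolding minus_eq_zero_iff[OF cl] by blast
  then show "x = y" unfolding 1(3) 2(3) using fr_eq_iff[OF 1(1,2) 2(1,2)] w(1) by blast
qed

text \<open>The resolution consists of \<open>Vl.L\<close>, its quotient by the embedded local ring,
  and zero. The first two are the two instances of \<open>baer_quo\<close>: zero modulus for the
  first, and for the second the whole ring, with divisibility tested by
  \<open>expand_divisible\<close>.\<close>

theorem finite_self_injective_dimension_localization: "finite_self_injective_dimension L"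
proof -
  interpret VL: cring Vl.L by (rule Vl.cring_L)
  interpret Q0: frobenius_at_quotient R \<alpha> tau B e e' \<mm> "{\<zero>}" "{0}"
  proof (intro frobenius_at_quotient.intro frobenius_at_quotient_axioms.intro frobenius_at_axioms)
    show "fract_submodule {0 :: 'k poly fract}" by (simp add: fract_submodule_def)
    show "to_fract (tau n) \<in> {0}" if "n \<in> {\<zero>}" for n using that by (simp add: tau_zero)
    show "\<exists>n\<in>{\<zero>}. z = \<alpha> p \<otimes> n"
      if "z \<in> carrier R" "p \<noteq> 0" "\<And>y. y \<in> carrier R \<Longrightarrow> to_fract (tau (z \<otimes> y)) / to_fract p \<in> {0}" for z p
      using tau_nondegenerate[OF that(1)] that(2,3) by simp
  qed (use zeroideal in simp_all)
  interpret Q1: frobenius_at_quotient R \<alpha> tau B e e' \<mm> "carrier R" "range to_fract"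
  proof (intro frobenius_at_quotient.intro frobenius_at_quotient_axioms.intro frobenius_at_axioms)
    show "fract_submodule (range to_fract :: 'k poly fract set)"
      unfolding fract_submodule_def by (auto simp flip: to_fract_add to_fract_mult to_fract_0)
    show "\<exists>n\<in>carrier R. z = \<alpha> p \<otimes> n"
      if z: "z \<in> carrier R" "p \<noteq> 0" "\<And>y. y \<in> carrier R \<Longrightarrow> to_fract (tau (z \<otimes> y)) / to_fract p \<in> range to_fract" for z p
    proof (rule expand_divisible[OF z(1)])
      fix y assume "y \<in> carrier R"
      then obtain n where "to_fract (tau (z \<otimes> y)) / to_fract p = to_fract n" using z(3) by blast
      then have "to_fract (tau (z \<otimes> y)) = to_fract (p * n)" using z(2) by (simp add: field_simps)
      then have "tau (z \<otimes> y) = p * n" by (simp only: to_fract_eq_iff)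
      then show "p dvd tau (z \<otimes> y)" by simp
    qed
  qed (use oneideal in simp_all)
  interpret Q2: labelled_quotient L Vl.L iota "carrier Vl.L"
  proof (intro labelled_quotient.intro labelled_quotient_axioms.intro)
    show "cring L" by (rule cring_L)
    show "cring Vl.L" by (rule Vl.cring_L)
    show "iota \<in> ring_hom L Vl.L" by (rule iota_hom)
    show "additive_subgroup (carrier Vl.L) Vl.L"
      using ideal.axioms(1)[OF VL.oneideal] .
  qed (use Q0.iota_closed in auto)
  have N0: "Q0.N = {\<zero>\<^bsub>Vl.L\<^esub>}"
  proof -
    have "Vl.fr \<zero> u = \<zero>\<^bsub>Vl.L\<^esub>" if "u \<in> carrier R - \<mm>" for u
      unfolding Vl.zero_L using that by (intro Vl.fr_eqI) (auto intro: U_in_V)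
    then show ?thesis unfolding Q0.N_def using U_one by blast
  qed
  have N1: "Q1.N = iota ` carrier L"
  proof
    show "Q1.N \<subseteq> iota ` carrier L"
    proof
      fix x assume "x \<in> Q1.N"
      then obtain n u where 1: "n \<in> carrier R" "u \<in> carrier R - \<mm>" "x = Vl.fr n u" by (rule Q1.N_E)
      then have "x = iota (fr n u)" by (simp add: iota_fr)
      then show "x \<in> iota ` carrier L" using fr_closed[OF 1(1,2)] by blast
    qed
    show "iota ` carrier L \<subseteq> Q1.N"
    proof
      fix x assume "x \<in> iota ` carrier L"
      then obtain y where y: "y \<in> carrier L" "x = iota y" by blast
      obtain n u where 1: "n \<in> carrier R" "u \<in> carrier R - \<mm>" "y = fr n u" using y(1) by (rule carrE)
      show "x \<in> Q1.N" unfolding y(2) 1(3) iota_fr[OF 1(1,2)] by (rule Q1.N_I[OF 1(1,2)])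
    qed
  qed
  interpret P01: labelled_quotient_pair L Vl.L iota Q0.N Q1.N
    by unfold_locales (use N0 Q1.N.zero_closed in simp)
  interpret P12: labelled_quotient_pair L Vl.L iota Q1.N "carrier Vl.L"
    by unfold_locales (use Q1.N_carr in blast)
  interpret P22: labelled_quotient_pair L Vl.L iota "carrier Vl.L" "carrier Vl.L"
    by unfold_locales blast
  \<comment> \<open>From index 2 on the module is \<open>Vl.L\<close> modulo itself, a zero module
    on the right type.\<close>
  define E where "E i = (if i = 0 then Q0.quo else if i = 1 then Q1.quo else Q2.quo)" for i :: nat
  define \<delta> where "\<delta> i = (if i = 0 then (\<lambda>Y. Q1.cls (Q0.rep Y)) else if i = 1 then (\<lambda>Y. Q2.cls (Q1.rep Y))
     else (\<lambda>Y. Q2.cls (Q2.rep Y)))" for i :: nat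
  have Q2_carr: "carrier Q2.quo = {\<zero>\<^bsub>Q2.quo\<^esub>}"
  proof -
    have "Q2.cls q = \<zero>\<^bsub>Q2.quo\<^esub>" if "q \<in> carrier Vl.L" for q
      unfolding Q2.zero_quo using Q2.cls_eq_iff[OF that VL.zero_closed] that by simp
    then show ?thesis unfolding Q2.carrier_quo using VL.zero_closed by blast
  qed
  have baer2: "baer L Q2.quo" unfolding baer_def
  proof (intro allI impI, elim conjE)
    fix J f assume J: "ideal J L" and f: "linear_on L Q2.quo J f"
    have "f x = x \<odot>\<^bsub>Q2.quo\<^esub> \<zero>\<^bsub>Q2.quo\<^esub>" if "x \<in> J" for x
      using f that module.smult_closed[OF Q2.module_quo ideal.Icarr[OF J that], of "\<zero>\<^bsub>Q2.quo\<^esub>"] Q2_carr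
      unfolding linear_on_def by auto
    then show "\<exists>e\<in>carrier Q2.quo. \<forall>x\<in>J. f x = x \<odot>\<^bsub>Q2.quo\<^esub> e" using Q2_carr by blast
  qed
  have "injective_resolution L (regular_module L) (\<lambda>r. Q0.cls (iota r)) E \<delta>"
    unfolding injective_resolution_def
  proof (intro conjI allI)
    fix i
    show "injective_module L (E i)" unfolding E_def
      using baer_imp_injective_module[OF Q0.module_quo Q0.baer_quo] baer_imp_injective_module[OF Q1.module_quo Q1.baer_quo]
        baer_imp_injective_module[OF Q2.module_quo baer2] by simp
    show "\<delta> i \<in> linear_maps L (E i) (E (Suc i))"
      using P01.proj_linear P12.proj_linear P22.proj_linear unfolding E_def \<delta>_def by simp
    show "\<delta> i ` carrier (E i) = a_kernel (E (Suc i)) (E (Suc (Suc i))) (\<delta> (Suc i))"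
      using P01.proj_image P12.proj_image P22.proj_image P12.proj_kernel P22.proj_kernel
      unfolding E_def \<delta>_def a_kernel_def' by (simp add: Q1.carrier_quo Q2.carrier_quo)
  next
    show "(\<lambda>r. Q0.cls (iota r)) \<in> linear_maps L (regular_module L) (E 0)"
      unfolding linear_maps_def E_def regular_module_def
      by (auto simp: Q0.cls_in Q0.add_quo Q0.smult_quo ring_hom_add[OF iota_hom] ring_hom_mult[OF iota_hom])
    show "inj_on (\<lambda>r. Q0.cls (iota r)) (carrier (regular_module L))"
    proof (rule inj_onI)
      fix x y assume "x \<in> carrier (regular_module L)" "y \<in> carrier (regular_module L)"
        and eq: "Q0.cls (iota x) = Q0.cls (iota y)"
      then have xy: "x \<in> carrier L" "y \<in> carrier L" by (simp_all add: regular_module_def)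
      have "iota x \<ominus>\<^bsub>Vl.L\<^esub> iota y = \<zero>\<^bsub>Vl.L\<^esub>" using eq Q0.cls_eq_iff[of "iota x" "iota y"] xy N0 by simp
      then have "iota x = iota y" using xy by simp
      then show "x = y" using iota_inj xy by (rule_tac inj_onD)
    qed
    show "(\<lambda>r. Q0.cls (iota r)) ` carrier (regular_module L) = a_kernel (E 0) (E 1) (\<delta> 0)"
      using P01.proj_kernel unfolding E_def \<delta>_def a_kernel_def' N1 by (simp add: regular_module_def image_image)
  qed
  moreover have "\<forall>i>1. carrier (E i) = {\<zero>\<^bsub>E i\<^esub>}" using Q2_carr by (simp add: E_def)
  ultimately show ?thesis unfolding finite_self_injective_dimension_def by blast
qed

end

theorem (in frobenius_extension) gorenstein_ring_R: "gorenstein_ring R"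
  unfolding gorenstein_ring_def
proof (intro conjI allI impI)
  fix \<mm> assume m: "maximalideal \<mm> R"
  interpret frobenius_at R \<alpha> tau B e e' \<mm>
    by (intro frobenius_at.intro localization_at.intro localization_at_axioms.intro frobenius_extension_axioms cring_axioms m)
  show "gorenstein_local_ring (localization R (carrier R - \<mm>))"
    unfolding gorenstein_local_ring_def
    by (intro conjI cring_L noetherian_L[OF noetherian_R] ex1_maximalideal finite_self_injective_dimension_localization)
qed (rule noetherian_R cring_axioms)+

section \<open>Homogeneous components of polynomials\<close>

lemma poly_ring_simps:
  "f \<otimes>\<^bsub>poly_ring n\<^esub> g = f * g" "f \<oplus>\<^bsub>poly_ring n\<^esub> g = f + g" "\<zero>\<^bsub>poly_ring n\<^esub> = 0" "\<one>\<^bsub>poly_ring n\<^esub> = 1"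
  by (simp_all add: poly_ring_def ring_of_type_algebra_def)

lemma in_poly_ring: "f \<in> carrier (poly_ring n) \<longleftrightarrow> (\<forall>t\<in>Poly_Mapping.keys f. Poly_Mapping.keys t \<subseteq> {0..n})"
  by (simp add: poly_ring_def)

lemma keys_plus_nat: "Poly_Mapping.keys (s + t) = Poly_Mapping.keys s \<union> Poly_Mapping.keys (t :: nat \<Rightarrow>\<^sub>0 nat)"
  by (auto simp: in_keys_iff lookup_add)

lemma total_deg_plus: "total_deg (s + t) = total_deg s + total_deg t"
proof -
  let ?K = "Poly_Mapping.keys s \<union> Poly_Mapping.keys t"
  have "total_deg u = (\<Sum>j\<in>?K. Poly_Mapping.lookup u j)" if "Poly_Mapping.keys u \<subseteq> ?K" for u
    unfolding total_deg_def by (rule sum.mono_neutral_left) (use that in \<open>auto simp: in_keys_iff\<close>)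
  then show ?thesis by (simp add: keys_plus_nat lookup_add sum.distrib)
qed

lemma total_deg_zero [simp]: "total_deg 0 = 0" by (simp add: total_deg_def)

lemma total_deg_single [simp]: "total_deg (Poly_Mapping.single j d) = d"
  by (simp add: total_deg_def)

lemma mult_in_poly_ring:
  assumes "f \<in> carrier (poly_ring n)" "g \<in> carrier (poly_ring n)" shows "f * g \<in> carrier (poly_ring n)"
  unfolding in_poly_ring
proof
  fix t assume "t \<in> Poly_Mapping.keys (f * g)"
  then obtain a b where "t = a + b" "a \<in> Poly_Mapping.keys f" "b \<in> Poly_Mapping.keys g"
    using keys_mult[of f g] by blast
  then show "Poly_Mapping.keys t \<subseteq> {0..n}" using assms unfolding in_poly_ring by (auto simp: keys_plus_nat)
qed

lemma add_in_poly_ring: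
  assumes "f \<in> carrier (poly_ring n)" "g \<in> carrier (poly_ring n)" shows "f + g \<in> carrier (poly_ring n)"
  using assms Poly_Mapping.keys_add[of f g] unfolding in_poly_ring by blast

lemma uminus_in_poly_ring:
  "f \<in> carrier (poly_ring n) \<Longrightarrow> - f \<in> carrier (poly_ring n)"
  unfolding in_poly_ring by (simp add: in_keys_iff)

lemma minus_in_poly_ring:
  "\<lbrakk>f \<in> carrier (poly_ring n); g \<in> carrier (poly_ring n)\<rbrakk> \<Longrightarrow> f - g \<in> carrier (poly_ring n)"
  using add_in_poly_ring[of f n "- g"] uminus_in_poly_ring[of g n] by simp

lemma const_in_poly_ring: "0 \<in> carrier (poly_ring n)" "1 \<in> carrier (poly_ring n)" "Poly_Mapping.single 0 c \<in> carrier (poly_ring n)"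
  by (auto simp: in_poly_ring)

lemma sum_in_poly_ring: "(\<And>i. i \<in> A \<Longrightarrow> f i \<in> carrier (poly_ring n)) \<Longrightarrow> (\<Sum>i\<in>A. f i) \<in> carrier (poly_ring n)"
  by (induction A rule: infinite_finite_induct) (auto intro: add_in_poly_ring const_in_poly_ring)

lemmas poly_ring_intros = mult_in_poly_ring add_in_poly_ring uminus_in_poly_ring minus_in_poly_ring
  const_in_poly_ring sum_in_poly_ring

lemma cring_poly_ring: "cring (poly_ring n :: 'k::field mpoly ring)"
proof (rule cringI)
  show "abelian_group (poly_ring n :: 'k mpoly ring)"
  proof (rule abelian_groupI)
    fix x :: "'k mpoly" assume "x \<in> carrier (poly_ring n)"
    then show "\<exists>y\<in>carrier (poly_ring n). y \<oplus>\<^bsub>poly_ring n\<^esub> x = \<zero>\<^bsub>poly_ring n\<^esub>"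
      by (intro bexI[of _ "- x"]) (auto simp: poly_ring_simps poly_ring_intros)
  qed (auto simp: poly_ring_simps algebra_simps poly_ring_intros)
  show "Group.comm_monoid (poly_ring n :: 'k mpoly ring)"
    by (rule comm_monoidI) (auto simp: poly_ring_simps algebra_simps poly_ring_intros)
qed (auto simp: poly_ring_simps algebra_simps)

lemma poly_ring_uminus: "f \<in> carrier (poly_ring n) \<Longrightarrow> \<ominus>\<^bsub>poly_ring n\<^esub> f = - f"
proof -
  assume f: "f \<in> carrier (poly_ring n)"
  interpret cring "poly_ring n" by (rule cring_poly_ring)
  show ?thesis by (rule minus_equality) (use f in \<open>auto simp: poly_ring_simps poly_ring_intros\<close>)
qed

definition hom_piece :: "nat \<Rightarrow> nat \<Rightarrow> 'k::field mpoly set" where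
  "hom_piece n i = {f \<in> carrier (poly_ring n). \<forall>t\<in>Poly_Mapping.keys f. total_deg t = i}"

lemma poly_piece_int: "poly_piece n (int i) = hom_piece n i"
  by (simp add: poly_piece_def hom_piece_def)

lemma poly_piece_neg: assumes "i < 0" shows "poly_piece n i = {0}"
proof -
  have "f = 0" if "f \<in> poly_piece n i" for f :: "'k::field mpoly"
  proof -
    have "Poly_Mapping.keys f = {}" using that assms unfolding poly_piece_def by force
    then show "f = 0" by simp
  qed
  moreover have "0 \<in> poly_piece n i" by (simp add: poly_piece_def const_in_poly_ring)
  ultimately show ?thesis by auto
qed

lift_definition cmp :: "nat \<Rightarrow> 'k::zero mpoly \<Rightarrow> 'k mpoly" is
  "\<lambda>i f t. f t when total_deg t = i"
  by (rule finite_subset) auto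

lemma lookup_cmp: "Poly_Mapping.lookup (cmp i f) t = (Poly_Mapping.lookup f t when total_deg t = i)"
  by transfer simp

lemma cmp_add: "cmp i (f + g) = cmp i f + cmp i (g :: 'k::field mpoly)"
  by (rule poly_mapping_eqI) (simp add: lookup_cmp lookup_add when_add_distrib)

lemma cmp_zero [simp]: "cmp i 0 = 0"
  by (rule poly_mapping_eqI) (simp add: lookup_cmp)

lemma cmp_uminus: "cmp i (- f) = - cmp i (f :: 'k::field mpoly)"
  by (rule poly_mapping_eqI) (simp add: lookup_cmp when_def)

lemma cmp_diff: "cmp i (f - g) = cmp i f - cmp i (g :: 'k::field mpoly)"
  using cmp_add[of i f "- g"] by (simp add: cmp_uminus)

lemma cmp_sum: "cmp i (\<Sum>j\<in>A. f j) = (\<Sum>j\<in>A. cmp i (f j :: 'k::field mpoly))"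
  by (induction A rule: infinite_finite_induct) (auto simp: cmp_add)

lemma keys_cmp: "Poly_Mapping.keys (cmp i f) = {t \<in> Poly_Mapping.keys f. total_deg t = i}"
  by (auto simp: in_keys_iff lookup_cmp)

lemma cmp_in_hom_piece: "f \<in> carrier (poly_ring n) \<Longrightarrow> cmp i f \<in> hom_piece n i"
  by (auto simp: hom_piece_def in_poly_ring keys_cmp)

lemma hom_piece_carr: "f \<in> hom_piece n i \<Longrightarrow> f \<in> carrier (poly_ring n)"
  by (simp add: hom_piece_def)

lemma cmp_carr: "f \<in> carrier (poly_ring n) \<Longrightarrow> cmp i f \<in> carrier (poly_ring n)"
  using cmp_in_hom_piece hom_piece_carr by blast

lemma cmp_hom: "f \<in> hom_piece n i \<Longrightarrow> cmp j f = (if i = j then f else 0)"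
  by (rule poly_mapping_eqI) (auto simp: lookup_cmp hom_piece_def when_def in_keys_iff)

lemma cmp_hom_same [simp]: "f \<in> hom_piece n i \<Longrightarrow> cmp i f = f"
  by (simp add: cmp_hom)

text \<open>The bound is strict so that the bound 0 leaves only the zero polynomial and the
  filtration of S starts with the zero space.\<close>

definition deg_below :: "nat \<Rightarrow> 'k::zero mpoly \<Rightarrow> bool" where
  "deg_below N f \<longleftrightarrow> (\<forall>t\<in>Poly_Mapping.keys f. total_deg t < N)"

lemma deg_below_ex: "\<exists>N. deg_below N f"
proof -
  have "finite (total_deg ` Poly_Mapping.keys f)" by simp
  then obtain N where "\<forall>d\<in>total_deg ` Poly_Mapping.keys f. d < N" by (metis finite_nat_set_iff_bounded)
  then show ?thesis unfolding deg_below_def by auto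
qed

lemma deg_below_mono: "\<lbrakk>deg_below N f; N \<le> M\<rbrakk> \<Longrightarrow> deg_below M f"
  unfolding deg_below_def by force

lemma deg_below_cmp: "\<lbrakk>deg_below N f; N \<le> i\<rbrakk> \<Longrightarrow> cmp i f = 0"
  by (rule poly_mapping_eqI)
     (auto simp: lookup_cmp deg_below_def when_def not_in_keys_iff_lookup_eq_zero[symmetric])

lemma cmp_decomp: "deg_below N f \<Longrightarrow> f = (\<Sum>i<N. cmp i (f :: 'k::field mpoly))"
proof (rule poly_mapping_eqI)
  fix t assume N: "deg_below N f"
  have "Poly_Mapping.lookup (\<Sum>i<N. cmp i f) t = (\<Sum>i<N. if i = total_deg t then Poly_Mapping.lookup f t else 0)"
    by (auto simp: lookup_sum lookup_cmp when_def intro: sum.cong)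
  also have "\<dots> = Poly_Mapping.lookup f t" using N by (auto simp: deg_below_def in_keys_iff)
  finally show "Poly_Mapping.lookup f t = Poly_Mapping.lookup (\<Sum>i<N. cmp i f) t" by simp
qed

lemma hom_piece_mult:
  assumes "f \<in> hom_piece n i" "g \<in> hom_piece n j" shows "f * g \<in> hom_piece n (i + j)"
proof -
  have "total_deg t = i + j" if t: "t \<in> Poly_Mapping.keys (f * g)" for t
  proof -
    obtain a b where "t = a + b" "a \<in> Poly_Mapping.keys f" "b \<in> Poly_Mapping.keys g"
      using keys_mult[of f g] t by blast
    then show ?thesis using assms unfolding hom_piece_def by (auto simp: total_deg_plus)
  qed
  then show ?thesis using assms mult_in_poly_ring unfolding hom_piece_def by blast
qed

lemma hom_piece_zero [simp]: "0 \<in> hom_piece n i"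
  by (simp add: hom_piece_def const_in_poly_ring)

lemma hom_piece_add: "\<lbrakk>f \<in> hom_piece n i; g \<in> hom_piece n i\<rbrakk> \<Longrightarrow> f + g \<in> hom_piece n i"
  using Poly_Mapping.keys_add[of f g] unfolding hom_piece_def by (auto intro: add_in_poly_ring)

lemma hom_piece_uminus: "f \<in> hom_piece n i \<Longrightarrow> - f \<in> hom_piece n i"
  unfolding hom_piece_def by (auto intro: uminus_in_poly_ring simp: in_keys_iff)

lemma hom_piece_diff: "\<lbrakk>f \<in> hom_piece n i; g \<in> hom_piece n i\<rbrakk> \<Longrightarrow> f - g \<in> hom_piece n i"
  using hom_piece_add[of f n i "- g"] hom_piece_uminus[of g n i] by simp

lemma hom_piece_const: "Poly_Mapping.single 0 c \<in> hom_piece n 0"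
  by (auto simp: hom_piece_def const_in_poly_ring)

lemma hom_piece_one: "1 \<in> hom_piece n 0"
  using hom_piece_const[of 1 n] by simp

lemma hom_piece_sum: "(\<And>j. j \<in> A \<Longrightarrow> f j \<in> hom_piece n i) \<Longrightarrow> (\<Sum>j\<in>A. f j) \<in> hom_piece n i"
  by (induction A rule: infinite_finite_induct) (auto intro: hom_piece_add)

lemma hom_piece_zero_const:
  assumes "f \<in> hom_piece n 0" shows "f = Poly_Mapping.single 0 (Poly_Mapping.lookup f 0)"
proof (rule poly_mapping_eqI)
  fix t
  have "t = 0" if "t \<in> Poly_Mapping.keys f"
  proof -
    have "total_deg t = 0" using assms that unfolding hom_piece_def by auto
    then have "Poly_Mapping.lookup t j = 0" for j unfolding total_deg_def by (auto simp: in_keys_iff)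
    then show ?thesis by (intro poly_mapping_eqI) simp
  qed
  then show "Poly_Mapping.lookup f t = Poly_Mapping.lookup (Poly_Mapping.single 0 (Poly_Mapping.lookup f 0)) t"
    by (cases "t = 0") (auto simp: lookup_single in_keys_iff)
qed

lemma cmp_mult:
  assumes f: "f \<in> carrier (poly_ring n)" and g: "g \<in> hom_piece n j"
  shows "cmp k (f * g) = (if j \<le> k then cmp (k - j) f * g else 0)"
proof -
  obtain N where N: "deg_below N f" using deg_below_ex by blast
  have "cmp k (f * g) = cmp k ((\<Sum>i<N. cmp i f) * g)" using cmp_decomp[OF N] by simp
  also have "\<dots> = (\<Sum>i<N. cmp k (cmp i f * g))" by (simp add: sum_distrib_right cmp_sum)
  also have "\<dots> = (\<Sum>i<N. if i + j = k then cmp i f * g else 0)"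
    using cmp_hom[OF hom_piece_mult[OF cmp_in_hom_piece[OF f] g]] by simp
  also have "\<dots> = (if j \<le> k then cmp (k - j) f * g else 0)"
  proof (cases "j \<le> k")
    case True
    have "(\<Sum>i<N. if i + j = k then cmp i f * g else 0) = (\<Sum>i<N. if i = k - j then cmp i f * g else 0)"
      by (rule sum.cong) (use True in auto)
    also have "\<dots> = (if k - j < N then cmp (k - j) f * g else 0)" by simp
    finally show ?thesis using True deg_below_cmp[OF N, of "k - j"] by (auto simp: not_less)
  qed auto
  finally show ?thesis .
qed

definition X0 :: "'k::field mpoly" where
  "X0 = Poly_Mapping.single (Poly_Mapping.single 0 1) 1"

lemma X0_hom: "X0 \<in> hom_piece n 1"
  by (auto simp: X0_def hom_piece_def in_poly_ring)

lemma X0_pow_hom: "X0 ^ k \<in> hom_piece n k"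
  by (induction k) (use hom_piece_mult[OF X0_hom] in \<open>auto simp: hom_piece_one\<close>)

lemma X0_carr: "X0 \<in> carrier (poly_ring n)" "X0 ^ k \<in> carrier (poly_ring n)"
  using hom_piece_carr[OF X0_hom] hom_piece_carr[OF X0_pow_hom] by auto

lemma X0_mult_hom: "f \<in> hom_piece n i \<Longrightarrow> X0 ^ k * f \<in> hom_piece n (k + i)"
  by (rule hom_piece_mult[OF X0_pow_hom])

lemma cmp_X0_mult:
  assumes "f \<in> carrier (poly_ring n)"
  shows "cmp (Suc k) (X0 * f) = X0 * cmp k f" "cmp 0 (X0 * f) = 0"
  using cmp_mult[OF assms X0_hom, of "Suc k"] cmp_mult[OF assms X0_hom, of 0] by (simp_all add: mult.commute)

locale hom_ideal =
  fixes n :: nat and I :: "'k::field mpoly set"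
  assumes I_carr: "f \<in> I \<Longrightarrow> f \<in> carrier (poly_ring n)" and I_zero: "0 \<in> I"
    and I_add: "\<lbrakk>f \<in> I; g \<in> I\<rbrakk> \<Longrightarrow> f + g \<in> I"
    and I_mult: "\<lbrakk>f \<in> I; g \<in> carrier (poly_ring n)\<rbrakk> \<Longrightarrow> g * f \<in> I"
    and I_cmp: "f \<in> I \<Longrightarrow> cmp i f \<in> I"
begin

lemma I_mult': "\<lbrakk>f \<in> I; g \<in> carrier (poly_ring n)\<rbrakk> \<Longrightarrow> f * g \<in> I"
  using I_mult by (simp add: mult.commute)

lemma I_uminus: "f \<in> I \<Longrightarrow> - f \<in> I"
  using I_mult[of f "- 1"] by (simp add: poly_ring_intros)

lemma I_diff: "\<lbrakk>f \<in> I; g \<in> I\<rbrakk> \<Longrightarrow> f - g \<in> I"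
  using I_add[of f "- g"] I_uminus by simp

lemma I_sum: "(\<And>j. j \<in> A \<Longrightarrow> f j \<in> I) \<Longrightarrow> (\<Sum>j\<in>A. f j) \<in> I"
  by (induction A rule: infinite_finite_induct) (auto intro: I_add I_zero)

lemma I_by_cmp: "(\<And>i. cmp i f \<in> I) \<Longrightarrow> f \<in> I"
  using deg_below_ex[of f] cmp_decomp[of _ f] I_sum by metis

lemma ideal_I: "ideal I (poly_ring n)"
proof -
  interpret cring "poly_ring n :: 'k mpoly ring" by (rule cring_poly_ring)
  show ?thesis
  proof (rule idealI)
    show "ring (poly_ring n :: 'k mpoly ring)" by (rule ring_axioms)
    show "subgroup I (add_monoid (poly_ring n))"
    proof (rule add.subgroupI)
      show "I \<subseteq> carrier (poly_ring n)" "I \<noteq> {}" using I_carr I_zero by auto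
    qed (auto simp: poly_ring_simps poly_ring_uminus I_carr intro: I_uminus I_add)
  qed (auto simp: poly_ring_simps intro: I_mult I_mult')
qed

end

section \<open>Dimensions of vector spaces\<close>

context vector_space
begin

text \<open>Transfers dimension from module records to subspaces of a type: an injective linear
  \<Phi> matches finite bases of \<open>M\<close> with finite bases of \<open>W\<close>. All of
  these have \<open>dim W\<close> elements, so the choice inside \<open>vdim\<close> does not
  matter.\<close>

lemma vdim_linear_iso:
  fixes M :: "('a, 'v) module"
  assumes M: "abelian_group M" and smult: "\<And>c v. v \<in> carrier M \<Longrightarrow> c \<odot>\<^bsub>M\<^esub> v \<in> carrier M"
    and \<Phi>_add: "\<And>v w. \<lbrakk>v \<in> carrier M; w \<in> carrier M\<rbrakk> \<Longrightarrow> \<Phi> (v \<oplus>\<^bsub>M\<^esub> w) = \<Phi> v + \<Phi> w"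
    and \<Phi>_scale: "\<And>c v. v \<in> carrier M \<Longrightarrow> \<Phi> (c \<odot>\<^bsub>M\<^esub> v) = scale c (\<Phi> v)"
    and inj: "inj_on \<Phi> (carrier M)" and W: "\<Phi> ` carrier M = W"
  shows "vdim M = (if \<exists>C. finite C \<and> W \<subseteq> span C then enat (dim W) else \<infinity>)"
proof -
  interpret M: abelian_group M by fact
  have \<Phi>0: "\<Phi> \<zero>\<^bsub>M\<^esub> = 0" using \<Phi>_add[OF M.zero_closed M.zero_closed] by simp
  have sum: "\<Phi> (\<Oplus>\<^bsub>M\<^esub>b\<in>B. c b \<odot>\<^bsub>M\<^esub> b) = (\<Sum>b\<in>B. scale (c b) (\<Phi> b))"
    if "finite B" "B \<subseteq> carrier M" for B c
    using that
  proof (induction B rule: finite_induct)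
    case (insert b B)
    have cl: "(\<lambda>b. c b \<odot>\<^bsub>M\<^esub> b) \<in> B \<rightarrow> carrier M" "c b \<odot>\<^bsub>M\<^esub> b \<in> carrier M" using insert.prems smult by auto
    then show ?case using insert \<Phi>_add[OF cl(2) M.finsum_closed[OF cl(1)]] \<Phi>_scale by simp
  qed (simp add: \<Phi>0)
  have sum_closed: "(\<Oplus>\<^bsub>M\<^esub>b\<in>B. c b \<odot>\<^bsub>M\<^esub> b) \<in> carrier M" if "B \<subseteq> carrier M" for B c
    by (rule M.finsum_closed) (use that smult in auto)
  have sum_image: "(\<Sum>w\<in>\<Phi> ` B. scale (u w) w) = (\<Sum>b\<in>B. scale (u (\<Phi> b)) (\<Phi> b))" if "B \<subseteq> carrier M" for u B
    by (subst sum.reindex) (use inj_on_subset[OF inj that] in auto)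
  have basis_iff: "finite_basis M B \<longleftrightarrow> finite B \<and> B \<subseteq> carrier M \<and> independent (\<Phi> ` B) \<and> W \<subseteq> span (\<Phi> ` B)" for B
  proof (cases "finite B \<and> B \<subseteq> carrier M")
    case True
    then have B: "finite B" "B \<subseteq> carrier M" by auto
    have injB: "inj_on \<Phi> B" using inj_on_subset[OF inj B(2)] .
    have lift: "\<exists>u. \<forall>b\<in>B. u (\<Phi> b) = c b" for c :: "'v \<Rightarrow> 'a"
      by (rule exI[of _ "\<lambda>w. c (the_inv_into B \<Phi> w)"]) (simp add: the_inv_into_f_f[OF injB])
    have zero_iff: "(\<Oplus>\<^bsub>M\<^esub>b\<in>B. c b \<odot>\<^bsub>M\<^esub> b) = \<zero>\<^bsub>M\<^esub> \<longleftrightarrow> (\<Sum>b\<in>B. scale (c b) (\<Phi> b)) = 0" for c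
      using sum[OF B, of c] \<Phi>0 inj_onD[OF inj _ sum_closed[OF B(2)] M.zero_closed] by metis
    have "independent (\<Phi> ` B) \<longleftrightarrow> (\<forall>u. (\<Sum>w\<in>\<Phi> ` B. scale (u w) w) = 0 \<longrightarrow> (\<forall>w\<in>\<Phi> ` B. u w = 0))"
      using B(1) by (auto simp: dependent_finite)
    also have "\<dots> \<longleftrightarrow> (\<forall>u. (\<Sum>b\<in>B. scale (u (\<Phi> b)) (\<Phi> b)) = 0 \<longrightarrow> (\<forall>b\<in>B. u (\<Phi> b) = 0))"
      unfolding sum_image[OF B(2)] by simp
    also have "\<dots> \<longleftrightarrow> (\<forall>c. (\<Sum>b\<in>B. scale (c b) (\<Phi> b)) = 0 \<longrightarrow> (\<forall>b\<in>B. c b = 0))"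
    proof (intro iffI allI impI)
      fix c assume *: "\<forall>u. (\<Sum>b\<in>B. scale (u (\<Phi> b)) (\<Phi> b)) = 0 \<longrightarrow> (\<forall>b\<in>B. u (\<Phi> b) = 0)"
        and c: "(\<Sum>b\<in>B. scale (c b) (\<Phi> b)) = 0"
      obtain u where u: "\<forall>b\<in>B. u (\<Phi> b) = c b" using lift by blast
      then have "(\<Sum>b\<in>B. scale (u (\<Phi> b)) (\<Phi> b)) = 0" using c by (simp cong: sum.cong)
      then have "\<forall>b\<in>B. u (\<Phi> b) = 0" using * by blast
      then show "\<forall>b\<in>B. c b = 0" using u by simp
    next
      fix u assume *: "\<forall>c. (\<Sum>b\<in>B. scale (c b) (\<Phi> b)) = 0 \<longrightarrow> (\<forall>b\<in>B. c b = 0)"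
        and "(\<Sum>b\<in>B. scale (u (\<Phi> b)) (\<Phi> b)) = 0"
      then show "\<forall>b\<in>B. u (\<Phi> b) = 0" using spec[OF *, of "\<lambda>b. u (\<Phi> b)"] by simp
    qed
    finally have ind: "independent (\<Phi> ` B) \<longleftrightarrow> (\<forall>c. (\<Oplus>\<^bsub>M\<^esub>b\<in>B. c b \<odot>\<^bsub>M\<^esub> b) = \<zero>\<^bsub>M\<^esub> \<longrightarrow> (\<forall>b\<in>B. c b = 0))"
      unfolding zero_iff .
    have "\<Phi> v \<in> span (\<Phi> ` B) \<longleftrightarrow> (\<exists>c. v = (\<Oplus>\<^bsub>M\<^esub>b\<in>B. c b \<odot>\<^bsub>M\<^esub> b))" if v: "v \<in> carrier M" for v
    proof
      assume "\<Phi> v \<in> span (\<Phi> ` B)"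
      then obtain u where "\<Phi> v = (\<Sum>w\<in>\<Phi> ` B. scale (u w) w)" using span_finite[of "\<Phi> ` B"] B(1) by auto
      then have "\<Phi> v = \<Phi> (\<Oplus>\<^bsub>M\<^esub>b\<in>B. u (\<Phi> b) \<odot>\<^bsub>M\<^esub> b)" using sum[OF B, of "\<lambda>b. u (\<Phi> b)"] sum_image[OF B(2)] by simp
      then show "\<exists>c. v = (\<Oplus>\<^bsub>M\<^esub>b\<in>B. c b \<odot>\<^bsub>M\<^esub> b)"
        by (intro exI[of _ "\<lambda>b. u (\<Phi> b)"] inj_onD[OF inj _ v sum_closed[OF B(2)]])
    next
      assume "\<exists>c. v = (\<Oplus>\<^bsub>M\<^esub>b\<in>B. c b \<odot>\<^bsub>M\<^esub> b)"
      then obtain c where "v = (\<Oplus>\<^bsub>M\<^esub>b\<in>B. c b \<odot>\<^bsub>M\<^esub> b)" by blast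
      then have "\<Phi> v = (\<Sum>b\<in>B. scale (c b) (\<Phi> b))" using sum[OF B] by simp
      then show "\<Phi> v \<in> span (\<Phi> ` B)" by (simp, intro span_sum span_scale) (auto intro: span_base)
    qed
    then have "W \<subseteq> span (\<Phi> ` B) \<longleftrightarrow> (\<forall>v\<in>carrier M. \<exists>c. v = (\<Oplus>\<^bsub>M\<^esub>b\<in>B. c b \<odot>\<^bsub>M\<^esub> b))"
      unfolding W[symmetric] by blast
    then show ?thesis using ind True unfolding finite_basis_def by simp
  qed (auto simp: finite_basis_def)
  have card: "card B = dim W" if "finite_basis M B" for B
  proof -
    have B: "B \<subseteq> carrier M" "independent (\<Phi> ` B)" "W \<subseteq> span (\<Phi> ` B)" using that basis_iff by auto
    have "card B = card (\<Phi> ` B)" using card_image[OF inj_on_subset[OF inj B(1)]] by simp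
    also have "\<dots> = dim W" using B W by (intro basis_card_eq_dim) auto
    finally show ?thesis .
  qed
  have ex: "(\<exists>B. finite_basis M B) \<longleftrightarrow> (\<exists>C. finite C \<and> W \<subseteq> span C)"
  proof
    assume "\<exists>C. finite C \<and> W \<subseteq> span C"
    then obtain C where C: "finite C" "W \<subseteq> span C" by blast
    obtain Bw where Bw: "Bw \<subseteq> W" "independent Bw" "W \<subseteq> span Bw" using basis_exists[of W] by metis
    have "finite Bw" using independent_span_bound[OF C(1) Bw(2)] Bw(1) C(2) by blast
    then obtain B where "B \<subseteq> carrier M" "finite B" "Bw = \<Phi> ` B" using finite_subset_image[of Bw \<Phi> "carrier M"] Bw(1) W by auto
    then show "\<exists>B. finite_basis M B" using basis_iff Bw by blast
  qed (use basis_iff in blast)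
  show ?thesis
  proof (cases "\<exists>B. finite_basis M B")
    case True
    then have "finite_basis M (SOME B. finite_basis M B)" by (rule someI_ex)
    then have "card (SOME B. finite_basis M B) = dim W" by (rule card)
    then show ?thesis using True unfolding vdim_def ex[symmetric] by (simp only: if_True)
  next
    case False
    then show ?thesis unfolding vdim_def ex[symmetric] by (simp only: if_False)
  qed
qed

text \<open>First isomorphism theorem for \<open>quotient_module\<close>: a coset of the kernel is a
  fibre of \<phi>, so the induced map on cosets is injective with the same image.\<close>

lemma vdim_quotient:
  fixes M :: "('a, 'v) module"
  assumes M: "abelian_group M" and smult: "\<And>c v. v \<in> carrier M \<Longrightarrow> c \<odot>\<^bsub>M\<^esub> v \<in> carrier M"
    and \<phi>_add: "\<And>v w. \<lbrakk>v \<in> carrier M; w \<in> carrier M\<rbrakk> \<Longrightarrow> \<phi> (v \<oplus>\<^bsub>M\<^esub> w) = \<phi> v + \<phi> w"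
    and \<phi>_scale: "\<And>c v. v \<in> carrier M \<Longrightarrow> \<phi> (c \<odot>\<^bsub>M\<^esub> v) = scale c (\<phi> v)"
    and K: "K = {v \<in> carrier M. \<phi> v = 0}" and W: "\<phi> ` carrier M = W"
  shows "vdim (quotient_module M K) = (if \<exists>C. finite C \<and> W \<subseteq> span C then enat (dim W) else \<infinity>)"
proof -
  interpret M: abelian_group M by fact
  let ?Q = "quotient_module M K"
  have \<phi>0: "\<phi> \<zero>\<^bsub>M\<^esub> = 0" using \<phi>_add[OF M.zero_closed M.zero_closed] by simp
  have \<phi>neg: "\<phi> (\<ominus>\<^bsub>M\<^esub> v) = - \<phi> v" if "v \<in> carrier M" for v
    using \<phi>_add[OF that M.a_inv_closed[OF that]] that by (simp add: M.r_neg \<phi>0 eq_neg_iff_add_eq_0 add.commute)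
  have sub: "subgroup K (add_monoid M)"
    by (rule M.add.subgroupI) (auto simp: K \<phi>0 \<phi>neg \<phi>_add intro!: exI[of _ "\<zero>\<^bsub>M\<^esub>"])
  have KM: "abelian_subgroup K M"
    by (rule abelian_subgroupI3[OF additive_subgroup.intro[OF sub] M])
  have cos: "K +>\<^bsub>M\<^esub> v = {w \<in> carrier M. \<phi> w = \<phi> v}" if v: "v \<in> carrier M" for v
  proof -
    have "w \<in> K +>\<^bsub>M\<^esub> v" if w: "w \<in> carrier M" "\<phi> w = \<phi> v" for w
    proof -
      have "w \<oplus>\<^bsub>M\<^esub> \<ominus>\<^bsub>M\<^esub> v \<in> K" using w v by (simp add: K \<phi>_add \<phi>neg)
      moreover have "w = (w \<oplus>\<^bsub>M\<^esub> \<ominus>\<^bsub>M\<^esub> v) \<oplus>\<^bsub>M\<^esub> v" using w v by (simp add: M.a_assoc M.l_neg)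
      ultimately show ?thesis unfolding a_r_coset_def' by blast
    qed
    moreover have "w \<in> carrier M \<and> \<phi> w = \<phi> v" if "w \<in> K +>\<^bsub>M\<^esub> v" for w
      using that v unfolding a_r_coset_def' by (auto simp: K \<phi>_add)
    ultimately show ?thesis by blast
  qed
  have carr: "carrier ?Q = (\<lambda>v. K +>\<^bsub>M\<^esub> v) ` carrier M"
    by (auto simp: quotient_module_def A_RCOSETS_def')
  have add: "(K +>\<^bsub>M\<^esub> v) \<oplus>\<^bsub>?Q\<^esub> (K +>\<^bsub>M\<^esub> w) = K +>\<^bsub>M\<^esub> (v \<oplus>\<^bsub>M\<^esub> w)"
    if "v \<in> carrier M" "w \<in> carrier M" for v w
    using abelian_subgroup.a_rcos_sum[OF KM that] by (simp add: quotient_module_def)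
  have zero: "\<zero>\<^bsub>?Q\<^esub> = K +>\<^bsub>M\<^esub> \<zero>\<^bsub>M\<^esub>"
    using cos[OF M.zero_closed] by (simp add: quotient_module_def K \<phi>0)
  have scal: "c \<odot>\<^bsub>?Q\<^esub> (K +>\<^bsub>M\<^esub> v) = K +>\<^bsub>M\<^esub> (c \<odot>\<^bsub>M\<^esub> v)" if v: "v \<in> carrier M" for c v
  proof -
    have "c \<odot>\<^bsub>?Q\<^esub> (K +>\<^bsub>M\<^esub> v) = {k \<oplus>\<^bsub>M\<^esub> c \<odot>\<^bsub>M\<^esub> w | k w. k \<in> K \<and> w \<in> carrier M \<and> \<phi> w = \<phi> v}"
      unfolding cos[OF v] by (auto simp: quotient_module_def set_add_def')
    also have "\<dots> = {w \<in> carrier M. \<phi> w = \<phi> (c \<odot>\<^bsub>M\<^esub> v)}"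
    proof (intro equalityI subsetI)
      fix w assume "w \<in> {w \<in> carrier M. \<phi> w = \<phi> (c \<odot>\<^bsub>M\<^esub> v)}"
      then have w: "w \<in> carrier M" "\<phi> w = \<phi> (c \<odot>\<^bsub>M\<^esub> v)" by auto
      have "w \<oplus>\<^bsub>M\<^esub> \<ominus>\<^bsub>M\<^esub> (c \<odot>\<^bsub>M\<^esub> v) \<in> K" using w smult[OF v] by (simp add: K \<phi>_add \<phi>neg)
      moreover have "w = (w \<oplus>\<^bsub>M\<^esub> \<ominus>\<^bsub>M\<^esub> (c \<odot>\<^bsub>M\<^esub> v)) \<oplus>\<^bsub>M\<^esub> c \<odot>\<^bsub>M\<^esub> v" using w smult[OF v] by (simp add: M.a_assoc M.l_neg)
      ultimately show "w \<in> {k \<oplus>\<^bsub>M\<^esub> c \<odot>\<^bsub>M\<^esub> w | k w. k \<in> K \<and> w \<in> carrier M \<and> \<phi> w = \<phi> v}" using v by blast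
    qed (auto simp: K \<phi>_add smult \<phi>_scale v)
    finally show ?thesis unfolding cos[OF smult[OF v]] .
  qed
  define \<Phi> where "\<Phi> C = \<phi> (SOME v. v \<in> carrier M \<and> C = K +>\<^bsub>M\<^esub> v)" for C
  have \<Phi>: "\<Phi> (K +>\<^bsub>M\<^esub> v) = \<phi> v" if v: "v \<in> carrier M" for v
  proof -
    define w where "w = (SOME w. w \<in> carrier M \<and> K +>\<^bsub>M\<^esub> v = K +>\<^bsub>M\<^esub> w)"
    have "w \<in> carrier M \<and> K +>\<^bsub>M\<^esub> v = K +>\<^bsub>M\<^esub> w" unfolding w_def by (rule someI[of _ v]) (use v in simp)
    then have "\<phi> w = \<phi> v" using cos[OF v] cos[of w] by auto
    then show ?thesis unfolding \<Phi>_def w_def .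
  qed
  show ?thesis
  proof (rule vdim_linear_iso)
    show "abelian_group ?Q"
    proof (rule abelian_groupI)
      fix x assume "x \<in> carrier ?Q"
      then obtain v where v: "v \<in> carrier M" "x = K +>\<^bsub>M\<^esub> v" unfolding carr by auto
      show "\<exists>y\<in>carrier ?Q. y \<oplus>\<^bsub>?Q\<^esub> x = \<zero>\<^bsub>?Q\<^esub>"
        by (rule bexI[of _ "K +>\<^bsub>M\<^esub> (\<ominus>\<^bsub>M\<^esub> v)"]) (use v in \<open>simp_all add: add zero carr M.l_neg\<close>)
    qed (auto simp: carr add zero M.a_ac)
    show "\<Phi> ` carrier ?Q = W" unfolding carr image_image W[symmetric] using \<Phi> by simp
    show "inj_on \<Phi> (carrier ?Q)"
    proof (rule inj_onI)
      fix x y assume "x \<in> carrier ?Q" "y \<in> carrier ?Q" and eq: "\<Phi> x = \<Phi> y"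
      then obtain v w where vw: "v \<in> carrier M" "x = K +>\<^bsub>M\<^esub> v" "w \<in> carrier M" "y = K +>\<^bsub>M\<^esub> w"
        unfolding carr by blast
      then have "\<phi> v = \<phi> w" using eq \<Phi> by simp
      then show "x = y" unfolding vw(2,4) cos[OF vw(1)] cos[OF vw(3)] by simp
    qed
  qed (auto simp: carr add scal \<Phi> \<phi>_add \<phi>_scale smult)
qed

text \<open>A basis of \<open>W\<close> is extended to one of the whole space; the map kills the
  former and fixes the added vectors. Its image serves as the quotient by \<open>W\<close> inside
  the same type.\<close>

lemma linear_with_kernel:
  assumes "subspace W" obtains f where "Vector_Spaces.linear scale scale f" "\<And>v. f v = 0 \<longleftrightarrow> v \<in> W"
proof -
  interpret pair: vector_space_pair scale scale ..
  obtain B where B: "B \<subseteq> W" "independent B" "W \<subseteq> span B" using basis_exists[of W] by metis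
  obtain C where C: "B \<subseteq> C" "independent C" "span C = UNIV"
    using maximal_independent_subset_extend[of B UNIV] B(2) by (metis subset_UNIV UNIV_I top.extremum_uniqueI)
  obtain f where f: "Vector_Spaces.linear scale scale f" "\<forall>c\<in>C. f c = (if c \<in> B then 0 else c)"
    using pair.linear_independent_extend[OF C(2), of "\<lambda>c. if c \<in> B then 0 else c"] by blast
  interpret f: Vector_Spaces.linear scale scale f by (rule f(1))
  have zero: "f v = 0" if "v \<in> span B" for v
    using that by (induction rule: span_induct_alt) (use f(2) C(1) in \<open>auto simp: f.add f.scale\<close>)
  have id: "f v = v" if "v \<in> span (C - B)" for v
    using that by (induction rule: span_induct_alt) (use f(2) in \<open>auto simp: f.add f.scale\<close>)
  have WB: "W = span B" using B span_minimal[OF B(1) assms] by auto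
  have "f v = 0 \<longleftrightarrow> v \<in> W" for v
  proof
    assume v: "f v = 0"
    have "v \<in> span (B \<union> (C - B))" using C by (simp add: Un_absorb1)
    then obtain y z where yz: "y \<in> span B" "z \<in> span (C - B)" "v = y + z" unfolding span_Un by blast
    then have "z = 0" using v zero[OF yz(1)] id[OF yz(2)] by (simp add: f.add)
    then show "v \<in> W" using yz WB by simp
  qed (use zero WB in simp)
  then show ?thesis using that f(1) by blast
qed

end

section \<open>Finite-dimensional subspaces, rank and nullity\<close>

locale fd_space = vector_space scale for scale :: "'a::field \<Rightarrow> 'b::ab_group_add \<Rightarrow> 'b"
begin

definition fin_dim :: "'b set \<Rightarrow> bool" where "fin_dim V \<longleftrightarrow> (\<exists>C. finite C \<and> V \<subseteq> span C)"

lemma fin_dim_subset: "\<lbrakk>fin_dim W; V \<subseteq> W\<rbrakk> \<Longrightarrow> fin_dim V"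
  unfolding fin_dim_def by blast

lemma adapted_basis:
  assumes "subspace U" "subspace W" "U \<subseteq> W" "fin_dim W"
  obtains B B' where "B \<subseteq> B'" "finite B'" "independent B'" "span B = U" "span B' = W"
    "card B = dim U" "card B' = dim W"
proof -
  obtain C where C: "finite C" "W \<subseteq> span C" using assms(4) unfolding fin_dim_def by blast
  obtain B where B: "B \<subseteq> U" "independent B" "U \<subseteq> span B" "card B = dim U" using basis_exists[of U] by metis
  have "B \<subseteq> W" using B(1) assms(3) by blast
  then obtain B' where B': "B \<subseteq> B'" "B' \<subseteq> W" "independent B'" "W \<subseteq> span B'"
    using maximal_independent_subset_extend[of B W] B(2) by metis
  have fin: "finite B'" using independent_span_bound[OF C(1) B'(3)] B'(2) C(2) by blast
  have "span B = U" using B span_minimal[OF B(1) assms(1)] by blast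
  moreover have "span B' = W" using B' span_minimal[OF B'(2) assms(2)] by blast
  moreover have "card B' = dim W" by (rule basis_card_eq_dim[OF B'(2,4,3)])
  ultimately show ?thesis using that B'(1,3) fin B(4) by blast
qed

lemma dim_mono_fd: "\<lbrakk>subspace U; subspace W; U \<subseteq> W; fin_dim W\<rbrakk> \<Longrightarrow> dim U \<le> dim W"
  by (metis adapted_basis card_mono)

lemma dim_eq_imp_eq:
  assumes "subspace U" "subspace W" "U \<subseteq> W" "fin_dim W" "dim W \<le> dim U" shows "U = W"
proof -
  obtain B B' where B: "B \<subseteq> B'" "finite B'" "span B = U" "span B' = W" "card B = dim U" "card B' = dim W"
    using adapted_basis[OF assms(1-4)] by metis
  then have "B = B'" using assms(5) card_seteq[of B' B] by simp
  then show ?thesis using B by simp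
qed

lemma subspace_zero: "subspace {0}" by (simp add: subspace_def)

lemma dim_zero: "dim {0} = 0"
  using dim_eq_card_independent[of "{}"] by (metis card.empty dim_span independent_empty span_empty)

lemma fin_dim_zero: "fin_dim {0}" unfolding fin_dim_def by (intro exI[of _ "{}"]) auto

lemma dim_zero_imp:
  assumes "subspace W" "fin_dim W" "dim W = 0" shows "W = {0}"
  using dim_eq_imp_eq[OF subspace_zero assms(1) _ assms(2)] assms subspace_0[OF assms(1)] dim_zero by auto

end

locale fd_pair = vs1: fd_space s1 + vs2: fd_space s2
  for s1 :: "'a::field \<Rightarrow> 'b::ab_group_add \<Rightarrow> 'b" and s2 :: "'a \<Rightarrow> 'c::ab_group_add \<Rightarrow> 'c"
begin

sublocale vector_space_pair s1 s2 by unfold_locales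

lemma rank_nullity_global:
  assumes f: "Vector_Spaces.linear s1 s2 f" and W: "vs1.subspace W" "vs1.fin_dim W"
  shows "vs2.subspace (f ` W) \<and> vs2.fin_dim (f ` W) \<and> vs2.dim (f ` W) + vs1.dim {w \<in> W. f w = 0} = vs1.dim W"
proof -
  interpret f: Vector_Spaces.linear s1 s2 f by fact
  let ?U = "{w \<in> W. f w = 0}"
  have U: "vs1.subspace ?U"
    using W(1) by (auto simp: vs1.subspace_def f.add f.scale f.zero)
  obtain B B' where B: "B \<subseteq> B'" "finite B'" "vs1.independent B'" "vs1.span B = ?U" "vs1.span B' = W"
    "card B = vs1.dim ?U" "card B' = vs1.dim W"
    using vs1.adapted_basis[OF U W(1) _ W(2)] by (metis (mono_tags, lifting) mem_Collect_eq subsetI)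
  let ?D = "B' - B"
  have Bz: "f b = 0" if "b \<in> B" for b using that B(4) vs1.span_base[of b B] by blast
  have iD: "vs1.independent ?D" using vs1.independent_mono[OF B(3)] by blast
  have inj: "inj_on f (vs1.span ?D)"
  proof (rule inj_onI)
    fix x y assume x: "x \<in> vs1.span ?D" and y: "y \<in> vs1.span ?D" and "f x = f y"
    then have z: "f (x - y) = 0" "x - y \<in> vs1.span ?D" by (auto simp: f.diff vs1.span_diff)
    then have "x - y \<in> vs1.span B'" using vs1.span_mono[of ?D B'] by blast
    then have "x - y \<in> vs1.span B" using z B(4,5) by blast
    moreover have "vs1.span B \<inter> vs1.span ?D = {0}"
    proof -
      have "v = 0" if v: "v \<in> vs1.span B" "v \<in> vs1.span ?D" for v
      proof -
        have "vs1.representation B' v = vs1.representation B v" "vs1.representation B' v = vs1.representation ?D v"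
          using vs1.representation_extend[OF B(3) v(1) B(1)] vs1.representation_extend[OF B(3) v(2)] by auto
        then have "vs1.representation B' v b = 0" for b
          using vs1.representation_ne_zero[of B v b] vs1.representation_ne_zero[of ?D v b] by auto
        moreover have "v \<in> vs1.span B'" using v(1) vs1.span_mono[OF B(1)] by blast
        ultimately show "v = 0" using vs1.sum_representation_eq[OF B(3) _ B(2) order_refl, of v] by simp
      qed
      then show ?thesis using vs1.span_zero by blast
    qed
    ultimately show "x = y" using z by (metis IntI right_minus_eq singletonD)
  qed
  have iF: "vs2.independent (f ` ?D)" using f.independent_injective_image[OF iD inj] .
  have fW: "f ` W = vs2.span (f ` ?D)"
  proof -
    have "f ` W = vs2.span (f ` B')" using f.span_image[of B'] B(5) by simp
    also have "vs2.span (f ` B') = vs2.span (f ` ?D)"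
    proof (rule subset_antisym)
      have "f ` B' \<subseteq> vs2.span (f ` ?D)"
      proof (rule image_subsetI)
        fix b assume "b \<in> B'"
        then show "f b \<in> vs2.span (f ` ?D)" by (cases "b \<in> B") (auto simp: Bz vs2.span_zero intro: vs2.span_base)
      qed
      then show "vs2.span (f ` B') \<subseteq> vs2.span (f ` ?D)" by (rule vs2.span_minimal) (rule vs2.subspace_span)
      show "vs2.span (f ` ?D) \<subseteq> vs2.span (f ` B')" by (rule vs2.span_mono) blast
    qed
    finally show ?thesis by simp
  qed
  have "vs2.dim (f ` W) = card (f ` ?D)" unfolding fW using vs2.dim_span_eq_card_independent[OF iF] .
  also have "\<dots> = card ?D" by (rule card_image[OF inj_on_subset[OF inj vs1.span_superset]])
  also have "\<dots> = card B' - card B" using card_Diff_subset[OF finite_subset[OF B(1,2)] B(1)] .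
  finally have "vs2.dim (f ` W) + vs1.dim ?U = vs1.dim W" using B card_mono[OF B(2,1)] by simp
  moreover have "vs2.fin_dim (f ` W)" unfolding vs2.fin_dim_def by (rule exI[of _ "f ` ?D"]) (use B(2) in \<open>simp add: fW\<close>)
  ultimately show ?thesis using f.subspace_image[OF W(1)] by blast
qed

text \<open>A basis of \<open>W\<close> determines a global linear map, which then agrees with
  \<open>f\<close> on \<open>W\<close>. So rank and nullity become available for maps that are
  linear on \<open>W\<close> alone, such as coordinate maps on S.\<close>

lemma linear_on_extend:
  assumes W: "vs1.subspace W" and add: "\<And>v w. \<lbrakk>v \<in> W; w \<in> W\<rbrakk> \<Longrightarrow> f (v + w) = f v + f w"
    and scale: "\<And>c v. v \<in> W \<Longrightarrow> f (s1 c v) = s2 c (f v)"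
  obtains g where "Vector_Spaces.linear s1 s2 g" "\<And>v. v \<in> W \<Longrightarrow> g v = f v"
proof -
  obtain B where B: "B \<subseteq> W" "vs1.independent B" "W \<subseteq> vs1.span B" using vs1.basis_exists[of W] by metis
  obtain g where g: "Vector_Spaces.linear s1 s2 g" "\<forall>b\<in>B. g b = f b" using linear_independent_extend[OF B(2)] by blast
  interpret g: Vector_Spaces.linear s1 s2 g by (rule g(1))
  have f0: "f 0 = 0" using add[of 0 0] vs1.subspace_0[OF W] by simp
  have "v \<in> W \<and> g v = f v" if "v \<in> vs1.span B" for v
    using that
  proof (induction rule: vs1.span_induct_alt)
    case (step c b v)
    then have b: "b \<in> W" "s1 c b \<in> W" using B(1) vs1.subspace_scale[OF W] by auto
    then show ?case using step g(2) add[of "s1 c b" v] scale[OF b(1)] vs1.subspace_add[OF W] by (simp add: g.add g.scale)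
  qed (simp add: f0 g.zero vs1.subspace_0[OF W])
  then show ?thesis using that g(1) B(3) by blast
qed

lemma rank_nullity:
  assumes W: "vs1.subspace W" "vs1.fin_dim W" and add: "\<And>v w. \<lbrakk>v \<in> W; w \<in> W\<rbrakk> \<Longrightarrow> f (v + w) = f v + f w"
    and scale: "\<And>c v. v \<in> W \<Longrightarrow> f (s1 c v) = s2 c (f v)"
  shows "vs2.subspace (f ` W)" "vs2.fin_dim (f ` W)" "vs2.dim (f ` W) + vs1.dim {w \<in> W. f w = 0} = vs1.dim W"
proof -
  obtain g where g: "Vector_Spaces.linear s1 s2 g" "\<And>v. v \<in> W \<Longrightarrow> g v = f v"
    using linear_on_extend[OF W(1) add scale] by metis
  have "f ` W = g ` W" "{w \<in> W. f w = 0} = {w \<in> W. g w = 0}" using g(2) by (auto intro!: image_cong)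
  then show "vs2.subspace (f ` W)" "vs2.fin_dim (f ` W)" "vs2.dim (f ` W) + vs1.dim {w \<in> W. f w = 0} = vs1.dim W"
    using rank_nullity_global[OF g(1) W] by auto
qed

lemma fin_dim_by_image:
  assumes f: "Vector_Spaces.linear s1 s2 f" and W: "vs1.subspace W"
    and fin: "vs1.fin_dim {w \<in> W. f w = 0}" "vs2.fin_dim (f ` W)"
  shows "vs1.fin_dim W"
proof -
  interpret f: Vector_Spaces.linear s1 s2 f by fact
  obtain C where C: "finite C" "{w \<in> W. f w = 0} \<subseteq> vs1.span C" using fin(1) unfolding vs1.fin_dim_def by blast
  obtain B B' where B: "finite B'" "vs2.span B' = f ` W"
    using vs2.adapted_basis[OF vs2.subspace_zero f.subspace_image[OF W] _ fin(2)] vs2.subspace_0[OF f.subspace_image[OF W]]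
    by (metis empty_subsetI insert_subset)
  have "B' \<subseteq> f ` W" using B(2) vs2.span_superset by blast
  then obtain D where D: "D \<subseteq> W" "finite D" "B' = f ` D" using finite_subset_image[OF B(1)] by blast
  have "W \<subseteq> vs1.span (C \<union> D)"
  proof
    fix w assume w: "w \<in> W"
    then have "f w \<in> f ` (vs1.span D)" using B(2) D(3) f.span_image[of D] by auto
    then obtain v where v: "v \<in> vs1.span D" "f w = f v" by blast
    have "v \<in> W" using v(1) vs1.span_minimal[OF D(1) W] by blast
    then have "w - v \<in> vs1.span C" using C(2) w v(2) vs1.subspace_diff[OF W w] by (auto simp: f.diff)
    then have "(w - v) + v \<in> vs1.span (C \<union> D)"
      using v(1) vs1.span_mono[of C "C \<union> D"] vs1.span_mono[of D "C \<union> D"] by (intro vs1.span_add) auto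
    then show "w \<in> vs1.span (C \<union> D)" by simp
  qed
  then show ?thesis unfolding vs1.fin_dim_def using C(1) D(2) by blast
qed

end

global_interpretation fun_vs: fd_space "\<lambda>(c::'k::field) f x. c * f x"
  by unfold_locales (auto simp: algebra_simps fun_eq_iff)

lemma subspace_supported: "fun_vs.subspace {f :: 'b \<Rightarrow> 'k::field. \<forall>x. x \<notin> B \<longrightarrow> f x = 0}"
  by (auto simp: fun_vs.subspace_def)

lemma dim_supported:
  assumes "finite B"
  shows "fun_vs.fin_dim {f :: 'b \<Rightarrow> 'k::field. \<forall>x. x \<notin> B \<longrightarrow> f x = 0} \<and>
    fun_vs.dim {f :: 'b \<Rightarrow> 'k::field. \<forall>x. x \<notin> B \<longrightarrow> f x = 0} = card B"
  using assms
proof (induction B rule: finite_induct)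
  case empty
  have "{f :: 'b \<Rightarrow> 'k. \<forall>x. x \<notin> {} \<longrightarrow> f x = 0} = {0}" by (auto simp: fun_eq_iff)
  then show ?case using fun_vs.fin_dim_zero fun_vs.dim_zero by simp
next
  case (insert b B)
  let ?W = "{f :: 'b \<Rightarrow> 'k. \<forall>x. x \<notin> insert b B \<longrightarrow> f x = 0}"
  interpret sp: fd_space "(*) :: 'k \<Rightarrow> 'k \<Rightarrow> 'k" by unfold_locales (auto simp: algebra_simps)
  interpret pair: fd_pair "\<lambda>(c::'k) (f::'b \<Rightarrow> 'k) x. c * f x" "(*)" by unfold_locales
  have lin: "Vector_Spaces.linear (\<lambda>(c::'k) (f::'b \<Rightarrow> 'k) x. c * f x) (*) (\<lambda>f. f b)"
    by unfold_locales auto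
  have ker: "{f \<in> ?W. f b = 0} = {f. \<forall>x. x \<notin> B \<longrightarrow> f x = 0}" using insert.hyps by auto
  have im: "(\<lambda>f. f b) ` ?W = UNIV"
  proof -
    have "c \<in> (\<lambda>f. f b) ` ?W" for c by (rule image_eqI[of _ _ "\<lambda>x. if x = b then c else 0"]) auto
    then show ?thesis by blast
  qed
  have spU: "sp.span {1} = UNIV" by (auto simp: sp.span_singleton image_iff)
  then have fU: "sp.fin_dim UNIV" unfolding sp.fin_dim_def by (intro exI[of _ "{1}"]) auto
  have dU: "sp.dim UNIV = 1" using sp.dim_span_eq_card_independent[of "{1}"] spU by simp
  have fW: "fun_vs.fin_dim ?W"
    by (rule pair.fin_dim_by_image[OF lin subspace_supported]) (use ker im fU insert.IH in simp_all)
  have "sp.dim ((\<lambda>f. f b) ` ?W) + fun_vs.dim {f \<in> ?W. f b = 0} = fun_vs.dim ?W"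
    by (rule pair.rank_nullity(3)[OF subspace_supported fW]) auto
  then show ?case using fW insert ker im dU by simp
qed

section \<open>Dehomogenization\<close>

abbreviation sc :: "'k::field \<Rightarrow> 'k mpoly \<Rightarrow> 'k mpoly" where
  "sc c f \<equiv> Poly_Mapping.single 0 c * f"

global_interpretation mp: fd_space "sc :: 'k::field \<Rightarrow> _"
  by unfold_locales (simp_all add: algebra_simps single_add mult_single flip: mult.assoc)

lemma sc_hom: "f \<in> hom_piece n i \<Longrightarrow> sc c f \<in> hom_piece n i"
  using hom_piece_mult[OF hom_piece_const, of f n i c] by simp

lemma sc_carr: "f \<in> carrier (poly_ring n) \<Longrightarrow> sc c f \<in> carrier (poly_ring n)"
  by (intro poly_ring_intros)

lemma deg_below_add: "\<lbrakk>deg_below m f; deg_below m g\<rbrakk> \<Longrightarrow> deg_below m (f + g)"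
  using Poly_Mapping.keys_add[of f g] unfolding deg_below_def by blast

lemma deg_below_zero [simp]: "deg_below m 0" by (simp add: deg_below_def)

lemma deg_below_mult:
  assumes "deg_below (Suc a) f" "deg_below b g" shows "deg_below (a + b) (f * g)"
  unfolding deg_below_def
proof
  fix t assume "t \<in> Poly_Mapping.keys (f * g)"
  then obtain u v where uv: "t = u + v" "u \<in> Poly_Mapping.keys f" "v \<in> Poly_Mapping.keys g"
    using keys_mult[of f g] by blast
  then have "total_deg u < Suc a" "total_deg v < b" using assms unfolding deg_below_def by auto
  then show "total_deg t < a + b" unfolding uv(1) total_deg_plus by simp
qed

lemma deg_below_const: "deg_below (Suc 0) (Poly_Mapping.single 0 c)"
  by (simp add: deg_below_def)

lemma deg_below_sc: "deg_below m f \<Longrightarrow> deg_below m (sc c f)"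
  using deg_below_mult[OF deg_below_const, of m f c] by simp

lemma deg_below_hom: "f \<in> hom_piece n i \<Longrightarrow> i < m \<Longrightarrow> deg_below m f"
  by (auto simp: deg_below_def hom_piece_def)

lemma deg_below_0: "deg_below 0 f \<Longrightarrow> f = 0"
  by (simp add: deg_below_def)

context hom_ideal
begin

abbreviation P where "P \<equiv> carrier (poly_ring n) :: 'k mpoly set"
abbreviation rc where "rc \<equiv> residue_class n I"
abbreviation R where "R \<equiv> coord_ring n I"

lemma rc_mem: "x \<in> rc f \<longleftrightarrow> x - f \<in> I"
proof -
  have "x \<in> rc f \<longleftrightarrow> (\<exists>i\<in>I. x = i + f)"
    by (auto simp: residue_class_def a_r_coset_def' poly_ring_simps)
  also have "\<dots> \<longleftrightarrow> x - f \<in> I" by (auto simp: algebra_simps intro!: bexI[of _ "x - f"])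
  finally show ?thesis .
qed

lemma rc_eq_iff: "rc f = rc g \<longleftrightarrow> f - g \<in> I"
proof
  assume "rc f = rc g"
  moreover have "f \<in> rc f" by (simp add: rc_mem I_zero)
  ultimately show "f - g \<in> I" by (simp add: rc_mem)
next
  assume *: "f - g \<in> I"
  have "x - f \<in> I \<longleftrightarrow> x - g \<in> I" for x
    using I_add[OF _ *, of "x - f"] I_diff[OF _ *, of "x - g"] by auto
  then show "rc f = rc g" by (auto simp: rc_mem)
qed

lemma rc_zero_eq: "rc 0 = I" by (auto simp: rc_mem)

lemma carrier_R: "carrier R = rc ` P"
  unfolding coord_ring_def FactRing_def A_RCOSETS_def' residue_class_def by auto

lemma rc_closed [simp]: "f \<in> P \<Longrightarrow> rc f \<in> carrier R"
  by (simp add: carrier_R)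

lemma mult_R: "\<lbrakk>f \<in> P; g \<in> P\<rbrakk> \<Longrightarrow> rc f \<otimes>\<^bsub>R\<^esub> rc g = rc (f * g)"
  using ideal.rcoset_mult_add[OF ideal_I, of f g]
  by (simp add: coord_ring_def FactRing_def residue_class_def poly_ring_simps)

lemma add_R: "\<lbrakk>f \<in> P; g \<in> P\<rbrakk> \<Longrightarrow> rc f \<oplus>\<^bsub>R\<^esub> rc g = rc (f + g)"
proof -
  assume fg: "f \<in> P" "g \<in> P"
  interpret cring "poly_ring n :: 'k mpoly ring" by (rule cring_poly_ring)
  have "abelian_subgroup I (poly_ring n)"
    by (rule abelian_subgroupI3[OF ideal.axioms(1)[OF ideal_I] abelian_group_axioms])
  from abelian_subgroup.a_rcos_sum[OF this fg] show ?thesis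
    by (simp add: coord_ring_def FactRing_def residue_class_def poly_ring_simps)
qed

lemma zero_R: "\<zero>\<^bsub>R\<^esub> = rc 0" by (simp add: coord_ring_def FactRing_def rc_zero_eq)

lemma one_R: "\<one>\<^bsub>R\<^esub> = rc 1" by (simp add: coord_ring_def FactRing_def residue_class_def poly_ring_simps)

lemma cring_R: "cring R"
  unfolding coord_ring_def by (rule ideal.quotient_is_cring[OF ideal_I cring_poly_ring])

lemma RE: assumes "x \<in> carrier R" obtains f where "f \<in> P" "x = rc f"
  using assms by (auto simp: carrier_R)

lemma uminus_R: "f \<in> P \<Longrightarrow> \<ominus>\<^bsub>R\<^esub> rc f = rc (- f)"
proof -
  interpret cring R by (rule cring_R)
  assume f: "f \<in> P"
  then show ?thesis
    by (intro minus_equality) (simp_all add: add_R zero_R poly_ring_intros)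
qed

lemma minus_R: "\<lbrakk>f \<in> P; g \<in> P\<rbrakk> \<Longrightarrow> rc f \<ominus>\<^bsub>R\<^esub> rc g = rc (f - g)"
  by (simp add: a_minus_def uminus_R add_R poly_ring_intros)

lemma x0_R: "coord_x0 n I = rc X0" by (simp add: coord_x0_def X0_def)

lemma rc_pow: "f \<in> P \<Longrightarrow> rc f [^]\<^bsub>R\<^esub> (k::nat) = rc (f ^ k)"
proof (induction k)
  case 0 then show ?case by (simp add: one_R)
next
  case (Suc k)
  have "f ^ k \<in> P" using Suc(2) by (induction k) (auto intro: poly_ring_intros)
  then show ?case using Suc by (simp add: mult_R mult.commute)
qed

lemma coord_piece_nat: "coord_piece n I (int i) = rc ` hom_piece n i"
  by (simp add: coord_piece_def poly_piece_int)

lemma coord_piece_neg: "i < 0 \<Longrightarrow> coord_piece n I i = {rc 0}"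
  by (simp add: coord_piece_def poly_piece_neg)

lemma coord_pieces: "(\<Union>i. coord_piece n I i) = (\<Union>i. rc ` hom_piece n i)"
proof -
  have "coord_piece n I i \<subseteq> (\<Union>i. rc ` hom_piece n i)" for i
  proof (cases "i < 0")
    case True
    then show ?thesis using coord_piece_neg[OF True] hom_piece_zero[of n 0] by blast
  next
    case False
    then show ?thesis using coord_piece_nat[of "nat i"] by auto
  qed
  moreover have "rc ` hom_piece n i \<subseteq> (\<Union>i. coord_piece n I i)" for i
    unfolding coord_piece_nat[symmetric] by (rule UN_upper) simp
  ultimately show ?thesis by (intro equalityI UN_least)
qed

end

locale nzd_ideal = hom_ideal n I for n and I :: "'k::field mpoly set" +
  assumes nzd: "\<lbrakk>f \<in> carrier (poly_ring n); X0 * f \<in> I\<rbrakk> \<Longrightarrow> f \<in> I"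
begin

lemma nzd_pow: "f \<in> P \<Longrightarrow> X0 ^ k * f \<in> I \<Longrightarrow> f \<in> I"
proof (induction k)
  case (Suc k)
  have "X0 ^ k * f \<in> P" using Suc.prems(1) X0_carr by (intro poly_ring_intros)
  then show ?case using Suc nzd[of "X0 ^ k * f"] by (simp add: mult.assoc)
qed simp

text \<open>The ideal of the affine scheme in \<open>X\<^sub>0 \<noteq> 0\<close>, with \<open>X\<^sub>0\<close> kept as a variable.\<close>
definition It :: "'k mpoly set" where "It = {g + (X0 - 1) * h | g h. g \<in> I \<and> h \<in> P}"

lemma It_I: "\<lbrakk>g \<in> I; h \<in> P\<rbrakk> \<Longrightarrow> g + (X0 - 1) * h \<in> It" unfolding It_def by blast

lemma ItE: assumes "f \<in> It" obtains g h where "g \<in> I" "h \<in> P" "f = g + (X0 - 1) * h"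
  using assms unfolding It_def by blast

lemma I_sub_It: "f \<in> I \<Longrightarrow> f \<in> It" using It_I[of f 0] by (simp add: const_in_poly_ring)

lemma It_zero [simp]: "0 \<in> It" using I_sub_It I_zero by blast

lemma It_carr: "f \<in> It \<Longrightarrow> f \<in> P"
  by (elim ItE) (simp add: poly_ring_intros I_carr X0_carr)

lemma It_add: "\<lbrakk>f \<in> It; g \<in> It\<rbrakk> \<Longrightarrow> f + g \<in> It"
proof -
  assume "f \<in> It" "g \<in> It"
  then obtain a b c d where 1: "a \<in> I" "b \<in> P" "f = a + (X0 - 1) * b" "c \<in> I" "d \<in> P" "g = c + (X0 - 1) * d"
    by (metis ItE)
  have "f + g = (a + c) + (X0 - 1) * (b + d)" unfolding 1(3,6) by (simp add: algebra_simps)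
  then show ?thesis using It_I[of "a + c" "b + d"] 1 I_add poly_ring_intros(2) by metis
qed

lemma It_mult: "\<lbrakk>f \<in> It; p \<in> P\<rbrakk> \<Longrightarrow> p * f \<in> It"
proof -
  assume "f \<in> It" and p: "p \<in> P"
  then obtain a b where 1: "a \<in> I" "b \<in> P" "f = a + (X0 - 1) * b" by (metis ItE)
  have "p * f = p * a + (X0 - 1) * (p * b)" unfolding 1(3) by (simp add: algebra_simps)
  then show ?thesis using It_I[of "p * a" "p * b"] 1 p I_mult poly_ring_intros(1) by metis
qed

lemma It_mult': "\<lbrakk>f \<in> It; p \<in> P\<rbrakk> \<Longrightarrow> f * p \<in> It" using It_mult by (simp add: mult.commute)

lemma It_uminus: "f \<in> It \<Longrightarrow> - f \<in> It" using It_mult[of f "- 1"] by (simp add: poly_ring_intros)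

lemma It_diff: "\<lbrakk>f \<in> It; g \<in> It\<rbrakk> \<Longrightarrow> f - g \<in> It" using It_add[of f "- g"] It_uminus by simp

lemma It_sum: "(\<And>j. j \<in> A \<Longrightarrow> f j \<in> It) \<Longrightarrow> (\<Sum>j\<in>A. f j) \<in> It"
  by (induction A rule: infinite_finite_induct) (auto intro: It_add)

lemma X0_minus_one: "f \<in> P \<Longrightarrow> X0 * f - f \<in> It"
  using It_I[OF I_zero, of f] by (simp add: algebra_simps)

lemma X0_pow_minus_one: "f \<in> P \<Longrightarrow> X0 ^ k * f - f \<in> It"
proof (induction k)
  case (Suc k)
  have "X0 ^ k * f \<in> P" using Suc.prems X0_carr by (intro poly_ring_intros)
  then have "(X0 * (X0 ^ k * f) - X0 ^ k * f) + (X0 ^ k * f - f) \<in> It"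
    using X0_minus_one Suc It_add by blast
  then show ?case by (simp add: algebra_simps)
qed simp

text \<open>Write \<open>f = g + (X0 - 1) * h\<close>. Away from degree \<open>i\<close> the
  components satisfy \<open>h_m = g_m + X0 h_(m-1)\<close>. Below \<open>i\<close> this puts
  \<open>h_m\<close> into \<open>I\<close> going upwards. From \<open>i\<close> on one goes
  downwards from the top degree of \<open>h\<close>: there \<open>X0 h_(m-1)\<close> lies in
  \<open>I\<close>, and \<open>X0\<close> can be cancelled.\<close>

lemma It_hom:
  assumes f: "f \<in> hom_piece n i" "f \<in> It" shows "f \<in> I"
proof -
  obtain g h where gh: "g \<in> I" "h \<in> P" "f = g + (X0 - 1) * h" using f(2) by (rule ItE)
  have c: "cmp m f = cmp m g + cmp m (X0 * h) - cmp m h" for m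
    unfolding gh(3) by (simp add: left_diff_distrib cmp_add cmp_diff)
  have low: "cmp m h \<in> I" if "m < i" for m
    using that
  proof (induction m)
    case 0
    then have "cmp 0 h = cmp 0 g" using c[of 0] cmp_hom[OF f(1), of 0] cmp_X0_mult(2)[OF gh(2)] by simp
    then show ?case using I_cmp[OF gh(1)] by simp
  next
    case (Suc m)
    then have "cmp (Suc m) h = cmp (Suc m) g + X0 * cmp m h"
      using c[of "Suc m"] cmp_hom[OF f(1), of "Suc m"] cmp_X0_mult(1)[OF gh(2)] by simp
    then show ?case using I_cmp[OF gh(1)] I_add I_mult[OF _ X0_carr(1)] Suc by auto
  qed
  obtain N where N: "deg_below N h" using deg_below_ex by blast
  have high: "cmp m h \<in> I" if "i \<le> m" for m
  proof -
    have "cmp (m + (N - k)) h \<in> I" if "k \<le> N" for k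
      using that
    proof (induction k)
      case 0
      then show ?case using deg_below_cmp[OF N, of "m + N"] I_zero by simp
    next
      case (Suc k)
      define j where "j = m + (N - Suc k)"
      have j: "Suc j = m + (N - k)" "i < Suc j" using Suc.prems \<open>i \<le> m\<close> by (auto simp: j_def)
      have "X0 * cmp j h = cmp (Suc j) h - cmp (Suc j) g"
        using c[of "Suc j"] cmp_hom[OF f(1), of "Suc j"] j(2) cmp_X0_mult(1)[OF gh(2)] by (simp add: algebra_simps)
      then have "X0 * cmp j h \<in> I" using I_diff[OF _ I_cmp[OF gh(1)]] Suc j(1) by simp
      then show ?case using nzd[OF cmp_carr[OF gh(2)]] unfolding j_def by blast
    qed
    from this[of N] show ?thesis by simp
  qed
  have "h \<in> I" by (rule I_by_cmp) (use low high in \<open>meson not_le\<close>)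
  then have "g + (X0 - 1) * h \<in> I"
    by (intro I_add gh(1) I_mult) (auto intro: poly_ring_intros X0_carr)
  then show ?thesis using gh(3) by simp
qed

lemma It_hom_diff: "\<lbrakk>f \<in> hom_piece n i; g \<in> hom_piece n i; f - g \<in> It\<rbrakk> \<Longrightarrow> f - g \<in> I"
  by (rule It_hom[OF hom_piece_diff])

text \<open>Homogenization to degree \<open>N\<close>. Components above \<open>N\<close> are
  dropped, so it agrees with \<open>f\<close> in S under the bound of
  \<open>hz_cong\<close>.\<close>

definition hz :: "nat \<Rightarrow> 'k mpoly \<Rightarrow> 'k mpoly" where "hz N f = (\<Sum>i\<le>N. X0 ^ (N - i) * cmp i f)"

lemma hz_hom: "f \<in> P \<Longrightarrow> hz N f \<in> hom_piece n N"
  unfolding hz_def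
proof (rule hom_piece_sum)
  fix i assume "f \<in> P" "i \<in> {..N}"
  then show "X0 ^ (N - i) * cmp i f \<in> hom_piece n N"
    using X0_mult_hom[OF cmp_in_hom_piece, of f n "N - i" i] by simp
qed

lemma hz_cong:
  assumes "f \<in> P" "deg_below (Suc N) f" shows "hz N f - f \<in> It"
proof -
  have "f = (\<Sum>i\<le>N. cmp i f)" using cmp_decomp[OF assms(2)] by (simp add: lessThan_Suc_atMost)
  then have "hz N f - f = (\<Sum>i\<le>N. X0 ^ (N - i) * cmp i f - cmp i f)"
    unfolding hz_def by (simp add: sum_subtractf)
  also have "\<dots> \<in> It" by (rule It_sum) (use X0_pow_minus_one cmp_carr[OF assms(1)] in blast)
  finally show ?thesis .
qed

lemma subspace_It: "mp.subspace It"
  by (rule mp.subspaceI) (auto intro: It_add It_mult const_in_poly_ring)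

text \<open>A linear endomorphism with kernel \<open>It\<close>: its image of \<open>P\<close> is a copy of \<open>S\<close> inside the polynomials, with no
  cosets involved.\<close>
definition nu :: "'k mpoly \<Rightarrow> 'k mpoly" where
  "nu = (SOME f. Vector_Spaces.linear sc sc f \<and> (\<forall>v. f v = 0 \<longleftrightarrow> v \<in> It))"

lemma nu: "Vector_Spaces.linear sc sc nu" "nu v = 0 \<longleftrightarrow> v \<in> It"
proof -
  have "\<exists>f. Vector_Spaces.linear sc sc f \<and> (\<forall>v. f v = 0 \<longleftrightarrow> v \<in> It)"
    using mp.linear_with_kernel[OF subspace_It] by metis
  from someI_ex[OF this] show "Vector_Spaces.linear sc sc nu" "nu v = 0 \<longleftrightarrow> v \<in> It"
    unfolding nu_def by blast+
qed

sublocale nu: Vector_Spaces.linear sc sc nu by (rule nu(1))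

lemma nu_eq_iff: "nu f = nu g \<longleftrightarrow> f - g \<in> It"
  using nu(2)[of "f - g"] by (simp add: nu.diff)

text \<open>Strict degree bound: \<open>Vs (Suc i)\<close> consists of the dehomogenizations of forms of degree \<open>i\<close>.\<close>
definition Vs :: "nat \<Rightarrow> 'k mpoly set" where "Vs m = nu ` {f \<in> P. deg_below m f}"

definition S :: "'k mpoly set" where "S = nu ` P"

lemma VsI: "\<lbrakk>f \<in> P; deg_below m f\<rbrakk> \<Longrightarrow> nu f \<in> Vs m" unfolding Vs_def by blast

lemma Vs_mono: "m \<le> m' \<Longrightarrow> Vs m \<subseteq> Vs m'" unfolding Vs_def using deg_below_mono by blast

lemma Vs_sub_S: "Vs m \<subseteq> S" unfolding Vs_def S_def by blast

lemma S_Vs: "s \<in> S \<Longrightarrow> \<exists>m. s \<in> Vs m" unfolding Vs_def S_def using deg_below_ex by blast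

lemma subspace_Vs: "mp.subspace (Vs m)"
proof -
  have "mp.subspace {f \<in> P. deg_below m f}"
    by (rule mp.subspaceI) (auto intro: poly_ring_intros deg_below_add deg_below_sc)
  then show ?thesis unfolding Vs_def by (rule nu.subspace_image)
qed

lemma subspace_S: "mp.subspace S"
proof -
  have "mp.subspace P" by (rule mp.subspaceI) (auto intro: poly_ring_intros)
  then show ?thesis unfolding S_def by (rule nu.subspace_image)
qed

lemma Vs_0: "Vs 0 = {0}"
proof -
  have "{f \<in> P. deg_below 0 f} = {0}" using deg_below_0 by (auto intro: poly_ring_intros)
  then show ?thesis by (simp add: Vs_def nu.zero)
qed

lemma nu_hom: "nu ` hom_piece n i = Vs (Suc i)"
proof
  show "nu ` hom_piece n i \<subseteq> Vs (Suc i)" using VsI hom_piece_carr deg_below_hom by blast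
  show "Vs (Suc i) \<subseteq> nu ` hom_piece n i"
  proof
    fix v assume "v \<in> Vs (Suc i)"
    then obtain f where f: "f \<in> P" "deg_below (Suc i) f" "v = nu f" unfolding Vs_def by blast
    then have "v = nu (hz i f)" using nu_eq_iff hz_cong It_uminus[of "hz i f - f"] by fastforce
    then show "v \<in> nu ` hom_piece n i" using hz_hom[OF f(1)] by blast
  qed
qed

lemma Vs_hom: "v \<in> Vs (Suc i) \<Longrightarrow> \<exists>f\<in>hom_piece n i. v = nu f"
  using nu_hom by blast

end

section \<open>Points at infinity and non-zero-divisors\<close>

text \<open>The elements of \<open>I\<close> all of whose components lie in \<open>I\<close> form an
  ideal, and this ideal contains the homogeneous generators.\<close>

lemma hom_ideal_Idl:
  assumes hom: "homogeneous_ideal (poly_ring n) (poly_piece n) (I :: 'k::field mpoly set)"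
  shows "hom_ideal n I"
proof -
  interpret P: cring "poly_ring n :: 'k mpoly ring" by (rule cring_poly_ring)
  obtain H where H: "H \<subseteq> (\<Union>i. poly_piece n i)" "I = Idl\<^bsub>poly_ring n\<^esub> H" and I: "ideal I (poly_ring n)"
    using hom unfolding homogeneous_ideal_def by blast
  interpret I: ideal I "poly_ring n" by fact
  have Ic: "\<And>f. f \<in> I \<Longrightarrow> f \<in> carrier (poly_ring n)" using I.Icarr by blast
  have I0: "0 \<in> I" using I.zero_closed by (simp add: poly_ring_simps)
  have Ia: "f + g \<in> I" if "f \<in> I" "g \<in> I" for f g using I.a_closed[OF that] by (simp add: poly_ring_simps)
  have Im: "g * f \<in> I" if "f \<in> I" "g \<in> carrier (poly_ring n)" for f g
    using I.I_l_closed[OF that] by (simp add: poly_ring_simps)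
  have Isum: "(\<Sum>i\<in>A. f i) \<in> I" if "\<And>i. i \<in> A \<Longrightarrow> f i \<in> I" for f :: "nat \<Rightarrow> 'k mpoly" and A
    using that by (induction A rule: infinite_finite_induct) (auto intro: Ia I0)
  have Hc: "H \<subseteq> carrier (poly_ring n)" using H(1) unfolding poly_piece_def by auto
  define J where "J = {f \<in> I. \<forall>i. cmp i f \<in> I}"
  have "ideal J (poly_ring n)"
  proof (rule P.ideal_criterion)
    show "J \<subseteq> carrier (poly_ring n)" unfolding J_def using Ic by auto
    show "\<zero>\<^bsub>poly_ring n\<^esub> \<in> J" unfolding J_def using I0 by (simp add: poly_ring_simps)
  next
    fix f g assume "f \<in> J" "g \<in> J"
    then show "f \<oplus>\<^bsub>poly_ring n\<^esub> g \<in> J" unfolding J_def by (auto simp: poly_ring_simps cmp_add intro: Ia)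
  next
    fix g f :: "'k mpoly" assume g: "g \<in> carrier (poly_ring n)" and f: "f \<in> J"
    then have fI: "f \<in> I" "\<And>i. cmp i f \<in> I" "f \<in> carrier (poly_ring n)" unfolding J_def using Ic by auto
    have "cmp k (g * f) \<in> I" for k
    proof -
      obtain N where N: "deg_below N g" using deg_below_ex by blast
      have "cmp k (g * f) = cmp k ((\<Sum>j<N. cmp j g) * f)" using cmp_decomp[OF N] by simp
      also have "\<dots> = (\<Sum>j<N. cmp k (f * cmp j g))" by (simp add: sum_distrib_left cmp_sum mult.commute[of _ f])
      also have "\<dots> = (\<Sum>j<N. if j \<le> k then cmp j g * cmp (k - j) f else 0)"
        by (rule sum.cong) (simp_all add: cmp_mult[OF fI(3) cmp_in_hom_piece[OF g]] mult.commute)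
      also have "\<dots> \<in> I" by (rule Isum) (use fI(2) Im cmp_carr[OF g] I0 in auto)
      finally show ?thesis .
    qed
    then show "g \<otimes>\<^bsub>poly_ring n\<^esub> f \<in> J" unfolding J_def using Im[OF fI(1) g] by (simp add: poly_ring_simps)
  qed
  moreover have "H \<subseteq> J"
  proof
    fix h assume h: "h \<in> H"
    then have hI: "h \<in> I" unfolding H(2) using P.genideal_self[OF Hc] by blast
    obtain i where i: "h \<in> poly_piece n i" using h H(1) by blast
    have "cmp j h \<in> I" for j
    proof (cases "i < 0")
      case True then have "h = 0" using i poly_piece_neg[OF True] by auto
      then show ?thesis using I0 by simp
    next
      case False
      then have "h \<in> hom_piece n (nat i)" using i unfolding poly_piece_int[symmetric] by simp
      then show ?thesis using cmp_hom[of h n "nat i" j] hI I0 by simp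
    qed
    then show "h \<in> J" unfolding J_def using hI by simp
  qed
  ultimately have "I \<subseteq> J" unfolding H(2) by (rule P.genideal_minimal)
  then show ?thesis by unfold_locales (use Ic I0 Ia Im in \<open>auto simp: J_def\<close>)
qed

section \<open>Homogeneous prime ideals above a given ideal\<close>

definition monomials :: "nat \<Rightarrow> nat \<Rightarrow> (nat \<Rightarrow>\<^sub>0 nat) set" where
  "monomials n k = {t. Poly_Mapping.keys t \<subseteq> {0..n} \<and> total_deg t = k}"

lemma finite_monomials: "finite (monomials n k)"
proof (rule inj_on_finite)
  show "inj_on (\<lambda>t. restrict (Poly_Mapping.lookup t) {0..n}) (monomials n k)"
  proof (rule inj_onI)
    fix s t assume st: "s \<in> monomials n k" "t \<in> monomials n k"
      "restrict (Poly_Mapping.lookup s) {0..n} = restrict (Poly_Mapping.lookup t) {0..n}"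
    have "Poly_Mapping.lookup s j = Poly_Mapping.lookup t j" for j
    proof (cases "j \<in> {0..n}")
      case True then show ?thesis using fun_cong[OF st(3), of j] by simp
    next
      case False
      then have "j \<notin> Poly_Mapping.keys s" "j \<notin> Poly_Mapping.keys t" using st unfolding monomials_def by auto
      then show ?thesis by (simp add: in_keys_iff)
    qed
    then show "s = t" by (rule poly_mapping_eqI)
  qed
  show "(\<lambda>t. restrict (Poly_Mapping.lookup t) {0..n}) ` monomials n k \<subseteq> {0..n} \<rightarrow>\<^sub>E {..k}"
  proof (intro image_subsetI PiE_I)
    fix t j assume t: "t \<in> monomials n k" and j: "j \<in> {0..n}"
    have "Poly_Mapping.lookup t j \<le> total_deg t"
    proof (cases "j \<in> Poly_Mapping.keys t")
      case True then show ?thesis unfolding total_deg_def by (intro member_le_sum) auto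
    qed (simp add: in_keys_iff)
    then show "restrict (Poly_Mapping.lookup t) {0..n} j \<in> {..k}" using t j unfolding monomials_def by simp
  qed simp
qed (simp add: finite_PiE)

lemma single_monomial: "t \<in> monomials n k \<Longrightarrow> Poly_Mapping.single t c \<in> hom_piece n k"
  by (auto simp: monomials_def hom_piece_def in_poly_ring)

lemma hom_piece_keys: "f \<in> hom_piece n k \<Longrightarrow> Poly_Mapping.keys f \<subseteq> monomials n k"
  by (auto simp: monomials_def hom_piece_def in_poly_ring)

lemma mpoly_sum_single: "f = (\<Sum>t\<in>Poly_Mapping.keys f. Poly_Mapping.single t (Poly_Mapping.lookup f t))"
proof (rule poly_mapping_eqI)
  fix s
  have "(\<Sum>t\<in>Poly_Mapping.keys f. Poly_Mapping.lookup (Poly_Mapping.single t (Poly_Mapping.lookup f t)) s)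
    = (\<Sum>t\<in>Poly_Mapping.keys f. if t = s then Poly_Mapping.lookup f s else 0)"
    by (rule sum.cong) (auto simp: lookup_single when_def)
  then show "Poly_Mapping.lookup f s = Poly_Mapping.lookup (\<Sum>t\<in>Poly_Mapping.keys f. Poly_Mapping.single t (Poly_Mapping.lookup f t)) s"
    by (auto simp: lookup_sum in_keys_iff)
qed

text \<open>Containing a whole degree becomes a condition on finitely many monomials, which the
  union of a chain can satisfy only if a member does.\<close>

lemma (in hom_ideal) hom_piece_subset_iff:
  "hom_piece n k \<subseteq> I \<longleftrightarrow> (\<lambda>t. Poly_Mapping.single t 1) ` monomials n k \<subseteq> I"
proof
  assume *: "(\<lambda>t. Poly_Mapping.single t 1) ` monomials n k \<subseteq> I"
  show "hom_piece n k \<subseteq> I"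
  proof
    fix f :: "'k mpoly" assume f: "f \<in> hom_piece n k"
    have "Poly_Mapping.single t (Poly_Mapping.lookup f t) \<in> I" if "t \<in> Poly_Mapping.keys f" for t
    proof -
      have "Poly_Mapping.single t 1 \<in> I" using hom_piece_keys[OF f] that * by blast
      then have "sc (Poly_Mapping.lookup f t) (Poly_Mapping.single t 1) \<in> I" by (intro I_mult poly_ring_intros)
      then show ?thesis by (simp add: mult_single)
    qed
    then show "f \<in> I" by (subst mpoly_sum_single) (rule I_sum)
  qed
qed (use single_monomial in blast)

lemma split_monomial:
  "t \<in> monomials n (k + l) \<Longrightarrow> \<exists>u\<in>monomials n k. \<exists>v\<in>monomials n l. t = u + v"
proof (induction k arbitrary: t)
  case 0
  then show ?case by (intro bexI[of _ 0] bexI[of _ t]) (auto simp: monomials_def)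
next
  case (Suc k)
  then have "Poly_Mapping.keys t \<noteq> {}" by (auto simp: monomials_def)
  then obtain j where j: "j \<in> Poly_Mapping.keys t" by blast
  define s where "s = t - Poly_Mapping.single j 1"
  have t: "t = Poly_Mapping.single j 1 + s"
    by (rule poly_mapping_eqI) (use j in \<open>auto simp: s_def lookup_add lookup_minus lookup_single when_def in_keys_iff\<close>)
  have "s \<in> monomials n (k + l)" using Suc.prems unfolding t monomials_def
    by (auto simp: keys_plus_nat total_deg_plus)
  then obtain u v where uv: "u \<in> monomials n k" "v \<in> monomials n l" "s = u + v" using Suc.IH by blast
  have "Poly_Mapping.single j 1 + u \<in> monomials n (Suc k)" using uv(1) Suc.prems unfolding t monomials_def
    by (auto simp: keys_plus_nat total_deg_plus)
  then show ?case using uv unfolding t by (metis add.assoc)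
qed

context hom_ideal
begin

lemma hom_piece_subset_add:
  assumes "\<And>u v. \<lbrakk>u \<in> hom_piece n k; v \<in> hom_piece n l\<rbrakk> \<Longrightarrow> u * v \<in> I"
  shows "hom_piece n (k + l) \<subseteq> I"
  unfolding hom_piece_subset_iff
proof (rule image_subsetI)
  fix t assume "t \<in> monomials n (k + l)"
  then obtain u v where uv: "u \<in> monomials n k" "v \<in> monomials n l" "t = u + v" using split_monomial by blast
  have "Poly_Mapping.single t 1 = Poly_Mapping.single u 1 * Poly_Mapping.single v (1 :: 'k)" by (simp add: uv mult_single)
  then show "Poly_Mapping.single t 1 \<in> I" using assms single_monomial uv by metis
qed

lemma hom_ideal_add_hom:
  assumes a: "a \<in> hom_piece n i" shows "hom_ideal n {f + p * a | f p. f \<in> I \<and> p \<in> P}" (is "hom_ideal n ?K")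
proof
  have KI: "f + p * a \<in> ?K" if "f \<in> I" "p \<in> P" for f p using that by blast
  show "0 \<in> ?K" using KI[OF I_zero const_in_poly_ring(1)] by simp
  fix x assume "x \<in> ?K"
  then obtain f p where x: "f \<in> I" "p \<in> P" "x = f + p * a" by blast
  have ac: "a \<in> P" by (rule hom_piece_carr[OF a])
  show "x \<in> P" unfolding x(3) using x(1,2) I_carr ac by (intro poly_ring_intros) auto
  show "y * x \<in> ?K" if "y \<in> P" for y
    using KI[OF I_mult[OF x(1) that] mult_in_poly_ring[OF that x(2)]] by (simp add: x(3) algebra_simps)
  show "cmp m x \<in> ?K" for m
    using KI[OF I_cmp[OF x(1)] cmp_carr[OF x(2)], of m "m - i"] KI[OF I_cmp[OF x(1)] const_in_poly_ring(1), of m]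
    by (simp add: x(3) cmp_add cmp_mult[OF x(2) a])
  fix y assume "y \<in> ?K"
  then obtain g q where y: "g \<in> I" "q \<in> P" "y = g + q * a" by blast
  show "x + y \<in> ?K"
    using KI[OF I_add[OF x(1) y(1)] add_in_poly_ring[OF x(2) y(2)]] by (simp add: x(3) y(3) algebra_simps)
qed

text \<open>Take the lowest components of \<open>a\<close> and \<open>b\<close> outside
  \<open>I\<close>, in degrees \<open>i\<close> and \<open>j\<close>. In degree \<open>i + j\<close>
  of \<open>a * b\<close> every other product has a factor in \<open>I\<close>.\<close>

lemma prime_by_hom:
  assumes hom: "\<And>a b i j. \<lbrakk>a \<in> hom_piece n i; b \<in> hom_piece n j; a * b \<in> I\<rbrakk> \<Longrightarrow> a \<in> I \<or> b \<in> I"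
    and ab: "a \<in> P" "b \<in> P" "a * b \<in> I"
  shows "a \<in> I \<or> b \<in> I"
proof (rule ccontr)
  assume "\<not> (a \<in> I \<or> b \<in> I)"
  then obtain i0 j0 where n0: "cmp i0 a \<notin> I" "cmp j0 b \<notin> I" using I_by_cmp by metis
  define i where "i = (LEAST i. cmp i a \<notin> I)"
  define j where "j = (LEAST j. cmp j b \<notin> I)"
  have i: "cmp i a \<notin> I" "\<And>k. k < i \<Longrightarrow> cmp k a \<in> I"
    unfolding i_def using n0(1) by (rule LeastI, use not_less_Least in blast)
  have j: "cmp j b \<notin> I" "\<And>k. k < j \<Longrightarrow> cmp k b \<in> I"
    unfolding j_def using n0(2) by (rule LeastI, use not_less_Least in blast)
  obtain N where N: "deg_below N b" "j < N"
    using deg_below_ex[of b] deg_below_mono by (metis lessI less_or_eq_imp_le max.cobounded1 max.strict_coboundedI2)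
  let ?t = "\<lambda>t. if t \<le> i + j then cmp (i + j - t) a * cmp t b else 0"
  have "cmp (i + j) (a * b) = cmp (i + j) (a * (\<Sum>t<N. cmp t b))" using cmp_decomp[OF N(1)] by simp
  also have "\<dots> = (\<Sum>t<N. ?t t)"
    using cmp_mult[OF ab(1) cmp_in_hom_piece[OF ab(2)]] by (simp add: sum_distrib_left cmp_sum)
  also have "\<dots> = ?t j + (\<Sum>t\<in>{..<N} - {j}. ?t t)" by (rule sum.remove) (use N(2) in auto)
  finally have "cmp i a * cmp j b = cmp (i + j) (a * b) - (\<Sum>t\<in>{..<N} - {j}. ?t t)" by simp
  also have "\<dots> \<in> I"
  proof (intro I_diff I_cmp ab(3) I_sum)
    fix t assume "t \<in> {..<N} - {j}"
    then consider "t < j" | "t > j" by force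
    then show "?t t \<in> I"
    proof cases
      case 1 then show ?thesis using I_mult[OF j(2)[OF 1] cmp_carr[OF ab(1)]] by simp
    next
      case 2 then show ?thesis using I_mult'[OF i(2) cmp_carr[OF ab(2)], of "i + j - t"] I_zero by auto
    qed
  qed
  finally show False using hom[OF cmp_in_hom_piece[OF ab(1)] cmp_in_hom_piece[OF ab(2)]] i(1) j(1) by blast
qed

lemma point_of_hom_prime:
  assumes J: "hom_ideal n J" "I \<subseteq> J" and irr: "\<And>k. \<not> hom_piece n k \<subseteq> J"
    and prime: "\<And>a b. \<lbrakk>a \<in> P; b \<in> P; a * b \<in> J\<rbrakk> \<Longrightarrow> a \<in> J \<or> b \<in> J"
  shows "rc ` J \<in> points n I"
proof -
  interpret R: cring R by (rule cring_R)
  interpret J: hom_ideal n J by fact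
  have mem: "rc f \<in> rc ` J \<longleftrightarrow> f \<in> J" for f
  proof
    assume "rc f \<in> rc ` J"
    then obtain g where "g \<in> J" "f - g \<in> I" by (auto simp: rc_eq_iff)
    then have "g + (f - g) \<in> J" using J.I_add J(2) by blast
    then show "f \<in> J" by simp
  qed blast
  have ideal: "ideal (rc ` J) R"
  proof (rule R.ideal_criterion)
    show "rc ` J \<subseteq> carrier R" using J.I_carr by auto
    show "\<zero>\<^bsub>R\<^esub> \<in> rc ` J" unfolding zero_R mem by (rule J.I_zero)
  next
    fix x y assume "x \<in> rc ` J" "y \<in> rc ` J"
    then show "x \<oplus>\<^bsub>R\<^esub> y \<in> rc ` J" using J.I_carr J.I_add by (auto simp: add_R)
  next
    fix r x assume "r \<in> carrier R" "x \<in> rc ` J"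
    then show "r \<otimes>\<^bsub>R\<^esub> x \<in> rc ` J" using J.I_carr J.I_mult by (auto simp: mult_R elim!: RE)
  qed
  have prime: "primeideal (rc ` J) R"
  proof (rule primeidealI[OF ideal cring_R])
    have "rc 1 \<notin> rc ` J" unfolding mem using irr[of 0] J.I_mult[of 1] hom_piece_carr by (metis mult.right_neutral subsetI)
    then show "carrier R \<noteq> rc ` J" using rc_closed const_in_poly_ring(2) by metis
  next
    fix x y assume "x \<in> carrier R" "y \<in> carrier R" and xy: "x \<otimes>\<^bsub>R\<^esub> y \<in> rc ` J"
    then obtain f g where fg: "f \<in> P" "x = rc f" "g \<in> P" "y = rc g" by (metis RE)
    then show "x \<in> rc ` J \<or> y \<in> rc ` J" using xy prime by (simp add: mult_R mem)
  qed
  let ?H = "rc ` J \<inter> (\<Union>i. coord_piece n I i)"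
  have Hc: "?H \<subseteq> carrier R" using J.I_carr by auto
  have "rc ` J = Idl\<^bsub>R\<^esub> ?H"
  proof
    show "Idl\<^bsub>R\<^esub> ?H \<subseteq> rc ` J" by (rule R.genideal_minimal[OF ideal]) blast
    interpret G: ideal "Idl\<^bsub>R\<^esub> ?H" R by (rule R.genideal_ideal[OF Hc])
    show "rc ` J \<subseteq> Idl\<^bsub>R\<^esub> ?H"
    proof (rule image_subsetI)
      fix f assume f: "f \<in> J"
      have c: "rc (cmp i f) \<in> Idl\<^bsub>R\<^esub> ?H" for i
      proof -
        have "rc (cmp i f) \<in> (\<Union>i. coord_piece n I i)" unfolding coord_pieces
          using cmp_in_hom_piece[OF J.I_carr[OF f]] by blast
        then show ?thesis using R.genideal_self[OF Hc] J.I_cmp[OF f] by blast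
      qed
      obtain N where N: "deg_below N f" using deg_below_ex by blast
      have "rc (\<Sum>i<m. cmp i f) \<in> Idl\<^bsub>R\<^esub> ?H" for m
      proof (induction m)
        case 0 show ?case using G.zero_closed by (simp add: zero_R)
      next
        case (Suc m)
        have "rc (\<Sum>i<Suc m. cmp i f) = rc (\<Sum>i<m. cmp i f) \<oplus>\<^bsub>R\<^esub> rc (cmp m f)"
          using J.I_carr[OF f] by (simp add: add_R cmp_carr sum_in_poly_ring)
        then show ?case using G.a_closed[OF Suc c] by simp
      qed
      then show "rc f \<in> Idl\<^bsub>R\<^esub> ?H" using cmp_decomp[OF N] by metis
    qed
  qed
  then have hom: "homogeneous_ideal R (coord_piece n I) (rc ` J)"
    unfolding homogeneous_ideal_def using ideal by blast
  obtain f where "f \<in> hom_piece n 1" "f \<notin> J" using irr[of 1] by blast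
  then have "rc f \<in> coord_piece n I (int 1)" "rc f \<notin> rc ` J" unfolding coord_piece_nat mem by auto
  then have "\<not> (\<Union>i\<in>{1..}. coord_piece n I i) \<subseteq> rc ` J" by force
  then show ?thesis unfolding points_def using prime hom by blast
qed

text \<open>An ideal maximal among the homogeneous ideals above \<open>J0\<close> that contain no
  full degree is prime. Adjoining a form outside it captures some full degree; if the product of two
  such forms were inside, then so would be the full degree \<open>k + l\<close>, where
  \<open>k\<close> and \<open>l\<close> are the degrees captured.\<close>

lemma ex_point_above:
  assumes J0: "hom_ideal n J0" "I \<subseteq> J0" and irr: "\<And>k. \<not> hom_piece n k \<subseteq> J0"
  obtains J where "J0 \<subseteq> J" "rc ` J \<in> points n I"
proof -
  define S where "S = {J. hom_ideal n J \<and> J0 \<subseteq> J \<and> (\<forall>k. \<not> hom_piece n k \<subseteq> J)}"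
  have "J0 \<in> S" unfolding S_def using J0 irr by blast
  moreover have "\<Union>\<C> \<in> S" if ne: "\<C> \<noteq> {}" and ch: "subset.chain S \<C>" for \<C>
  proof -
    have sub: "\<And>J. J \<in> \<C> \<Longrightarrow> J \<in> S" using ch unfolding subset.chain_def by auto
    have hi: "hom_ideal n J" if "J \<in> \<C>" for J using sub[OF that] unfolding S_def by blast
    have tot: "\<And>J J'. J \<in> \<C> \<Longrightarrow> J' \<in> \<C> \<Longrightarrow> J \<subseteq> J' \<or> J' \<subseteq> J" using ch unfolding subset.chain_def by auto
    have hU: "hom_ideal n (\<Union>\<C>)"
    proof
      show "0 \<in> \<Union>\<C>" using ne hi hom_ideal.I_zero by blast
      fix f assume "f \<in> \<Union>\<C>"
      then obtain J where J: "J \<in> \<C>" "f \<in> J" by blast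
      interpret J: hom_ideal n J by (rule hi[OF J(1)])
      show "f \<in> P" "cmp i f \<in> \<Union>\<C>" for i using J J.I_carr J.I_cmp by blast+
      show "g * f \<in> \<Union>\<C>" if "g \<in> P" for g using J J.I_mult that by blast
      fix g assume "g \<in> \<Union>\<C>"
      then obtain J' where J': "J' \<in> \<C>" "g \<in> J'" by blast
      interpret J': hom_ideal n J' by (rule hi[OF J'(1)])
      show "f + g \<in> \<Union>\<C>" using tot[OF J(1) J'(1)] J J' J.I_add J'.I_add by blast
    qed
    have "\<not> hom_piece n k \<subseteq> \<Union>\<C>" for k
    proof
      assume "hom_piece n k \<subseteq> \<Union>\<C>"
      then have "(\<lambda>t. Poly_Mapping.single t 1) ` monomials n k \<subseteq> \<Union>\<C>"
        using hom_ideal.hom_piece_subset_iff[OF hU] by blast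
      then obtain J where "J \<in> \<C>" "(\<lambda>t. Poly_Mapping.single t 1) ` monomials n k \<subseteq> J"
        using finite_subset_Union_chain[OF _ _ ne ch] finite_monomials by (metis finite_imageI)
      then have "hom_piece n k \<subseteq> J" using hom_ideal.hom_piece_subset_iff[OF hi] by blast
      then show False using sub[OF \<open>J \<in> \<C>\<close>] unfolding S_def by blast
    qed
    moreover have "J0 \<subseteq> \<Union>\<C>" using ne sub unfolding S_def by blast
    ultimately show ?thesis unfolding S_def using hU by blast
  qed
  ultimately obtain J where JS: "J \<in> S" and max: "\<And>J'. J' \<in> S \<Longrightarrow> J \<subseteq> J' \<Longrightarrow> J' = J"
    using subset_Zorn_nonempty[of S] by blast
  then have J: "hom_ideal n J" "J0 \<subseteq> J" "\<And>k. \<not> hom_piece n k \<subseteq> J" unfolding S_def by auto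
  interpret J: hom_ideal n J by (rule J(1))
  have big: "\<exists>k. hom_piece n k \<subseteq> {f + p * a | f p. f \<in> J \<and> p \<in> P}" if a: "a \<in> hom_piece n i" "a \<notin> J" for a i
  proof (rule ccontr)
    assume n: "\<not> ?thesis"
    let ?K = "{f + p * a | f p. f \<in> J \<and> p \<in> P}"
    have KI: "f + p * a \<in> ?K" if "f \<in> J" "p \<in> P" for f p using that by blast
    have JK: "J \<subseteq> ?K"
    proof
      fix f assume "f \<in> J" from KI[OF this const_in_poly_ring(1)] show "f \<in> ?K" by simp
    qed
    have "?K \<in> S" unfolding S_def using J.hom_ideal_add_hom[OF a(1)] n JK J(2) by blast
    then have "?K = J" using max JK by blast
    moreover have "a \<in> ?K" using KI[OF J.I_zero const_in_poly_ring(2)] by simp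
    ultimately show False using a(2) by blast
  qed
  have "a \<in> J \<or> b \<in> J" if ab: "a \<in> hom_piece n i" "b \<in> hom_piece n j" "a * b \<in> J" for a b i j
  proof (rule ccontr)
    assume n: "\<not> (a \<in> J \<or> b \<in> J)"
    obtain k where k: "hom_piece n k \<subseteq> {f + p * a | f p. f \<in> J \<and> p \<in> P}" using big[OF ab(1)] n by blast
    obtain l where l: "hom_piece n l \<subseteq> {f + p * b | f p. f \<in> J \<and> p \<in> P}" using big[OF ab(2)] n by blast
    have "u * v \<in> J" if uv: "u \<in> hom_piece n k" "v \<in> hom_piece n l" for u v
    proof -
      obtain f p where u: "f \<in> J" "p \<in> P" "u = f + p * a" using k uv(1) by blast
      obtain g q where v: "g \<in> J" "q \<in> P" "v = g + q * b" using l uv(2) by blast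
      have "u * v = v * f + (p * a) * g + (p * q) * (a * b)" unfolding u(3) v(3) by (simp add: algebra_simps)
      also have "\<dots> \<in> J"
        by (intro J.I_add J.I_mult[OF u(1)] J.I_mult[OF v(1)] J.I_mult[OF ab(3)] poly_ring_intros
            hom_piece_carr[OF ab(1)] hom_piece_carr[OF uv(2)] u(2) v(2))
      finally show ?thesis .
    qed
    then have "hom_piece n (k + l) \<subseteq> J" by (rule J.hom_piece_subset_add)
    then show False using J(3) by blast
  qed
  then have "a \<in> J \<or> b \<in> J" if "a \<in> P" "b \<in> P" "a * b \<in> J" for a b
    using J.prime_by_hom[OF _ that] by blast
  then have "rc ` J \<in> points n I" using point_of_hom_prime[OF J(1) _ J(3)] J(2) J0(2) by blast
  then show ?thesis using that J(2) by blast
qed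

end

text \<open>If \<open>X0 * f\<close> lies in \<open>I\<close> for a form \<open>f\<close> outside
  \<open>I\<close>, the ideal of all \<open>g\<close> with \<open>g * f\<close> in \<open>I\<close>
  contains \<open>X0\<close>. Saturation keeps it from containing a full degree, so a point lies
  above it. In dimension zero this point is closed, and it lies on the hyperplane at
  infinity.\<close>

theorem nzd_ideal_of_no_point_at_infinity:
  assumes sat: "saturated_homogeneous_ideal n (I :: 'k::field mpoly set)"
    and zd: "zero_dimensional n I" and x0: "\<forall>p\<in>closed_points n I. coord_x0 n I \<notin> p"
  shows "nzd_ideal n I"
proof -
  interpret hom_ideal n I using hom_ideal_Idl sat unfolding saturated_homogeneous_ideal_def by blast
  have sat': "f \<in> I" if "f \<in> P" "\<And>h. h \<in> hom_piece n k \<Longrightarrow> h * f \<in> I" for f k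
    using sat that unfolding saturated_homogeneous_ideal_def by (metis poly_piece_int poly_ring_simps(1))
  have hom: "f \<in> I" if f: "f \<in> hom_piece n i" "X0 * f \<in> I" for f i
  proof (rule ccontr)
    assume nf: "f \<notin> I"
    have fc: "f \<in> P" by (rule hom_piece_carr[OF f(1)])
    define J0 where "J0 = {g \<in> P. g * f \<in> I}"
    have J0: "hom_ideal n J0"
    proof
      fix g assume "g \<in> J0"
      then have g: "g \<in> P" "g * f \<in> I" unfolding J0_def by auto
      show "g \<in> P" by (rule g(1))
      show "h * g \<in> J0" if "h \<in> P" for h using that g I_mult[OF g(2) that] unfolding J0_def
        by (auto simp: mult.assoc intro: poly_ring_intros)
      show "cmp k g \<in> J0" for k unfolding J0_def
        using cmp_mult[OF g(1) f(1), of "k + i"] I_cmp[OF g(2), of "k + i"] cmp_carr[OF g(1)] by simp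
      fix h assume "h \<in> J0"
      then show "g + h \<in> J0" using g unfolding J0_def by (auto simp: distrib_right intro: poly_ring_intros I_add)
    qed (auto simp: J0_def I_zero const_in_poly_ring)
    have "\<not> hom_piece n k \<subseteq> J0" for k
      using sat'[OF fc, of k] nf unfolding J0_def by blast
    moreover have "I \<subseteq> J0" unfolding J0_def using I_carr I_mult'[OF _ fc] by blast
    ultimately obtain J where J: "J0 \<subseteq> J" "rc ` J \<in> points n I" by (metis ex_point_above[OF J0])
    have "X0 \<in> J0" unfolding J0_def using f(2) X0_carr by simp
    then have "coord_x0 n I \<in> rc ` J" unfolding x0_R using J(1) by blast
    moreover have "rc ` J \<in> closed_points n I" using zd J(2) unfolding closed_points_def zero_dimensional_def by blast
    ultimately show False using x0 by blast
  qed
  show ?thesis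
  proof
    fix f assume f: "f \<in> P" "X0 * f \<in> I"
    show "f \<in> I"
    proof (rule I_by_cmp)
      fix i
      have "X0 * cmp i f \<in> I" using I_cmp[OF f(2), of "Suc i"] cmp_X0_mult(1)[OF f(1)] by simp
      then show "cmp i f \<in> I" by (rule hom[OF cmp_in_hom_piece[OF f(1)]])
    qed
  qed
qed

section \<open>Symmetric forms\<close>

locale gpos = nzd_ideal n I for n and I :: "'k::field mpoly set" + fixes d r :: nat
  assumes fin_Vs: "mp.fin_dim (Vs m)"
    and dim_Vs: "mp.dim (Vs (Suc i)) = (if i < r then (n + i) choose n else d)"
    and low: "i < r \<Longrightarrow> (n + i) choose n < d"
    and n1: "n \<ge> 1" and d1: "d \<ge> 1"
begin

abbreviation H where "H m \<equiv> mp.dim (Vs m)"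

lemma H_0 [simp]: "H 0 = 0" using mp.dim_zero by (simp add: Vs_0)

lemma H_top: "H (Suc r) = d" using dim_Vs[of r] by simp

lemma Vs_stable: "r \<le> i \<Longrightarrow> Vs (Suc i) = Vs (Suc r)"
  using mp.dim_eq_imp_eq[OF subspace_Vs subspace_Vs Vs_mono[of "Suc r" "Suc i"] fin_Vs] dim_Vs[of i] dim_Vs[of r] by simp

lemma S_eq: "S = Vs (Suc r)"
proof
  show "S \<subseteq> Vs (Suc r)"
  proof
    fix s assume "s \<in> S"
    then obtain m where "s \<in> Vs m" using S_Vs by blast
    then have "s \<in> Vs (Suc (max m r))" using subsetD[OF Vs_mono[of m "Suc (max m r)"]] by simp
    then show "s \<in> Vs (Suc r)" using Vs_stable[of "max m r"] by simp
  qed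
qed (rule Vs_sub_S)

lemma nu_in_top: "f \<in> P \<Longrightarrow> nu f \<in> Vs (Suc r)" using S_eq unfolding S_def by blast

lemma nu_in_Vs_stable: "\<lbrakk>f \<in> P; r < m\<rbrakk> \<Longrightarrow> nu f \<in> Vs m"
  using nu_in_top Vs_stable[of "m - 1"] by simp

text \<open>For \<open>r = 0\<close> the formula \<open>dim_Vs\<close> only says \<open>d\<close>.
  Forms of degree 0 are constants, so the space is spanned by \<open>nu 1\<close>, which bounds
  \<open>d\<close> by 1.\<close>

lemma H_1: "H (Suc 0) = 1"
proof (cases "r = 0")
  case True
  have "Vs (Suc 0) \<subseteq> mp.span {nu 1}"
  proof
    fix v assume "v \<in> Vs (Suc 0)"
    then obtain f where "f \<in> hom_piece n 0" "v = nu f" using Vs_hom by blast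
    then have "v = nu (sc (Poly_Mapping.lookup f 0) 1)" using hom_piece_zero_const[of f n] by simp
    then show "v \<in> mp.span {nu 1}" unfolding nu.scale by (simp add: mp.span_base mp.span_scale)
  qed
  then have "H (Suc 0) \<le> card {nu 1}" by (rule mp.dim_le_card) simp
  then show ?thesis using dim_Vs[of 0] True d1 by simp
qed (use dim_Vs[of 0] in simp)

lemma H_r_less: "H r < d"
proof (cases r)
  case 0 then show ?thesis using d1 by simp
next
  case (Suc i) then show ?thesis using dim_Vs[of i] low[of i] by simp
qed

lemma H_le: "H m \<le> d"
proof (cases "m \<le> Suc r")
  case True
  then show ?thesis using mp.dim_mono_fd[OF subspace_Vs subspace_Vs Vs_mono fin_Vs] H_top by metis
next
  case False
  then show ?thesis using Vs_stable[of "m - 1"] H_top by simp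
qed

lemma nu_mult_cong: "\<lbrakk>f \<in> P; f' \<in> P; g \<in> P; nu f = nu f'\<rbrakk> \<Longrightarrow> nu (f * g) = nu (f' * g)"
  unfolding nu_eq_iff using It_mult'[of "f - f'" g] by (simp add: left_diff_distrib)

lemma nu_mult_Vs:
  assumes "f \<in> P" "nu f \<in> Vs a" "g \<in> P" "deg_below b g" "a + b \<le> Suc c"
  shows "nu (f * g) \<in> Vs c"
proof -
  obtain f' where f': "f' \<in> P" "deg_below a f'" "nu f = nu f'" using assms(2) unfolding Vs_def by blast
  have "deg_below c (f' * g)"
  proof (cases a)
    case 0 then show ?thesis using deg_below_0[of f'] f' by simp
  next
    case (Suc a')
    have "deg_below (a' + b) (f' * g)" using f'(2) Suc by (intro deg_below_mult assms(4)) simp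
    then show ?thesis using Suc assms(5) by (auto intro: deg_below_mono)
  qed
  then have "nu (f' * g) \<in> Vs c" using f'(1) assms(3) by (intro VsI poly_ring_intros)
  then show ?thesis using nu_mult_cong[OF assms(1) f'(1) assms(3) f'(3)] by simp
qed

text \<open>A linear functional on S, written on polynomials; vanishing on \<open>It\<close> lets it
  descend.\<close>

definition functional :: "('k mpoly \<Rightarrow> 'k) \<Rightarrow> bool" where
  "functional \<tau> \<longleftrightarrow> (\<forall>f\<in>P. \<forall>g\<in>P. \<tau> (f + g) = \<tau> f + \<tau> g) \<and> (\<forall>c. \<forall>f\<in>P. \<tau> (sc c f) = c * \<tau> f) \<and> (\<forall>f\<in>It. \<tau> f = 0)"

lemma functionalD:
  assumes "functional \<tau>"
  shows "\<lbrakk>f \<in> P; g \<in> P\<rbrakk> \<Longrightarrow> \<tau> (f + g) = \<tau> f + \<tau> g" "f \<in> P \<Longrightarrow> \<tau> (sc c f) = c * \<tau> f" "f \<in> It \<Longrightarrow> \<tau> f = 0"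
  using assms unfolding functional_def by auto

lemma functional_sum:
  assumes "functional \<tau>" "\<And>i. i \<in> A \<Longrightarrow> f i \<in> P" shows "\<tau> (\<Sum>i\<in>A. f i) = (\<Sum>i\<in>A. \<tau> (f i))"
  using assms(2) by (induction A rule: infinite_finite_induct)
    (auto simp: functionalD[OF assms(1)] sum_in_poly_ring)

lemma functional_cong:
  assumes "functional \<tau>" "f \<in> P" "g \<in> P" "nu f = nu g" shows "\<tau> f = \<tau> g"
proof -
  have "\<tau> ((f - g) + g) = \<tau> (f - g) + \<tau> g" using assms by (intro functionalD(1)) (auto intro: poly_ring_intros)
  then show ?thesis using functionalD(3)[OF assms(1)] assms(4) nu_eq_iff by simp
qed

text \<open>For \<open>m = Suc r\<close> the condition amounts to nondegeneracy, for
  \<open>m = 1\<close> it says that the kernel of \<tau> is \<open>Vs r\<close>, and for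
  \<open>m = Suc i\<close> with \<open>i < r\<close> that the orthogonal complement of S_i is
  S_(r-1-i).\<close>

definition symmetric_form :: "('k mpoly \<Rightarrow> 'k) \<Rightarrow> bool" where
  "symmetric_form \<tau> \<longleftrightarrow> functional \<tau> \<and> (\<forall>m\<le>Suc r. \<forall>f\<in>P. (\<forall>g\<in>P. deg_below m g \<longrightarrow> \<tau> (f * g) = 0) \<longleftrightarrow> nu f \<in> Vs (Suc r - m))"

lemma symmetric_formD:
  assumes "symmetric_form \<tau>"
  shows "functional \<tau>" "\<lbrakk>m \<le> Suc r; f \<in> P; \<And>g. g \<in> P \<Longrightarrow> deg_below m g \<Longrightarrow> \<tau> (f * g) = 0\<rbrakk> \<Longrightarrow> nu f \<in> Vs (Suc r - m)"
    "\<lbrakk>m \<le> Suc r; f \<in> P; nu f \<in> Vs (Suc r - m); g \<in> P; deg_below m g\<rbrakk> \<Longrightarrow> \<tau> (f * g) = 0"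
  using assms unfolding symmetric_form_def by blast+

definition nondegenerate :: "('k mpoly \<Rightarrow> 'k) \<Rightarrow> bool" where
  "nondegenerate \<tau> \<longleftrightarrow> (\<forall>f\<in>P. (\<forall>g\<in>P. \<tau> (f * g) = 0) \<longrightarrow> f \<in> It)"

lemma symmetric_form_nondegenerate: "symmetric_form \<tau> \<Longrightarrow> nondegenerate \<tau>"
  unfolding nondegenerate_def using symmetric_formD(2)[of \<tau> "Suc r"] Vs_0 nu(2) by auto

lemma symmetric_form_low: "\<lbrakk>symmetric_form \<tau>; f \<in> P; nu f \<in> Vs r\<rbrakk> \<Longrightarrow> \<tau> f = 0"
  using symmetric_formD(3)[of \<tau> "Suc 0" f 1] by (simp add: const_in_poly_ring deg_below_def)

definition pr :: "'k mpoly \<Rightarrow> 'k mpoly" where "pr s = (SOME f. f \<in> P \<and> nu f = s)"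

lemma pr: "s \<in> S \<Longrightarrow> pr s \<in> P \<and> nu (pr s) = s"
  unfolding pr_def S_def by (rule someI_ex) blast

text \<open>In coordinates with respect to a basis of \<open>S\<close>, a nondegenerate form identifies \<open>S\<close> with its dual.\<close>
lemma form_coordinates:
  assumes \<tau>: "functional \<tau>" and nd: "nondegenerate \<tau>"
    and B: "finite B" "mp.independent B" "mp.span B = S"
    and \<Theta>_def: "\<Theta> = (\<lambda>s b. if b \<in> B then \<tau> (pr s * pr b) else 0)"
  shows "\<Theta> ` S = {f. \<forall>x. x \<notin> B \<longrightarrow> f x = 0}" "inj_on \<Theta> S"
    "\<And>s t. s \<in> S \<Longrightarrow> t \<in> S \<Longrightarrow> \<Theta> (s + t) = \<Theta> s + \<Theta> t" "\<And>c s. s \<in> S \<Longrightarrow> \<Theta> (sc c s) = (\<lambda>x. c * \<Theta> s x)"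
    "\<And>f g U. \<lbrakk>f \<in> P; U \<subseteq> B; \<And>b. b \<in> U \<Longrightarrow> \<Theta> (nu f) b = 0; g \<in> P; nu g \<in> mp.span U\<rbrakk> \<Longrightarrow> \<tau> (f * g) = 0"
    "\<And>f b. \<lbrakk>f \<in> P; b \<in> B\<rbrakk> \<Longrightarrow> \<Theta> (nu f) b = \<tau> (f * pr b)"
proof -
  have BS: "b \<in> S" if "b \<in> B" for b using that B(3) mp.span_base by blast
  have prB: "pr b \<in> P" "nu (pr b) = b" if "b \<in> B" for b using pr[OF BS[OF that]] by auto
  have val: "\<Theta> (nu f) b = \<tau> (f * pr b)" if "f \<in> P" "b \<in> B" for f b
  proof -
    have s: "nu f \<in> S" using that by (auto simp: S_def)
    have "nu (pr (nu f) * pr b) = nu (f * pr b)"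
      using pr[OF s] prB[OF that(2)] that(1) by (intro nu_mult_cong) auto
    then have "\<tau> (pr (nu f) * pr b) = \<tau> (f * pr b)"
      using pr[OF s] prB[OF that(2)] that(1) by (intro functional_cong[OF \<tau>] poly_ring_intros) auto
    then show ?thesis using that by (simp add: \<Theta>_def)
  qed
  then show "\<And>f b. \<lbrakk>f \<in> P; b \<in> B\<rbrakk> \<Longrightarrow> \<Theta> (nu f) b = \<tau> (f * pr b)" .
  show add: "\<Theta> (s + t) = \<Theta> s + \<Theta> t" if "s \<in> S" "t \<in> S" for s t
  proof
    fix b
    obtain f g where fg: "f \<in> P" "g \<in> P" "s = nu f" "t = nu g" using \<open>s \<in> S\<close> \<open>t \<in> S\<close> unfolding S_def by blast
    have "\<tau> ((f + g) * pr b) = \<tau> (f * pr b) + \<tau> (g * pr b)" if "b \<in> B"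
      unfolding distrib_right using fg prB[OF that] by (intro functionalD(1)[OF \<tau>] poly_ring_intros)
    then show "\<Theta> (s + t) b = (\<Theta> s + \<Theta> t) b"
      using val[of "f + g" b] val[of f b] val[of g b] fg poly_ring_intros(2)[of f n g]
      by (cases "b \<in> B") (simp_all add: nu.add, simp add: \<Theta>_def)
  qed
  show scale: "\<Theta> (sc c s) = (\<lambda>x. c * \<Theta> s x)" if "s \<in> S" for c s
  proof
    fix b
    obtain f where f: "f \<in> P" "s = nu f" using \<open>s \<in> S\<close> unfolding S_def by blast
    have "\<tau> (sc c f * pr b) = c * \<tau> (f * pr b)" if "b \<in> B"
      unfolding mult.assoc using f prB[OF that] by (intro functionalD(2)[OF \<tau>] poly_ring_intros)
    then show "\<Theta> (sc c s) b = c * \<Theta> s b"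
      using val[of "sc c f" b] val[of f b] f sc_carr[of f n c]
      by (cases "b \<in> B") (simp_all add: nu.scale, simp add: \<Theta>_def)
  qed
  show span0: "\<tau> (f * g) = 0"
    if "f \<in> P" "U \<subseteq> B" "\<And>b. b \<in> U \<Longrightarrow> \<Theta> (nu f) b = 0" "g \<in> P" "nu g \<in> mp.span U" for f g U
  proof -
    have "v \<in> S \<and> (\<forall>g\<in>P. nu g = v \<longrightarrow> \<tau> (f * g) = 0)" if "v \<in> mp.span U" for v
      using that
    proof (induction rule: mp.span_induct_alt)
      case base
      have "\<tau> (f * g) = 0" if "g \<in> P" "nu g = 0" for g
        using that nu(2) It_mult[OF _ \<open>f \<in> P\<close>] by (intro functionalD(3)[OF \<tau>]) blast
      then show ?case using mp.subspace_0[OF subspace_S] by blast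
    next
      case (step c b v)
      have b: "b \<in> B" using step(1) \<open>U \<subseteq> B\<close> by blast
      have p: "pr v \<in> P" "nu (pr v) = v" using pr step by auto
      have "\<tau> (f * g) = 0" if g: "g \<in> P" "nu g = sc c b + v" for g
      proof -
        have "nu g = nu (sc c (pr b) + pr v)" using g prB[OF b] p by (simp add: nu.add nu.scale)
        then have "nu (f * g) = nu (f * (sc c (pr b) + pr v))"
          using nu_mult_cong[of g "sc c (pr b) + pr v" f] g(1) prB[OF b] p \<open>f \<in> P\<close>
          by (simp add: mult.commute poly_ring_intros)
        then have "\<tau> (f * g) = \<tau> (f * (sc c (pr b) + pr v))"
          using g(1) prB[OF b] p \<open>f \<in> P\<close> by (intro functional_cong[OF \<tau>] poly_ring_intros) auto
        also have "f * (sc c (pr b) + pr v) = sc c (f * pr b) + f * pr v" by (simp add: algebra_simps)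
        also have "\<tau> \<dots> = c * \<tau> (f * pr b) + \<tau> (f * pr v)"
          using functionalD(1)[OF \<tau>, of "sc c (f * pr b)" "f * pr v"] functionalD(2)[OF \<tau>, of "f * pr b" c] prB[OF b] p \<open>f \<in> P\<close>
          by (simp add: poly_ring_intros)
        also have "\<dots> = 0" using val[OF \<open>f \<in> P\<close> b] \<open>\<And>b. b \<in> U \<Longrightarrow> _\<close> step p by simp
        finally show ?thesis .
      qed
      moreover have "sc c b + v \<in> S"
        using mp.subspace_add[OF subspace_S mp.subspace_scale[OF subspace_S BS[OF b]]] step by blast
      ultimately show ?case by blast
    qed
    then show ?thesis using that by blast
  qed
  have ker: "s = 0" if s: "s \<in> S" "\<Theta> s = 0" for s
  proof -
    obtain f where f: "f \<in> P" "s = nu f" using s(1) unfolding S_def by blast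
    have "\<tau> (f * g) = 0" if g: "g \<in> P" for g
      by (rule span0[OF f(1) order_refl _ g]) (use s(2) f(2) g B(3) in \<open>auto simp: S_def\<close>)
    then have "f \<in> It" using nd f(1) unfolding nondegenerate_def by blast
    then show ?thesis using nu(2) f(2) by simp
  qed
  show inj: "inj_on \<Theta> S"
  proof (rule inj_onI)
    fix s t assume st: "s \<in> S" "t \<in> S" "\<Theta> s = \<Theta> t"
    have m: "sc (- 1) t \<in> S" using st(2) by (rule mp.subspace_scale[OF subspace_S])
    have "\<Theta> (s + sc (- 1) t) = \<Theta> s + (\<lambda>x. - 1 * \<Theta> t x)"
      unfolding add[OF st(1) m] scale[OF st(2)] ..
    also have "\<dots> = 0" unfolding st(3) by (auto simp: fun_eq_iff)
    finally have "s + sc (- 1) t = 0" using ker mp.subspace_add[OF subspace_S st(1) m] by blast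
    then show "s = t" by (simp add: single_uminus)
  qed
  interpret pair: fd_pair "sc :: 'k \<Rightarrow> _" "\<lambda>(c::'k) (f::'k mpoly \<Rightarrow> 'k) x. c * f x" by unfold_locales
  have finS: "mp.fin_dim S" unfolding S_eq by (rule fin_Vs)
  \<comment> \<open>Injectivity and \<open>dim S = card B\<close> force the image to be everything
    supported on \<open>B\<close>.\<close>
  have rn: "fun_vs.subspace (\<Theta> ` S)" "fun_vs.dim (\<Theta> ` S) + mp.dim {w \<in> S. \<Theta> w = 0} = mp.dim S"
    using pair.rank_nullity[OF subspace_S finS, of \<Theta>] add scale by auto
  have "{w \<in> S. \<Theta> w = 0} = {0}"
  proof -
    have "\<Theta> 0 = 0" using scale[of 0 0] mp.subspace_0[OF subspace_S] by (auto simp: fun_eq_iff)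
    then show ?thesis using ker mp.subspace_0[OF subspace_S] by blast
  qed
  then have "fun_vs.dim (\<Theta> ` S) = card B" using rn(2) mp.dim_span_eq_card_independent[OF B(2)] B(3) by (simp add: mp.dim_zero)
  moreover have "\<Theta> ` S \<subseteq> {f. \<forall>x. x \<notin> B \<longrightarrow> f x = 0}" by (auto simp: \<Theta>_def)
  ultimately show "\<Theta> ` S = {f. \<forall>x. x \<notin> B \<longrightarrow> f x = 0}"
    using fun_vs.dim_eq_imp_eq[OF rn(1) subspace_supported] dim_supported[OF B(1), where 'k='k] by simp
qed

definition perp :: "('k mpoly \<Rightarrow> 'k) \<Rightarrow> nat \<Rightarrow> 'k mpoly set" where
  "perp \<tau> m = {nu f | f. f \<in> P \<and> (\<forall>g\<in>P. deg_below m g \<longrightarrow> \<tau> (f * g) = 0)}"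

text \<open>Take a basis of S that extends one of \<open>Vs m\<close>. Orthogonality to
  \<open>Vs m\<close> means that the coordinates \<Theta> vanish on the smaller basis, which leaves
  one free coordinate for each added basis vector.\<close>

lemma perp_dim:
  assumes \<tau>: "functional \<tau>" and nd: "nondegenerate \<tau>" and m: "m \<le> Suc r"
  shows "mp.subspace (perp \<tau> m)" "perp \<tau> m \<subseteq> S" "mp.dim (perp \<tau> m) + H m = d"
proof -
  have "Vs m \<subseteq> S" by (rule Vs_sub_S)
  have finS: "mp.fin_dim S" unfolding S_eq by (rule fin_Vs)
  obtain B B' where B: "B \<subseteq> B'" "finite B'" "mp.independent B'" "mp.span B = Vs m" "mp.span B' = S" "card B = H m" "card B' = mp.dim S"
    using mp.adapted_basis[OF subspace_Vs subspace_S \<open>Vs m \<subseteq> S\<close> finS] by metis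
  define \<Theta> where "\<Theta> = (\<lambda>s b. if b \<in> B' then \<tau> (pr s * pr b) else 0)"
  note F = form_coordinates[OF \<tau> nd B(2,3,5) \<Theta>_def]
  show sub: "perp \<tau> m \<subseteq> S" unfolding perp_def S_def by blast
  have eq: "perp \<tau> m = {s \<in> S. \<forall>x. x \<notin> B' - B \<longrightarrow> \<Theta> s x = 0}"
  proof
    show "perp \<tau> m \<subseteq> {s \<in> S. \<forall>x. x \<notin> B' - B \<longrightarrow> \<Theta> s x = 0}"
    proof
      fix s assume "s \<in> perp \<tau> m"
      then obtain f where f: "f \<in> P" "s = nu f" "\<And>g. g \<in> P \<Longrightarrow> deg_below m g \<Longrightarrow> \<tau> (f * g) = 0" unfolding perp_def by blast
      have "\<Theta> s x = 0" if "x \<notin> B' - B" for x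
      proof (cases "x \<in> B'")
        case True
        then have xB: "x \<in> B" using that by blast
        then have "x \<in> Vs m" using B(4) mp.span_base by blast
        then obtain g where g: "g \<in> P" "deg_below m g" "x = nu g" unfolding Vs_def by blast
        have x: "pr x \<in> P" "nu (pr x) = x" using pr g(1,3) unfolding S_def by auto
        have "nu (f * pr x) = nu (f * g)" using nu_mult_cong[of "pr x" g f] x g f(1) by (simp add: mult.commute)
        then have "\<tau> (f * pr x) = \<tau> (f * g)" using x g f(1) by (intro functional_cong[OF \<tau>] poly_ring_intros)
        moreover have "\<Theta> (nu f) x = \<tau> (f * pr x)" by (rule F(6)[OF f(1) True])
        ultimately show ?thesis unfolding f(2) using f(3)[OF g(1,2)] by simp
      qed (simp add: \<Theta>_def)
      then show "s \<in> {s \<in> S. \<forall>x. x \<notin> B' - B \<longrightarrow> \<Theta> s x = 0}" using f unfolding S_def by blast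
    qed
    show "{s \<in> S. \<forall>x. x \<notin> B' - B \<longrightarrow> \<Theta> s x = 0} \<subseteq> perp \<tau> m"
    proof
      fix s assume s: "s \<in> {s \<in> S. \<forall>x. x \<notin> B' - B \<longrightarrow> \<Theta> s x = 0}"
      then obtain f where f: "f \<in> P" "s = nu f" unfolding S_def by blast
      have "\<tau> (f * g) = 0" if "g \<in> P" "deg_below m g" for g
        by (rule F(5)[OF f(1) B(1) _ that(1)]) (use s f that VsI B(4) in auto)
      then show "s \<in> perp \<tau> m" unfolding perp_def using f by blast
    qed
  qed
  interpret pair: fd_pair "sc :: 'k \<Rightarrow> _" "\<lambda>(c::'k) (f::'k mpoly \<Rightarrow> 'k) x. c * f x" by unfold_locales
  have "\<Theta> 0 = 0" using F(4)[of 0 0] mp.subspace_0[OF subspace_S] by (auto simp: fun_eq_iff)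
  then show subsp: "mp.subspace (perp \<tau> m)" unfolding eq
    using mp.subspace_0[OF subspace_S] mp.subspace_add[OF subspace_S] mp.subspace_scale[OF subspace_S]
    by (intro mp.subspaceI) (auto simp: F(3,4))
  have img: "\<Theta> ` perp \<tau> m = {f. \<forall>x. x \<notin> B' - B \<longrightarrow> f x = 0}"
  proof -
    have "\<Theta> ` perp \<tau> m = \<Theta> ` S \<inter> {f. \<forall>x. x \<notin> B' - B \<longrightarrow> f x = 0}" unfolding eq by blast
    also have "\<dots> = {f. \<forall>x. x \<notin> B' - B \<longrightarrow> f x = 0}" unfolding F(1) by blast
    finally show ?thesis .
  qed
  have ker: "{w \<in> perp \<tau> m. \<Theta> w = 0} = {0}"
    using inj_onD[OF F(2), of _ 0] \<open>\<Theta> 0 = 0\<close> sub mp.subspace_0[OF subsp] mp.subspace_0[OF subspace_S] by auto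
  have "fun_vs.dim (\<Theta> ` perp \<tau> m) + mp.dim {w \<in> perp \<tau> m. \<Theta> w = 0} = mp.dim (perp \<tau> m)"
    by (rule pair.rank_nullity(3)[OF subsp mp.fin_dim_subset[OF finS sub]]) (use F(3,4) sub in blast)+
  then have "mp.dim (perp \<tau> m) = card (B' - B)"
    unfolding ker img using dim_supported[of "B' - B", where 'k='k] B(2) by (simp add: mp.dim_zero)
  also have "\<dots> = d - H m" using card_Diff_subset[OF finite_subset[OF B(1,2)] B(1)] B(6,7) S_eq H_top by simp
  finally show "mp.dim (perp \<tau> m) + H m = d" using H_le[of m] by simp
qed

lemma symmetric_form_perp: "\<lbrakk>symmetric_form \<tau>; m \<le> Suc r\<rbrakk> \<Longrightarrow> perp \<tau> m = Vs (Suc r - m)"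
  unfolding perp_def Vs_def symmetric_form_def by blast

lemma symmetric_form_H: "\<lbrakk>symmetric_form \<tau>; m \<le> Suc r\<rbrakk> \<Longrightarrow> H m + H (Suc r - m) = d"
  using perp_dim(3)[OF symmetric_formD(1) symmetric_form_nondegenerate] symmetric_form_perp by (simp add: add.commute)

text \<open>The ideal C_j, the largest ideal of S inside S_j; it turns out to be the coefficient
  space of the conductor in degree \<open>j\<close> (\<open>conductor_layer\<close>).\<close>

definition cs :: "nat \<Rightarrow> 'k mpoly set" where
  "cs j = {nu f | f. f \<in> P \<and> (\<forall>g\<in>P. nu (f * g) \<in> Vs (Suc j))}"

lemma cs_sub: "cs j \<subseteq> Vs (Suc j)"
proof
  fix v assume "v \<in> cs j"
  then obtain f where "v = nu f" "\<forall>g\<in>P. nu (f * g) \<in> Vs (Suc j)" unfolding cs_def by blast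
  then show "v \<in> Vs (Suc j)" using const_in_poly_ring(2)[of n] by force
qed

lemma cs_I: "\<lbrakk>f \<in> P; \<And>g. g \<in> P \<Longrightarrow> nu (f * g) \<in> Vs (Suc j)\<rbrakk> \<Longrightarrow> nu f \<in> cs j"
  unfolding cs_def by blast

lemma cs_D:
  assumes "f \<in> P" "nu f \<in> cs j" "g \<in> P" shows "nu (f * g) \<in> Vs (Suc j)"
proof -
  obtain f' where "f' \<in> P" "nu f = nu f'" "nu (f' * g) \<in> Vs (Suc j)" using assms unfolding cs_def by blast
  then show ?thesis using nu_mult_cong[of f f' g] assms by simp
qed

lemma subspace_cs: "mp.subspace (cs j)"
proof (rule mp.subspaceI)
  show "0 \<in> cs j" using cs_I[of 0 j] mp.subspace_0[OF subspace_Vs] by (simp add: const_in_poly_ring nu.zero)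
next
  fix x y assume "x \<in> cs j" "y \<in> cs j"
  then obtain f g where fg: "f \<in> P" "x = nu f" "\<And>h. h \<in> P \<Longrightarrow> nu (f * h) \<in> Vs (Suc j)"
     "g \<in> P" "y = nu g" "\<And>h. h \<in> P \<Longrightarrow> nu (g * h) \<in> Vs (Suc j)"
    unfolding cs_def by blast
  have "nu (f + g) \<in> cs j"
    by (rule cs_I) (use fg in \<open>auto simp: distrib_right nu.add intro: poly_ring_intros mp.subspace_add[OF subspace_Vs]\<close>)
  then show "x + y \<in> cs j" by (simp add: fg nu.add)
next
  fix c x assume "x \<in> cs j"
  then obtain f where f: "f \<in> P" "x = nu f" "\<And>h. h \<in> P \<Longrightarrow> nu (f * h) \<in> Vs (Suc j)"
    unfolding cs_def by blast
  have "nu (sc c f) \<in> cs j"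
    by (rule cs_I) (use f in \<open>auto simp: mult.assoc nu.scale intro: poly_ring_intros mp.subspace_scale[OF subspace_Vs]\<close>)
  then show "sc c x \<in> cs j" by (simp add: f nu.scale)
qed

lemma symmetric_form_cs: assumes "symmetric_form \<tau>" "j < r" shows "cs j = {0}"
proof -
  have "nu f = 0" if f: "f \<in> P" "\<And>g. g \<in> P \<Longrightarrow> nu (f * g) \<in> Vs (Suc j)" for f
  proof -
    have "\<tau> (f * g) = 0" if "g \<in> P" for g
      using f(2)[OF that] Vs_mono[of "Suc j" r] assms(2) f(1) that
      by (intro symmetric_form_low[OF assms(1)] poly_ring_intros) auto
    then show ?thesis using symmetric_form_nondegenerate[OF assms(1)] f(1) nu(2) unfolding nondegenerate_def by blast
  qed
  then show ?thesis using mp.subspace_0[OF subspace_cs[of j]] unfolding cs_def by blast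
qed

lemma ex_functional:
  assumes \<sigma>: "\<sigma> \<in> P" "nu \<sigma> \<notin> Vs r" and span: "\<And>f. f \<in> P \<Longrightarrow> \<exists>c. nu f - sc c (nu \<sigma>) \<in> Vs r"
  obtains \<tau> where "functional \<tau>" "\<And>f. f \<in> P \<Longrightarrow> \<tau> f = 0 \<longleftrightarrow> nu f \<in> Vs r"
proof -
  define \<tau> where "\<tau> f = (THE c. nu f - sc c (nu \<sigma>) \<in> Vs r)" for f
  have uniq: "c = c'" if "v - sc c (nu \<sigma>) \<in> Vs r" "v - sc c' (nu \<sigma>) \<in> Vs r" for v c c'
  proof (rule ccontr)
    assume ne: "c \<noteq> c'"
    have "(v - sc c' (nu \<sigma>)) - (v - sc c (nu \<sigma>)) \<in> Vs r" using mp.subspace_diff[OF subspace_Vs that(2,1)] .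
    then have "sc (c - c') (nu \<sigma>) \<in> Vs r" by (simp add: single_diff left_diff_distrib)
    then have "sc (inverse (c - c')) (sc (c - c') (nu \<sigma>)) \<in> Vs r" by (rule mp.subspace_scale[OF subspace_Vs])
    then show False using ne \<sigma>(2) by (simp add: mult_single flip: mult.assoc)
  qed
  have \<tau>: "nu f - sc (\<tau> f) (nu \<sigma>) \<in> Vs r" if "f \<in> P" for f
    unfolding \<tau>_def by (rule theI') (use span[OF that] uniq in blast)
  have \<tau>_eq: "\<tau> f = c" if "nu f - sc c (nu \<sigma>) \<in> Vs r" for f c
    unfolding \<tau>_def by (rule the_equality, rule that) (use uniq that in blast)
  have "functional \<tau>" unfolding functional_def
  proof (intro conjI ballI allI)
    fix f g assume "f \<in> P" "g \<in> P"
    then have "(nu f - sc (\<tau> f) (nu \<sigma>)) + (nu g - sc (\<tau> g) (nu \<sigma>)) \<in> Vs r" by (intro mp.subspace_add[OF subspace_Vs] \<tau>)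
    then show "\<tau> (f + g) = \<tau> f + \<tau> g" by (intro \<tau>_eq) (simp add: nu.add single_add algebra_simps)
  next
    fix c f assume "f \<in> P"
    then have "sc c (nu f - sc (\<tau> f) (nu \<sigma>)) \<in> Vs r" by (intro mp.subspace_scale[OF subspace_Vs] \<tau>)
    then show "\<tau> (sc c f) = c * \<tau> f"
      by (intro \<tau>_eq) (simp add: nu.scale right_diff_distrib mult_single flip: mult.assoc)
  next
    fix f assume "f \<in> It"
    then show "\<tau> f = 0" by (intro \<tau>_eq) (simp add: nu(2)[THEN iffD2] mp.subspace_0[OF subspace_Vs])
  qed
  moreover have "\<tau> f = 0 \<longleftrightarrow> nu f \<in> Vs r" if "f \<in> P" for f
    using \<tau>[OF that] \<tau>_eq[of f 0] by auto
  ultimately show ?thesis using that by blast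
qed

text \<open>The case \<open>m = 1\<close> makes \<open>Vs r\<close> a hyperplane in S, and \<tau> is
  a functional with that kernel. Its radical is an ideal inside \<open>Vs r\<close> and therefore
  zero. Products of \<open>Vs m\<close> and \<open>Vs (Suc r - m)\<close> fall into
  \<open>Vs r\<close>, so the latter space is orthogonal to the former, and the dimensions make it
  the full complement.\<close>

lemma symmetric_form_of_dims:
  assumes sym: "\<And>m. m \<le> Suc r \<Longrightarrow> H m + H (Suc r - m) = d" and cs: "r > 0 \<Longrightarrow> cs (r - 1) = {0}"
  shows "\<exists>\<tau>. symmetric_form \<tau>"
proof -
  have finS: "mp.fin_dim S" unfolding S_eq by (rule fin_Vs)
  have "S \<noteq> Vs r" using H_r_less H_top S_eq by auto
  then obtain \<sigma> where \<sigma>: "\<sigma> \<in> P" "nu \<sigma> \<notin> Vs r" using Vs_sub_S[of r] unfolding S_def by blast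
  obtain B B' where B: "finite B" "mp.span B = Vs r" "card B = H r" "mp.independent B"
    using mp.adapted_basis[OF subspace_Vs subspace_Vs order_refl fin_Vs[of r]] by metis
  have "mp.independent (insert (nu \<sigma>) B)" using \<sigma>(2) B by (intro mp.independent_insertI) auto
  moreover have "nu \<sigma> \<notin> B" using \<sigma>(2) B(2) mp.span_base by blast
  ultimately have "mp.dim (mp.span (insert (nu \<sigma>) B)) = Suc (H r)"
    using mp.dim_span_eq_card_independent[of "insert (nu \<sigma>) B"] B by simp
  also have "\<dots> = d" using sym[of "Suc 0"] H_1 by simp
  finally have dm: "mp.dim (mp.span (insert (nu \<sigma>) B)) = d" .
  have "insert (nu \<sigma>) B \<subseteq> S" using \<sigma>(1) B(2) mp.span_superset Vs_sub_S[of r] unfolding S_def by blast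
  then have "mp.span (insert (nu \<sigma>) B) \<subseteq> S" by (rule mp.span_minimal[OF _ subspace_S])
  then have spS: "mp.span (insert (nu \<sigma>) B) = S"
    using mp.dim_eq_imp_eq[OF mp.subspace_span subspace_S _ finS] dm H_top S_eq by simp
  have "\<exists>c. nu f - sc c (nu \<sigma>) \<in> Vs r" if "f \<in> P" for f
    using that spS B(2) mp.span_breakdown_eq[of "nu f" "nu \<sigma>" B] unfolding S_def by blast
  then obtain \<tau> where \<tau>: "functional \<tau>" "\<And>f. f \<in> P \<Longrightarrow> \<tau> f = 0 \<longleftrightarrow> nu f \<in> Vs r"
    using ex_functional[OF \<sigma>] by metis
  have nd: "nondegenerate \<tau>" unfolding nondegenerate_def
  proof (intro ballI impI)
    fix f assume f: "f \<in> P" "\<forall>g\<in>P. \<tau> (f * g) = 0"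
    then have v: "nu (f * g) \<in> Vs r" if "g \<in> P" for g using \<tau>(2)[OF mult_in_poly_ring[OF f(1) that]] that by blast
    have "nu f = 0"
    proof (cases "r = 0")
      case True then show ?thesis using v[of 1] Vs_0 by (simp add: const_in_poly_ring)
    next
      case False
      then have "nu f \<in> cs (r - 1)" using v by (intro cs_I[OF f(1)]) simp
      then show ?thesis using cs False by simp
    qed
    then show "f \<in> It" using nu(2) by simp
  qed
  have low: "\<tau> (f * g) = 0" if "m \<le> Suc r" "f \<in> P" "nu f \<in> Vs (Suc r - m)" "g \<in> P" "deg_below m g" for m f g
    using that nu_mult_Vs[OF that(2-5), of r] \<tau>(2)[OF mult_in_poly_ring[OF that(2,4)]] by simp
  have "perp \<tau> m = Vs (Suc r - m)" if m: "m \<le> Suc r" for m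
  proof -
    have "Vs (Suc r - m) \<subseteq> perp \<tau> m"
    proof
      fix v assume v: "v \<in> Vs (Suc r - m)"
      then obtain f where f: "f \<in> P" "v = nu f" unfolding Vs_def by blast
      then show "v \<in> perp \<tau> m" unfolding perp_def using low[OF m f(1)] v by blast
    qed
    then show ?thesis
      using mp.dim_eq_imp_eq[OF subspace_Vs[of "Suc r - m"] perp_dim(1)[OF \<tau>(1) nd m] _ mp.fin_dim_subset[OF finS perp_dim(2)[OF \<tau>(1) nd m]]]
        perp_dim(3)[OF \<tau>(1) nd m] sym[OF m] by simp
  qed
  then have "symmetric_form \<tau>" unfolding symmetric_form_def
    using \<tau>(1) low unfolding perp_def by blast
  then show ?thesis by blast
qed

text \<open>By Pascal's rule the increments \<open>(n + k) choose (n - 1)\<close> grow with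
  \<open>k\<close>. Raising the smaller argument and lowering the larger one therefore does not
  increase the sum; the 1 on the right is the value at \<open>i = 0\<close>.\<close>

lemma binomial_convex:
  "\<lbrakk>2 * i < j\<rbrakk> \<Longrightarrow> ((n + i) choose n) + ((n + (j - Suc i)) choose n) \<le> ((n + (j - 1)) choose n) + 1"
proof (induction i)
  case (Suc i)
  have n: "n = Suc (n - 1)" using n1 by simp
  have pas: "(n + Suc k) choose n = ((n + k) choose n) + ((n + k) choose (n - 1))" for k
    by (subst (1 3) n) (simp add: add.commute)
  have j: "j - Suc i = Suc (j - Suc (Suc i))" using Suc.prems by simp
  have "((n + i) choose (n - 1)) \<le> ((n + (j - Suc (Suc i))) choose (n - 1))"
    by (rule binomial_right_mono) (use Suc.prems in simp)
  moreover have "(n + (j - Suc i)) choose n = ((n + (j - Suc (Suc i))) choose n) + ((n + (j - Suc (Suc i))) choose (n - 1))"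
    unfolding j by (rule pas)
  ultimately show ?case using Suc pas[of i] by simp
qed simp

text \<open>Below the middle this is \<open>binomial_convex\<close>, whose surplus 1 is absorbed by
  the strict bound \<open>low\<close> at \<open>r - 1\<close>. The other half follows by the
  reflection \<open>i \<mapsto> r - 1 - i\<close>.\<close>

lemma H_sub_additive:
  assumes "i < r" shows "H (Suc i) + H (r - i) \<le> d"
proof -
  have *: "H (Suc i) + H (r - i) \<le> d" if "2 * i < r" for i
  proof -
    have "H (Suc i) = (n + i) choose n" using that dim_Vs[of i] by simp
    moreover have "H (r - i) = (n + (r - Suc i)) choose n" using that dim_Vs[of "r - Suc i"] by (simp add: Suc_diff_Suc)
    moreover have "(n + (r - 1)) choose n < d" using low[of "r - 1"] that by simp
    ultimately show ?thesis using binomial_convex[OF that] by simp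
  qed
  show ?thesis
  proof (cases "2 * i < r")
    case False
    then have "2 * (r - Suc i) < r" using assms by simp
    from *[OF this] show ?thesis using assms by (simp add: add.commute Suc_diff_Suc)
  qed (rule *)
qed

text \<open>Both sides are compared with the sum of the \<open>H (Suc j)\<close>, which equals its
  own reversal. One strict inequality at a single index would separate the two sides.\<close>

theorem symmetric_form_iff_lengths:
  "(\<exists>\<tau>. symmetric_form \<tau>) \<longleftrightarrow> (\<Sum>j<r. d - H (Suc j)) = (\<Sum>j<r. H (Suc j) - mp.dim (cs j))"
proof
  assume "\<exists>\<tau>. symmetric_form \<tau>"
  then obtain \<tau> where \<tau>: "symmetric_form \<tau>" by blast
  have "(\<Sum>j<r. d - H (Suc j)) = (\<Sum>j<r. H (r - j))"
  proof (rule sum.cong)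
    fix j assume "j \<in> {..<r}"
    then show "d - H (Suc j) = H (r - j)" using symmetric_form_H[OF \<tau>, of "Suc j"] by simp
  qed simp
  also have "\<dots> = (\<Sum>j<r. H (Suc j))"
  proof -
    have "(\<Sum>j<r. H (r - j)) = (\<Sum>j<r. H (Suc (r - Suc j)))" by (rule sum.cong) (auto simp: Suc_diff_Suc)
    also have "\<dots> = (\<Sum>j<r. H (Suc j))" by (rule sum.nat_diff_reindex)
    finally show ?thesis .
  qed
  also have "\<dots> = (\<Sum>j<r. H (Suc j) - mp.dim (cs j))"
    by (rule sum.cong) (use symmetric_form_cs[OF \<tau>] in \<open>auto simp: mp.dim_zero\<close>)
  finally show "(\<Sum>j<r. d - H (Suc j)) = (\<Sum>j<r. H (Suc j) - mp.dim (cs j))" .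
next
  assume eq: "(\<Sum>j<r. d - H (Suc j)) = (\<Sum>j<r. H (Suc j) - mp.dim (cs j))"
  have refl: "(\<Sum>j<r. H (Suc j)) = (\<Sum>j<r. H (r - j))"
  proof -
    have "(\<Sum>j<r. H (r - j)) = (\<Sum>j<r. H (Suc (r - Suc j)))" by (rule sum.cong) (auto simp: Suc_diff_Suc)
    also have "\<dots> = (\<Sum>j<r. H (Suc j))" by (rule sum.nat_diff_reindex)
    finally show ?thesis by simp
  qed
  have le1: "(\<Sum>j<r. H (r - j)) \<le> (\<Sum>j<r. d - H (Suc j))"
    by (rule sum_mono) (use H_sub_additive in fastforce)
  have le2: "(\<Sum>j<r. H (Suc j) - mp.dim (cs j)) \<le> (\<Sum>j<r. H (Suc j))" by (rule sum_mono) simp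
  have e1: "H (r - j) = d - H (Suc j)" if "j < r" for j
  proof (rule ccontr)
    assume "H (r - j) \<noteq> d - H (Suc j)"
    then have "H (r - j) < d - H (Suc j)" using H_sub_additive[OF that] by simp
    then have "(\<Sum>j<r. H (r - j)) < (\<Sum>j<r. d - H (Suc j))"
      using that H_sub_additive by (intro sum_strict_mono_ex1) fastforce+
    then show False using eq refl le2 by simp
  qed
  have dcs: "mp.dim (cs j) = 0" if "j < r" for j
  proof (rule ccontr)
    assume "mp.dim (cs j) \<noteq> 0"
    then have "H (Suc j) - mp.dim (cs j) < H (Suc j)"
      using mp.dim_mono_fd[OF subspace_cs subspace_Vs cs_sub fin_Vs, of j] by simp
    then have "(\<Sum>j<r. H (Suc j) - mp.dim (cs j)) < (\<Sum>j<r. H (Suc j))"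
      using that by (intro sum_strict_mono_ex1) auto
    then show False using eq refl le1 by simp
  qed
  show "\<exists>\<tau>. symmetric_form \<tau>"
  proof (rule symmetric_form_of_dims)
    fix m assume m: "m \<le> Suc r"
    consider "m = 0" | "m = Suc r" | j where "m = Suc j" "j < r"
      using m by (metis le_neq_implies_less less_Suc_eq_le not0_implies_Suc Suc_less_eq)
    then show "H m + H (Suc r - m) = d"
    proof cases
      case 3
      then show ?thesis using e1[of j] H_le[of "Suc j"] by simp
    qed (use H_top in simp_all)
  next
    assume "r > 0"
    then show "cs (r - 1) = {0}"
      using mp.dim_zero_imp[OF subspace_cs mp.fin_dim_subset[OF fin_Vs cs_sub]] dcs[of "r - 1"] by simp
  qed
qed

end

section \<open>Symmetric forms make the coordinate ring Gorenstein\<close>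

text \<open>Substitution of \<open>X0\<close> for the variable; through it the coordinate ring is an
  algebra over \<open>K[x]\<close>.\<close>

definition ap :: "'k::field poly \<Rightarrow> 'k mpoly" where
  "ap p = fold_coeffs (\<lambda>a v. Poly_Mapping.single 0 a + X0 * v) p 0"

lemma ap_0 [simp]: "ap 0 = 0" by (simp add: ap_def)

lemma ap_pCons: "ap (pCons a p) = Poly_Mapping.single 0 a + X0 * ap p"
  by (cases "p = 0"; cases "a = 0") (simp_all add: ap_def)

lemma ap_add: "ap (p + q) = ap p + ap q"
  by (induction p q rule: poly_induct2) (simp_all add: ap_pCons single_add algebra_simps)

lemma ap_smult: "ap (smult c p) = sc c (ap p)"
  by (induction p) (simp_all add: ap_pCons algebra_simps mult_single)

lemma ap_mult: "ap (p * q) = ap p * ap q"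
  by (induction p) (simp_all add: ap_pCons ap_add ap_smult algebra_simps)

lemma ap_1: "ap 1 = 1" by (simp add: one_pCons ap_pCons)

lemma ap_monom: "ap (monom c j) = sc c (X0 ^ j)"
  by (induction j) (simp_all add: monom_0 monom_Suc ap_pCons algebra_simps)

lemma ap_carr: "ap p \<in> carrier (poly_ring n)"
  by (induction p) (auto simp: ap_pCons intro: poly_ring_intros X0_carr)

lemma cmp_sc: "f \<in> carrier (poly_ring n) \<Longrightarrow> cmp m (sc c f) = sc c (cmp m f)"
  using cmp_mult[OF _ hom_piece_const[of c n], of f m] by (simp add: mult.commute)

context hom_ideal
begin

lemma finsum_R:
  assumes "finite A" "\<And>b. b \<in> A \<Longrightarrow> f b \<in> P"
  shows "(\<Oplus>\<^bsub>R\<^esub>b\<in>A. rc (f b)) = rc (\<Sum>b\<in>A. f b)"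
proof -
  interpret cring R by (rule cring_R)
  show ?thesis using assms
  proof (induction A rule: finite_induct)
    case empty show ?case by (simp add: zero_R)
  next
    case (insert a A)
    then have "(\<lambda>b. rc (f b)) \<in> A \<rightarrow> carrier R" "rc (f a) \<in> carrier R" by auto
    then show ?case using insert by (simp add: add_R sum_in_poly_ring)
  qed
qed

end

context gpos
begin

lemma adapted_chain:
  obtains Bs :: "nat \<Rightarrow> 'k mpoly set" where "\<And>m. finite (Bs m)" "\<And>m. mp.independent (Bs m)" "\<And>m. mp.span (Bs m) = Vs m"
    "\<And>m. Bs m \<subseteq> Bs (Suc m)"
proof -
  let ?P = "\<lambda>m B. finite B \<and> mp.independent B \<and> mp.span B = Vs m"
  have "\<exists>Bs. \<forall>m. ?P m (Bs m) \<and> Bs m \<subseteq> Bs (Suc m)"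
  proof (rule dependent_nat_choice)
    show "\<exists>B. ?P 0 B" by (rule exI[of _ "{}"]) (simp add: Vs_0 mp.independent_empty)
  next
    fix B m assume B: "?P m B"
    from B have "B \<subseteq> Vs m" using mp.span_superset[of B] by simp
    then have "B \<subseteq> Vs (Suc m)" using Vs_mono[of m "Suc m"] by simp
    then obtain C where C: "B \<subseteq> C" "C \<subseteq> Vs (Suc m)" "mp.independent C" "Vs (Suc m) \<subseteq> mp.span C"
      using mp.maximal_independent_subset_extend[of B "Vs (Suc m)"] B by metis
    obtain F where F: "finite F" "Vs (Suc m) \<subseteq> mp.span F" using fin_Vs[of "Suc m"] unfolding mp.fin_dim_def by blast
    have "finite C" using mp.independent_span_bound[OF F(1) C(3)] C(2) F(2) by blast
    moreover have "mp.span C = Vs (Suc m)" using C mp.span_minimal[OF C(2) subspace_Vs] by blast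
    ultimately show "\<exists>C. ?P (Suc m) C \<and> B \<subseteq> C" using C by blast
  qed
  then show ?thesis using that by blast
qed

end

section \<open>Homogeneous dual bases and the homogenized functional\<close>

locale gpos_form = gpos n I d r for n and I :: "'k::field mpoly set" and d r +
  fixes \<tau> assumes sym: "symmetric_form \<tau>"
begin

lemmas \<tau>D = functionalD[OF symmetric_formD(1)[OF sym]]

lemma \<tau>_zero [simp]: "\<tau> 0 = 0" using \<tau>D(3)[OF It_zero] .

lemma \<tau>_X0_pow: assumes "f \<in> P" shows "\<tau> (X0 ^ k * f) = \<tau> f"
proof (rule functional_cong[OF symmetric_formD(1)[OF sym] _ assms])
  show "X0 ^ k * f \<in> P" by (rule mult_in_poly_ring[OF X0_carr(2) assms])
  show "nu (X0 ^ k * f) = nu f" using X0_pow_minus_one[OF assms] by (simp add: nu_eq_iff)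
qed

text \<open>The basis follows the filtration, and \<open>kd b\<close> is the degree in which
  \<open>b\<close> first appears. The dual vector of \<open>b\<close> is orthogonal to the basis
  vectors of lower degree, that is to \<open>Vs (kd b)\<close>, so the symmetry of the form places
  it in \<open>Vs (Suc r - kd b)\<close>. This is why a representative of degree
  \<open>r - kd b\<close> exists.\<close>

lemma dual_bases:
  obtains B :: "'k mpoly set" and kd e e' where "finite B" "mp.span B = S" "\<And>b. b \<in> B \<Longrightarrow> kd b \<le> r"
    "\<And>b. b \<in> B \<Longrightarrow> e b \<in> hom_piece n (kd b)" "\<And>b. b \<in> B \<Longrightarrow> e' b \<in> hom_piece n (r - kd b)"
    "\<And>b. b \<in> B \<Longrightarrow> nu (e b) = b"
    "\<And>b c. b \<in> B \<Longrightarrow> c \<in> B \<Longrightarrow> \<tau> (e c * e' b) = (if c = b then 1 else 0)"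
    "\<And>b g. b \<in> B \<Longrightarrow> g \<in> P \<Longrightarrow> deg_below (kd b) g \<Longrightarrow> \<tau> (g * e' b) = 0"
proof -
  obtain Bs where Bs: "\<And>m. finite (Bs m)" "\<And>m. mp.independent (Bs m)" "\<And>m. mp.span (Bs m) = Vs m"
    "\<And>m. Bs m \<subseteq> Bs (Suc m)" using adapted_chain by metis
  have Bmono: "Bs m \<subseteq> Bs m'" if "m \<le> m'" for m m' using lift_Suc_mono_le[of Bs, OF Bs(4) that] .
  define B where "B = Bs (Suc r)"
  have spB: "mp.span B = S" unfolding B_def Bs(3) S_eq ..
  define kd where "kd b = (LEAST m. b \<in> Bs (Suc m))" for b
  have kd: "kd b \<le> r" "b \<in> Bs (Suc (kd b))" if "b \<in> B" for b
    using that unfolding kd_def B_def by (auto intro: Least_le LeastI)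
  \<comment> \<open>Minimality of \<open>kd b\<close> says nothing if \<open>kd b = 0\<close>; there
    \<open>Bs 0\<close> is empty, being independent in the zero space.\<close>
  have kd_not: "b \<notin> Bs (kd b)" if "b \<in> B" for b
  proof (cases "kd b")
    case 0
    have "b \<noteq> 0" if "b \<in> Bs 0" using that Bs(2)[of 0] mp.dependent_zero by blast
    moreover have "b = 0" if "b \<in> Bs 0" using that Bs(3)[of 0] mp.span_base[of b "Bs 0"] Vs_0 by auto
    ultimately show ?thesis using 0 by auto
  next
    case (Suc j)
    then have "j < kd b" by simp
    from not_less_Least[OF this[unfolded kd_def]] show ?thesis unfolding Suc .
  qed
  have "\<forall>b\<in>B. \<exists>f. f \<in> hom_piece n (kd b) \<and> nu f = b"
  proof
    fix b assume "b \<in> B"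
    then have "b \<in> Vs (Suc (kd b))" using kd(2) Bs(3) mp.span_base by blast
    then show "\<exists>f. f \<in> hom_piece n (kd b) \<and> nu f = b" using Vs_hom by blast
  qed
  then obtain e where e: "\<And>b. b \<in> B \<Longrightarrow> e b \<in> hom_piece n (kd b)" "\<And>b. b \<in> B \<Longrightarrow> nu (e b) = b" by metis
  define \<Theta> where "\<Theta> = (\<lambda>s b. if b \<in> B then \<tau> (pr s * pr b) else 0)"
  note F = form_coordinates[OF symmetric_formD(1)[OF sym] symmetric_form_nondegenerate[OF sym] Bs(1)[of "Suc r", folded B_def] Bs(2)[of "Suc r", folded B_def] spB \<Theta>_def]
  have "\<forall>b\<in>B. \<exists>f. f \<in> hom_piece n (r - kd b) \<and> (\<forall>c\<in>B. \<tau> (e c * f) = (if c = b then 1 else 0)) \<and> (\<forall>g\<in>P. deg_below (kd b) g \<longrightarrow> \<tau> (g * f) = 0)"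
  proof
    fix b assume b: "b \<in> B"
    have "(\<lambda>c. if c = b then 1 else 0) \<in> \<Theta> ` S" unfolding F(1) using b by auto
    then obtain s where s: "s \<in> S" "\<Theta> s = (\<lambda>c. if c = b then 1 else 0)" by (metis imageE)
    obtain f where f: "f \<in> P" "s = nu f" using s(1) unfolding S_def by blast
    have low: "\<tau> (f * g) = 0" if g: "g \<in> P" "deg_below (kd b) g" for g
    proof (rule F(5)[OF f(1) _ _ g(1)])
      show "Bs (kd b) \<subseteq> B" unfolding B_def using kd(1)[OF b] by (intro Bmono) simp
      show "\<Theta> (nu f) c = 0" if "c \<in> Bs (kd b)" for c using s(2) f(2) that kd_not[OF b] by auto
      show "nu g \<in> mp.span (Bs (kd b))" unfolding Bs(3) by (rule VsI[OF g])
    qed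
    have "nu f \<in> Vs (Suc r - kd b)"
      by (rule symmetric_formD(2)[OF sym _ f(1) low]) (use kd(1)[OF b] in auto)
    then obtain f' where f': "f' \<in> hom_piece n (r - kd b)" "nu f = nu f'" using Vs_hom[of "nu f" "r - kd b"] kd(1)[OF b] by (auto simp: Suc_diff_le)
    have f'P: "f' \<in> P" using hom_piece_carr[OF f'(1)] .
    have tr: "\<tau> (g * f') = \<tau> (f * g)" if "g \<in> P" for g
      using nu_mult_cong[OF f(1) f'P that f'(2)] f(1) f'P that
      by (intro functional_cong[OF symmetric_formD(1)[OF sym]] poly_ring_intros) (simp_all add: mult.commute)
    have "\<tau> (e c * f') = (if c = b then 1 else 0)" if c: "c \<in> B" for c
    proof -
      have ec: "e c \<in> P" "pr c \<in> P" "nu (e c) = nu (pr c)"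
        using e[OF c] hom_piece_carr pr[of c] spB mp.span_base[OF c] by auto
      have "\<tau> (e c * f') = \<tau> (f * e c)" by (rule tr[OF ec(1)])
      also have "\<dots> = \<tau> (f * pr c)" using nu_mult_cong[OF ec(1,2) f(1) ec(3)] ec f(1)
        by (intro functional_cong[OF symmetric_formD(1)[OF sym]] poly_ring_intros) (simp_all add: mult.commute)
      also have "\<dots> = \<Theta> s c" using F(6)[OF f(1) c] f(2) by simp
      finally show ?thesis using s(2) by simp
    qed
    moreover have "\<tau> (g * f') = 0" if "g \<in> P" "deg_below (kd b) g" for g using tr[OF that(1)] low[OF that] by simp
    ultimately show "\<exists>f. f \<in> hom_piece n (r - kd b) \<and> (\<forall>c\<in>B. \<tau> (e c * f) = (if c = b then 1 else 0)) \<and> (\<forall>g\<in>P. deg_below (kd b) g \<longrightarrow> \<tau> (g * f) = 0)"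
      using f'(1) by blast
  qed
  then obtain e' where "\<forall>b\<in>B. e' b \<in> hom_piece n (r - kd b) \<and> (\<forall>c\<in>B. \<tau> (e c * e' b) = (if c = b then 1 else 0)) \<and> (\<forall>g\<in>P. deg_below (kd b) g \<longrightarrow> \<tau> (g * e' b) = 0)"
    by metis
  then show ?thesis using that[of B kd e e'] e kd(1) spB Bs(1)[of "Suc r"] unfolding B_def[symmetric] by blast
qed

text \<open>The \<open>K[x\<^sub>0]\<close>-linear functional on \<open>R\<close> obtained from \<open>\<tau>\<close> by homogenization; \<open>X\<^sub>0\<close> becomes the variable
  of the univariate polynomials.\<close>
definition T :: "'k mpoly \<Rightarrow> 'k poly" where
  "T f = (\<Sum>m\<in>{m. cmp m f \<noteq> 0}. if r \<le> m then monom (\<tau> (cmp m f)) (m - r) else 0)"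

lemma T_eq: "deg_below N f \<Longrightarrow> T f = (\<Sum>m<N. if r \<le> m then monom (\<tau> (cmp m f)) (m - r) else 0)"
  unfolding T_def by (rule sum.mono_neutral_left) (use deg_below_cmp in \<open>auto simp: not_less[symmetric]\<close>)

lemma T_add:
  assumes "f \<in> P" "g \<in> P" shows "T (f + g) = T f + T g"
proof -
  obtain M N where "deg_below M f" "deg_below N g" using deg_below_ex by blast
  then have *: "deg_below (max M N) f" "deg_below (max M N) g" by (auto intro: deg_below_mono)
  show ?thesis unfolding T_eq[OF *(1)] T_eq[OF *(2)] T_eq[OF deg_below_add[OF *]] sum.distrib[symmetric]
    by (rule sum.cong) (simp_all add: cmp_add \<tau>D(1)[OF cmp_carr[OF assms(1)] cmp_carr[OF assms(2)]] add_monom)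
qed

lemma T_zero [simp]: "T 0 = 0" by (simp add: T_def)

lemma T_I: "f \<in> I \<Longrightarrow> T f = 0"
  unfolding T_def by (rule sum.neutral) (use I_cmp I_sub_It \<tau>D(3) in auto)

lemma T_hom:
  assumes "x \<in> hom_piece n m" shows "T x = (if r \<le> m then monom (\<tau> x) (m - r) else 0)"
proof -
  have "T x = (\<Sum>j<Suc m. if r \<le> j then monom (\<tau> (cmp j x)) (j - r) else 0)"
    by (rule T_eq[OF deg_below_hom[OF assms]]) simp
  also have "\<dots> = (\<Sum>j<Suc m. if j = m then (if r \<le> m then monom (\<tau> x) (m - r) else 0) else 0)"
    by (rule sum.cong) (auto simp: cmp_hom[OF assms])
  finally show ?thesis by simp
qed

lemma smult_sum: "smult c (\<Sum>i\<in>A. p i) = (\<Sum>i\<in>A. smult c (p i))"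
  by (induction A rule: infinite_finite_induct) (simp_all add: smult_add_right)

lemma T_sc: assumes "f \<in> P" shows "T (sc c f) = smult c (T f)"
proof -
  obtain N where N: "deg_below N f" using deg_below_ex by blast
  show ?thesis unfolding T_eq[OF N] T_eq[OF deg_below_sc[OF N]] smult_sum
    by (rule sum.cong) (simp_all add: cmp_sc[OF assms] \<tau>D(2)[OF cmp_carr[OF assms]] smult_monom)
qed

text \<open>Multiplication by \<open>X0\<close> moves the component of degree \<open>r - 1\<close>
  into the range that \<open>T\<close> counts. It adds nothing, since \<tau> vanishes on
  \<open>Vs r\<close>; all other terms are merely shifted.\<close>

lemma T_X0: assumes f: "f \<in> P" shows "T (X0 * f) = pCons 0 (T f)"
proof -
  obtain N where N: "deg_below N f" using deg_below_ex by blast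
  have N': "deg_below (Suc N) (X0 * f)"
    using deg_below_mult[OF deg_below_hom[OF X0_hom[of n], of "Suc 1"] N] by simp
  have low: "\<tau> (cmp m f) = 0" if "Suc m = r" for m
    using that VsI[OF cmp_carr[OF f, of m] deg_below_hom[OF cmp_in_hom_piece[OF f, of m]], of r]
    by (intro symmetric_form_low[OF sym cmp_carr[OF f]]) simp
  have "T (X0 * f) = (\<Sum>m<N. if r \<le> Suc m then monom (\<tau> (cmp (Suc m) (X0 * f))) (Suc m - r) else 0)"
    unfolding T_eq[OF N'] by (subst sum.lessThan_Suc_shift) (simp add: cmp_X0_mult[OF f])
  also have "\<dots> = (\<Sum>m<N. if r \<le> m then monom (\<tau> (cmp m f)) (Suc (m - r)) else 0)"
  proof (rule sum.cong)
    fix m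
    have "\<tau> (X0 * cmp m f) = \<tau> (cmp m f)" using \<tau>_X0_pow[OF cmp_carr[OF f], of 1 m] by simp
    then show "(if r \<le> Suc m then monom (\<tau> (cmp (Suc m) (X0 * f))) (Suc m - r) else 0) = (if r \<le> m then monom (\<tau> (cmp m f)) (Suc (m - r)) else 0)"
      using low[of m] by (auto simp: cmp_X0_mult[OF f] Suc_diff_le le_Suc_eq)
  qed simp
  also have "\<dots> = monom 1 1 * T f" unfolding T_eq[OF N] sum_distrib_left by (rule sum.cong) (auto simp: mult_monom)
  also have "\<dots> = pCons 0 (T f)" by (simp add: monom_Suc monom_0)
  finally show ?thesis .
qed

lemma T_ap: "f \<in> P \<Longrightarrow> T (ap p * f) = p * T f"
proof (induction p)
  case (pCons a p)
  have "ap (pCons a p) * f = sc a f + X0 * (ap p * f)" by (simp add: ap_pCons algebra_simps)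
  moreover have pf: "ap p * f \<in> P" by (rule mult_in_poly_ring[OF ap_carr pCons.prems])
  ultimately show ?case using pCons T_add[OF sc_carr[OF pCons.prems] mult_in_poly_ring[OF X0_carr(1) pf]]
    by (simp add: T_sc T_X0)
qed simp

text \<open>The families of \<open>dual_bases\<close> satisfy the expansion formula in
  \<open>R\<close>. The defect \<open>G x\<close> of a form \<open>x\<close> is again a form and is
  orthogonal to every \<open>e' c\<close>; hence it vanishes in S and lies in
  \<open>I\<close>.\<close>

theorem gorenstein_coord_ring: "gorenstein_ring R"
proof -
  obtain B kd e e' where B: "finite B" "mp.span B = S" "\<And>b. b \<in> B \<Longrightarrow> kd b \<le> r"
    "\<And>b. b \<in> B \<Longrightarrow> e b \<in> hom_piece n (kd b)" "\<And>b. b \<in> B \<Longrightarrow> e' b \<in> hom_piece n (r - kd b)"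
    "\<And>b. b \<in> B \<Longrightarrow> nu (e b) = b"
    "\<And>b c. b \<in> B \<Longrightarrow> c \<in> B \<Longrightarrow> \<tau> (e c * e' b) = (if c = b then 1 else 0)"
    "\<And>b g. b \<in> B \<Longrightarrow> g \<in> P \<Longrightarrow> deg_below (kd b) g \<Longrightarrow> \<tau> (g * e' b) = 0"
    using dual_bases by blast
  have eP: "e b \<in> P" and e'P: "e' b \<in> P" if "b \<in> B" for b using B(4,5) that hom_piece_carr by blast+
  define G where "G f = f - (\<Sum>b\<in>B. ap (T (f * e' b)) * e b)" for f
  have G_add: "G (f + g) = G f + G g" if "f \<in> P" "g \<in> P" for f g
    unfolding G_def using that e'P by (simp add: distrib_right T_add ap_add poly_ring_intros sum.distrib)
  have G_hom: "G x \<in> I" if x: "x \<in> hom_piece n m" for x m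
  proof -
    have xP: "x \<in> P" using hom_piece_carr[OF x] .
    define t where "t b = (if kd b \<le> m then sc (\<tau> (x * e' b)) (X0 ^ (m - kd b) * e b) else 0)" for b
    have tb: "ap (T (x * e' b)) * e b = t b" if "b \<in> B" for b
    proof -
      have "r \<le> m + (r - kd b) \<longleftrightarrow> kd b \<le> m" "kd b \<le> m \<Longrightarrow> m + (r - kd b) - r = m - kd b" using B(3)[OF that] by auto
      then show ?thesis unfolding T_hom[OF hom_piece_mult[OF x B(5)[OF that]]] t_def by (auto simp: ap_monom mult.assoc)
    qed
    have th: "t b \<in> hom_piece n m" if "b \<in> B" for b
      unfolding t_def using X0_mult_hom[OF B(4)[OF that], of "m - kd b"] by (auto intro: sc_hom)
    have Gx: "G x = x - (\<Sum>b\<in>B. t b)" unfolding G_def using tb by simp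
    have GH: "G x \<in> hom_piece n m" unfolding Gx by (intro hom_piece_diff x hom_piece_sum th)
    have GP: "G x \<in> P" using hom_piece_carr[OF GH] .
    have \<tau>G: "\<tau> (G x * e' c) = 0" if c: "c \<in> B" for c
    proof -
      have tc: "\<tau> (t b * e' c) = (if b = c then \<tau> (x * e' c) else 0)" if b: "b \<in> B" for b
      proof (cases "kd b \<le> m")
        case True
        have ebc: "e b * e' c \<in> P" by (rule mult_in_poly_ring[OF eP[OF b] e'P[OF c]])
        have "\<tau> (t b * e' c) = \<tau> (sc (\<tau> (x * e' b)) (X0 ^ (m - kd b) * (e b * e' c)))" using True by (simp add: t_def mult.assoc)
        also have "\<dots> = \<tau> (x * e' b) * \<tau> (e b * e' c)"
          by (simp add: \<tau>D(2)[OF mult_in_poly_ring[OF X0_carr(2) ebc]] \<tau>_X0_pow[OF ebc])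
        finally show ?thesis using B(7)[OF c b] by simp
      next
        case False
        \<comment> \<open>For \<open>kd b > m\<close> the term is cut off in \<open>T\<close>.
          Nothing is lost, because \<open>e' b\<close> is orthogonal to all degrees below
          \<open>kd b\<close>.\<close>
        then have "\<tau> (x * e' b) = 0" using B(8)[OF b xP deg_below_hom[OF x]] by simp
        then show ?thesis using False by (auto simp: t_def)
      qed
      have "x * e' c = G x * e' c + (\<Sum>b\<in>B. t b * e' c)" unfolding Gx by (simp add: left_diff_distrib sum_distrib_right)
      then have "\<tau> (x * e' c) = \<tau> (G x * e' c) + \<tau> (\<Sum>b\<in>B. t b * e' c)"
        using \<tau>D(1)[of "G x * e' c" "\<Sum>b\<in>B. t b * e' c"] GP e'P[OF c] hom_piece_carr[OF th] by (simp add: poly_ring_intros)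
      also have "\<tau> (\<Sum>b\<in>B. t b * e' c) = (\<Sum>b\<in>B. \<tau> (t b * e' c))"
        by (rule functional_sum[OF symmetric_formD(1)[OF sym]]) (use e'P[OF c] hom_piece_carr[OF th] in \<open>auto intro: poly_ring_intros\<close>)
      also have "\<dots> = \<tau> (x * e' c)" using tc B(1) c by simp
      finally show ?thesis by simp
    qed
    have "nu (G x) \<in> mp.span B" using GP B(2) unfolding S_def by blast
    then obtain a where a: "nu (G x) = (\<Sum>b\<in>B. sc (a b) b)" using mp.span_finite[OF B(1)] by auto
    define y where "y = (\<Sum>b\<in>B. sc (a b) (e b))"
    have yP: "y \<in> P" unfolding y_def using eP by (intro sum_in_poly_ring sc_carr)
    have "nu y = nu (G x)" unfolding y_def a by (simp add: nu.sum nu.scale B(6))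
    have "a c = 0" if c: "c \<in> B" for c
    proof -
      have "\<tau> (G x * e' c) = \<tau> (y * e' c)" using nu_mult_cong[OF GP yP e'P[OF c]] \<open>nu y = nu (G x)\<close> GP yP e'P[OF c]
        by (intro functional_cong[OF symmetric_formD(1)[OF sym]] poly_ring_intros) auto
      also have "y * e' c = (\<Sum>b\<in>B. sc (a b) (e b * e' c))" unfolding y_def by (simp add: sum_distrib_right mult.assoc)
      also have "\<tau> \<dots> = (\<Sum>b\<in>B. \<tau> (sc (a b) (e b * e' c)))"
        by (rule functional_sum[OF symmetric_formD(1)[OF sym]]) (use e'P[OF c] eP in \<open>auto intro: poly_ring_intros\<close>)
      also have "\<dots> = (\<Sum>b\<in>B. if b = c then a c else 0)"
        by (rule sum.cong) (use B(7)[OF c] eP e'P[OF c] in \<open>auto simp: \<tau>D(2) poly_ring_intros\<close>)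
      finally show ?thesis using \<tau>G[OF c] B(1) c by simp
    qed
    then have "nu (G x) = 0" unfolding a by simp
    then show "G x \<in> I" using nu(2) It_hom[OF GH] by simp
  qed
  have G_I: "G f \<in> I" if f: "f \<in> P" for f
  proof -
    have "G (\<Sum>m<N. cmp m f) \<in> I" for N
    proof (induction N)
      case 0 then show ?case by (simp add: G_def I_zero)
    next
      case (Suc N)
      then show ?case using G_add[of "\<Sum>m<N. cmp m f" "cmp N f"] cmp_carr[OF f] G_hom[OF cmp_in_hom_piece[OF f]]
        by (simp add: sum_in_poly_ring I_add)
    qed
    then show ?thesis using deg_below_ex[of f] cmp_decomp[of _ f] by metis
  qed
  \<comment> \<open>\<open>T\<close> vanishes on \<open>I\<close>, so the value does not depend on
    the representative chosen.\<close>
  define tau where "tau x = T (SOME f. f \<in> P \<and> x = rc f)" for x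
  have tau: "tau (rc f) = T f" if f: "f \<in> P" for f
  proof -
    define g where "g = (SOME g. g \<in> P \<and> rc f = rc g)"
    have g: "g \<in> P" "rc f = rc g" unfolding g_def using someI[of "\<lambda>g. g \<in> P \<and> rc f = rc g" f] f by auto
    then have "T ((f - g) + g) = T (f - g) + T g" using f by (intro T_add poly_ring_intros)
    moreover have "T (f - g) = 0" using g(2) by (intro T_I) (simp add: rc_eq_iff)
    ultimately show ?thesis unfolding tau_def g_def[symmetric] by simp
  qed
  interpret R: cring R by (rule cring_R)
  interpret F: frobenius_extension R "\<lambda>p. rc (ap p)" tau B "\<lambda>b. rc (e b)" "\<lambda>b. rc (e' b)"
  proof unfold_locales
    fix x assume "x \<in> carrier R"
    then obtain f where f: "f \<in> P" "x = rc f" by (rule RE)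
    show "x = (\<Oplus>\<^bsub>R\<^esub>b\<in>B. rc (ap (tau (x \<otimes>\<^bsub>R\<^esub> rc (e' b)))) \<otimes>\<^bsub>R\<^esub> rc (e b))"
    proof -
      have "(\<Oplus>\<^bsub>R\<^esub>b\<in>B. rc (ap (tau (x \<otimes>\<^bsub>R\<^esub> rc (e' b)))) \<otimes>\<^bsub>R\<^esub> rc (e b)) = (\<Oplus>\<^bsub>R\<^esub>b\<in>B. rc (ap (T (f * e' b)) * e b))"
        by (rule R.finsum_cong'[OF refl funcsetI])
          (simp_all add: f(2) mult_R[OF f(1) e'P] tau mult_in_poly_ring[OF f(1) e'P] mult_R[OF ap_carr eP] rc_closed[OF mult_in_poly_ring[OF ap_carr eP]])
      also have "\<dots> = rc (\<Sum>b\<in>B. ap (T (f * e' b)) * e b)"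
        by (rule finsum_R[OF B(1)]) (use eP ap_carr in \<open>auto intro: poly_ring_intros\<close>)
      also have "\<dots> = x" unfolding f(2) using G_I[OF f(1)] unfolding G_def by (simp add: rc_eq_iff[of f, symmetric])
      finally show ?thesis by simp
    qed
    show "tau (rc (ap p) \<otimes>\<^bsub>R\<^esub> x) = p * tau x" for p
      unfolding f(2) by (simp add: mult_R[OF ap_carr f(1)] tau[OF mult_in_poly_ring[OF ap_carr f(1)]] tau[OF f(1)] T_ap[OF f(1)])
    fix y assume "y \<in> carrier R"
    then obtain g where g: "g \<in> P" "y = rc g" by (rule RE)
    show "tau (x \<oplus>\<^bsub>R\<^esub> y) = tau x + tau y" unfolding f(2) g(2) using f(1) g(1) by (simp add: add_R tau T_add poly_ring_intros)
  qed (simp_all add: B(1) eP e'P rc_closed[OF ap_carr] ap_1 ap_add ap_mult one_R add_R[OF ap_carr ap_carr] mult_R[OF ap_carr ap_carr])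
  show ?thesis by (rule F.gorenstein_ring_R)
qed

end

section \<open>Gorenstein coordinate rings have symmetric forms\<close>

lemma cmp_mult_sum:
  assumes f: "f \<in> carrier (poly_ring n)" and g: "g \<in> carrier (poly_ring n)" "deg_below N g"
  shows "cmp k (f * g) = (\<Sum>j<N. if j \<le> k then cmp (k - j) f * cmp j g else 0)"
proof -
  have "f * g = (\<Sum>j<N. f * cmp j g)"
    by (subst cmp_decomp[OF g(2)]) (simp add: sum_distrib_left)
  then show ?thesis
    by (simp add: cmp_sum cmp_mult[OF f cmp_in_hom_piece[OF g(1)]])
qed

lemma cmp_0_mult:
  assumes f: "f \<in> carrier (poly_ring n)" and g: "g \<in> carrier (poly_ring n)"
  shows "cmp 0 (f * g) = cmp 0 f * cmp 0 g"
proof -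
  obtain N where "deg_below N g" using deg_below_ex by blast
  then have N: "deg_below (Suc N) g" using deg_below_mono[of N g "Suc N"] by simp
  show ?thesis unfolding cmp_mult_sum[OF f g N] by (subst sum.lessThan_Suc_shift) simp
qed

section \<open>The quotient of R by x_0 and the irrelevant maximal ideal\<close>

context gpos
begin

text \<open>The preimage of x_0 R among the polynomials, so that P modulo \<open>Q\<close> is R /
  x_0 R.\<close>

definition Q :: "'k mpoly set" where "Q = {f \<in> P. \<exists>c\<in>P. f - X0 * c \<in> I}"

lemma QI: "\<lbrakk>f \<in> P; c \<in> P; f - X0 * c \<in> I\<rbrakk> \<Longrightarrow> f \<in> Q" unfolding Q_def by blast

lemma QE: assumes "f \<in> Q" obtains c where "f \<in> P" "c \<in> P" "f - X0 * c \<in> I" using assms unfolding Q_def by blast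

lemma Q_zero: "0 \<in> Q" by (rule QI[of _ 0]) (simp_all add: const_in_poly_ring I_zero)

lemma Q_X0: "c \<in> P \<Longrightarrow> X0 * c \<in> Q"
  using QI[of "X0 * c" c] mult_in_poly_ring[OF X0_carr(1), of c n] by (simp add: I_zero)

lemma Q_add: assumes "f \<in> Q" "g \<in> Q" shows "f + g \<in> Q"
proof -
  obtain c where c: "f \<in> P" "c \<in> P" "f - X0 * c \<in> I" using assms(1) by (rule QE)
  obtain e where e: "g \<in> P" "e \<in> P" "g - X0 * e \<in> I" using assms(2) by (rule QE)
  show ?thesis
  proof (rule QI[of _ "c + e"])
    show "f + g - X0 * (c + e) \<in> I" using I_add[OF c(3) e(3)] by (simp add: algebra_simps)
  qed (simp_all add: add_in_poly_ring c e)
qed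

lemma Q_mult: assumes "f \<in> Q" "g \<in> P" shows "g * f \<in> Q"
proof -
  obtain c where c: "f \<in> P" "c \<in> P" "f - X0 * c \<in> I" using assms(1) by (rule QE)
  show ?thesis
  proof (rule QI[of _ "g * c"])
    show "g * f - X0 * (g * c) \<in> I" using I_mult[OF c(3) assms(2)] by (simp add: algebra_simps)
  qed (simp_all add: mult_in_poly_ring c assms)
qed

lemma Q_sc: "f \<in> Q \<Longrightarrow> sc c f \<in> Q" by (rule Q_mult) (simp_all add: const_in_poly_ring)

lemma Q_sum: "(\<And>i. i \<in> A \<Longrightarrow> f i \<in> Q) \<Longrightarrow> (\<Sum>i\<in>A. f i) \<in> Q"
  by (induction A rule: infinite_finite_induct) (simp_all add: Q_zero Q_add)

lemma Q_cong: assumes "f \<in> Q" "g \<in> P" "g - f \<in> I" shows "g \<in> Q"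
proof -
  obtain c where c: "f \<in> P" "c \<in> P" "f - X0 * c \<in> I" using assms(1) by (rule QE)
  show ?thesis by (rule QI[OF assms(2) c(2)]) (use I_add[OF assms(3) c(3)] in simp)
qed

lemma Q_cmp: assumes "f \<in> Q" shows "cmp i f \<in> Q"
proof -
  obtain c where c: "f \<in> P" "c \<in> P" "f - X0 * c \<in> I" using assms by (rule QE)
  have "cmp i (X0 * c) \<in> Q"
    by (cases i) (simp_all add: cmp_X0_mult[OF c(2)] Q_zero Q_X0[OF cmp_carr[OF c(2)]])
  then show ?thesis by (rule Q_cong) (use cmp_carr[OF c(1)] I_cmp[OF c(3), of i] in \<open>simp_all add: cmp_diff\<close>)
qed

lemma Q_by_cmp: assumes "\<And>i. cmp i f \<in> Q" shows "f \<in> Q"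
proof -
  obtain N where "deg_below N f" using deg_below_ex by blast
  from cmp_decomp[OF this] show ?thesis using Q_sum[of "{..<N}" "\<lambda>i. cmp i f"] assms by simp
qed

text \<open>In degree \<open>i\<close> the quotient R / x_0 R is S_i / S_(i-1), because
  \<open>X0\<close> becomes 1 in S.\<close>

lemma Q_hom: assumes f: "f \<in> hom_piece n i" shows "f \<in> Q \<longleftrightarrow> nu f \<in> Vs i"
proof
  assume "f \<in> Q"
  then obtain c where c: "f \<in> P" "c \<in> P" "f - X0 * c \<in> I" by (rule QE)
  have fi: "f - cmp i (X0 * c) \<in> I" using I_cmp[OF c(3), of i] by (simp add: cmp_diff cmp_hom_same[OF f])
  show "nu f \<in> Vs i"
  proof (cases i)
    case 0
    then have "f \<in> It" using fi by (simp add: cmp_X0_mult[OF c(2)] I_sub_It)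
    then show ?thesis using 0 nu(2) Vs_0 by simp
  next
    case (Suc j)
    have "f - X0 * cmp j c \<in> It" using fi by (simp add: Suc cmp_X0_mult[OF c(2)] I_sub_It)
    then have "f - cmp j c \<in> It" using It_add[OF _ X0_minus_one[OF cmp_carr[OF c(2), of j]]] by fastforce
    then have "nu f = nu (cmp j c)" by (simp add: nu_eq_iff)
    then show ?thesis using nu_hom[of j] cmp_in_hom_piece[OF c(2), of j] Suc by auto
  qed
next
  assume v: "nu f \<in> Vs i"
  show "f \<in> Q"
  proof (cases i)
    case 0
    then have "f \<in> I" using v Vs_0 nu(2)[of f] It_hom[OF f] by simp
    then show ?thesis using Q_cong[OF Q_zero hom_piece_carr[OF f]] by simp
  next
    case (Suc j)
    then obtain g where g: "g \<in> hom_piece n j" "nu f = nu g" using v Vs_hom by blast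
    have gP: "g \<in> P" by (rule hom_piece_carr[OF g(1)])
    have "f - g - (X0 * g - g) \<in> It" by (rule It_diff[OF _ X0_minus_one[OF gP]]) (use g(2) in \<open>simp add: nu_eq_iff\<close>)
    then have "f - X0 * g \<in> I" using It_hom_diff[OF f, of "X0 * g"] X0_mult_hom[OF g(1), of 1] Suc by simp
    then show ?thesis by (rule QI[OF hom_piece_carr[OF f] gP])
  qed
qed

lemma Q_high: "\<lbrakk>f \<in> hom_piece n i; r < i\<rbrakk> \<Longrightarrow> f \<in> Q"
  using Q_hom nu_in_Vs_stable[OF hom_piece_carr] by blast

lemma one_notin_It: "1 \<notin> It"
proof
  assume "1 \<in> It"
  then have "It = P" using It_mult[of 1] It_carr by auto
  then have "Vs (Suc 0) = {0}" using mp.subspace_0[OF subspace_Vs, of "Suc 0"] nu(2) unfolding Vs_def by auto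
  then show False using H_1 by (simp add: mp.dim_zero)
qed

lemma const_inverse:
  assumes "h \<in> P" "cmp 0 h \<noteq> 0" obtains c where "Poly_Mapping.single 0 c * cmp 0 h = 1"
proof -
  obtain e where e: "cmp 0 h = Poly_Mapping.single 0 e" using hom_piece_zero_const[OF cmp_in_hom_piece[OF assms(1)]] by blast
  then have "e \<noteq> 0" using assms(2) by auto
  then show ?thesis using that[of "inverse e"] e by (simp add: mult_single)
qed

lemma cmp_0_mult_nonzero:
  assumes "f \<in> P" "g \<in> P" "cmp 0 f \<noteq> 0" "cmp 0 g \<noteq> 0" shows "cmp 0 (f * g) \<noteq> 0"
proof -
  obtain c where c: "Poly_Mapping.single 0 c * cmp 0 f = 1" using const_inverse[OF assms(1,3)] by blast
  have "sc c (cmp 0 (f * g)) = cmp 0 g" using c by (simp add: cmp_0_mult[OF assms(1,2)] flip: mult.assoc)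
  then show ?thesis using assms(4) by auto
qed

lemma I_cmp_0: assumes "f \<in> I" shows "cmp 0 f = 0"
proof (rule ccontr)
  assume "cmp 0 f \<noteq> 0"
  then obtain c where "Poly_Mapping.single 0 c * cmp 0 f = 1" using const_inverse I_carr[OF assms] by blast
  then have "1 \<in> I" using I_mult[OF I_cmp[OF assms, of 0] const_in_poly_ring(3)[of c]] by simp
  then show False using one_notin_It I_sub_It by blast
qed

definition irr :: "'k mpoly set set" where "irr = rc ` {f \<in> P. cmp 0 f = 0}"

lemma rc_irr: "f \<in> P \<Longrightarrow> rc f \<in> irr \<longleftrightarrow> cmp 0 f = 0"
proof
  assume "rc f \<in> irr"
  then obtain g where "rc f = rc g" "cmp 0 g = 0" unfolding irr_def by blast
  then show "cmp 0 f = 0" using I_cmp_0[of "f - g"] by (simp add: rc_eq_iff cmp_diff)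
qed (simp add: irr_def)

lemma irrE: assumes "x \<in> irr" obtains f where "f \<in> P" "cmp 0 f = 0" "x = rc f" using assms unfolding irr_def by blast

lemma maximalideal_irr: "maximalideal irr R"
proof -
  interpret R: cring R by (rule cring_R)
  have idl: "ideal irr R"
  proof (rule idealI)
    show "ring R" by (rule R.ring_axioms)
    show "subgroup irr (add_monoid R)"
    proof (rule R.add.subgroupI)
      show "irr \<subseteq> carrier R" by (auto simp: irr_def)
      show "irr \<noteq> {}" unfolding irr_def using const_in_poly_ring(1)[of n] cmp_zero by blast
      fix x assume "x \<in> irr"
      then obtain f where f: "f \<in> P" "cmp 0 f = 0" "x = rc f" by (rule irrE)
      show "\<ominus>\<^bsub>R\<^esub> x \<in> irr" unfolding f(3) using f(2) by (simp add: uminus_R[OF f(1)] rc_irr[OF uminus_in_poly_ring[OF f(1)]] cmp_uminus)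
      fix y assume "y \<in> irr"
      then obtain g where g: "g \<in> P" "cmp 0 g = 0" "y = rc g" by (rule irrE)
      show "x \<oplus>\<^bsub>R\<^esub> y \<in> irr" unfolding f(3) g(3) using f(2) g(2)
        by (simp add: add_R[OF f(1) g(1)] rc_irr[OF add_in_poly_ring[OF f(1) g(1)]] cmp_add)
    qed
    fix x y assume "x \<in> irr" "y \<in> carrier R"
    then obtain f g where fg: "f \<in> P" "cmp 0 f = 0" "x = rc f" "g \<in> P" "y = rc g" by (metis irrE RE)
    show "y \<otimes>\<^bsub>R\<^esub> x \<in> irr" "x \<otimes>\<^bsub>R\<^esub> y \<in> irr" unfolding fg(3,5) using fg(2)
      by (simp_all add: mult_R[OF fg(1,4)] mult_R[OF fg(4,1)] rc_irr[OF mult_in_poly_ring[OF fg(1,4)]]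
          rc_irr[OF mult_in_poly_ring[OF fg(4,1)]] cmp_0_mult[OF fg(1,4)] cmp_0_mult[OF fg(4,1)])
  qed
  have one_P: "(1 :: 'k mpoly) \<in> P" by (rule const_in_poly_ring(2))
  have one: "rc 1 \<notin> irr" using rc_irr[OF one_P] by (simp add: cmp_hom_same[OF hom_piece_one])
  show ?thesis
  proof (rule maximalidealI[OF idl])
    show "carrier R \<noteq> irr" using one rc_closed[OF one_P] by blast
    fix J assume J: "ideal J R" "irr \<subseteq> J" "J \<subseteq> carrier R"
    interpret J: ideal J R by fact
    show "J = irr \<or> J = carrier R"
    proof (cases "J \<subseteq> irr")
      case False
      then obtain x where x: "x \<in> J" "x \<notin> irr" by blast
      then obtain f where f: "f \<in> P" "x = rc f" using J(3) RE by blast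
      then have c: "cmp 0 f \<noteq> 0" using x(2) rc_irr by blast
      have c0: "cmp 0 f \<in> P" by (rule cmp_carr[OF f(1)])
      have "rc (f - cmp 0 f) \<in> irr"
        by (subst rc_irr) (simp_all add: f(1) c0 minus_in_poly_ring cmp_diff cmp_hom_same[OF cmp_in_hom_piece[OF f(1)]])
      then have "rc f \<ominus>\<^bsub>R\<^esub> rc (f - cmp 0 f) \<in> J" unfolding a_minus_def using x(1) f(2) J(2) J.a_closed J.a_inv_closed by blast
      then have cJ: "rc (cmp 0 f) \<in> J" by (simp add: minus_R[OF f(1) minus_in_poly_ring[OF f(1) c0]])
      obtain e where e: "Poly_Mapping.single 0 e * cmp 0 f = 1" using const_inverse[OF f(1) c] by blast
      have "rc (Poly_Mapping.single 0 e) \<otimes>\<^bsub>R\<^esub> rc (cmp 0 f) \<in> J"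
        using cJ rc_closed[OF const_in_poly_ring(3)] by (rule J.I_l_closed)
      then have "\<one>\<^bsub>R\<^esub> \<in> J" by (simp add: mult_R[OF const_in_poly_ring(3) c0] e one_R)
      then show ?thesis using J.one_imp_carrier by blast
    qed (use J(2) in blast)
  qed
qed

end

locale gpos_gorenstein = gpos n I d r for n and I :: "'k::field mpoly set" and d r +
  assumes gor: "gorenstein_ring R"
begin

lemma ex_socle_generator: obtains \<sigma> where "\<sigma> \<in> hom_piece n r" "nu \<sigma> \<notin> Vs r"
proof -
  have "Vs (Suc r) \<noteq> Vs r" using H_r_less H_top by auto
  then obtain v where "v \<in> Vs (Suc r)" "v \<notin> Vs r" using Vs_mono[of r "Suc r"] by auto
  then show ?thesis using that Vs_hom by blast
qed

text \<open>\<open>socle_cyclic\<close> applies to the localization at the irrelevant ideal, with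
  x_0 as the non-zerodivisor. It gives a relation between fractions; after denominators are cleared,
  the component of degree \<open>i\<close> contains \<open>s\<close> only with a nonzero constant
  factor, which is divided out.\<close>

lemma socle_alternative:
  assumes \<sigma>: "\<sigma> \<in> hom_piece n r" "nu \<sigma> \<notin> Vs r"
    and s: "s \<in> hom_piece n i" and soc: "\<And>a. \<lbrakk>a \<in> P; cmp 0 a = 0\<rbrakk> \<Longrightarrow> a * s \<in> Q"
  shows "s \<in> Q \<or> i = r \<and> (\<exists>c. s - sc c \<sigma> \<in> Q)"
proof -
  have \<sigma>P: "\<sigma> \<in> P" and sP: "s \<in> P" using \<sigma>(1) s hom_piece_carr by blast+
  interpret localization_at R irr by (intro localization_at.intro cring_R localization_at_axioms.intro maximalideal_irr)
  note U_carr [simp del, rule del]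
  have one_P: "(1 :: 'k mpoly) \<in> P" by (rule const_in_poly_ring(2))
  have U: "rc f \<in> carrier R - irr \<longleftrightarrow> cmp 0 f \<noteq> 0" if "f \<in> P" for f using rc_irr[OF that] rc_closed[OF that] by simp
  have UE: "\<exists>f\<in>P. u = rc f \<and> cmp 0 f \<noteq> 0" if "u \<in> carrier R - irr" for u
    using that U RE by (metis DiffD1)
  have gl: "gorenstein_local_ring L" using gor maximalideal_irr unfolding gorenstein_ring_def by blast
  interpret L: cring L by (rule cring_L)
  interpret LN: noetherian_ring L using gl unfolding gorenstein_local_ring_def by blast
  have X0P: "X0 \<in> P" by (rule X0_carr(1))
  let ?x = "fr (rc X0) \<one>\<^bsub>R\<^esub>"
  \<comment> \<open>Fractions whose numerator starts in degree at least \<open>k\<close>. Level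
    \<open>Suc r\<close> is divisible by x_0, because all forms of degree above \<open>r\<close> lie
    in \<open>Q\<close>.\<close>
  define D where "D k = {fr (rc f) u | f u. f \<in> P \<and> (\<forall>i<k. cmp i f = 0) \<and> u \<in> carrier R - irr}" for k :: nat
  have LE: "\<exists>f\<in>P. \<exists>u\<in>carrier R - irr. y = fr (rc f) u" if "y \<in> carrier L" for y
    using that carrE RE by metis
  have x_mult: "?x \<otimes>\<^bsub>L\<^esub> fr (rc c) u = fr (rc (X0 * c)) u" if "c \<in> P" "u \<in> carrier R - irr" for c u
    using mult_L[OF rc_closed[OF X0P] U_one rc_closed[OF that(1)] that(2)] U_carr[OF that(2)] by (simp add: mult_R[OF X0P that(1)])
  have in_xL: "\<exists>c\<in>carrier L. fr (rc f) u = ?x \<otimes>\<^bsub>L\<^esub> c" if f: "f \<in> Q" and u: "u \<in> carrier R - irr" for f u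
  proof -
    obtain c where c: "f \<in> P" "c \<in> P" "f - X0 * c \<in> I" using f by (rule QE)
    have "rc f = rc (X0 * c)" using c(3) by (simp add: rc_eq_iff)
    then have "fr (rc f) u = ?x \<otimes>\<^bsub>L\<^esub> fr (rc c) u" using x_mult[OF c(2) u] by simp
    then show ?thesis using fr_closed[OF rc_closed[OF c(2)] u] by blast
  qed
  have mE: "\<exists>g\<in>P. \<exists>u\<in>carrier R - irr. a = fr (rc g) u \<and> cmp 0 g = 0" if "a \<in> mloc" for a
    using that irrE unfolding mloc_def by (smt (verit) mem_Collect_eq)
  have m_mult: "\<exists>c\<in>carrier L. a \<otimes>\<^bsub>L\<^esub> fr (rc t) \<one>\<^bsub>R\<^esub> = ?x \<otimes>\<^bsub>L\<^esub> c"
    if a: "a \<in> mloc" and t: "t \<in> P" "\<And>g. \<lbrakk>g \<in> P; cmp 0 g = 0\<rbrakk> \<Longrightarrow> g * t \<in> Q" for a t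
  proof -
    obtain g u where g: "g \<in> P" "u \<in> carrier R - irr" "a = fr (rc g) u" "cmp 0 g = 0" using mE[OF a] by blast
    have "a \<otimes>\<^bsub>L\<^esub> fr (rc t) \<one>\<^bsub>R\<^esub> = fr (rc (g * t)) u" unfolding g(3)
      using mult_L[OF rc_closed[OF g(1)] g(2) rc_closed[OF t(1)] U_one] U_carr[OF g(2)] by (simp add: mult_R[OF g(1) t(1)])
    then show ?thesis using in_xL[OF t(2)[OF g(1,4)] g(2)] by simp
  qed
  have \<sigma>_soc: "g * \<sigma> \<in> Q" if g: "g \<in> P" "cmp 0 g = 0" for g
  proof (rule Q_by_cmp)
    fix k show "cmp k (g * \<sigma>) \<in> Q"
    proof (cases "r < k")
      case True then show ?thesis by (rule Q_high[OF cmp_in_hom_piece[OF mult_in_poly_ring[OF g(1) \<sigma>P]]])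
    next
      case False then show ?thesis using g(2) by (simp add: cmp_mult[OF g(1) \<sigma>(1)] Q_zero)
    qed
  qed
  \<comment> \<open>A multiplier with nonzero constant term cannot push a form into
    \<open>Q\<close>: in the degree of the form, the product has a nonzero scalar multiple of it as
    component.\<close>
  have hom_descend: "f \<in> Q" if "f \<in> hom_piece n k" "h \<in> P" "cmp 0 h \<noteq> 0" "h * f \<in> Q" for f h k
  proof -
    have "cmp k (h * f) = cmp 0 h * f" using cmp_mult[OF that(2,1), of k] by simp
    then have 1: "cmp 0 h * f \<in> Q" using Q_cmp[OF that(4), of k] by simp
    from const_inverse[OF that(2,3)] obtain e where e: "Poly_Mapping.single 0 e * cmp 0 h = 1" by blast
    then show ?thesis using Q_sc[OF 1, of e] by (simp flip: mult.assoc)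
  qed
  interpret socle_setup L ?x mloc D "Suc r" "fr (rc \<sigma>) \<one>\<^bsub>R\<^esub>"
  proof (intro socle_setup.intro socle_setup_axioms.intro LN.noetherian_ring_axioms cring_L)
    show "maximalideal mloc L" by (rule maximalideal_mloc)
    show "?x \<in> mloc" using fr_in_mloc_iff[OF rc_closed[OF X0P] U_one] rc_irr[OF X0P] cmp_hom[OF X0_hom[of n], of 0] by simp
    fix a assume a: "a \<in> carrier L" "?x \<otimes>\<^bsub>L\<^esub> a = \<zero>\<^bsub>L\<^esub>"
    obtain f u where f: "f \<in> P" "u \<in> carrier R - irr" "a = fr (rc f) u" using LE[OF a(1)] by blast
    have Xf: "X0 * f \<in> P" by (rule mult_in_poly_ring[OF X0P f(1)])
    have "fr (rc (X0 * f)) u = \<zero>\<^bsub>L\<^esub>" using a(2) x_mult[OF f(1,2)] f(3) by simp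
    then obtain w where w: "w \<in> carrier R - irr" "w \<otimes>\<^bsub>R\<^esub> rc (X0 * f) = \<zero>\<^bsub>R\<^esub>" using fr_zero_iff[OF rc_closed[OF Xf] f(2)] by blast
    obtain h where h: "h \<in> P" "w = rc h" using UE[OF w(1)] by blast
    have hf: "h * f \<in> P" by (rule mult_in_poly_ring[OF h(1) f(1)])
    have "X0 * (h * f) \<in> I" using w(2) unfolding h(2) by (simp add: mult_R[OF h(1) Xf] zero_R rc_eq_iff mult.left_commute)
    then have "h * f \<in> I" by (rule nzd[OF hf])
    then have "w \<otimes>\<^bsub>R\<^esub> rc f = \<zero>\<^bsub>R\<^esub>" unfolding h(2) by (simp add: mult_R[OF h(1) f(1)] zero_R rc_eq_iff)
    then show "a = \<zero>\<^bsub>L\<^esub>" unfolding f(3) using fr_zero_iff[OF rc_closed[OF f(1)] f(2)] w(1) by blast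
  next
    show "\<one>\<^bsub>L\<^esub> \<in> D 0" unfolding D_def one_L one_R using one_P U_one[unfolded one_R] by blast
    show "D k \<subseteq> carrier L" for k unfolding D_def using fr_closed[OF rc_closed] by blast
  next
    fix k a b assume "a \<in> mloc" "b \<in> D k"
    then obtain g u f v where *: "g \<in> P" "u \<in> carrier R - irr" "a = fr (rc g) u" "cmp 0 g = 0"
        "f \<in> P" "\<forall>i<k. cmp i f = 0" "v \<in> carrier R - irr" "b = fr (rc f) v" using mE unfolding D_def by blast
    obtain M where M: "deg_below M f" using deg_below_ex by blast
    have "cmp i (g * f) = 0" if ik: "i < Suc k" for i
      unfolding cmp_mult_sum[OF *(1,5) M]
    proof (rule sum.neutral, rule ballI)
      fix j
      consider "j < k" | "i < j" | "j = i" using ik by linarith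
      then show "(if j \<le> i then cmp (i - j) g * cmp j f else 0) = 0"
        by cases (simp_all add: *(4,6))
    qed
    moreover have "a \<otimes>\<^bsub>L\<^esub> b = fr (rc (g * f)) (u \<otimes>\<^bsub>R\<^esub> v)" unfolding *(3,8)
      using mult_L[OF rc_closed[OF *(1)] *(2) rc_closed[OF *(5)] *(7)] by (simp add: mult_R[OF *(1,5)])
    ultimately show "a \<otimes>\<^bsub>L\<^esub> b \<in> D (Suc k)" unfolding D_def
      using mult_in_poly_ring[OF *(1,5)] U_mult[OF *(2,7)] by blast
  next
    fix b assume "b \<in> D (Suc r)"
    then obtain f u where *: "f \<in> P" "\<forall>i<Suc r. cmp i f = 0" "u \<in> carrier R - irr" "b = fr (rc f) u" unfolding D_def by blast
    have "f \<in> Q"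
    proof (rule Q_by_cmp)
      fix i show "cmp i f \<in> Q"
        using *(2) Q_zero Q_high[OF cmp_in_hom_piece[OF *(1)], of i] by (cases "i < Suc r") simp_all
    qed
    then show "\<exists>c\<in>carrier L. b = ?x \<otimes>\<^bsub>L\<^esub> c" unfolding *(4) by (rule in_xL[OF _ *(3)])
  next
    show "fr (rc \<sigma>) \<one>\<^bsub>R\<^esub> \<in> carrier L" by (rule fr_closed[OF rc_closed[OF \<sigma>P] U_one])
    fix c assume "c \<in> carrier L"
    then obtain f u where f: "f \<in> P" "u \<in> carrier R - irr" "c = fr (rc f) u" using LE by blast
    have Xf: "X0 * f \<in> P" by (rule mult_in_poly_ring[OF X0P f(1)])
    obtain v where v: "v \<in> P" "u = rc v" "cmp 0 v \<noteq> 0" using UE[OF f(2)] by blast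
    show "fr (rc \<sigma>) \<one>\<^bsub>R\<^esub> \<noteq> ?x \<otimes>\<^bsub>L\<^esub> c"
    proof
      assume "fr (rc \<sigma>) \<one>\<^bsub>R\<^esub> = ?x \<otimes>\<^bsub>L\<^esub> c"
      then have "fr (rc \<sigma>) \<one>\<^bsub>R\<^esub> = fr (rc (X0 * f)) u" unfolding f(3) x_mult[OF f(1,2)] .
      then obtain w where w: "w \<in> carrier R - irr" "w \<otimes>\<^bsub>R\<^esub> (rc \<sigma> \<otimes>\<^bsub>R\<^esub> u) = w \<otimes>\<^bsub>R\<^esub> (rc (X0 * f) \<otimes>\<^bsub>R\<^esub> \<one>\<^bsub>R\<^esub>)"
        using fr_eq_iff[OF rc_closed[OF \<sigma>P] U_one rc_closed[OF Xf] f(2)] by blast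
      obtain h where h: "h \<in> P" "w = rc h" "cmp 0 h \<noteq> 0" using UE[OF w(1)] by blast
      have "rc (h * (\<sigma> * v)) = rc (h * (X0 * f))" using w(2) unfolding h(2) v(2)
        by (simp add: mult_R[OF \<sigma>P v(1)] mult_R[OF h(1) mult_in_poly_ring[OF \<sigma>P v(1)]] mult_R[OF h(1) Xf] rc_closed[OF Xf])
      moreover have "h * (X0 * f) \<in> Q" by (rule Q_mult[OF Q_X0[OF f(1)] h(1)])
      ultimately have "(h * v) * \<sigma> \<in> Q"
        using Q_cong[of "h * (X0 * f)" "h * v * \<sigma>"] h(1) v(1) \<sigma>P by (simp add: rc_eq_iff ac_simps mult_in_poly_ring)
      moreover have "cmp 0 (h * v) \<noteq> 0" by (rule cmp_0_mult_nonzero[OF h(1) v(1) h(3) v(3)])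
      ultimately have "\<sigma> \<in> Q" using hom_descend[OF \<sigma>(1) mult_in_poly_ring[OF h(1) v(1)]] by blast
      then show False using Q_hom[OF \<sigma>(1)] \<sigma>(2) by blast
    qed
  next
    fix a assume "a \<in> mloc"
    then show "\<exists>c\<in>carrier L. a \<otimes>\<^bsub>L\<^esub> fr (rc \<sigma>) \<one>\<^bsub>R\<^esub> = ?x \<otimes>\<^bsub>L\<^esub> c" by (rule m_mult[OF _ \<sigma>P \<sigma>_soc])
  qed
  have fin: "finite_self_injective_dimension L" using gl unfolding gorenstein_local_ring_def by blast
  obtain \<rho> q where \<rho>: "\<rho> \<in> carrier L" "q \<in> carrier L"
      "fr (rc s) \<one>\<^bsub>R\<^esub> = \<rho> \<otimes>\<^bsub>L\<^esub> fr (rc \<sigma>) \<one>\<^bsub>R\<^esub> \<oplus>\<^bsub>L\<^esub> ?x \<otimes>\<^bsub>L\<^esub> q"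
    using socle_cyclic[OF fin fr_closed[OF rc_closed[OF sP] U_one] m_mult[OF _ sP soc]] by blast
  obtain p u where p: "p \<in> P" "u \<in> carrier R - irr" "\<rho> = fr (rc p) u" using LE[OF \<rho>(1)] by blast
  obtain c v where c: "c \<in> P" "v \<in> carrier R - irr" "q = fr (rc c) v" using LE[OF \<rho>(2)] by blast
  obtain u' where u': "u' \<in> P" "u = rc u'" "cmp 0 u' \<noteq> 0" using UE[OF p(2)] by blast
  obtain v' where v': "v' \<in> P" "v = rc v'" "cmp 0 v' \<noteq> 0" using UE[OF c(2)] by blast
  have ps: "p * \<sigma> \<in> P" and xc: "X0 * c \<in> P" using mult_in_poly_ring p(1) \<sigma>P c(1) X0P by blast+
  have uv: "u' * v' \<in> P" using mult_in_poly_ring u'(1) v'(1) by blast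
  let ?num = "p * \<sigma> * v' + X0 * c * u'"
  have num: "?num \<in> P" by (intro add_in_poly_ring mult_in_poly_ring p(1) \<sigma>P v'(1) X0P c(1) u'(1))
  have "fr (rc s) \<one>\<^bsub>R\<^esub> = fr (rc (p * \<sigma>)) u \<oplus>\<^bsub>L\<^esub> fr (rc (X0 * c)) v"
    unfolding \<rho>(3) p(3) c(3) x_mult[OF c(1,2)] using mult_L[OF rc_closed[OF p(1)] p(2) rc_closed[OF \<sigma>P] U_one] U_carr[OF p(2)]
    by (simp add: mult_R[OF p(1) \<sigma>P])
  also have "\<dots> = fr (rc ?num) (u \<otimes>\<^bsub>R\<^esub> v)"
    unfolding add_L[OF rc_closed[OF ps] p(2) rc_closed[OF xc] c(2)] unfolding u'(2) v'(2)
    by (simp add: mult_R[OF ps v'(1)] mult_R[OF xc u'(1)] add_R[OF mult_in_poly_ring[OF ps v'(1)] mult_in_poly_ring[OF xc u'(1)]])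
  finally obtain w where w: "w \<in> carrier R - irr" "w \<otimes>\<^bsub>R\<^esub> (rc s \<otimes>\<^bsub>R\<^esub> (u \<otimes>\<^bsub>R\<^esub> v)) = w \<otimes>\<^bsub>R\<^esub> (rc ?num \<otimes>\<^bsub>R\<^esub> \<one>\<^bsub>R\<^esub>)"
    using fr_eq_iff[OF rc_closed[OF sP] U_one rc_closed[OF num] U_mult[OF p(2) c(2)]] by blast
  obtain w' where w': "w' \<in> P" "w = rc w'" "cmp 0 w' \<noteq> 0" using UE[OF w(1)] by blast
  have eq: "rc (w' * (s * (u' * v'))) = rc (w' * ?num)" using w(2) unfolding w'(2) u'(2) v'(2)
    by (simp add: mult_R[OF u'(1) v'(1)] mult_R[OF sP uv] mult_R[OF w'(1) mult_in_poly_ring[OF sP uv]] mult_R[OF w'(1) num] rc_closed[OF num])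
  define h where "h = w' * (u' * v')"
  define b where "b = w' * p * v'"
  have hP: "h \<in> P" and bP: "b \<in> P" unfolding h_def b_def by (intro mult_in_poly_ring w'(1) u'(1) v'(1) p(1))+
  have h0: "cmp 0 h \<noteq> 0" unfolding h_def
    by (intro cmp_0_mult_nonzero w' uv cmp_0_mult_nonzero[OF u'(1) v'(1)] u'(3) v'(3))
  have "h * s - b * \<sigma> \<in> Q"
  proof (rule Q_cong)
    show "X0 * (w' * c * u') \<in> Q" by (intro Q_X0 mult_in_poly_ring w'(1) c(1) u'(1))
    show "h * s - b * \<sigma> \<in> P" by (intro minus_in_poly_ring mult_in_poly_ring hP sP bP \<sigma>P)
    show "h * s - b * \<sigma> - X0 * (w' * c * u') \<in> I" using eq unfolding rc_eq_iff h_def b_def by (simp add: algebra_simps)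
  qed
  \<comment> \<open>Degree \<open>i\<close> of \<open>h * s - b * \<sigma>\<close> isolates a
    nonzero scalar multiple of \<open>s\<close> and, if \<open>r \<le> i\<close>, a multiple of
    \<sigma>, which for \<open>i = r\<close> is a scalar one.\<close>
  from Q_cmp[OF this, of i] have key: "cmp 0 h * s - (if r \<le> i then cmp (i - r) b * \<sigma> else 0) \<in> Q"
    by (simp add: cmp_diff cmp_mult[OF hP s] cmp_mult[OF bP \<sigma>(1)])
  obtain e where e: "Poly_Mapping.single 0 e * cmp 0 h = 1" using const_inverse[OF hP h0] by blast
  consider "i < r" | "r < i" | "i = r" by linarith
  then show ?thesis
  proof cases
    case 1
    then have "cmp 0 h * s \<in> Q" using key by simp
    from Q_sc[OF this, of e] show ?thesis using e by (simp flip: mult.assoc)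
  next
    case 2
    then show ?thesis using Q_high[OF s] by blast
  next
    case 3
    obtain f where f: "cmp 0 b = Poly_Mapping.single 0 f" using hom_piece_zero_const[OF cmp_in_hom_piece[OF bP]] by blast
    have "cmp 0 h * s - sc f \<sigma> \<in> Q" using key 3 f by simp
    from Q_sc[OF this, of e] have "s - sc (e * f) \<sigma> \<in> Q" using e by (simp add: right_diff_distrib mult_single flip: mult.assoc)
    then show ?thesis using 3 by blast
  qed
qed

text \<open>Every form of degree \<open>r\<close> is a socle element modulo x_0, so
  \<open>socle_alternative\<close> makes \<open>Vs r\<close> a hyperplane in S and defines \<tau>.
  That the socle has no other degree gives orthogonality: any form outside \<open>Q\<close> can be
  multiplied into degree \<open>r\<close> without falling into \<open>Q\<close>.\<close>

theorem ex_symmetric_form: "\<exists>\<tau>. symmetric_form \<tau>"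
proof -
  obtain \<sigma> where \<sigma>: "\<sigma> \<in> hom_piece n r" "nu \<sigma> \<notin> Vs r" by (rule ex_socle_generator)
  have \<sigma>P: "\<sigma> \<in> P" by (rule hom_piece_carr[OF \<sigma>(1)])
  have "\<exists>c. nu f - sc c (nu \<sigma>) \<in> Vs r" if f: "f \<in> P" for f
  proof -
    obtain s where s: "s \<in> hom_piece n r" "nu f = nu s" using Vs_hom nu_in_top[OF f] by blast
    have "a * s \<in> Q" if a: "a \<in> P" "cmp 0 a = 0" for a
    proof (rule Q_by_cmp)
      fix k show "cmp k (a * s) \<in> Q"
        using a(2) Q_zero Q_high[OF cmp_in_hom_piece[OF mult_in_poly_ring[OF a(1) hom_piece_carr[OF s(1)]]], of k]
        by (cases "r < k") (simp_all add: cmp_mult[OF a(1) s(1)])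
    qed
    then consider "s \<in> Q" | c where "s - sc c \<sigma> \<in> Q" using socle_alternative[OF \<sigma> s(1)] by blast
    then show ?thesis
    proof cases
      case 1
      then show ?thesis using Q_hom[OF s(1)] s(2) by (intro exI[of _ 0]) simp
    next
      case 2
      then show ?thesis using Q_hom[OF hom_piece_diff[OF s(1) sc_hom[OF \<sigma>(1)]]] s(2)
        by (intro exI[of _ c]) (simp add: nu.diff nu.scale)
    qed
  qed
  then obtain \<tau> where \<tau>: "functional \<tau>" "\<And>f. f \<in> P \<Longrightarrow> \<tau> f = 0 \<longleftrightarrow> nu f \<in> Vs r" using ex_functional[OF \<sigma>P \<sigma>(2)] by metis
  have up: "\<exists>g\<in>P. deg_below m g \<and> \<tau> (f * g) \<noteq> 0" if m: "m \<le> Suc r" and f: "f \<in> P" "nu f \<notin> Vs (Suc r - m)" for m f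
  proof -
    \<comment> \<open>The exact position of \<open>nu f\<close> in the filtration, so that the form
      \<open>f1\<close> of degree \<open>k\<close> representing it is not in
      \<open>Q\<close>.\<close>
    define t where "t = (LEAST t. nu f \<in> Vs t)"
    have t: "nu f \<in> Vs t" "\<And>k. k < t \<Longrightarrow> nu f \<notin> Vs k"
      unfolding t_def using LeastI[of "\<lambda>t. nu f \<in> Vs t", OF nu_in_top[OF f(1)]] not_less_Least by auto
    have "Suc r - m < t" using t(1) f(2) Vs_mono[of t "Suc r - m"] by (meson not_le subsetD)
    then obtain k where k: "t = Suc k" "Suc r - m \<le> k" by (cases t) auto
    obtain f1 where f1: "f1 \<in> hom_piece n k" "nu f = nu f1" using Vs_hom t(1) k(1) by blast
    have f1P: "f1 \<in> P" by (rule hom_piece_carr[OF f1(1)])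
    have f1Q: "f1 \<notin> Q" using Q_hom[OF f1(1)] t(2)[of k] k(1) f1(2) by simp
    let ?E = "\<lambda>e. \<exists>g. g \<in> hom_piece n e \<and> f1 * g \<notin> Q"
    have bound: "e \<le> r" if "?E e" for e
    proof (rule ccontr)
      assume e: "\<not> e \<le> r"
      from that obtain g where g: "g \<in> hom_piece n e" "f1 * g \<notin> Q" by blast
      show False using g(2) Q_high[OF hom_piece_mult[OF f1(1) g(1)]] e by simp
    qed
    have "?E 0" using hom_piece_one f1Q by (intro exI[of _ 1]) simp
    \<comment> \<open>A multiplier of greatest degree with product outside \<open>Q\<close> makes
      the product a socle element, hence of degree exactly \<open>r\<close>.\<close>
    define e where "e = (GREATEST e. ?E e)"
    have e: "?E e" "\<And>e'. ?E e' \<Longrightarrow> e' \<le> e"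
      unfolding e_def using GreatestI_nat[of ?E, OF \<open>?E 0\<close>] Greatest_le_nat[of ?E] bound by blast+
    obtain g where g: "g \<in> hom_piece n e" "f1 * g \<notin> Q" using e(1) by blast
    have gP: "g \<in> P" by (rule hom_piece_carr[OF g(1)])
    have s: "f1 * g \<in> hom_piece n (k + e)" by (rule hom_piece_mult[OF f1(1) g(1)])
    have "a * (f1 * g) \<in> Q" if a: "a \<in> P" "cmp 0 a = 0" for a
    proof -
      obtain N where N: "deg_below N a" using deg_below_ex by blast
      have "cmp j a * (f1 * g) \<in> Q" for j
      proof (cases j)
        case (Suc j')
        have "f1 * (g * cmp j a) \<in> Q"
          using e(2)[of "e + j"] hom_piece_mult[OF g(1) cmp_in_hom_piece[OF a(1), of j]] Suc by auto
        then show ?thesis by (simp add: ac_simps)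
      qed (simp add: a(2) Q_zero)
      then have "(\<Sum>j<N. cmp j a * (f1 * g)) \<in> Q" by (intro Q_sum)
      then show ?thesis using cmp_decomp[OF N] by (metis sum_distrib_right)
    qed
    then have ke: "k + e = r" using socle_alternative[OF \<sigma> s] g(2) by blast
    have "nu (f1 * g) \<notin> Vs r" using Q_hom[OF s] g(2) ke by simp
    then have "nu (f * g) \<notin> Vs r" using nu_mult_cong[OF f(1) f1P gP f1(2)] by simp
    then have "\<tau> (f * g) \<noteq> 0" using \<tau>(2)[OF mult_in_poly_ring[OF f(1) gP]] by blast
    moreover have "deg_below m g" by (rule deg_below_hom[OF g(1)]) (use ke k(2) in linarith)
    ultimately show ?thesis using gP by blast
  qed
  have "symmetric_form \<tau>" unfolding symmetric_form_def
  proof (intro conjI \<tau>(1) allI impI ballI iffI)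
    fix m f assume m: "m \<le> Suc r" and f: "f \<in> P"
    show "nu f \<in> Vs (Suc r - m)" if "\<forall>g\<in>P. deg_below m g \<longrightarrow> \<tau> (f * g) = 0"
      using up[OF m f] that by blast
    fix g assume "nu f \<in> Vs (Suc r - m)" "g \<in> P" "deg_below m g"
    then show "\<tau> (f * g) = 0" using \<tau>(2)[OF mult_in_poly_ring[OF f \<open>g \<in> P\<close>]] nu_mult_Vs[OF f, of "Suc r - m" g m r] m by simp
  qed
  then show ?thesis by blast
qed

end

section \<open>The Hilbert function\<close>

context nzd_ideal
begin

text \<open>On forms of degree \<open>i\<close> the kernel of \<open>nu\<close> is given by
  \<open>I\<close> (\<open>It_hom\<close>), so the graded piece of R is isomorphic to
  \<open>Vs (Suc i)\<close>.\<close>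

lemma hilbert_function_eq:
  "hilbert_function n I (int i) = (if mp.fin_dim (Vs (Suc i)) then enat (mp.dim (Vs (Suc i))) else \<infinity>)"
proof -
  define M where "M = subspace_of_algebra (coord_scalar n I) R (coord_piece n I (int i))"
  define \<Phi> where "\<Phi> C = nu (SOME f. f \<in> hom_piece n i \<and> C = rc f)" for C
  have carr: "carrier M = rc ` hom_piece n i" by (simp add: M_def subspace_of_algebra_def coord_piece_nat)
  have add: "rc f \<oplus>\<^bsub>M\<^esub> rc g = rc (f + g)" if "f \<in> hom_piece n i" "g \<in> hom_piece n i" for f g
    using add_R[OF hom_piece_carr[OF that(1)] hom_piece_carr[OF that(2)]] by (simp add: M_def subspace_of_algebra_def)
  have zero: "\<zero>\<^bsub>M\<^esub> = rc 0" by (simp add: M_def subspace_of_algebra_def zero_R)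
  have smult: "c \<odot>\<^bsub>M\<^esub> rc f = rc (sc c f)" if "f \<in> hom_piece n i" for c f
    using mult_R[OF const_in_poly_ring(3) hom_piece_carr[OF that], of c] by (simp add: M_def subspace_of_algebra_def coord_scalar_def)
  have \<Phi>: "\<Phi> (rc f) = nu f" if f: "f \<in> hom_piece n i" for f
  proof -
    define g where "g = (SOME g. g \<in> hom_piece n i \<and> rc f = rc g)"
    have "g \<in> hom_piece n i \<and> rc f = rc g"
      unfolding g_def by (rule someI[of "\<lambda>g. g \<in> hom_piece n i \<and> rc f = rc g" f]) (simp add: f)
    then have "f - g \<in> It" using I_sub_It rc_eq_iff by blast
    then have "nu f = nu g" by (simp add: nu_eq_iff)
    then show ?thesis unfolding \<Phi>_def g_def[symmetric] by simp
  qed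
  have "vdim M = (if \<exists>C. finite C \<and> Vs (Suc i) \<subseteq> mp.span C then enat (mp.dim (Vs (Suc i))) else \<infinity>)"
  proof (rule mp.vdim_linear_iso[of M \<Phi>])
    show "abelian_group M"
    proof (rule abelian_groupI)
      fix x assume "x \<in> carrier M"
      then obtain f where f: "f \<in> hom_piece n i" "x = rc f" unfolding carr by blast
      show "\<zero>\<^bsub>M\<^esub> \<oplus>\<^bsub>M\<^esub> x = x" unfolding f(2) zero by (simp add: add f(1))
      show "\<exists>y\<in>carrier M. y \<oplus>\<^bsub>M\<^esub> x = \<zero>\<^bsub>M\<^esub>"
        by (rule bexI[of _ "rc (- f)"]) (simp_all add: f zero add carr hom_piece_uminus)
      fix y assume "y \<in> carrier M"
      then obtain g where g: "g \<in> hom_piece n i" "y = rc g" unfolding carr by blast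
      show "x \<oplus>\<^bsub>M\<^esub> y \<in> carrier M" "x \<oplus>\<^bsub>M\<^esub> y = y \<oplus>\<^bsub>M\<^esub> x"
        unfolding f(2) g(2) by (simp_all add: add f(1) g(1) carr hom_piece_add add.commute)
      fix z assume "z \<in> carrier M"
      then obtain h where h: "h \<in> hom_piece n i" "z = rc h" unfolding carr by blast
      show "x \<oplus>\<^bsub>M\<^esub> y \<oplus>\<^bsub>M\<^esub> z = x \<oplus>\<^bsub>M\<^esub> (y \<oplus>\<^bsub>M\<^esub> z)" unfolding f(2) g(2) h(2)
        by (simp add: add f(1) g(1) h(1) hom_piece_add add.assoc)
    qed (simp add: zero carr)
    fix v assume "v \<in> carrier M"
    then obtain f where f: "f \<in> hom_piece n i" "v = rc f" unfolding carr by blast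
    show "c \<odot>\<^bsub>M\<^esub> v \<in> carrier M" "\<Phi> (c \<odot>\<^bsub>M\<^esub> v) = sc c (\<Phi> v)" for c
      unfolding f(2) by (simp_all add: smult f(1) sc_hom carr \<Phi> nu.scale)
    fix w assume "w \<in> carrier M"
    then obtain g where g: "g \<in> hom_piece n i" "w = rc g" unfolding carr by blast
    show "\<Phi> (v \<oplus>\<^bsub>M\<^esub> w) = \<Phi> v + \<Phi> w" unfolding f(2) g(2) by (simp add: add f(1) g(1) \<Phi> hom_piece_add nu.add)
  next
    show "inj_on \<Phi> (carrier M)"
    proof (rule inj_onI)
      fix v w assume "v \<in> carrier M" "w \<in> carrier M" and eq: "\<Phi> v = \<Phi> w"
      then obtain f g where fg: "f \<in> hom_piece n i" "v = rc f" "g \<in> hom_piece n i" "w = rc g" unfolding carr by blast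
      then have "f - g \<in> I" using eq by (intro It_hom_diff[OF fg(1,3)]) (simp add: \<Phi> nu_eq_iff)
      then show "v = w" using fg(2,4) by (simp add: rc_eq_iff)
    qed
    have "\<Phi> ` carrier M = nu ` hom_piece n i" unfolding carr image_image by (rule image_cong) (simp_all add: \<Phi>)
    then show "\<Phi> ` carrier M = Vs (Suc i)" by (simp add: nu_hom)
  qed
  then show ?thesis by (simp add: hilbert_function_def M_def mp.fin_dim_def)
qed

lemma one_notin_I:
  assumes "points n I \<noteq> {}" shows "1 \<notin> I"
proof
  assume 1: "1 \<in> I"
  obtain p where "primeideal p R" using assms unfolding points_def by blast
  then interpret p: primeideal p R .
  have "rc f = \<zero>\<^bsub>R\<^esub>" if "f \<in> P" for f using I_mult[OF 1 that] by (simp add: zero_R rc_eq_iff)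
  then have "carrier R \<subseteq> p" using carrier_R p.zero_closed by auto
  then show False using p.I_notcarr p.Icarr by blast
qed

theorem gpos_of_generic_position:
  assumes n: "n \<ge> 1" and gp: "generic_position n I" and ne: "points n I \<noteq> {}"
  shows "\<exists>r. gpos n I (scheme_degree n I) r"
proof -
  define d where "d = scheme_degree n I"
  define r where "r = (LEAST i. d \<le> (n + i) choose n)"
  have "hilbert_function n I (int i) = enat (min d ((n + i) choose n))" for i
    using gp[unfolded generic_position_def, rule_format, of "int i"] by (simp add: d_def)
  then have V: "mp.fin_dim (Vs (Suc i))" "mp.dim (Vs (Suc i)) = min d ((n + i) choose n)" for i
    unfolding hilbert_function_eq by (metis enat.distinct(2), metis enat.distinct(2) enat.inject)
  \<comment> \<open>Guarantees that the least degree \<open>r\<close> exists: the binomial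
    coefficient has reached \<open>d\<close> in degree \<open>d\<close> at the latest.\<close>
  have "Suc d \<le> (n + d) choose n"
    using binomial_right_mono[of "Suc d" "n + d" d] binomial_symmetric[of n "n + d"] n by simp
  then have "d \<le> (n + d) choose n" by linarith
  then have r: "d \<le> (n + r) choose n" unfolding r_def by (rule LeastI[of "\<lambda>i. d \<le> (n + i) choose n"])
  have low: "(n + i) choose n < d" if "i < r" for i
    using not_less_Least[of i "\<lambda>i. d \<le> (n + i) choose n"] that unfolding r_def by simp
  \<comment> \<open>For \<open>d = 0\<close> the polynomial 1 would lie in \<open>It\<close>, hence
    in \<open>I\<close>, contrary to the existence of a point.\<close>
  have d1: "d \<ge> 1"
  proof (rule ccontr)
    assume "\<not> d \<ge> 1"
    then have "Vs (Suc 0) = {0}" using mp.dim_zero_imp[OF subspace_Vs V(1)] V(2)[of 0] by simp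
    then have "nu 1 = 0" using nu_hom[of 0] hom_piece_one[of n] by blast
    then show False using nu(2) It_hom[OF hom_piece_one] one_notin_I[OF ne] by blast
  qed
  have "gpos n I d r"
  proof
    fix m show "mp.fin_dim (Vs m)" using V(1) mp.fin_dim_zero Vs_0 by (cases m) simp_all
  next
    fix i show "mp.dim (Vs (Suc i)) = (if i < r then (n + i) choose n else d)"
      using V(2)[of i] low[of i] r binomial_right_mono[of "n + r" "n + i" n] by (auto simp: not_less)
  qed (use low n d1 in auto)
  then show ?thesis unfolding d_def by blast
qed

end

section \<open>The conductor\<close>

global_interpretation sq: fd_space "\<lambda>(c :: 'k::field) (h :: nat \<Rightarrow> 'k mpoly) j. sc c (h j)"
  by unfold_locales (simp_all add: fun_eq_iff algebra_simps single_add mult_single flip: mult.assoc)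

text \<open>The direct sum of the first \<open>r\<close> spaces, encoded as sequences in one
  type.\<close>

definition seqs :: "nat \<Rightarrow> (nat \<Rightarrow> 'k::field mpoly set) \<Rightarrow> (nat \<Rightarrow> 'k mpoly) set" where
  "seqs r A = {h. (\<forall>j<r. h j \<in> A j) \<and> (\<forall>j\<ge>r. h j = 0)}"

lemma dim_seqs:
  fixes A :: "nat \<Rightarrow> 'k::field mpoly set"
  assumes "\<And>j. j < r \<Longrightarrow> mp.subspace (A j)" "\<And>j. j < r \<Longrightarrow> mp.fin_dim (A j)"
  shows "sq.subspace (seqs r A) \<and> sq.fin_dim (seqs r A) \<and> sq.dim (seqs r A) = (\<Sum>j<r. mp.dim (A j))"
  using assms
proof (induction r)
  case 0
  have "seqs 0 A = {0}" by (auto simp: seqs_def fun_eq_iff)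
  then show ?case by (simp add: sq.subspace_zero sq.fin_dim_zero sq.dim_zero)
next
  case (Suc r)
  have IH: "sq.fin_dim (seqs r A)" "sq.dim (seqs r A) = (\<Sum>j<r. mp.dim (A j))" using Suc by simp_all
  have sub: "mp.subspace (A j)" if "j < Suc r" for j using Suc.prems(1)[OF that] .
  interpret pair: fd_pair "\<lambda>(c :: 'k) (h :: nat \<Rightarrow> 'k mpoly) j. sc c (h j)" "sc :: 'k \<Rightarrow> _" by unfold_locales
  let ?e = "\<lambda>h :: nat \<Rightarrow> 'k mpoly. h r"
  have lin: "Vector_Spaces.linear (\<lambda>(c :: 'k) (h :: nat \<Rightarrow> 'k mpoly) j. sc c (h j)) sc ?e"
    by unfold_locales simp_all
  have W: "sq.subspace (seqs (Suc r) A)"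
    by (rule sq.subspaceI)
       (auto simp: seqs_def intro: mp.subspace_0[OF sub] mp.subspace_add[OF sub] mp.subspace_scale[OF sub])
  have ker: "{w \<in> seqs (Suc r) A. ?e w = 0} = seqs r A"
  proof -
    have "(\<forall>j\<ge>r. w j = 0) \<longleftrightarrow> w r = 0 \<and> (\<forall>j\<ge>Suc r. w j = 0)" for w :: "nat \<Rightarrow> 'k mpoly"
      by (metis Suc_leD le_antisym not_less_eq_eq order_refl)
    then show ?thesis using mp.subspace_0[OF sub[of r]] by (auto simp: seqs_def less_Suc_eq)
  qed
  have img: "?e ` seqs (Suc r) A = A r"
  proof (intro equalityI subsetI)
    fix v assume "v \<in> A r"
    then have "(\<lambda>j. if j = r then v else 0) \<in> seqs (Suc r) A"
      using mp.subspace_0[OF sub] by (auto simp: seqs_def)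
    then show "v \<in> ?e ` seqs (Suc r) A" by (rule rev_image_eqI) simp
  qed (auto simp: seqs_def)
  have fin: "sq.fin_dim (seqs (Suc r) A)"
    by (rule pair.fin_dim_by_image[OF lin W]) (simp_all only: ker img IH(1) Suc.prems(2)[OF lessI])
  have "mp.dim (?e ` seqs (Suc r) A) + sq.dim {w \<in> seqs (Suc r) A. ?e w = 0} = sq.dim (seqs (Suc r) A)"
    by (rule pair.rank_nullity(3)[OF W fin]) simp_all
  then show ?case using W fin IH(2) unfolding ker img by simp
qed

lemma cmp_X0_pow:
  "f \<in> carrier (poly_ring n) \<Longrightarrow> cmp m (X0 ^ l * f) = (if l \<le> m then X0 ^ l * cmp (m - l) f else 0)"
  using cmp_mult[OF _ X0_pow_hom[of l n], of f m] by (simp add: mult.commute)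

section \<open>Fractions whose denominator is a power of x_0\<close>

context gpos
begin

abbreviation U where "U \<equiv> homogeneous_nzd n I"

definition nz :: "'k mpoly \<Rightarrow> bool" where "nz f \<longleftrightarrow> (\<forall>g\<in>P. f * g \<in> I \<longrightarrow> g \<in> I)"

lemma nzD: "\<lbrakk>nz f; g \<in> P; f * g \<in> I\<rbrakk> \<Longrightarrow> g \<in> I" by (simp add: nz_def)

lemma U_iff: "u \<in> U \<longleftrightarrow> (\<exists>i. \<exists>f\<in>hom_piece n i. u = rc f \<and> nz f)"
proof -
  define N where "N u \<longleftrightarrow> (\<forall>x\<in>carrier R. u \<otimes>\<^bsub>R\<^esub> x = \<zero>\<^bsub>R\<^esub> \<longrightarrow> x = \<zero>\<^bsub>R\<^esub>)" for u
  have N: "N (rc f) \<longleftrightarrow> nz f" if "f \<in> hom_piece n i" for f i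
    unfolding N_def nz_def carrier_R using mult_R[OF hom_piece_carr[OF that]] by (simp add: zero_R rc_eq_iff)
  have "U = {u \<in> (\<Union>i. rc ` hom_piece n i). N u}" unfolding homogeneous_nzd_def coord_pieces N_def ..
  then have "u \<in> U \<longleftrightarrow> (\<exists>i. \<exists>f\<in>hom_piece n i. u = rc f \<and> N u)" by blast
  then show ?thesis using N by metis
qed

lemma U_D: assumes "u \<in> U" obtains f where "f \<in> P" "u = rc f" "nz f"
  using assms hom_piece_carr unfolding U_iff by blast

lemma X0_pow_U: "rc (X0 ^ k) \<in> U"
proof -
  have "nz (X0 ^ k)" unfolding nz_def using nzd_pow by blast
  then show ?thesis unfolding U_iff using X0_pow_hom by blast
qed

lemma mult_closed_U: "mult_closed_subset R U"
proof (intro mult_closed_subset.intro cring_R mult_closed_subset_axioms.intro)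
  show "U \<subseteq> carrier R" using U_D rc_closed by blast
  show "\<one>\<^bsub>R\<^esub> \<in> U" using X0_pow_U[of 0] by (simp add: one_R)
  fix u v assume "u \<in> U" "v \<in> U"
  then obtain i f j g where fg: "f \<in> hom_piece n i" "u = rc f" "nz f" "g \<in> hom_piece n j" "v = rc g" "nz g"
    unfolding U_iff by blast
  have c: "f \<in> P" "g \<in> P" using fg(1,4) hom_piece_carr by blast+
  have "nz (f * g)" unfolding nz_def
  proof (intro ballI impI)
    fix h assume h: "h \<in> P" "f * g * h \<in> I"
    show "h \<in> I" using nzD[OF fg(3) mult_in_poly_ring[OF c(2) h(1)]] nzD[OF fg(6) h(1)] h(2) by (simp add: mult.assoc)
  qed
  then show "u \<otimes>\<^bsub>R\<^esub> v \<in> U" unfolding fg(2,5) mult_R[OF c] U_iff using hom_piece_mult[OF fg(1,4)] by blast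
qed

definition xf :: "'k mpoly \<Rightarrow> nat \<Rightarrow> ('k mpoly set \<times> 'k mpoly set) set" where
  "xf F k = Qh_frac n I (rc F) (rc (X0 ^ k))"

lemma xf_alt: "xf F k = fraction R U (rc F) (rc (X0 ^ k))" by (simp add: xf_def Qh_frac_def)

lemma cring_Qh: "cring (Qh n I)"
  unfolding Qh_def by (rule mult_closed_subset.cring_L[OF mult_closed_U])

lemma xf_closed: "F \<in> P \<Longrightarrow> xf F k \<in> carrier (Qh n I)"
  unfolding xf_alt Qh_def by (rule mult_closed_subset.fr_closed[OF mult_closed_U rc_closed X0_pow_U])

lemma xf_eq_iff:
  assumes F: "F \<in> P" and G: "G \<in> P"
  shows "xf F k = xf G l \<longleftrightarrow> X0 ^ l * F - X0 ^ k * G \<in> I"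
proof -
  have c: "F * X0 ^ l \<in> P" "G * X0 ^ k \<in> P" "X0 ^ l * F - X0 ^ k * G \<in> P"
    using mult_in_poly_ring[OF F X0_carr(2)] mult_in_poly_ring[OF G X0_carr(2)] minus_in_poly_ring[OF _ mult_in_poly_ring[OF X0_carr(2) G]]
      mult_in_poly_ring[OF X0_carr(2) F] by blast+
  have "xf F k = xf G l \<longleftrightarrow> (\<exists>w\<in>U. w \<otimes>\<^bsub>R\<^esub> (rc F \<otimes>\<^bsub>R\<^esub> rc (X0 ^ l)) = w \<otimes>\<^bsub>R\<^esub> (rc G \<otimes>\<^bsub>R\<^esub> rc (X0 ^ k)))"
    unfolding xf_alt by (rule mult_closed_subset.fr_eq_iff[OF mult_closed_U rc_closed[OF F] X0_pow_U rc_closed[OF G] X0_pow_U])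
  also have "\<dots> \<longleftrightarrow> X0 ^ l * F - X0 ^ k * G \<in> I"
  proof
    assume "\<exists>w\<in>U. w \<otimes>\<^bsub>R\<^esub> (rc F \<otimes>\<^bsub>R\<^esub> rc (X0 ^ l)) = w \<otimes>\<^bsub>R\<^esub> (rc G \<otimes>\<^bsub>R\<^esub> rc (X0 ^ k))"
    then obtain w where w: "w \<in> U" "w \<otimes>\<^bsub>R\<^esub> (rc F \<otimes>\<^bsub>R\<^esub> rc (X0 ^ l)) = w \<otimes>\<^bsub>R\<^esub> (rc G \<otimes>\<^bsub>R\<^esub> rc (X0 ^ k))" by blast
    obtain h where h: "h \<in> P" "w = rc h" "nz h" using U_D[OF w(1)] by metis
    have "h * (F * X0 ^ l) - h * (G * X0 ^ k) \<in> I" using w(2)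
      by (simp add: h(2) mult_R[OF F X0_carr(2)] mult_R[OF G X0_carr(2)] mult_R[OF h(1) c(1)] mult_R[OF h(1) c(2)] rc_eq_iff)
    then have "h * (X0 ^ l * F - X0 ^ k * G) \<in> I" by (simp add: algebra_simps)
    then show "X0 ^ l * F - X0 ^ k * G \<in> I" by (rule nzD[OF h(3) c(3)])
  next
    assume "X0 ^ l * F - X0 ^ k * G \<in> I"
    then have "rc F \<otimes>\<^bsub>R\<^esub> rc (X0 ^ l) = rc G \<otimes>\<^bsub>R\<^esub> rc (X0 ^ k)"
      by (simp add: mult_R[OF F X0_carr(2)] mult_R[OF G X0_carr(2)] rc_eq_iff mult.commute)
    then show "\<exists>w\<in>U. w \<otimes>\<^bsub>R\<^esub> (rc F \<otimes>\<^bsub>R\<^esub> rc (X0 ^ l)) = w \<otimes>\<^bsub>R\<^esub> (rc G \<otimes>\<^bsub>R\<^esub> rc (X0 ^ k))"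
      using X0_pow_U[of 0] by auto
  qed
  finally show ?thesis .
qed

lemma xf_mult: "\<lbrakk>F \<in> P; G \<in> P\<rbrakk> \<Longrightarrow> xf F k \<otimes>\<^bsub>Qh n I\<^esub> xf G l = xf (F * G) (k + l)"
  unfolding xf_alt Qh_def using mult_closed_subset.mult_L[OF mult_closed_U rc_closed X0_pow_U rc_closed X0_pow_U, of F G k l]
  by (simp add: mult_R mult_R[OF X0_carr(2) X0_carr(2)] power_add)

lemma xf_add_same: "\<lbrakk>F \<in> P; G \<in> P\<rbrakk> \<Longrightarrow> xf F k \<oplus>\<^bsub>Qh n I\<^esub> xf G k = xf (F + G) k"
  unfolding xf_alt Qh_def using mult_closed_subset.add_same_L[OF mult_closed_U rc_closed X0_pow_U rc_closed, of F G k]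
  by (simp add: add_R)

lemma xf_shift: assumes "F \<in> P" shows "xf (X0 ^ l * F) (l + k) = xf F k"
proof -
  have *: "X0 ^ k * (X0 ^ l * F) - X0 ^ (l + k) * F = 0" by (simp add: power_add ac_simps)
  show ?thesis unfolding xf_eq_iff[OF mult_in_poly_ring[OF X0_carr(2) assms] assms] * by (rule I_zero)
qed

lemma xf_zero: "\<zero>\<^bsub>Qh n I\<^esub> = xf 0 k"
proof -
  have "\<zero>\<^bsub>Qh n I\<^esub> = xf 0 0"
    unfolding xf_alt Qh_def mult_closed_subset.zero_L[OF mult_closed_U] by (simp add: zero_R one_R)
  then show ?thesis by (simp add: xf_eq_iff[OF const_in_poly_ring(1) const_in_poly_ring(1)] I_zero)
qed

lemma xf_one: "\<one>\<^bsub>Qh n I\<^esub> = xf 1 0"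
  unfolding xf_alt Qh_def mult_closed_subset.one_L[OF mult_closed_U] by (simp add: one_R)

definition high :: "nat \<Rightarrow> 'k mpoly \<Rightarrow> bool" where "high k F \<longleftrightarrow> F \<in> P \<and> (\<forall>i<k. cmp i F = 0)"

lemma high_P: "high k F \<Longrightarrow> F \<in> P" by (simp add: high_def)

lemma high_add: "\<lbrakk>high k F; high k G\<rbrakk> \<Longrightarrow> high k (F + G)"
  by (simp add: high_def add_in_poly_ring cmp_add)

lemma high_sc: "high k F \<Longrightarrow> high k (sc c F)"
  by (simp add: high_def sc_carr cmp_sc[of F n])

lemma high_shift: "high k F \<Longrightarrow> high (l + k) (X0 ^ l * F)"
  unfolding high_def using mult_in_poly_ring[OF X0_carr(2)] by (auto simp: cmp_X0_pow)

lemma high_hom: "\<lbrakk>F \<in> hom_piece n i; k \<le> i\<rbrakk> \<Longrightarrow> high k F"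
  unfolding high_def by (auto simp: cmp_hom hom_piece_carr)

text \<open>Fractions without components of negative degree. This is the ring S[x_0]
  (\<open>R_tilde_eq\<close>), described without evaluating polynomials over S.\<close>

definition T :: "('k mpoly set \<times> 'k mpoly set) set set" where "T = {xf F k | F k. high k F}"

lemma T_I: "high k F \<Longrightarrow> xf F k \<in> T" unfolding T_def by blast

lemma T_E: assumes "q \<in> T" obtains F k where "high k F" "q = xf F k" using assms unfolding T_def by blast

lemma T_closed: "q \<in> T \<Longrightarrow> q \<in> carrier (Qh n I)" using xf_closed high_P unfolding T_def by blast

lemma T_E2:
  assumes "p \<in> T" "q \<in> T" obtains F G k where "high k F" "p = xf F k" "high k G" "q = xf G k"
proof -
  obtain F k where F: "high k F" "p = xf F k" using assms(1) by (rule T_E)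
  obtain G l where G: "high l G" "q = xf G l" using assms(2) by (rule T_E)
  have "high (l + k) (X0 ^ l * F)" "p = xf (X0 ^ l * F) (l + k)"
    using high_shift[OF F(1)] xf_shift[OF high_P[OF F(1)]] F(2) by simp_all
  moreover have "high (l + k) (X0 ^ k * G)" "q = xf (X0 ^ k * G) (l + k)"
    using high_shift[OF G(1), of k] xf_shift[OF high_P[OF G(1)], of k l] G(2) by (simp_all add: add.commute)
  ultimately show ?thesis by (rule that)
qed

lemma T_add: "\<lbrakk>p \<in> T; q \<in> T\<rbrakk> \<Longrightarrow> p \<oplus>\<^bsub>Qh n I\<^esub> q \<in> T"
  by (erule T_E2, assumption) (simp add: xf_add_same high_P T_I high_add)

lemma T_zero: "\<zero>\<^bsub>Qh n I\<^esub> \<in> T" unfolding xf_zero[of 0] by (rule T_I) (simp add: high_def const_in_poly_ring)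

text \<open>Coefficients of the powers of \<open>x\<^sub>0\<close> of an element of \<open>S[x\<^sub>0]\<close>.\<close>
definition coef :: "('k mpoly set \<times> 'k mpoly set) set \<Rightarrow> nat \<Rightarrow> 'k mpoly" where
  "coef q = (THE h. \<exists>F k. high k F \<and> q = xf F k \<and> h = (\<lambda>j. nu (cmp (j + k) F)))"

lemma nu_X0_pow: "f \<in> P \<Longrightarrow> nu (X0 ^ k * f) = nu f" using X0_pow_minus_one[of f k] by (simp add: nu_eq_iff)

text \<open>Over the common denominator the components of the difference are forms, and a form lies
  in \<open>I\<close> as soon as \<open>nu\<close> kills it.\<close>

lemma xf_eq_coef:
  assumes F: "high k F" and G: "high l G"
  shows "xf F k = xf G l \<longleftrightarrow> (\<forall>j. nu (cmp (j + k) F) = nu (cmp (j + l) G))"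
proof -
  have P: "F \<in> P" "G \<in> P" using F G high_P by blast+
  have c: "cmp (j + k) F \<in> P" "cmp (j + l) G \<in> P" for j using cmp_carr P by blast+
  let ?D = "X0 ^ l * F - X0 ^ k * G"
  have D: "cmp (j + (k + l)) ?D = X0 ^ l * cmp (j + k) F - X0 ^ k * cmp (j + l) G" for j
    by (simp add: cmp_diff cmp_X0_pow[OF P(1)] cmp_X0_pow[OF P(2)])
  have nuD: "nu (cmp (j + (k + l)) ?D) = nu (cmp (j + k) F) - nu (cmp (j + l) G)" for j
    unfolding D by (simp add: nu.diff nu_X0_pow[OF c(1)] nu_X0_pow[OF c(2)])
  show ?thesis unfolding xf_eq_iff[OF P]
  proof
    assume "?D \<in> I"
    then have "nu (cmp (j + (k + l)) ?D) = 0" for j using nu(2) I_sub_It I_cmp by blast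
    then show "\<forall>j. nu (cmp (j + k) F) = nu (cmp (j + l) G)" unfolding nuD by simp
  next
    assume eq: "\<forall>j. nu (cmp (j + k) F) = nu (cmp (j + l) G)"
    show "?D \<in> I"
    proof (rule I_by_cmp)
      fix m show "cmp m ?D \<in> I"
      proof (cases "m < k + l")
        case True
        then have "cmp m ?D = 0" using high_shift[OF F, of l] high_shift[OF G, of k] by (simp add: high_def cmp_diff add.commute)
        then show ?thesis using I_zero by simp
      next
        case False
        then obtain j where m: "m = j + (k + l)" by (metis add.commute le_Suc_ex not_less)
        have "nu (cmp m ?D) = 0" unfolding m nuD using eq by simp
        then show ?thesis using nu(2) It_hom[OF cmp_in_hom_piece]
          minus_in_poly_ring[OF mult_in_poly_ring[OF X0_carr(2) P(1)] mult_in_poly_ring[OF X0_carr(2) P(2)]] by blast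
      qed
    qed
  qed
qed

lemma coef_xf: assumes F: "high k F" shows "coef (xf F k) = (\<lambda>j. nu (cmp (j + k) F))"
  unfolding coef_def
proof (rule the_equality)
  fix h assume "\<exists>G l. high l G \<and> xf F k = xf G l \<and> h = (\<lambda>j. nu (cmp (j + l) G))"
  then obtain G l where G: "high l G" "xf F k = xf G l" "h = (\<lambda>j. nu (cmp (j + l) G))" by blast
  then show "h = (\<lambda>j. nu (cmp (j + k) F))" using xf_eq_coef[OF F G(1)] by (simp add: fun_eq_iff)
qed (use F in blast)

lemma coef_inj: assumes "p \<in> T" "q \<in> T" "coef p = coef q" shows "p = q"
proof -
  obtain F G k where *: "high k F" "p = xf F k" "high k G" "q = xf G k" using assms(1,2) by (rule T_E2)
  have "\<forall>j. nu (cmp (j + k) F) = nu (cmp (j + k) G)"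
    using assms(3) unfolding *(2,4) coef_xf[OF *(1)] coef_xf[OF *(3)] by (simp add: fun_eq_iff)
  then show ?thesis unfolding *(2,4) xf_eq_coef[OF *(1,3)] .
qed

lemma coef_add: assumes "p \<in> T" "q \<in> T" shows "coef (p \<oplus>\<^bsub>Qh n I\<^esub> q) = coef p + coef q"
proof -
  obtain F G k where *: "high k F" "p = xf F k" "high k G" "q = xf G k" using assms by (rule T_E2)
  show ?thesis unfolding *(2,4) xf_add_same[OF high_P[OF *(1)] high_P[OF *(3)]]
      coef_xf[OF *(1)] coef_xf[OF *(3)] coef_xf[OF high_add[OF *(1,3)]]
    by (simp add: fun_eq_iff cmp_add nu.add)
qed

lemma coef_zero: "coef \<zero>\<^bsub>Qh n I\<^esub> = 0"
  using coef_add[OF T_zero T_zero] cring.cring_simprules(8)[OF cring_Qh T_closed[OF T_zero]] by simp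

lemma scalar_xf: "Qh_frac n I (coord_scalar n I c) \<one>\<^bsub>R\<^esub> = xf (Poly_Mapping.single 0 c) 0"
  by (simp add: xf_def coord_scalar_def one_R)

lemma scale_T:
  assumes "q \<in> T"
  shows "Qh_frac n I (coord_scalar n I c) \<one>\<^bsub>R\<^esub> \<otimes>\<^bsub>Qh n I\<^esub> q \<in> T"
    "coef (Qh_frac n I (coord_scalar n I c) \<one>\<^bsub>R\<^esub> \<otimes>\<^bsub>Qh n I\<^esub> q) = (\<lambda>j. sc c (coef q j))"
proof -
  obtain F k where *: "high k F" "q = xf F k" using assms by (rule T_E)
  have "Qh_frac n I (coord_scalar n I c) \<one>\<^bsub>R\<^esub> \<otimes>\<^bsub>Qh n I\<^esub> q = xf (sc c F) k"
    unfolding scalar_xf *(2) using xf_mult[OF const_in_poly_ring(3) high_P[OF *(1)], of c 0 k] by simp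
  moreover have "cmp m (sc c F) = sc c (cmp m F)" for m
    by (rule cmp_sc[OF high_P[OF *(1)]])
  ultimately show "Qh_frac n I (coord_scalar n I c) \<one>\<^bsub>R\<^esub> \<otimes>\<^bsub>Qh n I\<^esub> q \<in> T"
    "coef (Qh_frac n I (coord_scalar n I c) \<one>\<^bsub>R\<^esub> \<otimes>\<^bsub>Qh n I\<^esub> q) = (\<lambda>j. sc c (coef q j))"
    using T_I[OF high_sc[OF *(1)]] coef_xf[OF high_sc[OF *(1)]] coef_xf[OF *(1)] *(2) by (simp_all add: nu.scale)
qed

lemma coef_S: assumes "q \<in> T" shows "coef q j \<in> S"
proof -
  obtain F k where *: "high k F" "q = xf F k" using assms by (rule T_E)
  show ?thesis unfolding *(2) coef_xf[OF *(1)] S_def using cmp_carr[OF high_P[OF *(1)]] by blast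
qed

lemma coef_finite: assumes "q \<in> T" obtains N where "\<And>j. N \<le> j \<Longrightarrow> coef q j = 0"
proof -
  obtain F k where *: "high k F" "q = xf F k" using assms by (rule T_E)
  obtain N where "deg_below N F" using deg_below_ex by blast
  then show ?thesis using that[of N] deg_below_cmp[of N F] unfolding *(2) coef_xf[OF *(1)] by (simp add: nu.zero)
qed

text \<open>The denominator exponent \<open>k\<close> decides which coefficients are possible:
  \<open>k = 0\<close> gives the elements of R, while for \<open>k = r\<close> all finite sequences
  in S occur, since \<open>Vs (Suc (j + r))\<close> is S.\<close>

lemma ex_coef_gen:
  assumes v: "\<And>j. v j \<in> Vs (Suc (j + k))" "\<And>j. N \<le> j \<Longrightarrow> v j = 0"
  obtains F where "high k F" "coef (xf F k) = v"
proof -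
  have "\<exists>f. f \<in> hom_piece n (j + k) \<and> v j = nu f" for j using v(1)[of j] Vs_hom by blast
  then obtain f where f: "\<And>j. f j \<in> hom_piece n (j + k)" "\<And>j. v j = nu (f j)" by metis
  define F where "F = (\<Sum>j<N. f j)"
  have FP: "F \<in> P" unfolding F_def using f(1) hom_piece_carr by (blast intro: sum_in_poly_ring)
  have c: "cmp m F = (\<Sum>j<N. if j + k = m then f j else 0)" for m
    unfolding F_def cmp_sum by (rule sum.cong) (simp_all add: cmp_hom[OF f(1)])
  have "high k F" unfolding high_def using FP by (auto simp: c)
  moreover have "nu (cmp (j + k) F) = v j" for j using v(2)[of j] f(2)[of j] by (cases "j < N") (simp_all add: c nu.zero)
  ultimately show ?thesis using that coef_xf by (simp add: fun_eq_iff)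
qed

section \<open>Lengths of quotients between layers\<close>

definition layer :: "(nat \<Rightarrow> 'k mpoly set) \<Rightarrow> ('k mpoly set \<times> 'k mpoly set) set set" where
  "layer A = {q \<in> T. \<forall>j. coef q j \<in> A j}"

text \<open>In each degree \<open>j < r\<close> a linear map with kernel \<open>B j\<close> is
  applied to the coefficient. From degree \<open>r\<close> on the two layers have the same
  coefficient spaces, so the kernel of the combined map is the smaller layer, and the quotient
  becomes a finite direct sum.\<close>

lemma quotient_layer:
  assumes A: "\<And>j. mp.subspace (A j)" "\<And>j. A j \<subseteq> S" and B: "\<And>j. mp.subspace (B j)" "\<And>j. B j \<subseteq> A j"
    and top: "\<And>j. r \<le> j \<Longrightarrow> B j = A j"
  shows "Qh_quotient_dim n I (layer A) (layer B) = enat (\<Sum>j<r. mp.dim (A j) - mp.dim (B j))"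
proof -
  have finA: "mp.fin_dim (A j)" for j using mp.fin_dim_subset[OF fin_Vs A(2)[of j, unfolded S_eq]] .
  have "\<exists>f. Vector_Spaces.linear sc sc f \<and> (\<forall>v. f v = 0 \<longleftrightarrow> v \<in> B j)" for j
    using mp.linear_with_kernel[OF B(1)[of j]] by metis
  then obtain \<kappa> where \<kappa>: "\<And>j. Vector_Spaces.linear sc sc (\<kappa> j)" "\<And>j v. \<kappa> j v = 0 \<longleftrightarrow> v \<in> B j" by metis
  have \<kappa>_hom: "\<kappa> j (v + w) = \<kappa> j v + \<kappa> j w" "\<kappa> j (sc c v) = sc c (\<kappa> j v)" for j v w c
  proof -
    interpret k: Vector_Spaces.linear sc sc "\<kappa> j" by (rule \<kappa>(1))
    show "\<kappa> j (v + w) = \<kappa> j v + \<kappa> j w" "\<kappa> j (sc c v) = sc c (\<kappa> j v)" by (rule k.add, rule k.scale)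
  qed
  interpret pair: fd_pair "sc :: 'k \<Rightarrow> _" "sc :: 'k \<Rightarrow> _" by unfold_locales
  have rn: "mp.subspace (\<kappa> j ` A j)" "mp.fin_dim (\<kappa> j ` A j)" "mp.dim (\<kappa> j ` A j) = mp.dim (A j) - mp.dim (B j)" for j
  proof -
    have "{w \<in> A j. \<kappa> j w = 0} = B j" using \<kappa>(2) B(2) by blast
    then show "mp.subspace (\<kappa> j ` A j)" "mp.fin_dim (\<kappa> j ` A j)" "mp.dim (\<kappa> j ` A j) = mp.dim (A j) - mp.dim (B j)"
      using pair.rank_nullity[OF A(1)[of j] finA[of j], of "\<kappa> j"] \<kappa>_hom by simp_all
  qed
  let ?\<eta> = "\<lambda>c. Qh_frac n I (coord_scalar n I c) \<one>\<^bsub>R\<^esub>"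
  define M where "M = subspace_of_algebra ?\<eta> (Qh n I) (layer A)"
  define \<phi> where "\<phi> q = (\<lambda>j. if j < r then \<kappa> j (coef q j) else 0)" for q
  have M: "carrier M = layer A" "\<And>x y. x \<oplus>\<^bsub>M\<^esub> y = x \<oplus>\<^bsub>Qh n I\<^esub> y" "\<zero>\<^bsub>M\<^esub> = \<zero>\<^bsub>Qh n I\<^esub>" "\<And>c v. c \<odot>\<^bsub>M\<^esub> v = ?\<eta> c \<otimes>\<^bsub>Qh n I\<^esub> v"
    by (simp_all add: M_def subspace_of_algebra_def)
  interpret QH: cring "Qh n I" by (rule cring_Qh)
  have LT: "q \<in> T" "coef q j \<in> A j" if "q \<in> layer A" for q j using that unfolding layer_def by auto
  have LI: "q \<in> layer A" if "q \<in> T" "\<And>j. coef q j \<in> A j" for q using that unfolding layer_def by auto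
  have Lc: "q \<in> carrier (Qh n I)" if "q \<in> layer A" for q using T_closed[OF LT(1)[OF that]] .
  have Ladd: "p \<oplus>\<^bsub>Qh n I\<^esub> q \<in> layer A" if "p \<in> layer A" "q \<in> layer A" for p q
    by (rule LI) (simp_all add: T_add LT[OF that(1)] LT[OF that(2)] coef_add mp.subspace_add[OF A(1)])
  have Lscale: "?\<eta> c \<otimes>\<^bsub>Qh n I\<^esub> q \<in> layer A" if "q \<in> layer A" for c q
    by (rule LI) (simp_all add: scale_T LT[OF that] mp.subspace_scale[OF A(1)])
  have Lzero: "\<zero>\<^bsub>Qh n I\<^esub> \<in> layer A" by (rule LI) (simp_all add: T_zero coef_zero mp.subspace_0[OF A(1)])
  have "vdim (quotient_module M (layer B)) =
      (if \<exists>C. finite C \<and> seqs r (\<lambda>j. \<kappa> j ` A j) \<subseteq> sq.span C then enat (sq.dim (seqs r (\<lambda>j. \<kappa> j ` A j))) else \<infinity>)"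
  proof (rule sq.vdim_quotient[of M \<phi>])
    show "abelian_group M"
    proof (rule abelian_groupI)
      fix x assume "x \<in> carrier M"
      then have x: "x \<in> layer A" by (simp add: M(1))
      let ?y = "?\<eta> (- 1) \<otimes>\<^bsub>Qh n I\<^esub> x"
      have "?y \<oplus>\<^bsub>Qh n I\<^esub> x = \<zero>\<^bsub>Qh n I\<^esub>"
        by (rule coef_inj) (simp_all add: T_add T_zero scale_T LT[OF x] coef_add coef_zero fun_eq_iff single_uminus)
      then show "\<exists>y\<in>carrier M. y \<oplus>\<^bsub>M\<^esub> x = \<zero>\<^bsub>M\<^esub>" using Lscale[OF x] by (auto simp: M)
    qed (simp_all add: M Ladd Lzero Lc QH.add.m_ac)
    show "layer B = {v \<in> carrier M. \<phi> v = 0}"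
    proof -
      have "layer B = {v \<in> layer A. \<forall>j. coef v j \<in> B j}" using B(2) unfolding layer_def by blast
      also have "\<dots> = {v \<in> layer A. \<forall>j<r. coef v j \<in> B j}" using top LT(2) by (auto simp: not_less[symmetric])
      also have "\<dots> = {v \<in> carrier M. \<phi> v = 0}" unfolding M(1) \<phi>_def by (auto simp: fun_eq_iff \<kappa>(2))
      finally show ?thesis .
    qed
    show "\<phi> ` carrier M = seqs r (\<lambda>j. \<kappa> j ` A j)"
    proof (intro equalityI subsetI)
      fix h assume "h \<in> \<phi> ` carrier M"
      then show "h \<in> seqs r (\<lambda>j. \<kappa> j ` A j)" unfolding M(1) \<phi>_def seqs_def using LT(2) by auto
    next
      fix h assume h: "h \<in> seqs r (\<lambda>j. \<kappa> j ` A j)"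
      have "\<forall>j. \<exists>v. v \<in> A j \<and> (if j < r then h j = \<kappa> j v else v = 0)"
        proof
        fix j show "\<exists>v. v \<in> A j \<and> (if j < r then h j = \<kappa> j v else v = 0)"
          using h mp.subspace_0[OF A(1)[of j]] unfolding seqs_def by (cases "j < r") auto
      qed
      then obtain v where v: "\<And>j. v j \<in> A j" "\<And>j. j < r \<Longrightarrow> h j = \<kappa> j (v j)" "\<And>j. r \<le> j \<Longrightarrow> v j = 0"
        by (metis not_less)
      have "v j \<in> Vs (Suc (j + r))" for j using v(1)[of j] A(2)[of j] Vs_stable[of "j + r"] unfolding S_eq by auto
      then obtain F where F: "high r F" "coef (xf F r) = v" using v(3) by (rule ex_coef_gen) blast
      have "xf F r \<in> layer A" using T_I[OF F(1)] v(1) F(2) by (intro LI) simp_all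
      moreover have "\<phi> (xf F r) = h" unfolding \<phi>_def F(2) using v(2) h by (auto simp: fun_eq_iff seqs_def)
      ultimately show "h \<in> \<phi> ` carrier M" unfolding M(1) by blast
    qed
  qed (simp_all add: M Lscale LT \<phi>_def fun_eq_iff coef_add scale_T \<kappa>_hom)
  also have "\<dots> = enat (\<Sum>j<r. mp.dim (A j) - mp.dim (B j))"
    using dim_seqs[of r "\<lambda>j. \<kappa> j ` A j"] rn unfolding sq.fin_dim_def by simp
  finally show ?thesis unfolding Qh_quotient_dim_def M_def .
qed

lemma one_T: "xf 1 0 \<in> T" by (rule T_I) (simp add: high_def const_in_poly_ring)

lemma R_in_Qh_alt: "R_in_Qh n I = {xf f 0 | f. f \<in> P}"
proof -
  have "R_in_Qh n I = (\<lambda>f. xf f 0) ` P" unfolding R_in_Qh_def carrier_R image_image xf_def one_R by simp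
  then show ?thesis by blast
qed

lemma R_in_Qh_layer: "R_in_Qh n I = layer (\<lambda>j. Vs (Suc j))"
proof (intro equalityI subsetI)
  fix q assume "q \<in> R_in_Qh n I"
  then obtain f where f: "f \<in> P" "q = xf f 0" unfolding R_in_Qh_alt by blast
  have h: "high 0 f" using f(1) by (simp add: high_def)
  show "q \<in> layer (\<lambda>j. Vs (Suc j))" unfolding f(2) layer_def mem_Collect_eq coef_xf[OF h]
    using T_I[OF h] nu_hom cmp_in_hom_piece[OF f(1)] by auto
next
  fix q assume q: "q \<in> layer (\<lambda>j. Vs (Suc j))"
  then have qT: "q \<in> T" and c: "coef q j \<in> Vs (Suc (j + 0))" for j unfolding layer_def by auto
  obtain N where N: "\<And>j. N \<le> j \<Longrightarrow> coef q j = 0" using coef_finite[OF qT] by blast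
  obtain F where F: "high 0 F" "coef (xf F 0) = coef q" using ex_coef_gen[OF c N] by blast
  have "q = xf F 0" using coef_inj[OF T_I[OF F(1)] qT F(2)] by simp
  then show "q \<in> R_in_Qh n I" unfolding R_in_Qh_alt using high_P[OF F(1)] by blast
qed

lemma coef_mult_xf:
  assumes f: "f \<in> P" and G: "high l G"
  shows "high l (f * G)" "coef (xf (f * G) l) = (\<lambda>j. \<Sum>m\<le>j. nu (cmp m f * cmp (j + l - m) G))"
proof -
  have GP: "G \<in> P" by (rule high_P[OF G])
  obtain N where N: "deg_below N f" using deg_below_ex by blast
  have e: "cmp k (f * G) = (\<Sum>m<N. if m \<le> k then cmp m f * cmp (k - m) G else 0)" for k
    unfolding mult.commute[of f G] cmp_mult_sum[OF GP f N] by (simp add: mult.commute cong: if_cong)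
  have "cmp k (f * G) = 0" if "k < l" for k
    unfolding e using G that by (intro sum.neutral) (simp add: high_def)
  then show h: "high l (f * G)" unfolding high_def using mult_in_poly_ring[OF f GP] by blast
  have "cmp (j + l) (f * G) = (\<Sum>m\<le>j. cmp m f * cmp (j + l - m) G)" for j
    unfolding e
  proof (rule sum.mono_neutral_cong)
    fix m assume "m \<in> {..<N} - {..j}"
    then have "j + l - m < l \<or> j + l < m" by auto
    then show "(if m \<le> j + l then cmp m f * cmp (j + l - m) G else 0) = 0" using G by (auto simp: high_def)
  qed (use deg_below_cmp[OF N] in auto)
  then show "coef (xf (f * G) l) = (\<lambda>j. \<Sum>m\<le>j. nu (cmp m f * cmp (j + l - m) G))"
    unfolding coef_xf[OF h] by (simp add: nu.sum)
qed

lemma affine_rep: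
  assumes "g \<in> P" obtains N G where "G \<in> hom_piece n N" "nu G = nu g"
proof -
  obtain N where "deg_below N g" using deg_below_ex by blast
  then have "deg_below (Suc N) g" using deg_below_mono[of N g "Suc N"] by simp
  then show ?thesis using that[OF hz_hom[OF assms, of N]] hz_cong[OF assms, of N] by (simp add: nu_eq_iff)
qed

text \<open>Testing against fractions \<open>G / X0 ^ N\<close> with \<open>G\<close> of degree
  \<open>N\<close>, which are the elements of S in degree 0, forces each coefficient into
  \<open>cs j\<close>. Conversely, a coefficient in \<open>cs m\<close> times any element of S stays
  in \<open>Vs (Suc m)\<close>, and these spaces grow with \<open>m\<close>.\<close>

lemma conductor_layer:
  assumes T: "R_tilde n I = T"
  shows "conductor n I = layer cs"
proof (intro equalityI subsetI)
  fix q assume "q \<in> conductor n I"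
  then have q: "q \<in> carrier (Qh n I)" "\<And>g. g \<in> T \<Longrightarrow> q \<otimes>\<^bsub>Qh n I\<^esub> g \<in> R_in_Qh n I" unfolding conductor_def T by auto
  interpret QH: cring "Qh n I" by (rule cring_Qh)
  have "q \<in> R_in_Qh n I" using q(2)[OF one_T] q(1) by (simp add: xf_one[symmetric])
  then obtain f where f: "f \<in> P" "q = xf f 0" unfolding R_in_Qh_alt by blast
  have h: "high 0 f" using f(1) by (simp add: high_def)
  have "nu (cmp j f) \<in> cs j" for j
  proof (rule cs_I[OF cmp_carr[OF f(1)]])
    fix g assume g: "g \<in> P"
    obtain N G where G: "G \<in> hom_piece n N" "nu G = nu g" using affine_rep[OF g] by blast
    have GP: "G \<in> P" by (rule hom_piece_carr[OF G(1)])
    have hG: "high N G" by (rule high_hom[OF G(1) order_refl])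
    have "q \<otimes>\<^bsub>Qh n I\<^esub> xf G N = xf (f * G) N" unfolding f(2) using xf_mult[OF f(1) GP, of 0 N] by simp
    then have "xf (f * G) N \<in> layer (\<lambda>j. Vs (Suc j))" using q(2)[OF T_I[OF hG]] by (simp add: R_in_Qh_layer)
    then have "coef (xf (f * G) N) j \<in> Vs (Suc j)" unfolding layer_def by blast
    then have "nu (cmp j f * G) \<in> Vs (Suc j)"
      unfolding coef_xf[OF coef_mult_xf(1)[OF f(1) hG]] by (simp add: cmp_mult[OF f(1) G(1)])
    then show "nu (cmp j f * g) \<in> Vs (Suc j)"
      using nu_mult_cong[OF GP g cmp_carr[OF f(1)] G(2), of j] by (simp add: mult.commute)
  qed
  then show "q \<in> layer cs" unfolding f(2) layer_def mem_Collect_eq coef_xf[OF h] using T_I[OF h] by simp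
next
  fix q assume q: "q \<in> layer cs"
  then have "q \<in> R_in_Qh n I" unfolding R_in_Qh_layer layer_def using cs_sub by blast
  then obtain f where f: "f \<in> P" "q = xf f 0" unfolding R_in_Qh_alt by blast
  have h: "high 0 f" using f(1) by (simp add: high_def)
  have c: "nu (cmp m f) \<in> cs m" for m using q unfolding f(2) layer_def mem_Collect_eq coef_xf[OF h] by simp
  have "q \<otimes>\<^bsub>Qh n I\<^esub> g \<in> R_in_Qh n I" if "g \<in> T" for g
  proof -
    obtain G l where G: "high l G" "g = xf G l" using T_E[OF \<open>g \<in> T\<close>] by blast
    have GP: "G \<in> P" by (rule high_P[OF G(1)])
    have "(\<Sum>m\<le>j. nu (cmp m f * cmp (j + l - m) G)) \<in> Vs (Suc j)" for j
    proof (rule mp.subspace_sum[OF subspace_Vs])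
      fix m assume "m \<in> {..j}"
      then show "nu (cmp m f * cmp (j + l - m) G) \<in> Vs (Suc j)"
        using cs_D[OF cmp_carr[OF f(1)] c[of m] cmp_carr[OF GP]] Vs_mono[of "Suc m" "Suc j"] by auto
    qed
    then have "xf (f * G) l \<in> layer (\<lambda>j. Vs (Suc j))" unfolding layer_def mem_Collect_eq coef_mult_xf(2)[OF f(1) G(1)]
      using T_I[OF coef_mult_xf(1)[OF f(1) G(1)]] by blast
    then show ?thesis unfolding f(2) G(2) R_in_Qh_layer using xf_mult[OF f(1) GP, of 0 l] by simp
  qed
  then show "q \<in> conductor n I" unfolding conductor_def T using xf_closed[OF f(1)] f(2) by blast
qed

lemma cs_top: assumes "r \<le> j" shows "cs j = Vs (Suc j)"
proof
  show "Vs (Suc j) \<subseteq> cs j"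
  proof
    fix v assume "v \<in> Vs (Suc j)"
    then obtain f where f: "f \<in> P" "v = nu f" unfolding Vs_def by blast
    show "v \<in> cs j" unfolding f(2)
      by (rule cs_I[OF f(1)]) (rule nu_in_Vs_stable[OF mult_in_poly_ring[OF f(1)]], use assms in auto)
  qed
qed (rule cs_sub)

section \<open>The ring S[x_0] as a set of fractions\<close>

abbreviation J where "J \<equiv> Idl\<^bsub>R\<^esub> {coord_x0 n I \<ominus>\<^bsub>R\<^esub> \<one>\<^bsub>R\<^esub>}"

lemma X0_1_P: "X0 - 1 \<in> P" by (rule minus_in_poly_ring[OF X0_carr(1) const_in_poly_ring(2)])

lemma x0_minus_one: "coord_x0 n I \<ominus>\<^bsub>R\<^esub> \<one>\<^bsub>R\<^esub> = rc (X0 - 1)"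
  unfolding x0_R one_R by (rule minus_R[OF X0_carr(1) const_in_poly_ring(2)])

lemma ideal_J: "ideal J R"
proof -
  interpret R: cring R by (rule cring_R)
  show ?thesis by (rule R.genideal_ideal) (simp add: x0_minus_one rc_closed[OF X0_1_P])
qed

lemma rc_in_J: assumes f: "f \<in> P" shows "rc f \<in> J \<longleftrightarrow> f \<in> It"
proof -
  interpret R: cring R by (rule cring_R)
  have "J = PIdl\<^bsub>R\<^esub> (rc (X0 - 1))" unfolding x0_minus_one by (rule R.cgenideal_eq_genideal[symmetric, OF rc_closed[OF X0_1_P]])
  also have "\<dots> = (\<lambda>h. rc (h * (X0 - 1))) ` P"
    unfolding cgenideal_def carrier_R using mult_R[OF _ X0_1_P] by force
  finally have "rc f \<in> J \<longleftrightarrow> (\<exists>h\<in>P. rc f = rc (h * (X0 - 1)))" by blast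
  also have "\<dots> \<longleftrightarrow> f \<in> It"
  proof
    assume "\<exists>h\<in>P. rc f = rc (h * (X0 - 1))"
    then obtain h where h: "h \<in> P" "f - h * (X0 - 1) \<in> I" unfolding rc_eq_iff by blast
    from It_I[OF h(2,1)] show "f \<in> It" by (simp add: mult.commute)
  next
    assume "f \<in> It"
    then obtain g h where h: "g \<in> I" "h \<in> P" "f = g + (X0 - 1) * h" by (rule ItE)
    then show "\<exists>h\<in>P. rc f = rc (h * (X0 - 1))" unfolding rc_eq_iff by (intro bexI[of _ h]) (simp_all add: mult.commute)
  qed
  finally show ?thesis .
qed

lemma deh_eq_iff:
  assumes "f \<in> P" "g \<in> P" shows "deh n I (rc f) = deh n I (rc g) \<longleftrightarrow> nu f = nu g"
proof -
  interpret R: cring R by (rule cring_R)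
  have "deh n I (rc f) = deh n I (rc g) \<longleftrightarrow> rc f \<ominus>\<^bsub>R\<^esub> rc g \<in> J"
    unfolding deh_def Let_def by (rule R.quotient_eq_iff_same_a_r_cos[OF ideal_J rc_closed[OF assms(1)] rc_closed[OF assms(2)], symmetric])
  then show ?thesis unfolding minus_R[OF assms] rc_in_J[OF minus_in_poly_ring[OF assms]] nu_eq_iff .
qed

lemma cring_affine: "cring (affine_ring n I)"
  unfolding affine_ring_def Let_def by (rule ideal.quotient_is_cring[OF ideal_J cring_R])

lemma carrier_affine: "carrier (affine_ring n I) = (\<lambda>f. deh n I (rc f)) ` P"
  unfolding affine_ring_def Let_def FactRing_def A_RCOSETS_def' deh_def carrier_R by auto

lemma zero_affine: "\<zero>\<^bsub>affine_ring n I\<^esub> = deh n I (rc 0)"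
proof -
  interpret R: cring R by (rule cring_R)
  have "J \<subseteq> carrier R" using ideal.Icarr[OF ideal_J] by blast
  then show ?thesis unfolding affine_ring_def Let_def FactRing_def deh_def zero_R[symmetric] by simp
qed

text \<open>Forms with the same dehomogenization give the same fraction, as their coefficients
  agree; so the description in \<open>S_to_Qh\<close> determines a unique value.\<close>

lemma S_to_Qh_deh: assumes f: "f \<in> hom_piece n i" shows "S_to_Qh n I (deh n I (rc f)) = xf f i"
  unfolding S_to_Qh_def
proof (rule the_equality)
  have pw: "coord_x0 n I [^]\<^bsub>R\<^esub> (k::nat) = rc (X0 ^ k)" for k unfolding x0_R by (rule rc_pow[OF X0_carr(1)])
  show "\<exists>i' f'. f' \<in> coord_piece n I (int i') \<and> deh n I (rc f) = deh n I f' \<and>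
      xf f i = Qh_frac n I f' (coord_x0 n I [^]\<^bsub>R\<^esub> i')"
    by (intro exI[of _ i] exI[of _ "rc f"]) (simp add: coord_piece_nat f pw xf_def)
  fix q assume "\<exists>i' f'. f' \<in> coord_piece n I (int i') \<and> deh n I (rc f) = deh n I f' \<and>
      q = Qh_frac n I f' (coord_x0 n I [^]\<^bsub>R\<^esub> i')"
  then obtain j g where g: "g \<in> hom_piece n j" "deh n I (rc f) = deh n I (rc g)" "q = xf g j"
    unfolding coord_piece_nat pw xf_def by blast
  have P: "f \<in> P" "g \<in> P" using f g(1) hom_piece_carr by blast+
  have "nu f = nu g" using g(2) deh_eq_iff[OF P] by blast
  then have "\<forall>m. nu (cmp (m + i) f) = nu (cmp (m + j) g)" by (simp add: cmp_hom[OF f] cmp_hom[OF g(1)] nu.zero)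
  then show "q = xf f i" unfolding g(3) using xf_eq_coef[OF high_hom[OF f order_refl] high_hom[OF g(1) order_refl]] by simp
qed

lemma x0_pow_Qh: "xf X0 0 [^]\<^bsub>Qh n I\<^esub> (i::nat) = xf (X0 ^ i) 0"
proof -
  interpret QH: cring "Qh n I" by (rule cring_Qh)
  show ?thesis by (induction i) (simp_all add: xf_one xf_mult[OF X0_carr(2) X0_carr(1)] mult.commute)
qed

lemma R_tilde_term:
  assumes f: "f \<in> hom_piece n k"
  shows "S_to_Qh n I (deh n I (rc f)) \<otimes>\<^bsub>Qh n I\<^esub> xf X0 0 [^]\<^bsub>Qh n I\<^esub> (i::nat) = xf (X0 ^ i * f) k"
  unfolding S_to_Qh_deh[OF f] x0_pow_Qh using xf_mult[OF hom_piece_carr[OF f] X0_carr(2), of k i 0] by (simp add: mult.commute)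

text \<open>A term \<open>s x_0^i\<close> with \<open>s\<close> in S is a fraction
  \<open>X0 ^ i * f / X0 ^ k\<close> with \<open>f\<close> of degree \<open>k\<close>; conversely,
  the dehomogenized components of a numerator form a polynomial over S that evaluates to the
  fraction.\<close>

lemma R_tilde_eq: "R_tilde n I = T"
proof -
  let ?A = "affine_ring n I" and ?x = "xf X0 0"
  interpret QH: cring "Qh n I" by (rule cring_Qh)
  interpret UP_cring ?A "UP ?A" by (intro UP_cring.intro cring_affine)
  have ev: "UnivPoly.eval ?A (Qh n I) (S_to_Qh n I) ?x p =
      (\<Oplus>\<^bsub>Qh n I\<^esub>i\<in>{..UnivPoly.deg ?A p}. S_to_Qh n I (up_ring.coeff (UP ?A) p i) \<otimes>\<^bsub>Qh n I\<^esub> ?x [^]\<^bsub>Qh n I\<^esub> i)" if "p \<in> carrier (UP ?A)" for p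
    unfolding UnivPoly.eval_def using that by simp
  have Rt: "R_tilde n I = UnivPoly.eval ?A (Qh n I) (S_to_Qh n I) ?x ` carrier (UP ?A)"
    unfolding R_tilde_def xf_def x0_R one_R by simp
  have Tsum: "(\<Oplus>\<^bsub>Qh n I\<^esub>i\<in>A. t i) \<in> T" if "finite A" "\<And>i. i \<in> A \<Longrightarrow> t i \<in> T" for A :: "nat set" and t
    using that
  proof (induction A rule: finite_induct)
    case (insert a A)
    then have "t \<in> A \<rightarrow> carrier (Qh n I)" "t a \<in> carrier (Qh n I)" using T_closed by auto
    then show ?case using insert by (simp add: T_add)
  qed (simp add: T_zero)
  show ?thesis
  proof (intro equalityI subsetI)
    fix q assume "q \<in> R_tilde n I"
    then obtain p where p: "p \<in> carrier (UP ?A)" "q = UnivPoly.eval ?A (Qh n I) (S_to_Qh n I) ?x p" unfolding Rt by blast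
    show "q \<in> T" unfolding p(2) ev[OF p(1)]
    proof (rule Tsum)
      fix i
      have "up_ring.coeff (UP ?A) p i \<in> carrier ?A" using p(1) by (rule coeff_closed)
      then obtain g where g: "g \<in> P" "up_ring.coeff (UP ?A) p i = deh n I (rc g)" unfolding carrier_affine by blast
      obtain k f where f: "f \<in> hom_piece n k" "nu f = nu g" using affine_rep[OF g(1)] by blast
      have "up_ring.coeff (UP ?A) p i = deh n I (rc f)" unfolding g(2) using deh_eq_iff[OF g(1) hom_piece_carr[OF f(1)]] f(2) by simp
      then show "S_to_Qh n I (up_ring.coeff (UP ?A) p i) \<otimes>\<^bsub>Qh n I\<^esub> ?x [^]\<^bsub>Qh n I\<^esub> i \<in> T"
        using R_tilde_term[OF f(1), of i] T_I[OF high_hom[OF X0_mult_hom[OF f(1)], of k i]] by simp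
    qed simp
  next
    fix q assume "q \<in> T"
    then obtain F k where F: "high k F" "q = xf F k" by (rule T_E)
    have FP: "F \<in> P" by (rule high_P[OF F(1)])
    obtain N where N: "deg_below N F" using deg_below_ex by blast
    define p where "p j = deh n I (rc (cmp (j + k) F))" for j
    have "p m = \<zero>\<^bsub>?A\<^esub>" if "N < m" for m using deg_below_cmp[OF N, of "m + k"] that by (simp add: p_def zero_affine)
    moreover have "p m \<in> carrier ?A" for m unfolding carrier_affine p_def using cmp_carr[OF FP] by blast
    ultimately have pup: "p \<in> up ?A" unfolding up_def using bound.intro[of N p "\<zero>\<^bsub>?A\<^esub>"] by blast
    have "carrier (UP ?A) = up ?A" unfolding UP_def by (simp only: partial_object.select_convs)
    then have pc: "p \<in> carrier (UP ?A)" using pup by (simp only:)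
    have "up_ring.coeff (UP ?A) = (\<lambda>p\<in>up ?A. \<lambda>n. p n)" unfolding UP_def by (simp only: up_ring.select_convs)
    then have co: "up_ring.coeff (UP ?A) p i = p i" for i using restrict_apply'[OF pup, of "\<lambda>p n. p n"] by (simp only:)
    let ?D = "UnivPoly.deg ?A p"
    have P: "cmp m F \<in> P" for m by (rule cmp_carr[OF FP])
    have t: "S_to_Qh n I (p i) \<otimes>\<^bsub>Qh n I\<^esub> ?x [^]\<^bsub>Qh n I\<^esub> i = xf (cmp (i + k) F) k" for i
      unfolding p_def R_tilde_term[OF cmp_in_hom_piece[OF FP]] by (rule xf_shift[OF P])
    have sumxf: "(\<Oplus>\<^bsub>Qh n I\<^esub>i\<in>{..M}. xf (cmp (i + k) F) k) = xf (\<Sum>i\<le>M. cmp (i + k) F) k" for M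
    proof (induction M)
      case 0 show ?case using xf_closed[OF P] by simp
    next
      case (Suc M)
      have "(\<lambda>i. xf (cmp (i + k) F) k) \<in> {..M} \<rightarrow> carrier (Qh n I)" using xf_closed[OF P] by blast
      then show ?case using Suc xf_closed[OF P] xf_add_same[OF P sum_in_poly_ring[OF P], of "Suc M + k" k "\<lambda>i. i + k" "{..M}"]
        by (simp add: atMost_Suc add.commute)
    qed
    have "UnivPoly.eval ?A (Qh n I) (S_to_Qh n I) ?x p = xf (\<Sum>i\<le>?D. cmp (i + k) F) k"
      unfolding ev[OF pc] co t by (rule sumxf)
    \<comment> \<open>The degree of \<open>p\<close> may cut off components of \<open>F\<close>.
      Those vanish in S, so the fractions coincide although the numerators may differ.\<close>
    also have "\<dots> = xf F k"
    proof -
      let ?G = "\<Sum>i\<le>?D. cmp (i + k) F"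
      have c: "cmp m ?G = (\<Sum>i\<le>?D. if i + k = m then cmp m F else 0)" for m
        unfolding cmp_sum by (rule sum.cong) (auto simp: cmp_hom[OF cmp_in_hom_piece[OF FP]])
      have hG: "high k ?G" unfolding high_def c using sum_in_poly_ring[OF P] by auto
      have "nu (cmp (j + k) ?G) = nu (cmp (j + k) F)" for j
      proof (cases "j \<le> ?D")
        case False
        then have "p j = \<zero>\<^bsub>?A\<^esub>" using deg_aboveD[OF _ pc, of j] co by simp
        then have "nu (cmp (j + k) F) = nu 0" unfolding p_def zero_affine using deh_eq_iff[OF P const_in_poly_ring(1)] by blast
        then show ?thesis using False by (simp add: c nu.zero)
      qed (simp add: c)
      then show ?thesis using xf_eq_coef[OF hG F(1)] by blast
    qed
    finally show "q \<in> R_tilde n I" unfolding Rt F(2) using pc by (metis imageI)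
  qed
qed

theorem conductor_lengths:
  "Qh_quotient_dim n I (R_tilde n I) (R_in_Qh n I) = enat (\<Sum>j<r. d - H (Suc j))"
  "Qh_quotient_dim n I (R_in_Qh n I) (conductor n I) = enat (\<Sum>j<r. H (Suc j) - mp.dim (cs j))"
proof -
  have Rt: "R_tilde n I = layer (\<lambda>j. S)" unfolding R_tilde_eq layer_def using coef_S by blast
  have dS: "mp.dim S = d" unfolding S_eq by (rule H_top)
  have "Qh_quotient_dim n I (layer (\<lambda>j. S)) (layer (\<lambda>j. Vs (Suc j))) = enat (\<Sum>j<r. mp.dim S - H (Suc j))"
    by (rule quotient_layer[OF subspace_S order_refl subspace_Vs Vs_sub_S]) (unfold S_eq, rule Vs_stable)
  then show "Qh_quotient_dim n I (R_tilde n I) (R_in_Qh n I) = enat (\<Sum>j<r. d - H (Suc j))"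
    by (simp only: Rt R_in_Qh_layer dS)
  show "Qh_quotient_dim n I (R_in_Qh n I) (conductor n I) = enat (\<Sum>j<r. H (Suc j) - mp.dim (cs j))"
    unfolding R_in_Qh_layer conductor_layer[OF R_tilde_eq]
    by (rule quotient_layer[OF subspace_Vs Vs_sub_S subspace_cs cs_sub cs_top])
qed

end

theorem theorem1p1:
  fixes n :: nat and I :: "'k::field mpoly set"
  assumes "n \<ge> 1"
    and "saturated_homogeneous_ideal n I"
    and "zero_dimensional n I"
    and "locally_gorenstein n I"
    and "generic_position n I"
    and "CHAR('k) = 0 \<or> CHAR('k) > scheme_degree n I"
    and "\<forall>p\<in>closed_points n I. coord_x0 n I \<notin> p"
  shows "arithmetically_gorenstein n I \<longleftrightarrow>
     Qh_quotient_dim n I (R_tilde n I) (R_in_Qh n I) =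
     Qh_quotient_dim n I (R_in_Qh n I) (conductor n I)"
proof -
  interpret nzd_ideal n I by (rule nzd_ideal_of_no_point_at_infinity[OF assms(2,3,7)])
  have "points n I \<noteq> {}" using assms(3) by (simp add: zero_dimensional_def)
  then obtain r where gpos: "gpos n I (scheme_degree n I) r"
    using gpos_of_generic_position[OF assms(1,5)] by blast
  then interpret gpos n I "scheme_degree n I" r .
  have "gorenstein_ring R \<longleftrightarrow> (\<exists>\<tau>. symmetric_form \<tau>)"
  proof
    assume "gorenstein_ring R"
    from gpos_gorenstein.ex_symmetric_form[OF gpos_gorenstein.intro[OF gpos gpos_gorenstein_axioms.intro[OF this]]]
    show "\<exists>\<tau>. symmetric_form \<tau>" .
  next
    assume "\<exists>\<tau>. symmetric_form \<tau>"
    then obtain \<tau> where "symmetric_form \<tau>" by blast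
    from gpos_form.gorenstein_coord_ring[OF gpos_form.intro[OF gpos gpos_form_axioms.intro[OF this]]]
    show "gorenstein_ring R" .
  qed
  then show ?thesis
    unfolding arithmetically_gorenstein_def conductor_lengths enat.inject symmetric_form_iff_lengths .
qed

end
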